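(* Let $\alpha>0$ and let $\{\mathbf{S}(t)\}_{t\ge0}$ be the $C_0$-semigroup on $L^2(\mathbb{Q}_S)$ generated by the operator $-D^\alpha$. Let $\mathbf{T}(t):L^2(\mathbb{Q}_S)\to L^2(\mathbb{Q}_S)$ be given by $\mathbf{T}(t)f=Z(\cdot,t)*f$ for $t>0$ and $\mathbf{T}(0)=\mathrm{Id}$. Then $\mathbf{S}(t)=\mathbf{T}(t)$ for each $t\ge0$. In other words, for $f\in\mathrm{Dom}(D^\alpha)$, the solution of the abstract Cauchy problem $$\begin{cases}\dfrac{\partial u(x,t)}{\partial t}+D^\alpha u(x,t)=0, & x\in\mathbb{Q}_S,\ t>0,\\ u(x,0)=f(x),\end{cases}$$ is given by $u(\cdot,t)=\mathbf{T}(t)f$ for $t\ge0$, i.e. $u(x,t)=Z(x,t)*f(x)$.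
   Context: Let $S$ be a nonempty finite set of prime numbers, $\mathbb{Q}_S=\prod_{p\in S}\mathbb{Q}_p$ with the product topology and componentwise operations, and $\mathbb{Z}_S=\prod_{p\in S}\mathbb{Z}_p$; $\mathbb{Q}$ is embedded diagonally in $\mathbb{Q}_S$. Let $dx$ be the Haar measure on $(\mathbb{Q}_S,+)$ with $\mathbb{Z}_S$ of measure $1$. Let $q_1<q_2<\cdots$ be the increasing enumeration of $\{p^l: p\in S,\ l\ge 1\}$ and let $p_k\in S$ be the prime of which $q_k$ is a power. Define $\psi:\mathbb{Z}\to\mathbb{R}$ by $\psi(0)=0$, $\psi(n)=\sum_{k=1}^n\log p_k$ and $\psi(-n)=-\psi(n)$ for $n\ge1$; thus $e^{\psi(n)}\in\mathbb{Q}$ and $\psi$ is strictly increasing. Put $B_n=e^{-\psi(n)}\mathbb{Z}_S$ for $n\in\mathbb{Z}$. These are compact open subgroups with $B_{n-1}\subsetneq B_n$, $\bigcap_n B_n=\{0\}$, $\bigcup_n B_n=\mathbb{Q}_S$, and $B_n$ has Haar measure $e^{\psi(n)}$. Define $\|0\|=0$ and $\|x\|=e^{\psi(n)}$ if $x\in B_n\setminus B_{n-1}$. Let $\chi(x)=\prod_{p\in S}\exp(2\pi i\{x_p\}_p)$ for $x=(x_p)_{p\in S}$, where $\{\cdot\}_p$ is the $p$-adic fractional part. The Fourier transform is $\mathcal{F}f(\xi)=\widehat f(\xi)=\int_{\mathbb{Q}_S}f(x)\chi(\xi x)\,dx$, extended to a unitary operator of $L^2(\mathbb{Q}_S)$.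 For $\alpha>0$, $D^\alpha$ is the (positive, selfadjoint) unbounded operator on $L^2(\mathbb{Q}_S)$ given by $D^\alpha f=\mathcal{F}^{-1}(\|\xi\|^\alpha\widehat f(\xi))$ with $\mathrm{Dom}(D^\alpha)=\{f\in L^2(\mathbb{Q}_S):\|\xi\|^\alpha\widehat f\in L^2(\mathbb{Q}_S)\}$. The heat kernel is $Z(x,t)=\int_{\mathbb{Q}_S}\chi(-x\xi)\exp(-t\|\xi\|^\alpha)\,d\xi$ for $x\in\mathbb{Q}_S$, $t>0$. A solution (classical solution) of the Cauchy problem is a function $u$ such that $t\mapsto u(\cdot,t)$ is continuously differentiable from $[0,\infty)$ to $L^2(\mathbb{Q}_S)$, $u(\cdot,t)\in\mathrm{Dom}(D^\alpha)$ for all $t\ge0$, and $u$ satisfies the equation (in $L^2(\mathbb{Q}_S)$) and the initial condition. *)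

theory Defs
  imports
    "HOL-Analysis.Analysis"
    "HOL-Algebra.QuotRing"
    "HOL-Computational_Algebra.Primes"
begin

section \<open>The field of p-adic numbers\<close>

definition padic_abs_rat :: "nat \<Rightarrow> rat \<Rightarrow> real" where
  "padic_abs_rat p r =
     (if r = 0 then 0
      else real p powi (int (multiplicity (int p) (snd (quotient_of r)))
                        - int (multiplicity (int p) (fst (quotient_of r)))))"

definition padic_cauchy :: "nat \<Rightarrow> (nat \<Rightarrow> rat) \<Rightarrow> bool" where
  "padic_cauchy p X \<longleftrightarrow>
     (\<forall>e>0. \<exists>N. \<forall>m\<ge>N. \<forall>n\<ge>N. padic_abs_rat p (X m - X n) < e)"

definition padic_cauchy_ring :: "nat \<Rightarrow> (nat \<Rightarrow> rat) ring" where
  "padic_cauchy_ring p =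
     \<lparr>carrier = {X. padic_cauchy p X},
      mult = (\<lambda>X Y n. X n * Y n), one = (\<lambda>_. 1),
      zero = (\<lambda>_. 0), add = (\<lambda>X Y n. X n + Y n)\<rparr>"

definition padic_null :: "nat \<Rightarrow> (nat \<Rightarrow> rat) set" where
  "padic_null p = {X. (\<lambda>n. padic_abs_rat p (X n)) \<longlonglongrightarrow> 0}"

text \<open>The completion of the rationals with respect to the p-adic absolute value:
  Cauchy sequences modulo null sequences.  An element is a coset, i.e. a set of sequences.\<close>

type_synonym padic = "(nat \<Rightarrow> rat) set"

definition Qp :: "nat \<Rightarrow> padic ring" where
  "Qp p = padic_cauchy_ring p Quot padic_null p"

definition rat_to_Qp :: "nat \<Rightarrow> rat \<Rightarrow> padic" where
  "rat_to_Qp p r = padic_null p +>\<^bsub>padic_cauchy_ring p\<^esub> (\<lambda>_. r)"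

definition padic_abs :: "nat \<Rightarrow> padic \<Rightarrow> real" where
  "padic_abs p x = (THE c. \<forall>X\<in>x. (\<lambda>n. padic_abs_rat p (X n)) \<longlonglongrightarrow> c)"

text \<open>The value 0 outside the carrier is only there because the library locale for metric
  spaces on a carrier wants the distance to be nonnegative and symmetric on the whole type.\<close>

definition padic_dist :: "nat \<Rightarrow> padic \<Rightarrow> padic \<Rightarrow> real" where
  "padic_dist p x y =
     (if x \<in> carrier (Qp p) \<and> y \<in> carrier (Qp p) then padic_abs p (x \<ominus>\<^bsub>Qp p\<^esub> y) else 0)"

definition Qp_topology :: "nat \<Rightarrow> padic topology" where
  "Qp_topology p = Metric_space.mtopology (carrier (Qp p)) (padic_dist p)"

definition Zp :: "nat \<Rightarrow> padic set" where
  "Zp p = {x \<in> carrier (Qp p). padic_abs p x \<le> 1}"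

text \<open>The fractional part of \<open>x\<close> is the unique element of \<open>\<int>[1/p] \<inter> [0,1)\<close>
  that is congruent to \<open>x\<close> modulo the p-adic integers.\<close>

definition padic_frac :: "nat \<Rightarrow> padic \<Rightarrow> rat" where
  "padic_frac p x =
     (THE r. 0 \<le> r \<and> r < 1 \<and> (\<exists>k::nat. r * of_nat p ^ k \<in> \<int>)
             \<and> x \<ominus>\<^bsub>Qp p\<^esub> rat_to_Qp p r \<in> Zp p)"


section \<open>The ring \<open>Q\<^sub>S\<close>\<close>

type_synonym padics = "nat \<Rightarrow> padic"

definition QS :: "nat set \<Rightarrow> padics ring" where
  "QS S =
     \<lparr>carrier = (\<Pi>\<^sub>E p\<in>S. carrier (Qp p)),
      mult = (\<lambda>x y. \<lambda>p\<in>S. x p \<otimes>\<^bsub>Qp p\<^esub> y p), one = (\<lambda>p\<in>S. \<one>\<^bsub>Qp p\<^esub>),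
      zero = (\<lambda>p\<in>S. \<zero>\<^bsub>Qp p\<^esub>), add = (\<lambda>x y. \<lambda>p\<in>S. x p \<oplus>\<^bsub>Qp p\<^esub> y p)\<rparr>"

definition QS_topology :: "nat set \<Rightarrow> padics topology" where
  "QS_topology S = product_topology Qp_topology S"

definition ZS :: "nat set \<Rightarrow> padics set" where
  "ZS S = (\<Pi>\<^sub>E p\<in>S. Zp p)"

definition rat_to_QS :: "nat set \<Rightarrow> rat \<Rightarrow> padics" where
  "rat_to_QS S r = (\<lambda>p\<in>S. rat_to_Qp p r)"

definition chi :: "nat set \<Rightarrow> padics \<Rightarrow> complex" where
  "chi S x = (\<Prod>p\<in>S. exp (2 * complex_of_real pi * \<i> * of_rat (padic_frac p (x p))))"


section \<open>Haar measure\<close>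

text \<open>Haar measures on the additive group of \<open>G\<close>, for a second countable locally compact
  Hausdorff topology \<open>T\<close>; on such spaces a Borel measure that is finite on compact sets is
  automatically regular, so regularity is not repeated here.\<close>

definition haar_measure :: "('a, 'm) ring_scheme \<Rightarrow> 'a topology \<Rightarrow> 'a measure \<Rightarrow> bool" where
  "haar_measure G T \<mu> \<longleftrightarrow>
     sets \<mu> = sigma_sets (topspace T) {U. openin T U} \<and>
     (\<forall>a\<in>carrier G. \<forall>A\<in>sets \<mu>. emeasure \<mu> (a <+\<^bsub>G\<^esub> A) = emeasure \<mu> A) \<and>
     (\<forall>K. compactin T K \<longrightarrow> emeasure \<mu> K < \<infinity>) \<and>
     emeasure \<mu> (space \<mu>) \<noteq> 0"

definition normalized_haar_QS :: "nat set \<Rightarrow> padics measure \<Rightarrow> bool" where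
  "normalized_haar_QS S \<mu> \<longleftrightarrow>
     haar_measure (QS S) (QS_topology S) \<mu> \<and> emeasure \<mu> (ZS S) = 1"


section \<open>The function \<open>\<psi>\<close>, the filtration and the norm\<close>

text \<open>The enumeration \<open>q\<^sub>1 < q\<^sub>2 < \<dots>\<close> starts at index 1, the library one at index 0.\<close>

definition qk :: "nat set \<Rightarrow> nat \<Rightarrow> nat" where
  "qk S k = enumerate {p ^ l | p l. p \<in> S \<and> l \<ge> 1} (k - 1)"

definition pk :: "nat set \<Rightarrow> nat \<Rightarrow> nat" where
  "pk S k = (THE p. p \<in> S \<and> (\<exists>l\<ge>1. qk S k = p ^ l))"

definition psi :: "nat set \<Rightarrow> int \<Rightarrow> real" where
  "psi S n = (if n \<ge> 0 then (\<Sum>k = 1..nat n. ln (real (pk S k)))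
              else - (\<Sum>k = 1..nat (- n). ln (real (pk S k))))"

text \<open>The rational number \<open>e\<^bsup>\<psi>(n)\<^esup>\<close>, needed as a rational to embed it into \<open>Q\<^sub>S\<close>.\<close>

definition exp_psi_rat :: "nat set \<Rightarrow> int \<Rightarrow> rat" where
  "exp_psi_rat S n = (THE r. real_of_rat r = exp (psi S n))"

definition Bn :: "nat set \<Rightarrow> int \<Rightarrow> padics set" where
  "Bn S n = {rat_to_QS S (inverse (exp_psi_rat S n)) \<otimes>\<^bsub>QS S\<^esub> z | z. z \<in> ZS S}"

definition norm_QS :: "nat set \<Rightarrow> padics \<Rightarrow> real" where
  "norm_QS S x = (if x = \<zero>\<^bsub>QS S\<^esub> then 0
                  else exp (psi S (THE n. x \<in> Bn S n \<and> x \<notin> Bn S (n - 1))))"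


section \<open>Square integrable functions and operators on them\<close>

text \<open>Elements of \<open>L\<^sup>2\<close> are represented by functions; equality of elements is \<open>L2_eq\<close>.\<close>

definition L2 :: "'a measure \<Rightarrow> ('a \<Rightarrow> complex) set" where
  "L2 M = {f \<in> borel_measurable M. integrable M (\<lambda>x. (cmod (f x))\<^sup>2)}"

definition L2_norm :: "'a measure \<Rightarrow> ('a \<Rightarrow> complex) \<Rightarrow> real" where
  "L2_norm M f = sqrt (LINT x|M. (cmod (f x))\<^sup>2)"

definition L2_eq :: "'a measure \<Rightarrow> ('a \<Rightarrow> complex) \<Rightarrow> ('a \<Rightarrow> complex) \<Rightarrow> bool" where
  "L2_eq M f g \<longleftrightarrow> f \<in> L2 M \<and> g \<in> L2 M \<and> (AE x in M. f x = g x)"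

definition bounded_operator_L2 ::
  "'a measure \<Rightarrow> (('a \<Rightarrow> complex) \<Rightarrow> ('a \<Rightarrow> complex)) \<Rightarrow> bool" where
  "bounded_operator_L2 M T \<longleftrightarrow>
     (\<forall>f\<in>L2 M. T f \<in> L2 M) \<and>
     (\<forall>f\<in>L2 M. \<forall>g\<in>L2 M. \<forall>a b.
        L2_eq M (T (\<lambda>x. a * f x + b * g x)) (\<lambda>x. a * T f x + b * T g x)) \<and>
     (\<exists>C. \<forall>f\<in>L2 M. L2_norm M (T f) \<le> C * L2_norm M f)"

definition C0_semigroup_L2 ::
  "'a measure \<Rightarrow> (real \<Rightarrow> ('a \<Rightarrow> complex) \<Rightarrow> ('a \<Rightarrow> complex)) \<Rightarrow> bool" where
  "C0_semigroup_L2 M U \<longleftrightarrow>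
     (\<forall>t\<ge>0. bounded_operator_L2 M (U t)) \<and>
     (\<forall>f\<in>L2 M. L2_eq M (U 0 f) f) \<and>
     (\<forall>s\<ge>0. \<forall>t\<ge>0. \<forall>f\<in>L2 M. L2_eq M (U (s + t) f) (U s (U t f))) \<and>
     (\<forall>f\<in>L2 M. ((\<lambda>t. L2_norm M (\<lambda>x. U t f x - f x)) \<longlongrightarrow> 0) (at_right 0))"

text \<open>The graph of the infinitesimal generator of \<open>U\<close>.\<close>

definition generator_L2 ::
  "'a measure \<Rightarrow> (real \<Rightarrow> ('a \<Rightarrow> complex) \<Rightarrow> ('a \<Rightarrow> complex)) \<Rightarrow>
   ('a \<Rightarrow> complex) \<Rightarrow> ('a \<Rightarrow> complex) \<Rightarrow> bool" where
  "generator_L2 M U f g \<longleftrightarrow> f \<in> L2 M \<and> g \<in> L2 M \<and>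
     ((\<lambda>t. L2_norm M (\<lambda>x. (U t f x - f x) / complex_of_real t - g x)) \<longlongrightarrow> 0) (at_right 0)"

text \<open>\<open>U\<close> is a \<open>C\<^sub>0\<close>-semigroup whose generator is the operator \<open>A\<close> with domain \<open>D\<close>.\<close>

definition C0_semigroup_generated_by ::
  "'a measure \<Rightarrow> (real \<Rightarrow> ('a \<Rightarrow> complex) \<Rightarrow> ('a \<Rightarrow> complex)) \<Rightarrow>
   ('a \<Rightarrow> complex) set \<Rightarrow> (('a \<Rightarrow> complex) \<Rightarrow> ('a \<Rightarrow> complex)) \<Rightarrow> bool" where
  "C0_semigroup_generated_by M U D A \<longleftrightarrow>
     C0_semigroup_L2 M U \<and>
     (\<forall>f g. generator_L2 M U f g \<longleftrightarrow> f \<in> D \<and> L2_eq M g (A f))"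

text \<open>\<open>u\<close> is continuously differentiable from \<open>[0,\<infinity>)\<close> to \<open>L\<^sup>2\<close> with derivative \<open>u'\<close>
  (one-sided at 0).\<close>

definition C1_L2 ::
  "'a measure \<Rightarrow> (real \<Rightarrow> 'a \<Rightarrow> complex) \<Rightarrow> (real \<Rightarrow> 'a \<Rightarrow> complex) \<Rightarrow> bool" where
  "C1_L2 M u u' \<longleftrightarrow>
     (\<forall>t\<ge>0. u t \<in> L2 M \<and> u' t \<in> L2 M \<and>
        ((\<lambda>s. L2_norm M (\<lambda>x. (u s x - u t x) / complex_of_real (s - t) - u' t x)) \<longlongrightarrow> 0)
          (at t within {0..}) \<and>
        ((\<lambda>s. L2_norm M (\<lambda>x. u' s x - u' t x)) \<longlongrightarrow> 0) (at t within {0..}))"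


section \<open>Fourier transform, the operator \<open>D\<^sup>\<alpha>\<close> and the heat kernel\<close>

definition fourier ::
  "nat set \<Rightarrow> padics measure \<Rightarrow> (padics \<Rightarrow> complex) \<Rightarrow> padics \<Rightarrow> complex" where
  "fourier S \<mu> f \<xi> = (LINT x|\<mu>. f x * chi S (\<xi> \<otimes>\<^bsub>QS S\<^esub> x))"

text \<open>The extension to \<open>L\<^sup>2\<close> by continuity from \<open>L\<^sup>1 \<inter> L\<^sup>2\<close>; determined up to \<open>L2_eq\<close>.\<close>

definition fourier_L2 ::
  "nat set \<Rightarrow> padics measure \<Rightarrow> (padics \<Rightarrow> complex) \<Rightarrow> padics \<Rightarrow> complex" where
  "fourier_L2 S \<mu> f =
     (SOME g. g \<in> L2 \<mu> \<and>
        (\<exists>\<phi>::nat \<Rightarrow> padics \<Rightarrow> complex.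
           (\<forall>n. \<phi> n \<in> L2 \<mu> \<and> integrable \<mu> (\<phi> n) \<and> fourier S \<mu> (\<phi> n) \<in> L2 \<mu>) \<and>
           (\<lambda>n. L2_norm \<mu> (\<lambda>x. \<phi> n x - f x)) \<longlonglongrightarrow> 0 \<and>
           (\<lambda>n. L2_norm \<mu> (\<lambda>\<xi>. fourier S \<mu> (\<phi> n) \<xi> - g \<xi>)) \<longlonglongrightarrow> 0))"

definition inv_fourier_L2 ::
  "nat set \<Rightarrow> padics measure \<Rightarrow> (padics \<Rightarrow> complex) \<Rightarrow> padics \<Rightarrow> complex" where
  "inv_fourier_L2 S \<mu> g = (SOME f. f \<in> L2 \<mu> \<and> L2_eq \<mu> (fourier_L2 S \<mu> f) g)"

definition Dom_D ::
  "nat set \<Rightarrow> padics measure \<Rightarrow> real \<Rightarrow> (padics \<Rightarrow> complex) set" where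
  "Dom_D S \<mu> \<alpha> =
     {f \<in> L2 \<mu>. (\<lambda>\<xi>. complex_of_real (norm_QS S \<xi> powr \<alpha>) * fourier_L2 S \<mu> f \<xi>) \<in> L2 \<mu>}"

definition D_op ::
  "nat set \<Rightarrow> padics measure \<Rightarrow> real \<Rightarrow> (padics \<Rightarrow> complex) \<Rightarrow> padics \<Rightarrow> complex" where
  "D_op S \<mu> \<alpha> f =
     inv_fourier_L2 S \<mu>
       (\<lambda>\<xi>. complex_of_real (norm_QS S \<xi> powr \<alpha>) * fourier_L2 S \<mu> f \<xi>)"

definition heat_kernel ::
  "nat set \<Rightarrow> padics measure \<Rightarrow> real \<Rightarrow> padics \<Rightarrow> real \<Rightarrow> complex" where
  "heat_kernel S \<mu> \<alpha> x t =
     (LINT \<xi>|\<mu>. chi S ((\<ominus>\<^bsub>QS S\<^esub> x) \<otimes>\<^bsub>QS S\<^esub> \<xi>)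
                 * complex_of_real (exp (- t * norm_QS S \<xi> powr \<alpha>)))"

definition convolution_QS ::
  "nat set \<Rightarrow> padics measure \<Rightarrow> (padics \<Rightarrow> complex) \<Rightarrow> (padics \<Rightarrow> complex) \<Rightarrow>
   padics \<Rightarrow> complex" where
  "convolution_QS S \<mu> g f x = (LINT y|\<mu>. g (x \<ominus>\<^bsub>QS S\<^esub> y) * f y)"

definition heat_operator ::
  "nat set \<Rightarrow> padics measure \<Rightarrow> real \<Rightarrow> real \<Rightarrow> (padics \<Rightarrow> complex) \<Rightarrow> padics \<Rightarrow> complex" where
  "heat_operator S \<mu> \<alpha> t f =
     (if t = 0 then f else convolution_QS S \<mu> (\<lambda>x. heat_kernel S \<mu> \<alpha> x t) f)"

definition classical_solution ::
  "nat set \<Rightarrow> padics measure \<Rightarrow> real \<Rightarrow> (padics \<Rightarrow> complex) \<Rightarrow>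
   (real \<Rightarrow> padics \<Rightarrow> complex) \<Rightarrow> bool" where
  "classical_solution S \<mu> \<alpha> f u \<longleftrightarrow>
     (\<exists>u'. C1_L2 \<mu> u u' \<and>
        (\<forall>t\<ge>0. u t \<in> Dom_D S \<mu> \<alpha>) \<and>
        (\<forall>t>0. L2_eq \<mu> (\<lambda>x. u' t x + D_op S \<mu> \<alpha> (u t) x) (\<lambda>_. 0)) \<and>
        L2_eq \<mu> (u 0) f)"

end

theory Submission
  imports Defs "HOL-Number_Theory.Cong"
begin

text \<open>The Fourier transform turns \<open>D\<^sup>\<alpha>\<close> into multiplication by \<open>\<parallel>\<xi>\<parallel>\<^sup>\<alpha>\<close> and convolution with the heat
  kernel into multiplication by \<open>exp (- t \<parallel>\<xi>\<parallel>\<^sup>\<alpha>)\<close>, so the heat operators form the semigroup of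
  multiplication operators generated by \<open>- D\<^sup>\<alpha>\<close>. Solutions are unique because their squared norm
  does not increase. For an arbitrary semigroup with this generator, the uniform boundedness
  principle makes its orbits classical solutions, hence equal to the heat orbits on the domain, and
  by density everywhere.

  Plancherel's theorem and Fourier inversion need only that the dual of the ball \<open>B\<^sub>n\<close> is \<open>B\<^sub>-\<^sub>n\<close>: on
  indicator functions of cosets of the balls both are finite computations with characters, and the
  linear combinations of these are dense in \<open>L\<^sup>1 \<inter> L\<^sup>2\<close>. Neither Fubini's theorem nor
  compactness of the balls is used.\<close>

section \<open>Square integrable functions\<close>

text \<open>Elements of \<open>L2 M\<close> are functions, and \<open>fourier_L2\<close> and
  \<open>inv_fourier_L2\<close> are arbitrary choices among them; everything is therefore stated up
  to \<open>L2_eq\<close>, and of the transform the semigroup argument uses linearity, isometry,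
  surjectivity and the two multiplier identities. The heat operator, in contrast, is a concrete
  iterated integral. Exchanging the integrals would reveal its multiplier; the identity
  \<open>\<integral> (F h) f = \<integral> h (F f)\<close> does the same work and rests on
  Parseval's identity and density. Self-duality of the filtration comes from \<open>psi\<close>
  being odd: for each prime the radii of \<open>Bn S n\<close> and \<open>Bn S (- n)\<close> are
  inverse to each other, so \<open>w n * w (- n) = 1\<close>, and Plancherel and inversion carry no
  constant. Inversion is phrased with conjugations around the transform itself, so that a single
  transform is studied. For an arbitrary semigroup the hypotheses bound each operator separately,
  with no uniform control as t tends to 0; that is the gap which uniform boundedness closes.\<close>

lemma L2_measurable [measurable_dest]: "f \<in> L2 M \<Longrightarrow> f \<in> borel_measurable M"
  by (simp add: L2_def)

lemma L2_square_integrable: "f \<in> L2 M \<Longrightarrow> integrable M (\<lambda>x. (cmod (f x))\<^sup>2)"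
  by (simp add: L2_def)

lemma L2_norm_nonneg [simp]: "0 \<le> L2_norm M f"
  by (simp add: L2_norm_def)

lemma L2_norm_power2: "(L2_norm M f)\<^sup>2 = (LINT x|M. (cmod (f x))\<^sup>2)"
  by (simp add: L2_norm_def)

lemma L2_norm_cong: "(\<And>x. x \<in> space M \<Longrightarrow> cmod (f x) = cmod (g x)) \<Longrightarrow> L2_norm M f = L2_norm M g"
  unfolding L2_norm_def by (metis (mono_tags, lifting) Bochner_Integration.integral_cong)

lemma L2_norm_cong_AE:
  assumes "f \<in> borel_measurable M" "g \<in> borel_measurable M" "AE x in M. f x = g x"
  shows "L2_norm M f = L2_norm M g"
  unfolding L2_norm_def using assms
  by (intro arg_cong[where f = sqrt] integral_cong_AE) auto

lemma L2_nn_integral: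
  "f \<in> L2 M \<Longrightarrow> (\<integral>\<^sup>+x. ennreal ((cmod (f x))\<^sup>2) \<partial>M) = ennreal ((L2_norm M f)\<^sup>2)"
  unfolding L2_norm_power2 by (rule nn_integral_eq_integral) (auto simp: L2_square_integrable)

text \<open>Serves for functions whose square is not yet known to be integrable: nonnegative
  integrals always exist, so one bound yields membership and the norm estimate together.\<close>

lemma L2_I_nn_integral:
  assumes "f \<in> borel_measurable M" "(\<integral>\<^sup>+x. ennreal ((cmod (f x))\<^sup>2) \<partial>M) \<le> ennreal (C\<^sup>2)" "C \<ge> 0"
  shows "f \<in> L2 M" "L2_norm M f \<le> C"
proof -
  have "integrable M (\<lambda>x. (cmod (f x))\<^sup>2)"
    using assms by (intro integrableI_bounded) (auto simp: order_le_less_trans)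
  then show *: "f \<in> L2 M" using assms by (simp add: L2_def)
  have "ennreal ((L2_norm M f)\<^sup>2) \<le> ennreal (C\<^sup>2)"
    using L2_nn_integral[OF *] assms(2) by simp
  then show "L2_norm M f \<le> C"
    using assms(3) by (simp add: ennreal_le_iff power2_le_iff_abs_le)
qed

lemma L2_bound:
  assumes "g \<in> L2 M" "f \<in> borel_measurable M" "AE x in M. cmod (f x) \<le> cmod (g x)"
  shows "f \<in> L2 M" "L2_norm M f \<le> L2_norm M g"
proof -
  have "(\<integral>\<^sup>+x. ennreal ((cmod (f x))\<^sup>2) \<partial>M) \<le> (\<integral>\<^sup>+x. ennreal ((cmod (g x))\<^sup>2) \<partial>M)"
    using assms(3) by (intro nn_integral_mono_AE) (auto simp: ennreal_leI power_mono)
  then have "(\<integral>\<^sup>+x. ennreal ((cmod (f x))\<^sup>2) \<partial>M) \<le> ennreal ((L2_norm M g)\<^sup>2)"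
    by (simp add: L2_nn_integral[OF assms(1)])
  from L2_I_nn_integral[OF assms(2) this] show "f \<in> L2 M" "L2_norm M f \<le> L2_norm M g"
    by auto
qed

lemma L2_scale [simp]: "f \<in> L2 M \<Longrightarrow> (\<lambda>x. c * f x) \<in> L2 M"
  by (auto simp: L2_def norm_mult power_mult_distrib)

lemma L2_norm_scale: "L2_norm M (\<lambda>x. c * f x) = cmod c * L2_norm M f"
  by (simp add: L2_norm_def norm_mult power_mult_distrib real_sqrt_mult)

lemma L2_uminus [simp]: "f \<in> L2 M \<Longrightarrow> (\<lambda>x. - f x) \<in> L2 M"
  using L2_scale[of f M "-1"] by simp

lemma borel_measurable_cnj [measurable (raw)]:
  "f \<in> borel_measurable M \<Longrightarrow> (\<lambda>x. cnj (f x)) \<in> borel_measurable M"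
  by (rule measurable_compose[OF _ borel_measurable_continuous_onI[of cnj]])
    (auto intro: continuous_intros)

lemma L2_cnj [simp]: "f \<in> L2 M \<Longrightarrow> (\<lambda>x. cnj (f x)) \<in> L2 M"
  by (auto simp: L2_def)

lemma L2_zero [simp]: "(\<lambda>x. 0) \<in> L2 M"
  by (auto simp: L2_def)

lemma L2_norm_zero [simp]: "L2_norm M (\<lambda>x. 0) = 0"
  by (simp add: L2_norm_def)

lemma L2_norm_cnj [simp]: "L2_norm M (\<lambda>x. cnj (f x)) = L2_norm M f"
  by (simp add: L2_norm_def)

lemma L2_norm_commute: "L2_norm M (\<lambda>x. f x - g x) = L2_norm M (\<lambda>x. g x - f x)"
  by (simp add: L2_norm_def norm_minus_commute)

lemma L2_mult_integrable:
  assumes "f \<in> L2 M" "g \<in> L2 M"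
  shows "integrable M (\<lambda>x. f x * g x)"
proof (rule Bochner_Integration.integrable_bound)
  show "integrable M (\<lambda>x. (cmod (f x))\<^sup>2 + (cmod (g x))\<^sup>2)"
    using assms by (auto simp: L2_square_integrable)
  show "(\<lambda>x. f x * g x) \<in> borel_measurable M" using assms by measurable
  have "a * b \<le> a\<^sup>2 + b\<^sup>2" for a b :: real
    using sum_squares_bound[of a b] sum_power2_ge_zero[of a b] unfolding mult.assoc by linarith
  then show "AE x in M. norm (f x * g x) \<le> norm ((cmod (f x))\<^sup>2 + (cmod (g x))\<^sup>2)"
    by (auto simp: norm_mult)
qed

lemma L2_add [simp]:
  assumes "f \<in> L2 M" "g \<in> L2 M"
  shows "(\<lambda>x. f x + g x) \<in> L2 M"
proof -
  have "integrable M (\<lambda>x. (cmod (f x + g x))\<^sup>2)"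
  proof (rule Bochner_Integration.integrable_bound)
    show "integrable M (\<lambda>x. 2 * ((cmod (f x))\<^sup>2 + (cmod (g x))\<^sup>2))"
      using assms by (auto simp: L2_square_integrable)
    show "(\<lambda>x. (cmod (f x + g x))\<^sup>2) \<in> borel_measurable M" using assms by measurable
    have "(cmod (a + b))\<^sup>2 \<le> 2 * ((cmod a)\<^sup>2 + (cmod b)\<^sup>2)" for a b
    proof -
      have "(cmod (a + b))\<^sup>2 \<le> (cmod a + cmod b)\<^sup>2" by (simp add: norm_triangle_ineq power_mono)
      also have "\<dots> \<le> 2 * ((cmod a)\<^sup>2 + (cmod b)\<^sup>2)"
        using sum_squares_bound[of "cmod a" "cmod b"] by (simp add: power2_sum)
      finally show ?thesis .
    qed
    then show "AE x in M. norm ((cmod (f x + g x))\<^sup>2) \<le> norm (2 * ((cmod (f x))\<^sup>2 + (cmod (g x))\<^sup>2))"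
      by auto
  qed
  then show ?thesis using assms by (auto simp: L2_def)
qed

lemma L2_diff [simp]: "f \<in> L2 M \<Longrightarrow> g \<in> L2 M \<Longrightarrow> (\<lambda>x. f x - g x) \<in> L2 M"
  using L2_add[of f M "\<lambda>x. - g x"] by simp

lemma L2_divide [simp]: "f \<in> L2 M \<Longrightarrow> (\<lambda>x. f x / c) \<in> L2 M"
  using L2_scale[of f M "1/c"] by simp

lemma L2_norm_divide: "L2_norm M (\<lambda>x. f x / c) = L2_norm M f / cmod c"
  using L2_norm_scale[of M "1/c" f] by (simp add: norm_divide)

text \<open>Integrating \<open>2 (a |f|) (b |g|) \<le> a^2 |f|^2 + b^2 |g|^2\<close> leaves two free
  real parameters. Taking \<open>a = \<parallel>g\<parallel>\<close> and
  \<open>b = \<parallel>f\<parallel>\<close> gives the claim after cancellation, unless one norm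
  vanishes.\<close>

lemma L2_Cauchy_Schwarz_abs:
  assumes "f \<in> L2 M" "g \<in> L2 M"
  shows "(LINT x|M. cmod (f x) * cmod (g x)) \<le> L2_norm M f * L2_norm M g"
proof -
  define I where "I = (LINT x|M. cmod (f x) * cmod (g x))"
  have int: "integrable M (\<lambda>x. cmod (f x) * cmod (g x))"
    using integrable_norm[OF L2_mult_integrable[OF assms]] by (simp add: norm_mult)
  have I: "I \<ge> 0" unfolding I_def by simp
  have le: "2 * (a * b * I) \<le> a\<^sup>2 * (L2_norm M f)\<^sup>2 + b\<^sup>2 * (L2_norm M g)\<^sup>2" for a b
  proof -
    have "2 * (a * b * I) = (LINT x|M. 2 * (a * b * (cmod (f x) * cmod (g x))))"
      unfolding I_def by simp
    also have "\<dots> \<le> (LINT x|M. a\<^sup>2 * (cmod (f x))\<^sup>2 + b\<^sup>2 * (cmod (g x))\<^sup>2)"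
    proof (rule integral_mono)
      show "2 * (a * b * (cmod (f x) * cmod (g x))) \<le> a\<^sup>2 * (cmod (f x))\<^sup>2 + b\<^sup>2 * (cmod (g x))\<^sup>2" for x
        using sum_squares_bound[of "a * cmod (f x)" "b * cmod (g x)"]
        by (simp add: power_mult_distrib mult_ac)
    qed (use assms int in \<open>auto simp: L2_square_integrable\<close>)
    also have "\<dots> = a\<^sup>2 * (L2_norm M f)\<^sup>2 + b\<^sup>2 * (L2_norm M g)\<^sup>2"
      using assms by (simp add: L2_norm_power2 L2_square_integrable)
    finally show ?thesis .
  qed
  define F G where "F = L2_norm M f" and "G = L2_norm M g"
  have FG: "F \<ge> 0" "G \<ge> 0" by (auto simp: F_def G_def)
  have le': "2 * (a * b * I) \<le> a\<^sup>2 * F\<^sup>2 + b\<^sup>2 * G\<^sup>2" for a b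
    using le by (simp add: F_def G_def)
  have "I \<le> F * G"
  proof (cases "F = 0 \<or> G = 0")
    case True
    have "I \<le> 0"
    proof (rule ccontr)
      assume "\<not> I \<le> 0"
      then have Ip: "I > 0" by simp
      from True show False
      proof
        assume "F = 0"
        \<comment> \<open>With \<open>F = 0\<close> the coefficient of \<open>I\<close> can be made
          large at no cost on the right: this choice turns the inequality into
          \<open>2 (G^2 + 1) \<le> G^2\<close>.\<close>
        with le'[of "(G\<^sup>2 + 1) / I" 1] Ip zero_le_power2[of G] show False by (simp del: zero_le_power2)
      next
        assume "G = 0"
        with le'[of 1 "(F\<^sup>2 + 1) / I"] Ip zero_le_power2[of F] show False by (simp del: zero_le_power2)
      qed
    qed
    then show ?thesis using mult_nonneg_nonneg[OF FG] by linarith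
  next
    case False
    then have p: "F > 0" "G > 0" using FG by auto
    have "2 * (F * G) * I \<le> 2 * (F * G) * (F * G)"
      using le'[of G F] by (simp add: power2_eq_square mult_ac)
    then show ?thesis using p by simp
  qed
  then show ?thesis by (simp add: I_def F_def G_def)
qed

lemma L2_Cauchy_Schwarz:
  assumes "f \<in> L2 M" "g \<in> L2 M"
  shows "cmod (LINT x|M. f x * g x) \<le> L2_norm M f * L2_norm M g"
proof -
  have "cmod (LINT x|M. f x * g x) \<le> (LINT x|M. cmod (f x * g x))" by (rule integral_norm_bound)
  also have "\<dots> \<le> L2_norm M f * L2_norm M g"
    using L2_Cauchy_Schwarz_abs[OF assms] by (simp add: norm_mult)
  finally show ?thesis .
qed

lemma L2_norm_triangle:
  assumes "f \<in> L2 M" "g \<in> L2 M"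
  shows "L2_norm M (\<lambda>x. f x + g x) \<le> L2_norm M f + L2_norm M g"
proof -
  have int: "integrable M (\<lambda>x. cmod (f x) * cmod (g x))"
    using integrable_norm[OF L2_mult_integrable[OF assms]] by (simp add: norm_mult)
  have "(L2_norm M (\<lambda>x. f x + g x))\<^sup>2 = (LINT x|M. (cmod (f x + g x))\<^sup>2)" by (rule L2_norm_power2)
  also have "\<dots> \<le> (LINT x|M. (cmod (f x))\<^sup>2 + (cmod (g x))\<^sup>2 + 2 * (cmod (f x) * cmod (g x)))"
  proof (rule integral_mono)
    show "(cmod (f x + g x))\<^sup>2 \<le> (cmod (f x))\<^sup>2 + (cmod (g x))\<^sup>2 + 2 * (cmod (f x) * cmod (g x))" for x
      using power_mono[OF norm_triangle_ineq[of "f x" "g x"], of 2] by (simp add: power2_sum)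
  qed (use assms int L2_square_integrable[OF L2_add[OF assms]] in \<open>auto simp: L2_square_integrable\<close>)
  also have "\<dots> = (L2_norm M f)\<^sup>2 + (L2_norm M g)\<^sup>2 + 2 * (LINT x|M. cmod (f x) * cmod (g x))"
    using assms int by (simp add: L2_norm_power2 L2_square_integrable)
  also have "\<dots> \<le> (L2_norm M f)\<^sup>2 + (L2_norm M g)\<^sup>2 + 2 * (L2_norm M f * L2_norm M g)"
    using L2_Cauchy_Schwarz_abs[OF assms] by simp
  also have "\<dots> = (L2_norm M f + L2_norm M g)\<^sup>2" by (simp add: power2_sum)
  finally show ?thesis by (rule power2_le_imp_le) simp
qed

lemma L2_norm_triangle_diff:
  assumes "f \<in> L2 M" "g \<in> L2 M" "h \<in> L2 M"
  shows "L2_norm M (\<lambda>x. f x - h x) \<le> L2_norm M (\<lambda>x. f x - g x) + L2_norm M (\<lambda>x. g x - h x)"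
  using L2_norm_triangle[of "\<lambda>x. f x - g x" M "\<lambda>x. g x - h x"] assms by simp

lemma L2_norm_triangle_minus:
  assumes "f \<in> L2 M" "g \<in> L2 M"
  shows "L2_norm M (\<lambda>x. f x - g x) \<le> L2_norm M f + L2_norm M g"
  using L2_norm_triangle_diff[OF assms(1) L2_zero assms(2)]
  by (simp add: L2_norm_def)

lemma L2_norm_diff_abs:
  assumes "f \<in> L2 M" "g \<in> L2 M"
  shows "\<bar>L2_norm M f - L2_norm M g\<bar> \<le> L2_norm M (\<lambda>x. f x - g x)"
  using L2_norm_triangle[of "\<lambda>x. f x - g x" M g] L2_norm_triangle[of "\<lambda>x. g x - f x" M f] assms
    L2_norm_commute[of M f g] by auto

lemma L2_norm_eq_0_iff:
  assumes "f \<in> L2 M"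
  shows "L2_norm M f = 0 \<longleftrightarrow> (AE x in M. f x = 0)"
  unfolding L2_norm_def
  using integral_nonneg_eq_0_iff_AE[OF L2_square_integrable[OF assms]] by simp

lemma L2_eq_iff:
  "L2_eq M f g \<longleftrightarrow> f \<in> L2 M \<and> g \<in> L2 M \<and> L2_norm M (\<lambda>x. f x - g x) = 0"
  unfolding L2_eq_def using L2_norm_eq_0_iff[of "\<lambda>x. f x - g x" M] by auto

lemma L2_eq_refl: "f \<in> L2 M \<Longrightarrow> L2_eq M f f"
  by (simp add: L2_eq_def)

lemma L2_eq_sym: "L2_eq M f g \<Longrightarrow> L2_eq M g f"
  by (auto simp: L2_eq_def elim: AE_mp)

lemma L2_eq_trans: "L2_eq M f g \<Longrightarrow> L2_eq M g h \<Longrightarrow> L2_eq M f h"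
  unfolding L2_eq_def by (auto elim: AE_mp)

lemma L2_eq_norm: "L2_eq M f g \<Longrightarrow> L2_norm M f = L2_norm M g"
  unfolding L2_eq_def by (intro L2_norm_cong_AE) (auto simp: L2_measurable)

lemma L2_eq_lin:
  assumes "L2_eq M f f'" "L2_eq M g g'"
  shows "L2_eq M (\<lambda>x. a * f x + b * g x) (\<lambda>x. a * f' x + b * g' x)"
proof -
  have "AE x in M. f x = f' x" "AE x in M. g x = g' x" using assms by (auto simp: L2_eq_def)
  then have "AE x in M. a * f x + b * g x = a * f' x + b * g' x" by eventually_elim simp
  then show ?thesis using assms by (simp add: L2_eq_def)
qed

lemma L2_eq_diff:
  assumes "L2_eq M f f'" "L2_eq M g g'"
  shows "L2_eq M (\<lambda>x. f x - g x) (\<lambda>x. f' x - g' x)"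
  using L2_eq_lin[OF assms, of 1 "-1"] by simp

lemma L2_eqI: "f \<in> L2 M \<Longrightarrow> g \<in> L2 M \<Longrightarrow> AE x in M. f x = g x \<Longrightarrow> L2_eq M f g"
  by (simp add: L2_eq_def)

lemma L2_eqI_space: "f \<in> L2 M \<Longrightarrow> g \<in> L2 M \<Longrightarrow> (\<And>x. x \<in> space M \<Longrightarrow> f x = g x) \<Longrightarrow> L2_eq M f g"
  by (simp add: L2_eq_def)

section \<open>Convergence and completeness in L^2\<close>

lemma L2_limit_unique:
  assumes "\<And>n. f n \<in> L2 M" "g \<in> L2 M" "h \<in> L2 M" "F \<noteq> bot"
    and "((\<lambda>n. L2_norm M (\<lambda>x. f n x - g x)) \<longlongrightarrow> 0) F"
    and "((\<lambda>n. L2_norm M (\<lambda>x. f n x - h x)) \<longlongrightarrow> 0) F"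
  shows "L2_eq M g h"
proof -
  have "((\<lambda>n. L2_norm M (\<lambda>x. f n x - g x) + L2_norm M (\<lambda>x. f n x - h x)) \<longlongrightarrow> 0) F"
    using tendsto_add[OF assms(5,6)] by simp
  moreover have "L2_norm M (\<lambda>x. g x - h x) \<le> L2_norm M (\<lambda>x. f n x - g x) + L2_norm M (\<lambda>x. f n x - h x)" for n
    using L2_norm_triangle_diff[OF assms(2) assms(1) assms(3), of n] L2_norm_commute[of M g "f n"] by simp
  ultimately have "L2_norm M (\<lambda>x. g x - h x) \<le> 0"
    using assms(4) by (metis (no_types, lifting) always_eventually tendsto_lowerbound)
  then show ?thesis using assms by (simp add: L2_eq_iff order_antisym)
qed

text \<open>Puts a pointwise limit into L^2 without a dominating function. It identifies the limit
  of a Cauchy sequence and, later, the Fourier transform of a function that is only approximated.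
  The bound is asked from \<open>N\<close> on, so that it can be a tail estimate.\<close>

lemma L2_Fatou:
  assumes "\<And>n. h n \<in> L2 M" "g \<in> borel_measurable M" "AE x in M. (\<lambda>n. h n x) \<longlonglongrightarrow> g x"
    and "\<And>n. n \<ge> N \<Longrightarrow> L2_norm M (h n) \<le> C"
  shows "g \<in> L2 M" "L2_norm M g \<le> C"
proof -
  have C: "C \<ge> 0" using order_trans[OF L2_norm_nonneg assms(4)[of N]] by simp
  have "(\<integral>\<^sup>+x. ennreal ((cmod (g x))\<^sup>2) \<partial>M) = (\<integral>\<^sup>+x. liminf (\<lambda>n. ennreal ((cmod (h n x))\<^sup>2)) \<partial>M)"
  proof (rule nn_integral_cong_AE)
    show "AE x in M. ennreal ((cmod (g x))\<^sup>2) = liminf (\<lambda>n. ennreal ((cmod (h n x))\<^sup>2))"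
      using assms(3)
    proof (rule AE_mp, intro AE_I2 impI)
      fix x assume "(\<lambda>n. h n x) \<longlonglongrightarrow> g x"
      then have "(\<lambda>n. ennreal ((cmod (h n x))\<^sup>2)) \<longlonglongrightarrow> ennreal ((cmod (g x))\<^sup>2)"
        by (intro tendsto_ennrealI tendsto_power tendsto_norm)
      then show "ennreal ((cmod (g x))\<^sup>2) = liminf (\<lambda>n. ennreal ((cmod (h n x))\<^sup>2))"
        using lim_imp_Liminf[OF sequentially_bot] by (metis (no_types, lifting))
    qed
  qed
  also have "\<dots> \<le> liminf (\<lambda>n. \<integral>\<^sup>+x. ennreal ((cmod (h n x))\<^sup>2) \<partial>M)"
    using assms(1) by (intro nn_integral_liminf) (auto dest: L2_measurable)
  also have "\<dots> \<le> liminf (\<lambda>n. ennreal (C\<^sup>2))"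
  proof (rule Liminf_mono)
    show "\<forall>\<^sub>F n in sequentially. (\<integral>\<^sup>+x. ennreal ((cmod (h n x))\<^sup>2) \<partial>M) \<le> ennreal (C\<^sup>2)"
      using eventually_ge_at_top[of N]
    proof eventually_elim
      case (elim n)
      then show ?case using L2_nn_integral[OF assms(1)[of n]] assms(4)[of n]
        by (simp add: ennreal_leI power_mono)
    qed
  qed
  also have "\<dots> = ennreal (C\<^sup>2)" by (simp add: Liminf_const)
  finally show "g \<in> L2 M" "L2_norm M g \<le> C"
    using L2_I_nn_integral[OF assms(2) _ C] by auto
qed

text \<open>Weights make a pointwise argument possible on a measure space that may be infinite: with
  \<open>a k\<close> the k-th increment, \<open>\<Sum> 2^k (a k)^2\<close> has finite integral
  because \<open>2^k 4^(-k) = 2^(-k)\<close>, so it is finite almost everywhere. Then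
  \<open>2 a k \<le> 2^(-k) + 2^k (a k)^2\<close> shows that the increments are absolutely summable
  there.\<close>

lemma L2_complete_fast:
  assumes f: "\<And>n. f n \<in> L2 M" and fast: "\<And>n. L2_norm M (\<lambda>x. f (Suc n) x - f n x) \<le> (1/2)^n"
  shows "\<exists>g\<in>L2 M. (\<lambda>n. L2_norm M (\<lambda>x. f n x - g x)) \<longlonglongrightarrow> 0"
proof -
  define a where "a k x = cmod (f (Suc k) x - f k x)" for k x
  have am: "a k \<in> borel_measurable M" for k
    unfolding a_def using f by (auto dest: L2_measurable)
  have ak: "(\<integral>\<^sup>+x. ennreal (2^k * (a k x)\<^sup>2) \<partial>M) \<le> ennreal ((1/2)^k)" for k
  proof -
    have "(\<integral>\<^sup>+x. ennreal (2^k * (a k x)\<^sup>2) \<partial>M) = ennreal (2^k) * (\<integral>\<^sup>+x. ennreal ((a k x)\<^sup>2) \<partial>M)"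
      using am by (subst nn_integral_cmult[symmetric]) (auto simp: ennreal_mult)
    also have "(\<integral>\<^sup>+x. ennreal ((a k x)\<^sup>2) \<partial>M) = ennreal ((L2_norm M (\<lambda>x. f (Suc k) x - f k x))\<^sup>2)"
      unfolding a_def by (rule L2_nn_integral) (simp add: f)
    also have "\<dots> \<le> ennreal (((1/2)^k)\<^sup>2)"
      by (intro ennreal_leI power_mono fast) auto
    also have "ennreal (2^k) * ennreal (((1/2)^k)\<^sup>2) = ennreal ((1/2)^k)"
      by (simp add: ennreal_mult[symmetric] power2_eq_square power_divide)
    finally show ?thesis by (simp add: mult_left_mono)
  qed
  have "(\<integral>\<^sup>+x. (\<Sum>k. ennreal (2^k * (a k x)\<^sup>2)) \<partial>M) = (\<Sum>k. \<integral>\<^sup>+x. ennreal (2^k * (a k x)\<^sup>2) \<partial>M)"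
    using am by (intro nn_integral_suminf) auto
  also have "\<dots> \<le> (\<Sum>k. ennreal ((1/2)^k))" by (intro suminf_le ak) auto
  also have "\<dots> < \<infinity>"
    by (subst suminf_ennreal2) (auto intro!: summable_geometric)
  finally have "AE x in M. (\<Sum>k. ennreal (2^k * (a k x)\<^sup>2)) \<noteq> \<infinity>"
    using am by (intro nn_integral_PInf_AE) auto
  then have conv: "AE x in M. (\<lambda>n. f n x) \<longlonglongrightarrow> lim (\<lambda>n. f n x)"
  proof (rule AE_mp, intro AE_I2 impI)
    fix x assume fin: "(\<Sum>k. ennreal (2^k * (a k x)\<^sup>2)) \<noteq> \<infinity>"
    have s1: "summable (\<lambda>k. 2^k * (a k x)\<^sup>2)"
      using fin by (intro summable_suminf_not_top) auto
    have s2: "summable (\<lambda>k. (1/2)^k + 2^k * (a k x)\<^sup>2)"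
      by (intro summable_add s1 summable_geometric) auto
    have "summable (\<lambda>k. f (Suc k) x - f k x)"
    proof (rule summable_comparison_test'[OF s2, of 0])
      fix k :: nat
      \<comment> \<open>A square, multiplied by \<open>2^k\<close> to match the weights.\<close>
      have "(0::real) \<le> ((1/2)^k - a k x)\<^sup>2 * 2^k" by simp
      also have "\<dots> = (1/2)^k + 2^k * (a k x)\<^sup>2 - 2 * a k x"
        by (simp add: power2_diff algebra_simps power2_eq_square power_divide)
      finally show "norm (f (Suc k) x - f k x) \<le> (1/2)^k + 2^k * (a k x)\<^sup>2"
        using norm_ge_zero[of "f (Suc k) x - f k x"] unfolding a_def by linarith
    qed
    then have "convergent (\<lambda>n. \<Sum>k<n. f (Suc k) x - f k x)"
      by (simp add: summable_iff_convergent)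
    moreover have "(\<Sum>k<n. f (Suc k) x - f k x) = f n x - f 0 x" for n
      by (induction n) auto
    ultimately have "convergent (\<lambda>n. f n x - f 0 x)" by simp
    then have "convergent (\<lambda>n. (f n x - f 0 x) + f 0 x)" by (intro convergent_add convergent_const)
    then show "(\<lambda>n. f n x) \<longlonglongrightarrow> lim (\<lambda>n. f n x)" by (simp add: convergent_LIMSEQ_iff)
  qed
  define g where "g = (\<lambda>x. lim (\<lambda>n. f n x))"
  have gm: "g \<in> borel_measurable M" unfolding g_def using f
    by (intro borel_measurable_lim_metric) (auto dest: L2_measurable)
  \<comment> \<open>The exact value of the finite geometric sum is kept on the right, so that the
    induction closes.\<close>
  have tail: "L2_norm M (\<lambda>x. f (n + j) x - f n x) \<le> 2 * (1/2)^n - 2 * (1/2)^(n+j)" for n j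
  proof (induction j)
    case (Suc j)
    have "L2_norm M (\<lambda>x. f (n + Suc j) x - f n x) \<le>
      L2_norm M (\<lambda>x. f (Suc (n+j)) x - f (n+j) x) + L2_norm M (\<lambda>x. f (n+j) x - f n x)"
      using L2_norm_triangle_diff[OF f[of "Suc (n+j)"] f[of "n+j"] f[of n]] by simp
    then show ?case using Suc fast[of "n+j"] by simp
  qed simp
  have tail': "L2_norm M (\<lambda>x. f m x - f n x) \<le> 2 * (1/2)^n" if "m \<ge> n" for m n
    using tail[of n "m-n"] that order_trans[OF tail[of n "m-n"], of "2 * (1/2)^n"] by simp
  have lim: "(\<lambda>x. g x - f n x) \<in> L2 M \<and> L2_norm M (\<lambda>x. g x - f n x) \<le> 2 * (1/2)^n" for n
  proof -
    have ae: "AE x in M. (\<lambda>m. f m x - f n x) \<longlonglongrightarrow> g x - f n x"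
      using conv unfolding g_def by eventually_elim (intro tendsto_diff tendsto_const)
    show ?thesis
      using L2_Fatou[of "\<lambda>m x. f m x - f n x" M "\<lambda>x. g x - f n x" n "2 * (1/2)^n", OF _ _ ae tail']
        f gm by (auto dest: L2_measurable)
  qed
  have "g \<in> L2 M" using L2_add[OF conjunct1[OF lim[of 0]] f[of 0]] by simp
  moreover have "(\<lambda>n. L2_norm M (\<lambda>x. f n x - g x)) \<longlonglongrightarrow> 0"
  proof (rule tendsto_sandwich[OF _ _ tendsto_const])
    show "(\<lambda>n. 2 * (1/2::real)^n) \<longlonglongrightarrow> 0" using tendsto_mult[OF tendsto_const[of 2] LIMSEQ_realpow_zero[of "1/2::real"]] by simp
    show "\<forall>\<^sub>F n in sequentially. L2_norm M (\<lambda>x. f n x - g x) \<le> 2 * (1/2)^n"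
      using lim L2_norm_commute[of M _ g] by simp
  qed simp
  ultimately show ?thesis by blast
qed

lemma L2_complete:
  assumes f: "\<And>n. f n \<in> L2 M"
    and cauchy: "\<And>e. e > 0 \<Longrightarrow> \<exists>N. \<forall>m\<ge>N. \<forall>n\<ge>N. L2_norm M (\<lambda>x. f m x - f n x) < e"
  shows "\<exists>g\<in>L2 M. (\<lambda>n. L2_norm M (\<lambda>x. f n x - g x)) \<longlonglongrightarrow> 0"
proof -
  have "\<exists>N. \<forall>m\<ge>N. \<forall>n\<ge>N. L2_norm M (\<lambda>x. f m x - f n x) < (1/2)^k" for k
    by (rule cauchy) simp
  then obtain N where N: "\<And>k m n. m \<ge> N k \<Longrightarrow> n \<ge> N k \<Longrightarrow> L2_norm M (\<lambda>x. f m x - f n x) < (1/2)^k"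
    by metis
  \<comment> \<open>At least \<open>N k\<close>, nondecreasing and unbounded: an explicit index
    sequence with all three properties.\<close>
  define r where "r k = k + (\<Sum>j\<le>k. N j)" for k
  have r: "r k \<ge> N k" "r (Suc k) \<ge> r k" "r k \<ge> k" for k
    unfolding r_def by (auto intro!: trans_le_add2 member_le_sum)
  have "L2_norm M (\<lambda>x. f (r (Suc n)) x - f (r n) x) \<le> (1/2)^n" for n
    using N[of n "r (Suc n)" "r n"] r[of n] by force
  from L2_complete_fast[of "\<lambda>n. f (r n)", OF f this] obtain g
    where g: "g \<in> L2 M" "(\<lambda>n. L2_norm M (\<lambda>x. f (r n) x - g x)) \<longlonglongrightarrow> 0" by blast
  have "(\<lambda>n. L2_norm M (\<lambda>x. f n x - g x)) \<longlonglongrightarrow> 0"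
  proof (rule LIMSEQ_I)
    fix e :: real assume e: "e > 0"
    obtain K where K: "\<forall>m\<ge>K. \<forall>n\<ge>K. L2_norm M (\<lambda>x. f m x - f n x) < e/2"
      using cauchy[of "e/2"] e by auto
    obtain J where J: "\<And>n. n \<ge> J \<Longrightarrow> L2_norm M (\<lambda>x. f (r n) x - g x) < e/2"
      using LIMSEQ_D[OF g(2), of "e/2"] e by auto
    have "L2_norm M (\<lambda>x. f n x - g x) < e" if "n \<ge> K" for n
    proof -
      have "r (max J K) \<ge> K" using r(3)[of "max J K"] by simp
      then have "L2_norm M (\<lambda>x. f n x - f (r (max J K)) x) < e/2" using K that by blast
      moreover have "L2_norm M (\<lambda>x. f (r (max J K)) x - g x) < e/2" using J by simp
      ultimately show ?thesis
        using L2_norm_triangle_diff[OF f[of n] f[of "r (max J K)"] g(1)] by simp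
    qed
    then show "\<exists>no. \<forall>n\<ge>no. norm (L2_norm M (\<lambda>x. f n x - g x) - 0) < e" by auto
  qed
  with g(1) show ?thesis by blast
qed

text \<open>Sequences tending to \<open>t0\<close> inside \<open>T - {t0}\<close> suffice, and along
  each of them the squares are dominated by the integrable \<open>|h|^2\<close>.\<close>

lemma L2_dominated_convergence:
  assumes h: "h \<in> L2 M" and f: "\<And>t. t \<in> T - {t0} \<Longrightarrow> f t \<in> borel_measurable M"
    and lim: "\<And>x. x \<in> space M \<Longrightarrow> ((\<lambda>t. f t x) \<longlongrightarrow> 0) (at (t0::real) within T)"
    and bound: "\<And>t x. t \<in> T - {t0} \<Longrightarrow> x \<in> space M \<Longrightarrow> cmod (f t x) \<le> cmod (h x)"
  shows "((\<lambda>t. L2_norm M (f t)) \<longlongrightarrow> 0) (at t0 within T)"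
  unfolding tendsto_at_iff_sequentially comp_def
proof (intro allI impI)
  fix X :: "nat \<Rightarrow> real" assume X: "\<forall>i. X i \<in> T - {t0}" "X \<longlonglongrightarrow> t0"
  have "(\<lambda>i. LINT x|M. (cmod (f (X i) x))\<^sup>2) \<longlonglongrightarrow> (LINT x|M. 0)"
  proof (rule integral_dominated_convergence[where w = "\<lambda>x. (cmod (h x))\<^sup>2"])
    show "AE x in M. (\<lambda>i. (cmod (f (X i) x))\<^sup>2) \<longlonglongrightarrow> 0"
    proof (rule AE_I2)
      fix x assume "x \<in> space M"
      then have "(\<lambda>i. f (X i) x) \<longlonglongrightarrow> 0"
        using lim[of x] X unfolding tendsto_at_iff_sequentially comp_def by blast
      then have "(\<lambda>i. (cmod (f (X i) x))\<^sup>2) \<longlonglongrightarrow> (cmod 0)\<^sup>2" by (intro tendsto_intros)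
      then show "(\<lambda>i. (cmod (f (X i) x))\<^sup>2) \<longlonglongrightarrow> 0" by simp
    qed
    show "AE x in M. norm ((cmod (f (X i) x))\<^sup>2) \<le> (cmod (h x))\<^sup>2" for i
      using bound[of "X i"] X(1) by (auto intro!: power_mono)
    show "(\<lambda>x. (cmod (f (X i) x))\<^sup>2) \<in> borel_measurable M" for i using f[of "X i"] X(1) by auto
  qed (use h in \<open>auto simp: L2_square_integrable\<close>)
  then have "(\<lambda>i. sqrt (LINT x|M. (cmod (f (X i) x))\<^sup>2)) \<longlonglongrightarrow> sqrt 0"
    by (intro tendsto_real_sqrt) simp
  then show "(\<lambda>i. L2_norm M (f (X i))) \<longlonglongrightarrow> 0" by (simp add: L2_norm_def)
qed

lemma L2_dominated_convergence_sequentially: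
  assumes h: "h \<in> L2 M" and f: "\<And>n. f n \<in> borel_measurable M"
    and lim: "\<And>x. x \<in> space M \<Longrightarrow> (\<lambda>n. f n x) \<longlonglongrightarrow> 0"
    and bound: "\<And>n x. x \<in> space M \<Longrightarrow> cmod (f n x) \<le> cmod (h x)"
  shows "(\<lambda>n. L2_norm M (f n)) \<longlonglongrightarrow> 0"
proof -
  have "(\<lambda>i. LINT x|M. (cmod (f i x))\<^sup>2) \<longlonglongrightarrow> (LINT x|M. 0)"
  proof (rule integral_dominated_convergence[where w = "\<lambda>x. (cmod (h x))\<^sup>2"])
    show "AE x in M. (\<lambda>i. (cmod (f i x))\<^sup>2) \<longlonglongrightarrow> 0"
    proof (rule AE_I2)
      fix x assume "x \<in> space M"
      then have "(\<lambda>i. (cmod (f i x))\<^sup>2) \<longlonglongrightarrow> (cmod 0)\<^sup>2" by (intro tendsto_intros lim)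
      then show "(\<lambda>i. (cmod (f i x))\<^sup>2) \<longlonglongrightarrow> 0" by simp
    qed
    show "AE x in M. norm ((cmod (f i x))\<^sup>2) \<le> (cmod (h x))\<^sup>2" for i
      using bound by (auto intro!: power_mono)
    show "(\<lambda>x. (cmod (f i x))\<^sup>2) \<in> borel_measurable M" for i using f by auto
  qed (use h in \<open>auto simp: L2_square_integrable\<close>)
  then have "(\<lambda>i. sqrt (LINT x|M. (cmod (f i x))\<^sup>2)) \<longlonglongrightarrow> sqrt 0"
    by (intro tendsto_real_sqrt) simp
  then show ?thesis by (simp add: L2_norm_def)
qed

section \<open>Strongly continuous semigroups\<close>

lemma bounded_operator_L2_closed: "bounded_operator_L2 M T \<Longrightarrow> f \<in> L2 M \<Longrightarrow> T f \<in> L2 M"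
  by (simp add: bounded_operator_L2_def)

lemma bounded_operator_L2_bound:
  assumes "bounded_operator_L2 M T"
  obtains C where "\<And>f. f \<in> L2 M \<Longrightarrow> L2_norm M (T f) \<le> C * L2_norm M f"
  using assms unfolding bounded_operator_L2_def by blast

lemma bounded_operator_L2_lin:
  "bounded_operator_L2 M T \<Longrightarrow> f \<in> L2 M \<Longrightarrow> g \<in> L2 M \<Longrightarrow>
    L2_eq M (T (\<lambda>x. a * f x + b * g x)) (\<lambda>x. a * T f x + b * T g x)"
  by (simp add: bounded_operator_L2_def)

lemma bounded_operator_L2_lin3:
  assumes "bounded_operator_L2 M T" "f \<in> L2 M" "g \<in> L2 M" "h \<in> L2 M"
  shows "L2_eq M (T (\<lambda>x. a * f x + b * g x + c * h x)) (\<lambda>x. a * T f x + b * T g x + c * T h x)"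
proof -
  have 1: "L2_eq M (T (\<lambda>x. 1 * (a * f x + b * g x) + c * h x))
      (\<lambda>x. 1 * T (\<lambda>x. a * f x + b * g x) x + c * T h x)"
    using assms by (intro bounded_operator_L2_lin) auto
  have 2: "L2_eq M (\<lambda>x. 1 * T (\<lambda>x. a * f x + b * g x) x + c * T h x)
      (\<lambda>x. 1 * (a * T f x + b * T g x) + c * T h x)"
    by (rule L2_eq_lin[OF bounded_operator_L2_lin[OF assms(1-3)]
          L2_eq_refl[OF bounded_operator_L2_closed[OF assms(1,4)]]])
  show ?thesis using L2_eq_trans[OF 1 2] by simp
qed

lemma bounded_operator_L2_diff:
  "bounded_operator_L2 M T \<Longrightarrow> f \<in> L2 M \<Longrightarrow> g \<in> L2 M \<Longrightarrow>
    L2_eq M (T (\<lambda>x. f x - g x)) (\<lambda>x. T f x - T g x)"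
  using bounded_operator_L2_lin[of M T f g 1 "-1"] by simp

lemma bounded_operator_L2_diff_norm:
  assumes "bounded_operator_L2 M T" "\<And>f. f \<in> L2 M \<Longrightarrow> L2_norm M (T f) \<le> K * L2_norm M f"
    and "f \<in> L2 M" "g \<in> L2 M"
  shows "L2_norm M (\<lambda>x. T f x - T g x) \<le> K * L2_norm M (\<lambda>x. f x - g x)"
  using L2_eq_norm[OF bounded_operator_L2_diff[OF assms(1,3,4)]] assms(2)[of "\<lambda>x. f x - g x"] assms
  by simp

text \<open>Among \<open>T (x + y)\<close> and \<open>T (x - y)\<close>, one has at least the norm of \<open>T y\<close>; this is what
  replaces Baire's theorem in the proof of the uniform boundedness principle below (Sokal).\<close>

lemma bounded_operator_L2_max:
  assumes T: "bounded_operator_L2 M T" and L: "x \<in> L2 M" "y \<in> L2 M"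
  shows "\<exists>s\<in>{1, -1}. cmod r * L2_norm M (T y) \<le> L2_norm M (T (\<lambda>z. x z + (s * r) * y z))"
proof -
  note TL = L[THEN bounded_operator_L2_closed[OF T]]
  have n: "L2_norm M (T (\<lambda>z. x z + (s * r) * y z)) = L2_norm M (\<lambda>z. T x z + (s * r) * T y z)" for s
    using L2_eq_norm[OF bounded_operator_L2_lin[OF T L, of 1 "s * r"]] by simp
  have "cmod (2 * r) * L2_norm M (T y)
      = L2_norm M (\<lambda>z. (T x z + (1 * r) * T y z) - (T x z + (- 1 * r) * T y z))"
    using L2_norm_scale[of M "2 * r" "T y"] by (simp add: algebra_simps)
  also have "\<dots> \<le> L2_norm M (\<lambda>z. T x z + (1 * r) * T y z) + L2_norm M (\<lambda>z. T x z + (- 1 * r) * T y z)"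
    using TL by (intro L2_norm_triangle_minus) auto
  finally have "2 * (cmod r * L2_norm M (T y)) \<le> L2_norm M (T (\<lambda>z. x z + (1 * r) * y z))
      + L2_norm M (T (\<lambda>z. x z + (-1 * r) * y z))"
    unfolding n by (simp add: norm_mult)
  then have "cmod r * L2_norm M (T y) \<le> L2_norm M (T (\<lambda>z. x z + (1 * r) * y z)) \<or>
     cmod r * L2_norm M (T y) \<le> L2_norm M (T (\<lambda>z. x z + (-1 * r) * y z))" by linarith
  then show ?thesis by blast
qed

text \<open>\<open>N\<close> is the operator norm, obtained as a supremum over the unit ball; the
  vector \<open>f0\<close> forces it above \<open>K\<close>. Norming up to the factor 3/4 is enough
  below, where an error of relative size 1/2 is subtracted.\<close>

lemma bounded_operator_L2_near_norming:
  assumes T: "bounded_operator_L2 M T" and K: "K > 0" "f0 \<in> L2 M" "K * L2_norm M f0 < L2_norm M (T f0)"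
  shows "\<exists>N y. K \<le> N \<and> y \<in> L2 M \<and> L2_norm M y \<le> 1 \<and> 3/4 * N \<le> L2_norm M (T y) \<and>
    (\<forall>f\<in>L2 M. L2_norm M (T f) \<le> N * L2_norm M f)"
proof -
  obtain C where C: "\<And>f. f \<in> L2 M \<Longrightarrow> L2_norm M (T f) \<le> C * L2_norm M f"
    using bounded_operator_L2_bound[OF T] by blast
  define X where "X = {L2_norm M (T f) |f. f \<in> L2 M \<and> L2_norm M f \<le> 1}"
  have bdd: "bdd_above X"
  proof
    fix z assume "z \<in> X"
    then obtain f where f: "f \<in> L2 M" "L2_norm M f \<le> 1" "z = L2_norm M (T f)" by (auto simp: X_def)
    have "z \<le> C * L2_norm M f" using C f by simp
    also have "\<dots> \<le> \<bar>C\<bar> * 1" using f by (intro mult_mono) auto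
    finally show "z \<le> \<bar>C\<bar>" by simp
  qed
  have scaled: "L2_norm M (T f) / L2_norm M f \<in> X" if f: "f \<in> L2 M" "L2_norm M f > 0" for f
  proof -
    define c where "c = complex_of_real (1 / L2_norm M f)"
    have "L2_norm M (T (\<lambda>x. c * f x + 0 * f x)) = L2_norm M (\<lambda>x. c * T f x + 0 * T f x)"
      by (intro L2_eq_norm bounded_operator_L2_lin T f)
    then have "L2_norm M (T (\<lambda>x. c * f x)) = L2_norm M (T f) / L2_norm M f"
      using f by (simp add: L2_norm_scale L2_norm_divide c_def norm_divide)
    moreover have "L2_norm M (\<lambda>x. c * f x) \<le> 1"
      using f by (simp add: L2_norm_scale L2_norm_divide c_def norm_divide)
    moreover have "(\<lambda>x. c * f x) \<in> L2 M" using f by simp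
    ultimately show ?thesis unfolding X_def by (metis (mono_tags, lifting) mem_Collect_eq)
  qed
  define N where "N = Sup X"
  have f0: "L2_norm M f0 > 0"
  proof (rule ccontr)
    assume "\<not> ?thesis"
    then have "L2_norm M f0 = 0" using L2_norm_nonneg[of M f0] by linarith
    then show False using K(3) C[OF K(2)] by simp
  qed
  have "K < L2_norm M (T f0) / L2_norm M f0" using K f0 by (simp add: field_simps)
  also have "\<dots> \<le> N" unfolding N_def using scaled[OF K(2) f0] bdd by (rule cSup_upper)
  finally have KN: "K < N" .
  have "\<exists>z\<in>X. 3/4 * N < z"
    using scaled[OF K(2) f0] KN K bdd less_cSup_iff[of X "3/4*N"] by (auto simp: N_def)
  then obtain y where y: "y \<in> L2 M" "L2_norm M y \<le> 1" "3/4 * N < L2_norm M (T y)"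
    by (auto simp: X_def)
  have "L2_norm M (T f) \<le> N * L2_norm M f" if f: "f \<in> L2 M" for f
  proof (cases "L2_norm M f = 0")
    case True then show ?thesis using C[OF f] by simp
  next
    case False
    then have p: "L2_norm M f > 0" using L2_norm_nonneg[of M f] by linarith
    have "L2_norm M (T f) / L2_norm M f \<le> N" unfolding N_def using scaled[OF f p] bdd by (rule cSup_upper)
    then show ?thesis using p by (simp add: field_simps)
  qed
  with y KN show ?thesis by (intro exI[of _ N] exI[of _ y]) auto
qed

text \<open>Gliding hump: operators \<open>T (k j)\<close> of norm \<open>N j \<ge> 4^j\<close> and
  almost norming vectors \<open>y j\<close> are combined into
  \<open>g = \<Sum> \<plusminus> 3^(-j) y j\<close>, the signs being chosen one after another so
  that the j-th term is not cancelled. Then \<open>T (k j) g\<close> has norm at least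
  \<open>3^(-j) N j / 4\<close>, which is unbounded in j.\<close>

lemma L2_uniform_boundedness:
  fixes T :: "nat \<Rightarrow> ('a \<Rightarrow> complex) \<Rightarrow> ('a \<Rightarrow> complex)"
  assumes T: "\<And>k. bounded_operator_L2 M (T k)"
    and pw: "\<And>f. f \<in> L2 M \<Longrightarrow> \<exists>B. \<forall>k. L2_norm M (T k f) \<le> B"
  shows "\<exists>K. \<forall>k. \<forall>f\<in>L2 M. L2_norm M (T k f) \<le> K * L2_norm M f"
proof (rule ccontr)
  assume neg: "\<not> ?thesis"
  have "\<exists>k N y. 4^j \<le> N \<and> y \<in> L2 M \<and> L2_norm M y \<le> 1 \<and> 3/4 * N \<le> L2_norm M (T k y) \<and>
    (\<forall>f\<in>L2 M. L2_norm M (T k f) \<le> N * L2_norm M f)" for j :: nat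
  proof -
    obtain k f where "f \<in> L2 M" "4^j * L2_norm M f < L2_norm M (T k f)"
      using neg by (meson not_le)
    from bounded_operator_L2_near_norming[OF T _ this] show ?thesis by auto
  qed
  then obtain k N y where kNy: "\<And>j::nat. 4^j \<le> N j" "\<And>j::nat. y j \<in> L2 M" "\<And>j. L2_norm M (y j) \<le> 1"
    "\<And>j. 3/4 * N j \<le> L2_norm M (T (k j) (y j))"
    "\<And>j f. f \<in> L2 M \<Longrightarrow> L2_norm M (T (k j) f) \<le> N j * L2_norm M f"
    by metis
  define r where "r j = complex_of_real ((1/3)^j)" for j
  have cr: "cmod (r j) = (1/3)^j" for j by (simp add: r_def norm_power norm_divide)
  have "\<exists>s\<in>{1,-1}. cmod (r j) * L2_norm M (T (k j) (y j)) \<le> L2_norm M (T (k j) (\<lambda>z. x z + (s * r j) * y j z))"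
    if "x \<in> L2 M" for x j
    using bounded_operator_L2_max[OF T that kNy(2)] .
  then have "\<forall>x\<in>L2 M. \<forall>j. \<exists>s. s \<in> {1,-1} \<and>
      cmod (r j) * L2_norm M (T (k j) (y j)) \<le> L2_norm M (T (k j) (\<lambda>z. x z + (s * r j) * y j z))"
    by blast
  then obtain s where s: "\<And>x j. x \<in> L2 M \<Longrightarrow> s x j \<in> {1,-1}"
    "\<And>x j. x \<in> L2 M \<Longrightarrow> cmod (r j) * L2_norm M (T (k j) (y j)) \<le> L2_norm M (T (k j) (\<lambda>z. x z + (s x j * r j) * y j z))"
    unfolding bchoice_iff choice_iff by blast
  \<comment> \<open>Partial sums; the sign of the next term depends on the current partial sum,
    hence the recursion.\<close>
  define X where "X = rec_nat (\<lambda>z. 0) (\<lambda>j x. (\<lambda>z. x z + (s x j * r j) * y j z))"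
  have X0: "X 0 = (\<lambda>z. 0)" and XS: "X (Suc j) = (\<lambda>z. X j z + (s (X j) j * r j) * y j z)" for j
    by (simp_all add: X_def)
  have XL: "X j \<in> L2 M" for j
    by (induction j) (auto simp: X0 XS kNy)
  have step: "L2_norm M (\<lambda>z. X (Suc j) z - X j z) \<le> (1/3)^j" for j
  proof -
    have "cmod (s (X j) j) = 1" using s(1)[OF XL, of j j] by auto
    then have "L2_norm M (\<lambda>z. X (Suc j) z - X j z) = (1/3)^j * L2_norm M (y j)"
      by (simp add: XS L2_norm_scale norm_mult cr)
    also have "\<dots> \<le> (1/3)^j * 1" using kNy(3) by (intro mult_left_mono) auto
    finally show ?thesis by simp
  qed
  have "L2_norm M (\<lambda>z. X (Suc j) z - X j z) \<le> (1/2)^j" for j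
    by (rule order_trans[OF step]) (auto intro: power_mono)
  from L2_complete_fast[OF XL this] obtain g where
    g: "g \<in> L2 M" "(\<lambda>n. L2_norm M (\<lambda>x. X n x - g x)) \<longlonglongrightarrow> 0" by blast
  have tail: "L2_norm M (\<lambda>z. X (n + j) z - X n z) \<le> 3/2 * (1/3)^n - 3/2 * (1/3)^(n+j)" for n j
  proof (induction j)
    case (Suc j)
    have "L2_norm M (\<lambda>x. X (n + Suc j) x - X n x) \<le>
      L2_norm M (\<lambda>x. X (Suc (n+j)) x - X (n+j) x) + L2_norm M (\<lambda>x. X (n+j) x - X n x)"
      using L2_norm_triangle_diff[OF XL[of "Suc (n+j)"] XL[of "n+j"] XL[of n]] by simp
    then show ?case using Suc step[of "n+j"] by simp
  qed simp
  have lim: "L2_norm M (\<lambda>z. g z - X n z) \<le> 3/2 * (1/3)^n" for n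
  proof (rule tendsto_lowerbound)
    show "(\<lambda>j. L2_norm M (\<lambda>x. X (j+n) x - g x) + 3/2 * (1/3)^n) \<longlonglongrightarrow> 3/2 * (1/3)^n" 
      using tendsto_add[OF LIMSEQ_ignore_initial_segment[OF g(2), of n] tendsto_const] by simp
    have "L2_norm M (\<lambda>z. g z - X n z) \<le> L2_norm M (\<lambda>x. X (j+n) x - g x) + 3/2 * (1/3)^n" for j
    proof -
      have "L2_norm M (\<lambda>x. X (j+n) x - X n x) \<le> 3/2 * (1/3)^n"
        using order_trans[OF tail[of n j], of "3/2 * (1/3)^n"] by (simp add: add.commute)
      then show ?thesis
        using L2_norm_triangle_diff[OF g(1) XL[of "j+n"] XL[of n]] L2_norm_commute[of M g "X (j+n)"]
        by simp
    qed
    then show "\<forall>\<^sub>F j in sequentially. L2_norm M (\<lambda>z. g z - X n z) \<le> L2_norm M (\<lambda>x. X (j+n) x - g x) + 3/2 * (1/3)^n"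
      by simp
  qed simp
  obtain B where B: "\<And>k. L2_norm M (T k g) \<le> B" using pw[OF g(1)] by blast
  \<comment> \<open>The partial sum with its j-th term is mapped to norm at least
    \<open>3/4 * 3^(-j) N j\<close>, while the remaining terms have norm at most
    \<open>3/2 * 3^(-j-1) = 1/2 * 3^(-j)\<close> before \<open>T (k j)\<close> is applied; the
    difference leaves \<open>1/4 * 3^(-j) N j\<close>.\<close>
  have "1/4 * (4/3)^j \<le> B" for j
  proof -
    have Np: "0 \<le> N j" using kNy(1)[of j] by (rule order_trans[rotated]) simp
    have a: "(1/3)^j * (3/4 * N j) \<le> L2_norm M (T (k j) (X (Suc j)))"
      using s(2)[OF XL[of j], of j] kNy(4)[of j] unfolding XS cr
      by (meson mult_left_mono order_trans zero_le_power zero_le_divide_1_iff zero_le_numeral)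
    have "L2_norm M (T (k j) (X (Suc j))) - L2_norm M (T (k j) g)
        \<le> L2_norm M (\<lambda>x. T (k j) (X (Suc j)) x - T (k j) g x)"
      using L2_norm_diff_abs[of "T (k j) (X (Suc j))" M "T (k j) g"] T XL g
      by (simp add: bounded_operator_L2_closed)
    also have "\<dots> \<le> N j * L2_norm M (\<lambda>x. X (Suc j) x - g x)"
      by (rule bounded_operator_L2_diff_norm[OF T kNy(5) XL g(1)])
    also have "\<dots> \<le> N j * (3/2 * (1/3)^Suc j)"
      using lim[of "Suc j"] L2_norm_commute[of M g] Np by (intro mult_left_mono) auto
    finally have "L2_norm M (T (k j) g) \<ge> (1/3)^j * (1/4 * N j)"
      using a by (simp add: algebra_simps)
    moreover have "(1/3)^j * (1/4 * N j) \<ge> (1/3)^j * (1/4 * 4^j)"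
      using kNy(1)[of j] by (intro mult_left_mono) auto
    moreover have "(1/3)^j * (1/4 * 4^j) = 1/4 * (4/3::real)^j" by (simp add: power_divide)
    ultimately show ?thesis using B[of "k j"] by linarith
  qed
  then have *: "\<And>j. 1/4 * (4/3)^j \<le> B" .
  obtain j where "4 * B < (4/3::real)^j" using real_arch_pow[of "4/3" "4 * B"] by auto
  with *[of j] show False by simp
qed

section \<open>Local bounds and regularity of the orbits of a semigroup\<close>

locale L2_semigroup =
  fixes M :: "'a measure" and U :: "real \<Rightarrow> ('a \<Rightarrow> complex) \<Rightarrow> ('a \<Rightarrow> complex)"
  assumes C0: "C0_semigroup_L2 M U"
begin

lemma bounded: "t \<ge> 0 \<Longrightarrow> bounded_operator_L2 M (U t)"
  using C0 by (simp add: C0_semigroup_L2_def)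

lemma closed: "t \<ge> 0 \<Longrightarrow> f \<in> L2 M \<Longrightarrow> U t f \<in> L2 M"
  using bounded bounded_operator_L2_closed by blast

lemma at_0: "f \<in> L2 M \<Longrightarrow> L2_eq M (U 0 f) f"
  using C0 by (simp add: C0_semigroup_L2_def)

lemma add: "s \<ge> 0 \<Longrightarrow> t \<ge> 0 \<Longrightarrow> f \<in> L2 M \<Longrightarrow> L2_eq M (U (s + t) f) (U s (U t f))"
  using C0 by (simp add: C0_semigroup_L2_def)

lemma continuous_at_0: "f \<in> L2 M \<Longrightarrow> ((\<lambda>t. L2_norm M (\<lambda>x. U t f x - f x)) \<longlongrightarrow> 0) (at_right 0)"
  using C0 by (simp add: C0_semigroup_L2_def)

text \<open>If no bound held near 0, there would be times \<open>t m \<le> 1/(m+1)\<close> at which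
  the operator norm exceeds \<open>m\<close>. Strong continuity at 0 makes every orbit bounded along
  these times, so the uniform boundedness principle applies to the sequence
  \<open>U (t m)\<close>.\<close>

lemma bound_near_0:
  "\<exists>\<delta>>0. \<exists>K. \<forall>t\<in>{0..\<delta>}. \<forall>f\<in>L2 M. L2_norm M (U t f) \<le> K * L2_norm M f"
proof (rule ccontr)
  assume neg: "\<not> ?thesis"
  have "\<exists>t\<in>{0..1 / real (Suc m)}. \<exists>f\<in>L2 M. real m * L2_norm M f < L2_norm M (U t f)" for m
    using neg by (meson not_le of_nat_0_less_iff zero_less_Suc zero_less_divide_1_iff)
  then obtain t f where tf: "\<And>m. t m \<in> {0..1 / real (Suc m)}" "\<And>m. f m \<in> L2 M"
    "\<And>m. real m * L2_norm M (f m) < L2_norm M (U (t m) (f m))"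
    by metis
  have t0: "t m \<ge> 0" for m using tf(1)[of m] by simp
  have "\<exists>B. \<forall>m. L2_norm M (U (t m) g) \<le> B" if g: "g \<in> L2 M" for g
  proof -
    from continuous_at_0[OF g] have "\<forall>\<^sub>F t in at_right 0. L2_norm M (\<lambda>x. U t g x - g x) < 1"
      by (rule order_tendstoD) simp
    then obtain d where d: "d > 0" "\<And>t. 0 < t \<Longrightarrow> t < d \<Longrightarrow> L2_norm M (\<lambda>x. U t g x - g x) < 1"
      by (auto simp: eventually_at_right_field)
    obtain m0 where m0: "1 / real (Suc m0) < d" using d(1) nat_approx_posE by blast
    have "L2_norm M (U (t m) g) \<le> L2_norm M g + 1" if "m \<ge> m0" for m
    proof (cases "t m = 0")
      case True then show ?thesis using L2_eq_norm[OF at_0[OF g]] by simp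
    next
      case False
      have "1 / real (Suc m) \<le> 1 / real (Suc m0)" using that by (simp add: frac_le)
      then have "0 < t m" "t m < d" using False tf(1)[of m] m0 by auto
      then show ?thesis
        using d(2)[of "t m"] L2_norm_diff_abs[OF closed[OF t0[of m] g] g] by simp
    qed
    \<comment> \<open>The finitely many times before \<open>m0\<close> escape the continuity
      estimate and are covered by the sum of their norms.\<close>
    then have "L2_norm M (U (t m) g) \<le> max (L2_norm M g + 1) (\<Sum>i<m0. L2_norm M (U (t i) g))" for m
      using member_le_sum[of m "{..<m0}" "\<lambda>i. L2_norm M (U (t i) g)"]
      by (cases "m \<ge> m0") (auto simp: max_def intro: order_trans)
    then show ?thesis by blast
  qed
  from L2_uniform_boundedness[of M "\<lambda>m. U (t m)", OF bounded[OF t0] this]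
  obtain K where K: "\<And>m f. f \<in> L2 M \<Longrightarrow> L2_norm M (U (t m) f) \<le> K * L2_norm M f" by blast
  obtain m where m: "real m \<ge> K" using real_arch_simple by blast
  have "L2_norm M (U (t m) (f m)) \<le> real m * L2_norm M (f m)"
    using K[OF tf(2)[of m], of m] mult_right_mono[OF m L2_norm_nonneg[of M "f m"]] by linarith
  then show False using tf(3)[of m] by simp
qed

text \<open>A time up to \<open>n d\<close> is reached in n steps of length at most
  \<open>d\<close>, each costing a factor \<open>K1\<close>; \<open>K1 \<ge> 1\<close> makes the
  estimate monotone in n.\<close>

lemma bound: "\<exists>K\<ge>0. \<forall>t\<in>{0..b}. \<forall>f\<in>L2 M. L2_norm M (U t f) \<le> K * L2_norm M f"
proof -
  obtain d K where dK: "d > 0" "\<And>t f. t \<in> {0..d} \<Longrightarrow> f \<in> L2 M \<Longrightarrow> L2_norm M (U t f) \<le> K * L2_norm M f"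
    using bound_near_0 by blast
  define K1 where "K1 = max K 1"
  have K1: "L2_norm M (U t f) \<le> K1 * L2_norm M f" if "t \<in> {0..d}" "f \<in> L2 M" for t f
    using dK(2)[OF that] mult_right_mono[of K K1 "L2_norm M f"] by (simp add: K1_def)
  have K1p: "K1 \<ge> 1" by (simp add: K1_def)
  have *: "L2_norm M (U t f) \<le> K1 ^ n * L2_norm M f" if "t \<in> {0..real n * d}" "f \<in> L2 M" for n t f
    using that
  proof (induction n arbitrary: t f)
    case 0
    then show ?case using L2_eq_norm[OF at_0] by simp
  next
    case (Suc n)
    show ?case
    proof (cases "t \<le> d")
      case True
      then have "L2_norm M (U t f) \<le> K1 * L2_norm M f" using K1 Suc by simp
      also have "\<dots> \<le> K1 ^ Suc n * L2_norm M f"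
        using K1p by (intro mult_right_mono) (auto intro: order_trans[OF _ self_le_power])
      finally show ?thesis .
    next
      case False
      have "L2_norm M (U (d + (t - d)) f) = L2_norm M (U d (U (t - d) f))"
        using False Suc.prems dK(1) by (intro L2_eq_norm add) auto
      also have "\<dots> \<le> K1 * L2_norm M (U (t - d) f)" using K1[of d "U (t - d) f"] closed[of "t - d" f] False Suc.prems dK(1) by simp
      also have "\<dots> \<le> K1 * (K1 ^ n * L2_norm M f)"
        using False Suc.prems K1p by (intro mult_left_mono Suc.IH) (auto simp: algebra_simps)
      finally show ?thesis by simp
    qed
  qed
  obtain n where "real n * d \<ge> b" using dK(1) by (metis reals_Archimedean3 less_imp_le)
  then show ?thesis using *[of _ n] K1p by (intro exI[of _ "K1 ^ n"]) auto
qed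

text \<open>Lets limits known only from the right at 0 be used at an arbitrary time and from both
  sides.\<close>

lemma abs_diff_at_right: "filterlim (\<lambda>s. \<bar>s - t\<bar>) (at_right 0) (at t within (T::real set))"
  unfolding filterlim_at
  by (auto simp: eventually_at_filter intro!: tendsto_eq_intros)

text \<open>With \<open>m = min s t\<close> the difference is, up to sign,
  \<open>U m (U |s - t| f - f)\<close>. This treats both sides of \<open>t\<close> alike, since the
  bound for \<open>U m\<close> is uniform on \<open>[0, t + 1]\<close>.\<close>

lemma orbit_continuous:
  assumes t: "t \<ge> 0" and f: "f \<in> L2 M"
  shows "((\<lambda>s. L2_norm M (\<lambda>x. U s f x - U t f x)) \<longlongrightarrow> 0) (at t within {0..})"
proof -
  obtain K where K: "K \<ge> 0" "\<And>s f. s \<in> {0..t + 1} \<Longrightarrow> f \<in> L2 M \<Longrightarrow> L2_norm M (U s f) \<le> K * L2_norm M f"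
    using bound by blast
  have est: "L2_norm M (\<lambda>x. U s f x - U t f x) \<le> K * L2_norm M (\<lambda>x. U \<bar>s - t\<bar> f x - f x)"
    if s: "s \<in> {0..t + 1}" for s
  proof -
    define m where "m = min s t"
    have m: "m \<ge> 0" "m \<in> {0..t+1}" using s t by (auto simp: m_def)
    note Uh = closed[OF abs_ge_zero[of "s - t"] f]
    have e: "L2_eq M (U (m + \<bar>s - t\<bar>) f) (U m (U \<bar>s - t\<bar> f))" using m f by (intro add) auto
    have "L2_norm M (\<lambda>x. U s f x - U t f x) = L2_norm M (\<lambda>x. U (m + \<bar>s - t\<bar>) f x - U m f x)"
      using L2_norm_commute[of M "U s f" "U t f"] by (cases "s \<le> t") (auto simp: m_def)
    also have "\<dots> = L2_norm M (\<lambda>x. U m (U \<bar>s - t\<bar> f) x - U m f x)"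
      using m f by (intro L2_eq_norm L2_eq_diff e L2_eq_refl closed) auto
    also have "\<dots> \<le> K * L2_norm M (\<lambda>x. U \<bar>s - t\<bar> f x - f x)"
      using m by (intro bounded_operator_L2_diff_norm bounded K(2) Uh f) auto
    finally show ?thesis .
  qed
  show ?thesis
  proof (rule tendsto_sandwich[OF _ _ tendsto_const])
    show "((\<lambda>s. K * L2_norm M (\<lambda>x. U \<bar>s - t\<bar> f x - f x)) \<longlongrightarrow> 0) (at t within {0..})"
      using tendsto_mult[OF tendsto_const[of K] filterlim_compose[OF continuous_at_0[OF f] abs_diff_at_right[of t "{0..}"]]]
      by simp
    have "\<forall>\<^sub>F s in at t within {0..}. s < t + 1 \<and> s \<in> {0..}"
      using order_tendstoD(2)[OF tendsto_ident_at, of t "t+1" "{0..}"]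
      by (auto simp: eventually_at_filter elim: eventually_mono)
    then show "\<forall>\<^sub>F s in at t within {0..}. L2_norm M (\<lambda>x. U s f x - U t f x) \<le> K * L2_norm M (\<lambda>x. U \<bar>s - t\<bar> f x - f x)"
      by eventually_elim (auto intro: est)
  qed simp
qed

text \<open>\<open>U t\<close> commutes with \<open>U h\<close>, so it carries the difference
  quotients of \<open>f\<close> to those of \<open>U t f\<close>; being bounded, it carries the
  limit along.\<close>

lemma generator_orbit:
  assumes t: "t \<ge> 0" and gen: "generator_L2 M U f g"
  shows "generator_L2 M U (U t f) (U t g)"
proof -
  have f: "f \<in> L2 M" and g: "g \<in> L2 M"
    and lim: "((\<lambda>t. L2_norm M (\<lambda>x. (U t f x - f x) / complex_of_real t - g x)) \<longlongrightarrow> 0) (at_right 0)"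
    using gen by (auto simp: generator_L2_def)
  obtain K where K: "\<And>f. f \<in> L2 M \<Longrightarrow> L2_norm M (U t f) \<le> K * L2_norm M f"
    using bounded_operator_L2_bound[OF bounded[OF t]] by blast
  have est: "L2_norm M (\<lambda>x. (U h (U t f) x - U t f x) / complex_of_real h - U t g x)
      \<le> K * L2_norm M (\<lambda>x. (U h f x - f x) / complex_of_real h - g x)" if h: "h > 0" for h
  proof -
    note Uh = closed[OF less_imp_le[OF h] f]
    have "L2_eq M (U (h + t) f) (U h (U t f))" "L2_eq M (U (t + h) f) (U t (U h f))"
      using h t f by (auto intro!: add)
    then have e: "L2_eq M (U h (U t f)) (U t (U h f))"
      using L2_eq_trans[OF L2_eq_sym] by (simp add: add.commute)
    define a where "a = 1 / complex_of_real h"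
    \<comment> \<open>\<open>e\<close> replaces one summand only; the two others are packed into a
      single term to fit a linear combination of two functions.\<close>
    have e1: "L2_eq M (\<lambda>x. a * U h (U t f) x + 1 * (- a * U t f x + - 1 * U t g x))
       (\<lambda>x. a * U t (U h f) x + 1 * (- a * U t f x + - 1 * U t g x))"
      using closed[OF t f] closed[OF t g] by (intro L2_eq_lin e L2_eq_refl) auto
    have "L2_norm M (\<lambda>x. (U h (U t f) x - U t f x) / complex_of_real h - U t g x)
        = L2_norm M (\<lambda>x. a * U h (U t f) x + 1 * (- a * U t f x + - 1 * U t g x))"
      by (intro L2_norm_cong arg_cong[where f = cmod]) (simp add: a_def diff_divide_distrib)
    also have "\<dots> = L2_norm M (\<lambda>x. a * U t (U h f) x + - a * U t f x + - 1 * U t g x)"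
      using L2_eq_norm[OF e1] by (simp add: algebra_simps)
    also have "\<dots> = L2_norm M (U t (\<lambda>x. a * U h f x + - a * f x + - 1 * g x))"
      by (intro L2_eq_norm[symmetric] bounded_operator_L2_lin3 bounded t Uh f g)
    also have "\<dots> \<le> K * L2_norm M (\<lambda>x. a * U h f x + - a * f x + - 1 * g x)"
      using Uh f g L2_add[OF L2_add[OF L2_scale[OF Uh, of a] L2_scale[OF f, of "-a"]] L2_scale[OF g, of "-1"]]
      by (intro K)
    also have "L2_norm M (\<lambda>x. a * U h f x + - a * f x + - 1 * g x)
        = L2_norm M (\<lambda>x. (U h f x - f x) / complex_of_real h - g x)"
      by (intro L2_norm_cong arg_cong[where f = cmod]) (simp add: a_def diff_divide_distrib)
    finally show ?thesis .
  qed
  have "((\<lambda>h. L2_norm M (\<lambda>x. (U h (U t f) x - U t f x) / complex_of_real h - U t g x)) \<longlongrightarrow> 0) (at_right 0)"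
  proof (rule tendsto_sandwich[OF _ _ tendsto_const])
    show "((\<lambda>h. K * L2_norm M (\<lambda>x. (U h f x - f x) / complex_of_real h - g x)) \<longlongrightarrow> 0) (at_right 0)"
      using tendsto_mult[OF tendsto_const[of K] lim] by simp
  qed (use est in \<open>auto simp: eventually_at_filter\<close>)
  then show ?thesis using closed[OF t f] closed[OF t g] by (simp add: generator_L2_def)
qed

text \<open>The quotient between \<open>s\<close> and \<open>t\<close> is \<open>U m\<close> applied
  to the quotient of \<open>f\<close> at \<open>|s - t|\<close>, where \<open>m = min s t\<close>.
  On the left of \<open>t\<close> this tends to \<open>U s g\<close> rather than
  \<open>U t g\<close>; continuity of the orbit of \<open>g\<close> removes the difference, and the
  uniform bound on \<open>U m\<close> handles the moving operator.\<close>

lemma orbit_C1: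
  assumes gen: "generator_L2 M U f g"
  shows "C1_L2 M (\<lambda>t. U t f) (\<lambda>t. U t g)"
  unfolding C1_L2_def
proof (intro allI impI conjI)
  have f: "f \<in> L2 M" and g: "g \<in> L2 M"
    and lim: "((\<lambda>t. L2_norm M (\<lambda>x. (U t f x - f x) / complex_of_real t - g x)) \<longlongrightarrow> 0) (at_right 0)"
    using gen by (auto simp: generator_L2_def)
  fix t :: real assume t: "t \<ge> 0"
  show "U t f \<in> L2 M" "U t g \<in> L2 M" using t f g by (auto intro: closed)
  show "((\<lambda>s. L2_norm M (\<lambda>x. U s g x - U t g x)) \<longlongrightarrow> 0) (at t within {0..})"
    by (rule orbit_continuous[OF t g])
  obtain K where K: "K \<ge> 0" "\<And>s f. s \<in> {0..t + 1} \<Longrightarrow> f \<in> L2 M \<Longrightarrow> L2_norm M (U s f) \<le> K * L2_norm M f"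
    using bound by blast
  let ?Q = "\<lambda>h. L2_norm M (\<lambda>x. (U h f x - f x) / complex_of_real h - g x)"
  have est: "L2_norm M (\<lambda>x. (U s f x - U t f x) / complex_of_real (s - t) - U t g x)
     \<le> K * ?Q \<bar>s - t\<bar> + L2_norm M (\<lambda>x. U s g x - U t g x)"
    if s: "s \<in> {0..t + 1}" "s \<noteq> t" for s
  proof -
    define m h where "m = min s t" and "h = \<bar>s - t\<bar>"
    have m: "m \<ge> 0" "m \<in> {0..t+1}" and h: "h > 0" using s t by (auto simp: m_def h_def)
    note Uh = closed[OF less_imp_le[OF h] f]
    have e: "L2_eq M (U (m + h) f) (U m (U h f))" using m f h by (intro add) auto
    define a where "a = 1 / complex_of_real h"
    have e1: "L2_eq M (\<lambda>x. a * U (m + h) f x + 1 * (- a * U m f x + - 1 * U m g x))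
       (\<lambda>x. a * U m (U h f) x + 1 * (- a * U m f x + - 1 * U m g x))"
      using closed[OF m(1) f] closed[OF m(1) g] by (intro L2_eq_lin e L2_eq_refl) auto
    have q: "(U s f x - U t f x) / complex_of_real (s - t) = (U (m+h) f x - U m f x) * a" for x
    proof (cases "s \<le> t")
      case True
      have "(U s f x - U t f x) / complex_of_real (s - t)
          = - (U t f x - U s f x) / - complex_of_real (t - s)" by simp
      also have "\<dots> = (U t f x - U s f x) / complex_of_real (t - s)" by (rule minus_divide_divide)
      finally show ?thesis using True by (simp add: m_def h_def a_def)
    qed (auto simp: m_def h_def a_def)
    have L: "(\<lambda>x. (U (m+h) f x - U m f x) * a - U m g x) \<in> L2 M"
      using closed[of "m+h" f] closed[OF m(1) f] closed[OF m(1) g] m h f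
        L2_scale[of "\<lambda>x. U (m+h) f x - U m f x" M a]
      by (intro L2_diff) (auto simp: mult.commute)
    have "L2_norm M (\<lambda>x. (U (m+h) f x - U m f x) * a - U m g x)
        = L2_norm M (\<lambda>x. a * U (m+h) f x + 1 * (- a * U m f x + - 1 * U m g x))"
      by (intro L2_norm_cong) (simp add: algebra_simps)
    also have "\<dots> = L2_norm M (\<lambda>x. a * U m (U h f) x + - a * U m f x + - 1 * U m g x)"
      using L2_eq_norm[OF e1] by (simp add: algebra_simps)
    also have "\<dots> = L2_norm M (U m (\<lambda>x. a * U h f x + - a * f x + - 1 * g x))"
      by (intro L2_eq_norm[symmetric] bounded_operator_L2_lin3 bounded m Uh f g)
    also have "\<dots> \<le> K * L2_norm M (\<lambda>x. a * U h f x + - a * f x + - 1 * g x)"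
      using Uh f g m L2_add[OF L2_add[OF L2_scale[OF Uh, of a] L2_scale[OF f, of "-a"]] L2_scale[OF g, of "-1"]]
      by (intro K)
    also have "L2_norm M (\<lambda>x. a * U h f x + - a * f x + - 1 * g x) = ?Q h"
      by (intro L2_norm_cong arg_cong[where f = cmod]) (simp add: a_def diff_divide_distrib)
    finally have A: "L2_norm M (\<lambda>x. (U (m+h) f x - U m f x) * a - U m g x) \<le> K * ?Q h" .
    have B: "L2_norm M (\<lambda>x. U m g x - U t g x) \<le> L2_norm M (\<lambda>x. U s g x - U t g x)"
      by (cases "s \<le> t") (auto simp: m_def)
    have "L2_norm M (\<lambda>x. (U s f x - U t f x) / complex_of_real (s - t) - U t g x)
        = L2_norm M (\<lambda>x. ((U (m+h) f x - U m f x) * a - U m g x) + (U m g x - U t g x))"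
      unfolding q by (intro L2_norm_cong) simp
    also have "\<dots> \<le> L2_norm M (\<lambda>x. (U (m+h) f x - U m f x) * a - U m g x) + L2_norm M (\<lambda>x. U m g x - U t g x)"
      using closed[OF m(1) g] closed[OF t g] by (intro L2_norm_triangle L) auto
    finally show ?thesis using A B by (simp add: h_def)
  qed
  show "((\<lambda>s. L2_norm M (\<lambda>x. (U s f x - U t f x) / complex_of_real (s - t) - U t g x)) \<longlongrightarrow> 0) (at t within {0..})"
  proof (rule tendsto_sandwich[OF _ _ tendsto_const])
    show "((\<lambda>s. K * ?Q \<bar>s - t\<bar> + L2_norm M (\<lambda>x. U s g x - U t g x)) \<longlongrightarrow> 0) (at t within {0..})"
      using tendsto_add[OF tendsto_mult[OF tendsto_const[of K] filterlim_compose[OF lim abs_diff_at_right[of t "{0..}"]]]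
        orbit_continuous[OF t g]] by simp
    have "\<forall>\<^sub>F s in at t within {0..}. s < t + 1 \<and> s \<in> {0..} \<and> s \<noteq> t"
      using order_tendstoD(2)[OF tendsto_ident_at, of t "t+1" "{0..}"]
      by (auto simp: eventually_at_filter elim: eventually_mono)
    then show "\<forall>\<^sub>F s in at t within {0..}. L2_norm M (\<lambda>x. (U s f x - U t f x) / complex_of_real (s - t) - U t g x)
     \<le> K * ?Q \<bar>s - t\<bar> + L2_norm M (\<lambda>x. U s g x - U t g x)"
      by eventually_elim (rule est, auto)
  qed simp
qed

end

section \<open>Semigroups of multiplication operators\<close>

text \<open>Expansion of \<open>|f + g|^2\<close>. It differentiates the energy of a solution, and
  as polarization it turns preservation of norms into preservation of real parts of inner
  products.\<close>

lemma L2_norm_add_power2: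
  assumes "f \<in> L2 M" "g \<in> L2 M"
  shows "(L2_norm M (\<lambda>x. f x + g x))\<^sup>2
    = (L2_norm M f)\<^sup>2 + (L2_norm M g)\<^sup>2 + 2 * Re (LINT x|M. f x * cnj (g x))"
proof -
  have int: "integrable M (\<lambda>x. f x * cnj (g x))"
    using L2_mult_integrable[OF assms(1) L2_cnj[OF assms(2)]] .
  have "(cmod (f x + g x))\<^sup>2 = (cmod (f x))\<^sup>2 + (cmod (g x))\<^sup>2 + 2 * Re (f x * cnj (g x))" for x
    unfolding cmod_power2 by (simp add: power2_eq_square algebra_simps)
  then have "(L2_norm M (\<lambda>x. f x + g x))\<^sup>2
     = (LINT x|M. (cmod (f x))\<^sup>2 + (cmod (g x))\<^sup>2 + 2 * Re (f x * cnj (g x)))"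
    by (simp add: L2_norm_power2)
  also have "\<dots> = (L2_norm M f)\<^sup>2 + (L2_norm M g)\<^sup>2 + 2 * Re (LINT x|M. f x * cnj (g x))"
    using assms integrable_Re[OF int] integral_Re[OF int]
    by (simp add: L2_norm_power2 L2_square_integrable del: times_complex.sel)
  finally show ?thesis .
qed

text \<open>Lipschitz constant 1 on the half line bounds the difference quotients of
  \<open>exp (- t * lam x)\<close> in t by \<open>lam x\<close>, uniformly in t.\<close>

lemma abs_exp_minus_diff_le:
  fixes a b :: real
  assumes "a \<ge> 0" "b \<ge> 0"
  shows "\<bar>exp (- a) - exp (- b)\<bar> \<le> \<bar>a - b\<bar>"
proof -
  have *: "exp (- a) - exp (- b) \<le> b - a" if "0 \<le> a" "a \<le> b" for a b :: real
  proof -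
    have "exp (- a) - exp (- b) = exp (- a) * (1 - exp (- (b - a)))"
      by (simp add: algebra_simps exp_diff[symmetric] exp_add[symmetric])
    also have "\<dots> \<le> 1 * (b - a)"
      using that exp_ge_add_one_self[of "a - b"] by (intro mult_mono) (auto simp: algebra_simps)
    finally show ?thesis by simp
  qed
  show ?thesis
  proof (cases "a \<le> b")
    case True
    then show ?thesis using *[of a b] assms by simp
  next
    case False
    then show ?thesis using *[of b a] assms by simp
  qed
qed

text \<open>A model of the semigroup generated by \<open>- A\<close>, where the unitary operator \<open>F\<close> turns the
  unbounded operator \<open>A\<close> into multiplication by \<open>\<lambda> \<ge> 0\<close>.\<close>

locale spectral_semigroup =
  fixes M :: "'a measure" and F :: "('a \<Rightarrow> complex) \<Rightarrow> ('a \<Rightarrow> complex)"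
    and lam :: "'a \<Rightarrow> real" and Dom :: "('a \<Rightarrow> complex) set"
    and A :: "('a \<Rightarrow> complex) \<Rightarrow> ('a \<Rightarrow> complex)"
    and H :: "real \<Rightarrow> ('a \<Rightarrow> complex) \<Rightarrow> ('a \<Rightarrow> complex)"
  assumes F_closed: "f \<in> L2 M \<Longrightarrow> F f \<in> L2 M"
    and F_lin: "f \<in> L2 M \<Longrightarrow> g \<in> L2 M \<Longrightarrow>
      L2_eq M (F (\<lambda>x. a * f x + b * g x)) (\<lambda>x. a * F f x + b * F g x)"
    and F_norm: "f \<in> L2 M \<Longrightarrow> L2_norm M (F f) = L2_norm M f"
    and F_surj: "g \<in> L2 M \<Longrightarrow> \<exists>f\<in>L2 M. L2_eq M (F f) g"
    and lam_measurable [measurable]: "lam \<in> borel_measurable M"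
    and lam_nonneg: "x \<in> space M \<Longrightarrow> lam x \<ge> 0"
    and Dom_iff: "f \<in> Dom \<longleftrightarrow> f \<in> L2 M \<and> (\<lambda>x. complex_of_real (lam x) * F f x) \<in> L2 M"
    and A_closed: "f \<in> Dom \<Longrightarrow> A f \<in> L2 M"
    and F_A: "f \<in> Dom \<Longrightarrow> L2_eq M (F (A f)) (\<lambda>x. complex_of_real (lam x) * F f x)"
    and H_closed: "t \<ge> 0 \<Longrightarrow> f \<in> L2 M \<Longrightarrow> H t f \<in> L2 M"
    and F_H: "t \<ge> 0 \<Longrightarrow> f \<in> L2 M \<Longrightarrow>
      L2_eq M (F (H t f)) (\<lambda>x. complex_of_real (exp (- t * lam x)) * F f x)"
begin

text \<open>The dictionary between \<open>f\<close> and its spectral side: \<phi> may be any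
  representative of the transform, so that explicit formulas can stand for \<open>F f\<close> and be
  carried through linear combinations, \<open>A\<close> and \<open>H\<close>.\<close>

definition rep :: "('a \<Rightarrow> complex) \<Rightarrow> ('a \<Rightarrow> complex) \<Rightarrow> bool" where
  "rep f \<phi> \<longleftrightarrow> f \<in> L2 M \<and> L2_eq M (F f) \<phi>"

lemma rep_closed: "rep f \<phi> \<Longrightarrow> f \<in> L2 M" "rep f \<phi> \<Longrightarrow> \<phi> \<in> L2 M"
  by (auto simp: rep_def L2_eq_def)

lemma rep_F: "f \<in> L2 M \<Longrightarrow> rep f (F f)"
  by (simp add: rep_def L2_eq_refl F_closed)

lemma rep_cong: "rep f \<phi> \<Longrightarrow> L2_eq M \<phi> \<psi> \<Longrightarrow> rep f \<psi>"
  unfolding rep_def using L2_eq_trans by blast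

lemma rep_norm: "rep f \<phi> \<Longrightarrow> L2_norm M f = L2_norm M \<phi>"
  unfolding rep_def using L2_eq_norm F_norm by metis

lemma rep_lin: "rep f \<phi> \<Longrightarrow> rep g \<psi> \<Longrightarrow> rep (\<lambda>x. a * f x + b * g x) (\<lambda>x. a * \<phi> x + b * \<psi> x)"
  unfolding rep_def using L2_eq_trans[OF F_lin L2_eq_lin] by simp

lemma rep_diff: "rep f \<phi> \<Longrightarrow> rep g \<psi> \<Longrightarrow> rep (\<lambda>x. f x - g x) (\<lambda>x. \<phi> x - \<psi> x)"
  using rep_lin[of f \<phi> g \<psi> 1 "-1"] by simp

lemma rep_add: "rep f \<phi> \<Longrightarrow> rep g \<psi> \<Longrightarrow> rep (\<lambda>x. f x + g x) (\<lambda>x. \<phi> x + \<psi> x)"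
  using rep_lin[of f \<phi> g \<psi> 1 1] by simp

lemma rep_scale: "rep f \<phi> \<Longrightarrow> rep (\<lambda>x. a * f x) (\<lambda>x. a * \<phi> x)"
  using rep_lin[of f \<phi> f \<phi> a 0] by simp

lemma rep_uminus: "rep f \<phi> \<Longrightarrow> rep (\<lambda>x. - f x) (\<lambda>x. - \<phi> x)"
  using rep_scale[of f \<phi> "-1"] by simp

lemma rep_divide: "rep f \<phi> \<Longrightarrow> rep (\<lambda>x. f x / a) (\<lambda>x. \<phi> x / a)"
  using rep_scale[of f \<phi> "1 / a"] by simp

text \<open>The transform is isometric, hence injective up to null sets: identities between
  operators may be checked between multipliers.\<close>

lemma rep_eq:
  assumes "rep f \<phi>" "rep g \<psi>"
  shows "L2_eq M f g \<longleftrightarrow> L2_eq M \<phi> \<psi>"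
  using rep_norm[OF rep_diff[OF assms]] rep_closed[OF assms(1)] rep_closed[OF assms(2)]
  by (simp add: L2_eq_iff)

lemma rep_Dom_iff:
  assumes "rep f \<phi>"
  shows "f \<in> Dom \<longleftrightarrow> (\<lambda>x. complex_of_real (lam x) * \<phi> x) \<in> L2 M"
proof -
  have ae: "AE x in M. F f x = \<phi> x" and L: "F f \<in> L2 M" "\<phi> \<in> L2 M" "f \<in> L2 M"
    using assms by (auto simp: rep_def L2_eq_def)
  have m: "(\<lambda>x. complex_of_real (lam x) * \<phi> x) \<in> borel_measurable M"
    "(\<lambda>x. complex_of_real (lam x) * F f x) \<in> borel_measurable M"
    using L[THEN L2_measurable] by measurable
  have ae': "AE x in M. cmod (complex_of_real (lam x) * F f x) \<le> cmod (complex_of_real (lam x) * \<phi> x)"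
    "AE x in M. cmod (complex_of_real (lam x) * \<phi> x) \<le> cmod (complex_of_real (lam x) * F f x)"
    using ae by (eventually_elim, simp)+
  show ?thesis unfolding Dom_iff using L L2_bound(1)[OF _ m(1) ae'(2)] L2_bound(1)[OF _ m(2) ae'(1)]
    by blast
qed

lemma L2_eq_mult:
  assumes "L2_eq M \<phi> \<psi>" "(\<lambda>x. c x * \<phi> x) \<in> L2 M" "(\<lambda>x. c x * \<psi> x) \<in> L2 M"
  shows "L2_eq M (\<lambda>x. c x * \<phi> x) (\<lambda>x. c x * \<psi> x)"
proof -
  have "AE x in M. \<phi> x = \<psi> x" using assms by (simp add: L2_eq_def)
  then have "AE x in M. c x * \<phi> x = c x * \<psi> x" by eventually_elim simp
  then show ?thesis using assms by (simp add: L2_eq_def)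
qed

lemma rep_A:
  assumes "rep f \<phi>" "f \<in> Dom"
  shows "rep (A f) (\<lambda>x. complex_of_real (lam x) * \<phi> x)"
proof -
  have "L2_eq M (\<lambda>x. complex_of_real (lam x) * F f x) (\<lambda>x. complex_of_real (lam x) * \<phi> x)"
    using assms rep_Dom_iff[OF assms(1)] by (intro L2_eq_mult) (auto simp: rep_def Dom_iff)
  then have "L2_eq M (F (A f)) (\<lambda>x. complex_of_real (lam x) * \<phi> x)"
    by (rule L2_eq_trans[OF F_A[OF assms(2)]])
  then show ?thesis using A_closed[OF assms(2)] by (simp add: rep_def)
qed

lemma exp_mult_L2:
  assumes "t \<ge> 0" "\<phi> \<in> L2 M"
  shows "(\<lambda>x. complex_of_real (exp (- t * lam x)) * \<phi> x) \<in> L2 M"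
proof (rule L2_bound(1)[OF assms(2)])
  show "(\<lambda>x. complex_of_real (exp (- t * lam x)) * \<phi> x) \<in> borel_measurable M"
    using L2_measurable[OF assms(2)] by measurable
  show "AE x in M. cmod (complex_of_real (exp (- t * lam x)) * \<phi> x) \<le> cmod (\<phi> x)"
    using assms(1) lam_nonneg by (auto simp: norm_mult intro!: mult_left_le_one_le)
qed

lemma rep_H:
  assumes "rep f \<phi>" "t \<ge> 0"
  shows "rep (H t f) (\<lambda>x. complex_of_real (exp (- t * lam x)) * \<phi> x)"
proof -
  have "L2_eq M (\<lambda>x. complex_of_real (exp (- t * lam x)) * F f x) (\<lambda>x. complex_of_real (exp (- t * lam x)) * \<phi> x)"
    using assms rep_closed[OF assms(1)] by (intro L2_eq_mult exp_mult_L2 F_closed) (auto simp: rep_def)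
  then have "L2_eq M (F (H t f)) (\<lambda>x. complex_of_real (exp (- t * lam x)) * \<phi> x)"
    by (rule L2_eq_trans[OF F_H[OF assms(2) rep_closed(1)[OF assms(1)]]])
  then show ?thesis using H_closed[OF assms(2) rep_closed(1)[OF assms(1)]] by (simp add: rep_def)
qed

section \<open>The multiplication semigroup: continuity, smoothing and generator\<close>

lemma exp_continuous:
  assumes t: "t \<ge> 0" and \<phi>: "\<phi> \<in> L2 M"
  shows "((\<lambda>s. L2_norm M (\<lambda>x. complex_of_real (exp (- s * lam x)) * \<phi> x
      - complex_of_real (exp (- t * lam x)) * \<phi> x)) \<longlongrightarrow> 0) (at t within {0..})"
proof (rule L2_dominated_convergence[OF \<phi>])
  show "(\<lambda>x. complex_of_real (exp (- s * lam x)) * \<phi> x - complex_of_real (exp (- t * lam x)) * \<phi> x)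
      \<in> borel_measurable M" for s
    using L2_measurable[OF \<phi>] by measurable
  show "((\<lambda>s. complex_of_real (exp (- s * lam x)) * \<phi> x - complex_of_real (exp (- t * lam x)) * \<phi> x) \<longlongrightarrow> 0)
      (at t within {0..})" for x
    by (rule tendsto_eq_intros refl | simp)+
  fix s x assume s: "s \<in> {0..} - {t}" and x: "x \<in> space M"
  have "0 \<le> exp (- s * lam x)" "exp (- s * lam x) \<le> 1" "0 \<le> exp (- t * lam x)" "exp (- t * lam x) \<le> 1"
    using s t lam_nonneg[OF x] by auto
  then have "\<bar>exp (- s * lam x) - exp (- t * lam x)\<bar> \<le> 1" by linarith
  then have "\<bar>exp (- s * lam x) - exp (- t * lam x)\<bar> * cmod (\<phi> x) \<le> 1 * cmod (\<phi> x)"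
    by (intro mult_right_mono) auto
  then show "cmod (complex_of_real (exp (- s * lam x)) * \<phi> x - complex_of_real (exp (- t * lam x)) * \<phi> x)
      \<le> cmod (\<phi> x)"
    by (simp add: left_diff_distrib[symmetric] norm_mult flip: of_real_diff)
qed

text \<open>\<open>k s x\<close> is the error of the difference quotient. Quotient and derivative
  are each bounded by \<open>lam x\<close>, so \<open>2 lam |\<phi>|\<close>, square integrable by
  assumption, dominates.\<close>

lemma exp_derivative:
  assumes t: "t \<ge> 0" and \<phi>: "\<phi> \<in> L2 M" and lam\<phi>: "(\<lambda>x. complex_of_real (lam x) * \<phi> x) \<in> L2 M"
  shows "((\<lambda>s. L2_norm M (\<lambda>x. (complex_of_real (exp (- s * lam x)) * \<phi> x
      - complex_of_real (exp (- t * lam x)) * \<phi> x) / complex_of_real (s - t)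
      + complex_of_real (exp (- t * lam x)) * (complex_of_real (lam x) * \<phi> x))) \<longlongrightarrow> 0) (at t within {0..})"
proof -
  define k where "k s x = (exp (- s * lam x) - exp (- t * lam x)) / (s - t) + exp (- t * lam x) * lam x" for s x
  have k: "(complex_of_real (exp (- s * lam x)) * \<phi> x
      - complex_of_real (exp (- t * lam x)) * \<phi> x) / complex_of_real (s - t)
      + complex_of_real (exp (- t * lam x)) * (complex_of_real (lam x) * \<phi> x) = complex_of_real (k s x) * \<phi> x" for s x
    unfolding k_def by (simp add: algebra_simps diff_divide_distrib)
  show ?thesis unfolding k
  proof (rule L2_dominated_convergence[OF L2_scale[OF lam\<phi>, of 2]])
    show "(\<lambda>x. complex_of_real (k s x) * \<phi> x) \<in> borel_measurable M" for s
      unfolding k_def using L2_measurable[OF \<phi>] by measurable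
    fix x assume x: "x \<in> space M"
    have "((\<lambda>s. exp (- s * lam x)) has_field_derivative - (exp (- t * lam x) * lam x)) (at t within {0..})"
      by (auto intro!: derivative_eq_intros)
    then have "((\<lambda>s. (exp (- s * lam x) - exp (- t * lam x)) / (s - t)) \<longlongrightarrow> - (exp (- t * lam x) * lam x)) (at t within {0..})"
      by (simp add: has_field_derivative_iff)
    then have "((\<lambda>s. k s x) \<longlongrightarrow> - (exp (- t * lam x) * lam x) + exp (- t * lam x) * lam x) (at t within {0..})"
      unfolding k_def by (intro tendsto_add tendsto_const)
    then have "((\<lambda>s. complex_of_real (k s x) * \<phi> x) \<longlongrightarrow> complex_of_real 0 * \<phi> x) (at t within {0..})"
      by (intro tendsto_mult tendsto_of_real tendsto_const) simp
    then show "((\<lambda>s. complex_of_real (k s x) * \<phi> x) \<longlongrightarrow> 0) (at t within {0..})" by simp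
    fix s assume s: "s \<in> {0..} - {t}"
    have l: "lam x \<ge> 0" using lam_nonneg[OF x] .
    have "\<bar>exp (- (s * lam x)) - exp (- (t * lam x))\<bar> \<le> \<bar>s * lam x - t * lam x\<bar>"
      using s t l by (intro abs_exp_minus_diff_le) auto
    also have "\<dots> = lam x * \<bar>s - t\<bar>"
      using l by (simp add: left_diff_distrib[symmetric] abs_mult mult.commute)
    finally have "\<bar>(exp (- s * lam x) - exp (- t * lam x)) / (s - t)\<bar> \<le> lam x"
      using s by (simp add: abs_divide divide_le_eq)
    moreover have "\<bar>exp (- t * lam x) * lam x\<bar> \<le> lam x"
      using l t by (auto simp: abs_mult intro!: mult_left_le_one_le)
    ultimately have "\<bar>k s x\<bar> \<le> 2 * lam x" unfolding k_def by linarith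
    then have "\<bar>k s x\<bar> * cmod (\<phi> x) \<le> 2 * lam x * cmod (\<phi> x)" by (intro mult_right_mono) auto
    then show "cmod (complex_of_real (k s x) * \<phi> x) \<le> cmod (2 * (complex_of_real (lam x) * \<phi> x))"
      using l by (simp add: norm_mult)
  qed
qed

lemma at_right_0_le: "at_right (0::real) \<le> at 0 within {0..}"
  by (rule at_le) auto

lemma H_C0: "C0_semigroup_L2 M H"
  unfolding C0_semigroup_L2_def
proof (intro conjI allI impI ballI)
  fix t :: real assume t: "t \<ge> 0"
  show "bounded_operator_L2 M (H t)"
    unfolding bounded_operator_L2_def
  proof (intro conjI allI ballI exI[of _ 1])
    fix f assume f: "f \<in> L2 M"
    show "H t f \<in> L2 M" using t f by (rule H_closed)
    have "L2_norm M (H t f) = L2_norm M (\<lambda>x. complex_of_real (exp (- t * lam x)) * F f x)"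
      using rep_norm[OF rep_H[OF rep_F[OF f] t]] .
    also have "\<dots> \<le> L2_norm M (F f)"
    proof (rule L2_bound(2)[OF F_closed[OF f]])
      show "(\<lambda>x. complex_of_real (exp (- t * lam x)) * F f x) \<in> borel_measurable M"
        using L2_measurable[OF F_closed[OF f]] by measurable
      show "AE x in M. cmod (complex_of_real (exp (- t * lam x)) * F f x) \<le> cmod (F f x)"
        using t lam_nonneg by (auto simp: norm_mult intro!: mult_left_le_one_le)
    qed
    finally show "L2_norm M (H t f) \<le> 1 * L2_norm M f" using F_norm[OF f] by simp
    fix g a b assume g: "g \<in> L2 M"
    have "rep (H t (\<lambda>x. a * f x + b * g x))
       (\<lambda>x. complex_of_real (exp (- t * lam x)) * (a * F f x + b * F g x))"
      by (intro rep_H rep_lin rep_F f g t)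
    moreover have "rep (\<lambda>x. a * H t f x + b * H t g x)
       (\<lambda>x. a * (complex_of_real (exp (- t * lam x)) * F f x) + b * (complex_of_real (exp (- t * lam x)) * F g x))"
      by (intro rep_H rep_lin rep_F f g t)
    ultimately show "L2_eq M (H t (\<lambda>x. a * f x + b * g x)) (\<lambda>x. a * H t f x + b * H t g x)"
      by (subst rep_eq) (auto simp: algebra_simps intro!: L2_eqI_space dest: rep_closed)
  qed
next
  fix f assume f: "f \<in> L2 M"
  show "L2_eq M (H 0 f) f"
    using rep_eq[OF rep_H[OF rep_F[OF f] order_refl] rep_F[OF f]] by (simp add: L2_eq_refl F_closed f)
  have "((\<lambda>t. L2_norm M (\<lambda>x. complex_of_real (exp (- t * lam x)) * F f x
      - complex_of_real (exp (- 0 * lam x)) * F f x)) \<longlongrightarrow> 0) (at_right 0)"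
    using exp_continuous[of 0 "F f"] F_closed[OF f] by (intro tendsto_mono[OF at_right_0_le]) auto
  moreover have "\<forall>\<^sub>F t in at_right 0. L2_norm M (\<lambda>x. complex_of_real (exp (- t * lam x)) * F f x
      - complex_of_real (exp (- 0 * lam x)) * F f x) = L2_norm M (\<lambda>x. H t f x - f x)"
    using rep_norm[OF rep_diff[OF rep_H[OF rep_F[OF f]] rep_F[OF f]]]
    by (auto simp: eventually_at_filter)
  ultimately show "((\<lambda>t. L2_norm M (\<lambda>x. H t f x - f x)) \<longlongrightarrow> 0) (at_right 0)"
    by (rule Lim_transform_eventually)
next
  fix s t :: real and f assume st: "s \<ge> 0" "t \<ge> 0" and f: "f \<in> L2 M"
  have "rep (H (s + t) f) (\<lambda>x. complex_of_real (exp (- (s + t) * lam x)) * F f x)"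
    using st by (intro rep_H rep_F f) auto
  moreover have "rep (H s (H t f))
      (\<lambda>x. complex_of_real (exp (- s * lam x)) * (complex_of_real (exp (- t * lam x)) * F f x))"
    by (intro rep_H rep_F f st)
  ultimately show "L2_eq M (H (s + t) f) (H s (H t f))"
    by (subst rep_eq) (auto intro!: L2_eqI_space dest: rep_closed simp: exp_add[symmetric] algebra_simps
        simp flip: of_real_mult)
qed

sublocale H: L2_semigroup M H
  by unfold_locales (rule H_C0)

text \<open>\<open>lam * exp (- t * lam) \<le> 1 / t\<close> by \<open>u \<le> exp u\<close>. Since
  \<open>H t f\<close> tends to \<open>f\<close> as t tends to 0, this also makes the domain
  dense.\<close>

lemma H_smoothing:
  assumes t: "t > 0" and f: "f \<in> L2 M"
  shows "H t f \<in> Dom"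
proof -
  have t': "t \<ge> 0" using t by simp
  have le: "lam x * exp (- t * lam x) \<le> 1 / t" if "x \<in> space M" for x
  proof -
    have "t * lam x \<le> exp (t * lam x)" using exp_ge_add_one_self[of "t * lam x"] by linarith
    then show ?thesis using t by (simp add: exp_minus field_simps)
  qed
  have "(\<lambda>x. complex_of_real (lam x) * (complex_of_real (exp (- t * lam x)) * F f x)) \<in> L2 M"
  proof (rule L2_bound(1)[OF L2_scale[OF F_closed[OF f], of "complex_of_real (1/t)"]])
    show "(\<lambda>x. complex_of_real (lam x) * (complex_of_real (exp (- t * lam x)) * F f x)) \<in> borel_measurable M"
      using L2_measurable[OF F_closed[OF f]] by measurable
    show "AE x in M. cmod (complex_of_real (lam x) * (complex_of_real (exp (- t * lam x)) * F f x))
        \<le> cmod (complex_of_real (1/t) * F f x)"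
    proof (rule AE_I2)
      fix x assume x: "x \<in> space M"
      have "(lam x * exp (- t * lam x)) * cmod (F f x) \<le> 1 / t * cmod (F f x)"
        using le[OF x] by (intro mult_right_mono) auto
      then show "cmod (complex_of_real (lam x) * (complex_of_real (exp (- t * lam x)) * F f x))
        \<le> cmod (complex_of_real (1/t) * F f x)"
        using lam_nonneg[OF x] t by (simp add: norm_mult norm_divide mult.assoc)
    qed
  qed
  then show ?thesis using rep_Dom_iff[OF rep_H[OF rep_F[OF f] t']] by simp
qed

text \<open>The direction from left to right says that no further function has a derivative at 0. On
  each set \<open>lam \<le> k\<close> the limit of the quotients must be \<open>- lam * F f\<close>;
  these sets exhaust the space, and since \<open>F g\<close> is square integrable, so is
  \<open>lam * F f\<close>.\<close>

lemma H_generator: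
  "generator_L2 M H f g \<longleftrightarrow> f \<in> Dom \<and> L2_eq M g (\<lambda>x. - A f x)"
proof
  assume R: "f \<in> Dom \<and> L2_eq M g (\<lambda>x. - A f x)"
  then have f: "f \<in> L2 M" "f \<in> Dom" and lf: "(\<lambda>x. complex_of_real (lam x) * F f x) \<in> L2 M"
    by (auto simp: Dom_iff)
  have g: "rep g (\<lambda>x. - (complex_of_real (lam x) * F f x))"
    using rep_uminus[OF rep_A[OF rep_F[OF f(1)] f(2)]] R rep_eq[OF rep_F] rep_cong
    by (metis L2_eq_def rep_F)
  have "((\<lambda>s. L2_norm M (\<lambda>x. (complex_of_real (exp (- s * lam x)) * F f x
      - complex_of_real (exp (- 0 * lam x)) * F f x) / complex_of_real (s - 0)
      + complex_of_real (exp (- 0 * lam x)) * (complex_of_real (lam x) * F f x))) \<longlongrightarrow> 0) (at_right 0)"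
    using exp_derivative[OF order_refl F_closed[OF f(1)] lf] by (rule tendsto_mono[OF at_right_0_le])
  moreover have "\<forall>\<^sub>F s in at_right 0. L2_norm M (\<lambda>x. (complex_of_real (exp (- s * lam x)) * F f x
      - complex_of_real (exp (- 0 * lam x)) * F f x) / complex_of_real (s - 0)
      + complex_of_real (exp (- 0 * lam x)) * (complex_of_real (lam x) * F f x))
      = L2_norm M (\<lambda>x. (H s f x - f x) / complex_of_real s - g x)"
    using rep_norm[OF rep_diff[OF rep_divide[OF rep_diff[OF rep_H[OF rep_F[OF f(1)]] rep_F[OF f(1)]]] g]]
    by (auto simp: eventually_at_filter)
  ultimately show "generator_L2 M H f g"
    unfolding generator_L2_def using f rep_closed[OF g] by (auto intro: Lim_transform_eventually)
next
  assume gen: "generator_L2 M H f g"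
  then have f: "f \<in> L2 M" and g: "g \<in> L2 M"
    and lim: "((\<lambda>t. L2_norm M (\<lambda>x. (H t f x - f x) / complex_of_real t - g x)) \<longlongrightarrow> 0) (at_right 0)"
    by (auto simp: generator_L2_def)
  define Q where "Q t x = (complex_of_real (exp (- t * lam x)) * F f x - F f x) / complex_of_real t" for t x
  have Q: "rep (\<lambda>x. (H t f x - f x) / complex_of_real t) (Q t)" if "t > 0" for t
    unfolding Q_def using that by (intro rep_divide rep_diff rep_H rep_F f) auto
  have limQ: "((\<lambda>t. L2_norm M (\<lambda>x. Q t x - F g x)) \<longlongrightarrow> 0) (at_right 0)"
    using lim
  proof (rule Lim_transform_eventually)
    show "\<forall>\<^sub>F t in at_right 0. L2_norm M (\<lambda>x. (H t f x - f x) / complex_of_real t - g x) = L2_norm M (\<lambda>x. Q t x - F g x)"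
      using rep_norm[OF rep_diff[OF Q rep_F[OF g]]] by (auto simp: eventually_at_filter)
  qed
  text \<open>Cutting off at \<open>\<lambda> \<le> k\<close> makes the difference quotient converge, whatever \<open>f\<close> is.\<close>
  have cut: "AE x in M. lam x \<le> real k \<longrightarrow> F g x = - (complex_of_real (lam x) * F f x)" for k
  proof -
    define c where "c x = (if lam x \<le> real k then 1 else 0 :: complex)" for x
    have c [measurable]: "c \<in> borel_measurable M" unfolding c_def by measurable
    have cL: "(\<lambda>x. c x * h x) \<in> L2 M" "L2_norm M (\<lambda>x. c x * h x) \<le> L2_norm M h" if h: "h \<in> L2 M" for h
      using L2_bound[OF h, of "\<lambda>x. c x * h x"] L2_measurable[OF h] by (auto simp: c_def)
    have m: "(\<lambda>x. complex_of_real (lam x) * (c x * F f x)) \<in> borel_measurable M"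
      using L2_measurable[OF F_closed[OF f]] by measurable
    have le: "AE x in M. cmod (complex_of_real (lam x) * (c x * F f x)) \<le> cmod (complex_of_real k * F f x)"
      using lam_nonneg by (auto simp: c_def norm_mult intro!: mult_right_mono)
    have lcf: "(\<lambda>x. complex_of_real (lam x) * (c x * F f x)) \<in> L2 M"
      by (rule L2_bound(1)[OF L2_scale[OF F_closed[OF f]] m le])
    have 1: "((\<lambda>s. L2_norm M (\<lambda>x. c x * Q s x - - (complex_of_real (lam x) * (c x * F f x)))) \<longlongrightarrow> 0) (at_right 0)"
    proof -
      have "((\<lambda>s. L2_norm M (\<lambda>x. (complex_of_real (exp (- s * lam x)) * (c x * F f x)
        - complex_of_real (exp (- 0 * lam x)) * (c x * F f x)) / complex_of_real (s - 0)
        + complex_of_real (exp (- 0 * lam x)) * (complex_of_real (lam x) * (c x * F f x)))) \<longlongrightarrow> 0) (at_right 0)"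
        using exp_derivative[OF order_refl cL(1)[OF F_closed[OF f]] lcf] by (rule tendsto_mono[OF at_right_0_le])
      then show ?thesis unfolding Q_def by (simp add: algebra_simps)
    qed
    have 2: "((\<lambda>s. L2_norm M (\<lambda>x. c x * Q s x - c x * F g x)) \<longlongrightarrow> 0) (at_right 0)"
    proof (rule tendsto_sandwich[OF _ _ tendsto_const limQ])
      show "\<forall>\<^sub>F s in at_right 0. L2_norm M (\<lambda>x. c x * Q s x - c x * F g x) \<le> L2_norm M (\<lambda>x. Q s x - F g x)"
        using cL(2)[OF L2_diff[OF rep_closed(2)[OF Q] F_closed[OF g]]]
        by (auto simp: eventually_at_filter right_diff_distrib)
    qed simp
    \<comment> \<open>Uniqueness of limits is applied along \<open>1/(n+1)\<close>, because the
      quotients \<open>Q t\<close> are known to be square integrable only for positive t.\<close>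
    have f1: "filterlim (\<lambda>n. inverse (real (Suc n))) (at_right 0) sequentially"
      unfolding filterlim_at using LIMSEQ_inverse_real_of_nat by auto
    have QL: "(\<lambda>x. c x * Q (inverse (real (Suc n))) x) \<in> L2 M" for n
      using cL(1)[OF rep_closed(2)[OF Q[of "inverse (real (Suc n))"]]] by simp
    have "L2_eq M (\<lambda>x. - (complex_of_real (lam x) * (c x * F f x))) (\<lambda>x. c x * F g x)"
      by (rule L2_limit_unique[OF QL L2_uminus[OF lcf] cL(1)[OF F_closed[OF g]] sequentially_bot
            filterlim_compose[OF 1 f1] filterlim_compose[OF 2 f1]])
    then have "AE x in M. - (complex_of_real (lam x) * (c x * F f x)) = c x * F g x" by (simp add: L2_eq_def)
    then show ?thesis by eventually_elim (auto simp: c_def)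
  qed
  have ae: "AE x in M. F g x = - (complex_of_real (lam x) * F f x)"
  proof -
    have "AE x in M. \<forall>k::nat. lam x \<le> real k \<longrightarrow> F g x = - (complex_of_real (lam x) * F f x)"
      unfolding AE_all_countable using cut by blast
    then show ?thesis
    proof eventually_elim
      case (elim x)
      then show ?case using real_arch_simple[of "lam x"] by blast
    qed
  qed
  have m: "(\<lambda>x. complex_of_real (lam x) * F f x) \<in> borel_measurable M"
    using L2_measurable[OF F_closed[OF f]] by measurable
  have lcf: "(\<lambda>x. complex_of_real (lam x) * F f x) \<in> L2 M"
    by (rule L2_bound(1)[OF F_closed[OF g] m]) (use ae in \<open>eventually_elim, simp\<close>)
  then have fD: "f \<in> Dom" using f by (simp add: Dom_iff)
  moreover have "L2_eq M g (\<lambda>x. - A f x)"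
    unfolding rep_eq[OF rep_F[OF g] rep_uminus[OF rep_A[OF rep_F[OF f] fD]]]
    using ae lcf by (simp add: L2_eq_def F_closed g)
  ultimately show "f \<in> Dom \<and> L2_eq M g (\<lambda>x. - A f x)" by simp
qed

lemma H_generated: "C0_semigroup_generated_by M H Dom (\<lambda>f x. - A f x)"
  unfolding C0_semigroup_generated_by_def using H_C0 H_generator by simp

section \<open>Solutions of the Cauchy problem and uniqueness\<close>

definition solution :: "('a \<Rightarrow> complex) \<Rightarrow> (real \<Rightarrow> 'a \<Rightarrow> complex) \<Rightarrow> bool" where
  "solution f u \<longleftrightarrow> (\<exists>u'. C1_L2 M u u' \<and> (\<forall>t\<ge>0. u t \<in> Dom) \<and>
        (\<forall>t>0. L2_eq M (\<lambda>x. u' t x + A (u t) x) (\<lambda>_. 0)) \<and> L2_eq M (u 0) f)"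

text \<open>With \<open>g = - A f\<close> the orbit has derivative \<open>U t g\<close>. The pair of
  \<open>U t f\<close> and \<open>U t g\<close> again lies in the graph of the generator, which says
  precisely that \<open>U t g = - A (U t f)\<close>.\<close>

lemma generated_solution:
  assumes U: "C0_semigroup_generated_by M U Dom (\<lambda>f x. - A f x)" and f: "f \<in> Dom"
  shows "solution f (\<lambda>t. U t f)"
proof -
  interpret U: L2_semigroup M U
    using U by unfold_locales (simp add: C0_semigroup_generated_by_def)
  have gen: "generator_L2 M U h g \<longleftrightarrow> h \<in> Dom \<and> L2_eq M g (\<lambda>x. - A h x)" for h g
    using U by (simp add: C0_semigroup_generated_by_def)
  have fL: "f \<in> L2 M" using f by (simp add: Dom_iff)
  define g where "g = (\<lambda>x. - A f x)"
  have fg: "generator_L2 M U f g"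
    unfolding gen g_def using f A_closed[OF f] by (simp add: L2_eq_refl)
  have orb: "U t f \<in> Dom \<and> L2_eq M (U t g) (\<lambda>x. - A (U t f) x)" if "t \<ge> 0" for t
    using U.generator_orbit[OF that fg] unfolding gen .
  have "L2_eq M (\<lambda>x. U t g x + A (U t f) x) (\<lambda>_. 0)" if "t > 0" for t
  proof -
    have t: "t \<ge> 0" using that by simp
    have "L2_eq M (\<lambda>x. 1 * U t g x + 1 * A (U t f) x) (\<lambda>x. 1 * (- A (U t f) x) + 1 * A (U t f) x)"
      using orb[OF t] A_closed by (intro L2_eq_lin) (auto intro: L2_eq_refl)
    then show ?thesis by simp
  qed
  then show ?thesis
    unfolding solution_def using U.orbit_C1[OF fg] orb U.at_0[OF fL] by blast
qed

text \<open>The transform preserves the norms of \<open>f\<close>, \<open>A f\<close> and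
  \<open>f + A f\<close>, hence the real part of the inner product of \<open>f\<close> and
  \<open>A f\<close>; on the spectral side the integrand is \<open>lam * |F f|^2\<close>.\<close>

lemma A_nonneg:
  assumes f: "f \<in> Dom"
  shows "Re (LINT x|M. f x * cnj (A f x)) \<ge> 0"
proof -
  have fL: "f \<in> L2 M" and lf: "(\<lambda>x. complex_of_real (lam x) * F f x) \<in> L2 M" using f by (auto simp: Dom_iff)
  note rf = rep_F[OF fL] note rA = rep_A[OF rf f]
  have "2 * Re (LINT x|M. f x * cnj (A f x))
      = 2 * Re (LINT x|M. F f x * cnj (complex_of_real (lam x) * F f x))"
    using L2_norm_add_power2[OF fL A_closed[OF f]] L2_norm_add_power2[OF F_closed[OF fL] lf]
      rep_norm[OF rf] rep_norm[OF rA] rep_norm[OF rep_add[OF rf rA]] by simp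
  also have "Re (LINT x|M. F f x * cnj (complex_of_real (lam x) * F f x))
      = (LINT x|M. Re (F f x * cnj (complex_of_real (lam x) * F f x)))"
    by (rule integral_Re[OF L2_mult_integrable[OF F_closed[OF fL] L2_cnj[OF lf]], symmetric])
  finally have "2 * Re (LINT x|M. f x * cnj (A f x)) = 2 * (LINT x|M. Re (F f x * cnj (complex_of_real (lam x) * F f x)))" .
  moreover have "(LINT x|M. Re (F f x * cnj (complex_of_real (lam x) * F f x))) \<ge> 0"
  proof (rule integral_nonneg_AE, rule AE_I2)
    fix x assume x: "x \<in> space M"
    have "Re (F f x * cnj (complex_of_real (lam x) * F f x)) = lam x * (cmod (F f x))\<^sup>2"
      unfolding cmod_power2 by (simp add: power2_eq_square algebra_simps)
    then show "0 \<le> Re (F f x * cnj (complex_of_real (lam x) * F f x))" using lam_nonneg[OF x] by simp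
  qed
  ultimately show ?thesis by linarith
qed

text \<open>Energy method: the squared norm of the difference \<open>w\<close> of two solutions has derivative
  \<open>- 2 \<langle>w, A w\<rangle> \<le> 0\<close>.\<close>

lemma solution_unique:
  assumes u: "solution f u" and v: "solution f v" and t: "t \<ge> 0"
  shows "L2_eq M (u t) (v t)"
proof -
  obtain u' where u': "C1_L2 M u u'" "\<And>t. t \<ge> 0 \<Longrightarrow> u t \<in> Dom"
    "\<And>t. t > 0 \<Longrightarrow> L2_eq M (\<lambda>x. u' t x + A (u t) x) (\<lambda>_. 0)" "L2_eq M (u 0) f"
    using u unfolding solution_def by blast
  obtain v' where v': "C1_L2 M v v'" "\<And>t. t \<ge> 0 \<Longrightarrow> v t \<in> Dom"
    "\<And>t. t > 0 \<Longrightarrow> L2_eq M (\<lambda>x. v' t x + A (v t) x) (\<lambda>_. 0)" "L2_eq M (v 0) f"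
    using v unfolding solution_def by blast
  have L: "u t \<in> L2 M" "u' t \<in> L2 M" "v t \<in> L2 M" "v' t \<in> L2 M" if "t \<ge> 0" for t
    using u'(1) v'(1) that by (auto simp: C1_L2_def)
  define w w' where "w t x = u t x - v t x" and "w' t x = u' t x - v' t x" for t x
  have w: "w t \<in> L2 M" "w' t \<in> L2 M" if "t \<ge> 0" for t
    unfolding w_def w'_def using L[OF that] by auto
  define q where "q s t x = (w s x - w t x) / complex_of_real (s - t)" for s t x
  have qL: "q s t \<in> L2 M" if "s \<ge> 0" "t \<ge> 0" for s t
    unfolding q_def using w[OF that(1)] w[OF that(2)] by auto
  have q: "((\<lambda>s. L2_norm M (\<lambda>x. q s t x - w' t x)) \<longlongrightarrow> 0) (at t within {0..})" if t: "t \<ge> 0" for t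
  proof -
    let ?a = "\<lambda>s x. (u s x - u t x) / complex_of_real (s - t) - u' t x"
    let ?b = "\<lambda>s x. (v s x - v t x) / complex_of_real (s - t) - v' t x"
    have "((\<lambda>s. L2_norm M (?a s) + L2_norm M (?b s)) \<longlongrightarrow> 0 + 0) (at t within {0..})"
      using u'(1) v'(1) t by (intro tendsto_add) (auto simp: C1_L2_def)
    then have lim: "((\<lambda>s. L2_norm M (?a s) + L2_norm M (?b s)) \<longlongrightarrow> 0) (at t within {0..})" by simp
    show ?thesis
    proof (rule tendsto_sandwich[OF _ _ tendsto_const lim])
      have "L2_norm M (\<lambda>x. q s t x - w' t x) \<le> L2_norm M (?a s) + L2_norm M (?b s)" if s: "s \<ge> 0" for s
      proof -
        have "L2_norm M (\<lambda>x. q s t x - w' t x) = L2_norm M (\<lambda>x. ?a s x - ?b s x)"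
          unfolding q_def w_def w'_def
          by (intro L2_norm_cong arg_cong[where f = cmod]) (simp add: diff_divide_distrib)
        also have "\<dots> \<le> L2_norm M (?a s) + L2_norm M (?b s)"
          using L[OF s] L[OF t] by (intro L2_norm_triangle_minus) auto
        finally show ?thesis .
      qed
      then show "\<forall>\<^sub>F s in at t within {0..}. L2_norm M (\<lambda>x. q s t x - w' t x) \<le> L2_norm M (?a s) + L2_norm M (?b s)"
        by (auto simp: eventually_at_filter)
    qed simp
  qed
  define E where "E t = (L2_norm M (w t))\<^sup>2" for t
  have der: "(E has_field_derivative (2 * Re (LINT x|M. w t x * cnj (w' t x)))) (at t within {0..})"
    if t: "t \<ge> 0" for t
  proof -
    have ip: "((\<lambda>s. LINT x|M. w t x * cnj (q s t x)) \<longlongrightarrow> (LINT x|M. w t x * cnj (w' t x))) (at t within {0..})"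
    proof (subst Lim_null, rule tendsto_0_le[where K = "L2_norm M (w t)", OF q[OF t]])
      have "cmod ((LINT x|M. w t x * cnj (q s t x)) - (LINT x|M. w t x * cnj (w' t x)))
          \<le> norm (L2_norm M (\<lambda>x. q s t x - w' t x)) * L2_norm M (w t)" if s: "s \<ge> 0" for s
      proof -
        have "(LINT x|M. w t x * cnj (q s t x)) - (LINT x|M. w t x * cnj (w' t x))
            = (LINT x|M. w t x * cnj (q s t x - w' t x))"
          using L2_mult_integrable[OF w(1)[OF t] L2_cnj[OF qL[OF s t]]]
            L2_mult_integrable[OF w(1)[OF t] L2_cnj[OF w(2)[OF t]]]
          by (simp add: algebra_simps)
        also have "cmod \<dots> \<le> L2_norm M (w t) * L2_norm M (\<lambda>x. cnj (q s t x - w' t x))"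
          using w[OF t] qL[OF s t] by (intro L2_Cauchy_Schwarz L2_cnj L2_diff)
        finally show ?thesis by (simp add: mult.commute del: complex_cnj_diff)
      qed
      then show "\<forall>\<^sub>F s in at t within {0..}. cmod ((LINT x|M. w t x * cnj (q s t x)) - (LINT x|M. w t x * cnj (w' t x)))
          \<le> norm (L2_norm M (\<lambda>x. q s t x - w' t x)) * L2_norm M (w t)"
        by (auto simp: eventually_at_filter)
    qed
    have nq: "((\<lambda>s. L2_norm M (q s t)) \<longlongrightarrow> L2_norm M (w' t)) (at t within {0..})"
    proof (subst Lim_null, rule tendsto_0_le[where K = 1, OF q[OF t]])
      show "\<forall>\<^sub>F s in at t within {0..}. norm (L2_norm M (q s t) - L2_norm M (w' t))
          \<le> norm (L2_norm M (\<lambda>x. q s t x - w' t x)) * 1"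
        using L2_norm_diff_abs[OF qL w(2)] t by (auto simp: eventually_at_filter)
    qed
    have "((\<lambda>s. 2 * Re (LINT x|M. w t x * cnj (q s t x)) + (s - t) * (L2_norm M (q s t))\<^sup>2)
        \<longlongrightarrow> 2 * Re (LINT x|M. w t x * cnj (w' t x)) + (t - t) * (L2_norm M (w' t))\<^sup>2) (at t within {0..})"
      by (intro tendsto_intros ip nq)
    then have lim: "((\<lambda>s. 2 * Re (LINT x|M. w t x * cnj (q s t x)) + (s - t) * (L2_norm M (q s t))\<^sup>2)
        \<longlongrightarrow> 2 * Re (LINT x|M. w t x * cnj (w' t x))) (at t within {0..})" by simp
    \<comment> \<open>Substituting \<open>w s = w t + (s - t) q\<close> in the squared norm gives
      the difference quotient of the energy exactly; the term with the factor \<open>s - t\<close>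
      disappears in the limit.\<close>
    have "2 * Re (LINT x|M. w t x * cnj (q s t x)) + (s - t) * (L2_norm M (q s t))\<^sup>2 = (E s - E t) / (s - t)"
      if s: "s \<ge> 0" "s \<noteq> t" for s
    proof -
      have "E s = (L2_norm M (\<lambda>x. w t x + complex_of_real (s - t) * q s t x))\<^sup>2"
        unfolding E_def q_def using s by simp
      also have "\<dots> = E t + (L2_norm M (\<lambda>x. complex_of_real (s - t) * q s t x))\<^sup>2
          + 2 * Re (LINT x|M. w t x * cnj (complex_of_real (s - t) * q s t x))"
        unfolding E_def by (intro L2_norm_add_power2 w t L2_scale qL s)
      also have "(LINT x|M. w t x * cnj (complex_of_real (s - t) * q s t x))
          = (LINT x|M. complex_of_real (s - t) * (w t x * cnj (q s t x)))"
        by (intro Bochner_Integration.integral_cong) auto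
      also have "\<dots> = complex_of_real (s - t) * (LINT x|M. w t x * cnj (q s t x))"
        by (rule integral_mult_right_zero)
      also have "L2_norm M (\<lambda>x. complex_of_real (s - t) * q s t x) = \<bar>s - t\<bar> * L2_norm M (q s t)"
        unfolding L2_norm_scale norm_of_real ..
      finally have "E s - E t = (s - t) * (2 * Re (LINT x|M. w t x * cnj (q s t x)) + (s - t) * (L2_norm M (q s t))\<^sup>2)"
        by (simp add: power_mult_distrib power2_eq_square[of "s - t"] distrib_left del: of_real_diff)
      then show ?thesis using s by simp
    qed
    then have "((\<lambda>s. (E s - E t) / (s - t)) \<longlongrightarrow> 2 * Re (LINT x|M. w t x * cnj (w' t x))) (at t within {0..})"
      by (intro Lim_transform_eventually[OF lim]) (auto simp: eventually_at_filter)
    then show ?thesis by (simp add: has_field_derivative_iff)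
  qed
  have neg: "Re (LINT x|M. w t x * cnj (w' t x)) \<le> 0" if t: "t > 0" for t
  proof -
    have t0: "t \<ge> 0" using t by simp
    have reps: "rep (u t) (F (u t))" "rep (v t) (F (v t))" "rep (w t) (\<lambda>x. F (u t) x - F (v t) x)"
      using rep_F[OF L(1)[OF t0]] rep_F[OF L(3)[OF t0]] rep_diff[OF rep_F[OF L(1)[OF t0]] rep_F[OF L(3)[OF t0]]]
      by (auto simp: w_def[abs_def])
    have ld: "(\<lambda>x. complex_of_real (lam x) * (F (u t) x - F (v t) x)) \<in> L2 M"
      using u'(2)[OF t0] v'(2)[OF t0] L2_diff[of "\<lambda>x. complex_of_real (lam x) * F (u t) x" M]
      by (simp add: Dom_iff right_diff_distrib)
    have wD: "w t \<in> Dom" using rep_Dom_iff[OF reps(3)] ld by simp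
    have "rep (\<lambda>x. A (u t) x - A (v t) x)
        (\<lambda>x. complex_of_real (lam x) * F (u t) x - complex_of_real (lam x) * F (v t) x)"
      by (intro rep_diff rep_A reps u' v' t0)
    then have Aeq: "L2_eq M (\<lambda>x. A (u t) x - A (v t) x) (A (w t))"
      using rep_eq[OF _ rep_A[OF reps(3) wD]] ld by (simp add: right_diff_distrib L2_eq_refl)
    have "AE x in M. u' t x + A (u t) x = 0" "AE x in M. v' t x + A (v t) x = 0"
      "AE x in M. A (u t) x - A (v t) x = A (w t) x"
      using u'(3)[OF t] v'(3)[OF t] Aeq by (auto simp: L2_eq_def)
    then have "AE x in M. w' t x = - A (w t) x"
    proof eventually_elim
      case (elim x)
      have "u' t x = - A (u t) x" "v' t x = - A (v t) x"
        using elim(1,2) by (simp_all add: eq_neg_iff_add_eq_0)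
      then show ?case using elim(3)[symmetric] by (simp add: w'_def)
    qed
    then have "AE x in M. w t x * cnj (w' t x) = - (w t x * cnj (A (w t) x))" by eventually_elim simp
    then have "(LINT x|M. w t x * cnj (w' t x)) = (LINT x|M. - (w t x * cnj (A (w t) x)))"
      using w[OF t0] A_closed[OF wD] by (intro integral_cong_AE) (auto dest: L2_measurable)
    then show ?thesis using A_nonneg[OF wD] by simp
  qed
  have "E t \<le> E 0"
  \<comment> \<open>The equation, and with it the sign of the derivative, is available only for
    positive times; at the endpoint 0 continuity is enough.\<close>
  proof (rule DERIV_nonpos_imp_decreasing_open[OF t])
    fix s assume s: "0 < s" "s < t"
    have "at s within {0..} = at s" using s by (intro at_within_interior) auto
    then show "\<exists>y. (E has_real_derivative y) (at s) \<and> y \<le> 0" using der[of s] neg[of s] s by auto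
  next
    have "continuous (at s within {0..}) E" if "s \<ge> 0" for s
      using der[OF that] by (rule DERIV_continuous)
    then have "continuous_on {0..} E" by (simp add: continuous_on_eq_continuous_within)
    then show "continuous_on {0..t} E" by (rule continuous_on_subset) auto
  qed
  also have "E 0 = 0"
    using L2_eq_trans[OF u'(4) L2_eq_sym[OF v'(4)]] by (simp add: E_def w_def[abs_def] L2_eq_iff)
  finally have "(L2_norm M (w t))\<^sup>2 \<le> 0" by (simp add: E_def)
  then have "L2_norm M (w t) = 0" by simp
  then show ?thesis using L[OF t] by (simp add: L2_eq_iff w_def[abs_def])
qed

lemma H_solution: "f \<in> Dom \<Longrightarrow> solution f (\<lambda>t. H t f)"
  by (rule generated_solution[OF H_generated])

text \<open>The approximants \<open>H (1/(n+1)) f\<close> lie in the domain by smoothing. On them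
  both semigroups give solutions with the same initial value, and at the fixed time t both operators
  are bounded, so the equality passes to \<open>f\<close>.\<close>

lemma generated_unique:
  assumes U: "C0_semigroup_generated_by M U Dom (\<lambda>f x. - A f x)" and t: "t \<ge> 0" and f: "f \<in> L2 M"
  shows "L2_eq M (U t f) (H t f)"
proof -
  interpret U: L2_semigroup M U
    using U by unfold_locales (simp add: C0_semigroup_generated_by_def)
  obtain K where K: "\<And>f. f \<in> L2 M \<Longrightarrow> L2_norm M (U t f) \<le> K * L2_norm M f"
    using bounded_operator_L2_bound[OF U.bounded[OF t]] by blast
  obtain K' where K': "\<And>f. f \<in> L2 M \<Longrightarrow> L2_norm M (H t f) \<le> K' * L2_norm M f"
    using bounded_operator_L2_bound[OF H.bounded[OF t]] by blast
  define g where "g n = H (inverse (real (Suc n))) f" for n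
  have gD: "g n \<in> Dom" and gL: "g n \<in> L2 M" for n
    unfolding g_def using H_smoothing[OF _ f] by (auto simp: Dom_iff)
  have "filterlim (\<lambda>n. inverse (real (Suc n))) (at_right 0) sequentially"
    unfolding filterlim_at using LIMSEQ_inverse_real_of_nat by auto
  from filterlim_compose[OF H.continuous_at_0[OF f] this]
  have g: "(\<lambda>n. L2_norm M (\<lambda>x. g n x - f x)) \<longlonglongrightarrow> 0" by (simp add: g_def)
  have eq: "L2_eq M (U t (g n)) (H t (g n))" for n
    using solution_unique[OF generated_solution[OF U gD] H_solution[OF gD] t] .
  have 1: "(\<lambda>n. L2_norm M (\<lambda>x. U t (g n) x - U t f x)) \<longlonglongrightarrow> 0"
  proof (rule tendsto_sandwich[OF _ _ tendsto_const])
    show "(\<lambda>n. K * L2_norm M (\<lambda>x. g n x - f x)) \<longlonglongrightarrow> 0"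
      using tendsto_mult[OF tendsto_const g] by simp
    show "\<forall>\<^sub>F n in sequentially. L2_norm M (\<lambda>x. U t (g n) x - U t f x) \<le> K * L2_norm M (\<lambda>x. g n x - f x)"
      using bounded_operator_L2_diff_norm[OF U.bounded[OF t] K gL f] by simp
  qed simp
  have 2: "(\<lambda>n. L2_norm M (\<lambda>x. U t (g n) x - H t f x)) \<longlonglongrightarrow> 0"
  proof (rule tendsto_sandwich[OF _ _ tendsto_const])
    show "(\<lambda>n. K' * L2_norm M (\<lambda>x. g n x - f x)) \<longlonglongrightarrow> 0"
      using tendsto_mult[OF tendsto_const g] by simp
    have "L2_norm M (\<lambda>x. U t (g n) x - H t f x) = L2_norm M (\<lambda>x. H t (g n) x - H t f x)" for n
      by (intro L2_eq_norm L2_eq_diff eq L2_eq_refl H.closed t f)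
    then show "\<forall>\<^sub>F n in sequentially. L2_norm M (\<lambda>x. U t (g n) x - H t f x) \<le> K' * L2_norm M (\<lambda>x. g n x - f x)"
      using bounded_operator_L2_diff_norm[OF H.bounded[OF t] K' gL f] by simp
  qed simp
  show ?thesis
    by (rule L2_limit_unique[OF _ _ _ _ 1 2]) (auto intro!: U.closed H.closed t f gL)
qed

end

section \<open>Fourier analysis on self-dual filtered groups\<close>

lemma (in abelian_group) minus_swap:
  "x \<in> carrier G \<Longrightarrow> y \<in> carrier G \<Longrightarrow> \<ominus> (x \<ominus> y) = y \<ominus> x"
  by (simp add: a_minus_def minus_add a_comm)

lemma (in abelian_group) minus_trans:
  "x \<in> carrier G \<Longrightarrow> y \<in> carrier G \<Longrightarrow> z \<in> carrier G \<Longrightarrow> (x \<ominus> y) \<oplus> (y \<ominus> z) = x \<ominus> z"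
  by (simp add: a_minus_def a_assoc r_neg1)

lemma (in abelian_group) minus_minus_cancel:
  assumes "x \<in> carrier G" "y \<in> carrier G" "z \<in> carrier G"
  shows "(x \<ominus> z) \<ominus> (x \<ominus> y) = y \<ominus> z"
proof -
  have "(x \<ominus> z) \<ominus> (x \<ominus> y) = (x \<ominus> z) \<oplus> (y \<ominus> x)"
    using assms by (simp add: a_minus_def[of G "x \<ominus> z"] minus_swap)
  also have "\<dots> = y \<ominus> z" using assms by (simp add: a_comm[of "x \<ominus> z"] minus_trans)
  finally show ?thesis .
qed

lemma (in abelian_group) add_minus_cancel:
  "x \<in> carrier G \<Longrightarrow> y \<in> carrier G \<Longrightarrow> x \<oplus> (y \<ominus> x) = y"
  by (simp add: a_minus_def a_lcomm[of x y] r_neg)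

lemma (in abelian_group) add_minus_left:
  "x \<in> carrier G \<Longrightarrow> y \<in> carrier G \<Longrightarrow> (x \<oplus> y) \<ominus> x = y"
  by (simp add: a_minus_def a_comm[of x y] a_assoc r_neg)

lemma has_bochner_integral_complex_indicator:
  assumes "X \<in> sets M" "emeasure M X < \<infinity>"
  shows "has_bochner_integral M (indicator X :: 'a \<Rightarrow> complex) (complex_of_real (measure M X))"
proof -
  have "(\<lambda>x. indicator X x *\<^sub>R (1::complex)) = indicator X" by (auto simp: indicator_def)
  then show ?thesis using has_bochner_integral_indicator[OF assms, of "1::complex"]
    by (simp add: scaleR_conv_of_real)
qed

text \<open>A filtered group that is its own dual: \<open>e\<close> is a bicharacter for which the annihilator of
  \<open>B n\<close> is \<open>B (- n)\<close>.\<close>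

locale dual_filtered_group = abelian_group R for R (structure) +
  fixes M :: "'a measure" and B :: "int \<Rightarrow> 'a set" and w :: "int \<Rightarrow> real"
    and e :: "'a \<Rightarrow> 'a \<Rightarrow> complex"
  assumes B_subset: "B n \<subseteq> carrier R"
    and B_zero: "\<zero> \<in> B n"
    and B_minus: "x \<in> B n \<Longrightarrow> y \<in> B n \<Longrightarrow> x \<ominus> y \<in> B n"
    and B_mono: "m \<le> n \<Longrightarrow> B m \<subseteq> B n"
    and B_cover: "x \<in> carrier R \<Longrightarrow> \<exists>n. x \<in> B n"
    and sets_eq: "sets M = sigma_sets (carrier R) {{x \<in> carrier R. x \<ominus> a \<in> B n} | a n. a \<in> carrier R}"
    and countable_cosets: "countable {{x \<in> carrier R. x \<ominus> a \<in> B n} | a n. a \<in> carrier R}"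
    and translation_invariant:
      "a \<in> carrier R \<Longrightarrow> X \<in> sets M \<Longrightarrow> emeasure M ((\<lambda>x. a \<oplus> x) ` X) = emeasure M X"
    and emeasure_B: "emeasure M (B n) = ennreal (w n)"
    and w_pos: "w n > 0"
    and w_dual: "w n * w (- n) = 1"
    and e_norm: "x \<in> carrier R \<Longrightarrow> y \<in> carrier R \<Longrightarrow> cmod (e x y) = 1"
    and e_commute: "x \<in> carrier R \<Longrightarrow> y \<in> carrier R \<Longrightarrow> e x y = e y x"
    and e_add: "x \<in> carrier R \<Longrightarrow> y \<in> carrier R \<Longrightarrow> z \<in> carrier R \<Longrightarrow> e (x \<oplus> y) z = e x z * e y z"
    and e_trivial: "x \<in> B n \<Longrightarrow> y \<in> B (- n) \<Longrightarrow> e x y = 1"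
    and e_separates: "y \<in> carrier R \<Longrightarrow> y \<notin> B (- n) \<Longrightarrow> \<exists>x\<in>B n. e x y \<noteq> 1"
begin

section \<open>Cosets of the filtration and translation of integrals\<close>

definition coset :: "'a \<Rightarrow> int \<Rightarrow> 'a set" where
  "coset a n = {x \<in> carrier R. x \<ominus> a \<in> B n}"

definition cosets :: "'a set set" where
  "cosets = {coset a n | a n. a \<in> carrier R}"

lemma sets_eq_cosets: "sets M = sigma_sets (carrier R) cosets"
  using sets_eq by (simp add: cosets_def coset_def)

lemma countable_cosets': "countable cosets"
  using countable_cosets by (simp add: cosets_def coset_def)

lemma coset_subset: "coset a n \<subseteq> carrier R"
  by (auto simp: coset_def)

lemma space_eq [simp]: "space M = carrier R"
proof -
  have sub: "cosets \<subseteq> Pow (carrier R)" using coset_subset by (auto simp: cosets_def)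
  have "sets M = sets (sigma (carrier R) cosets)"
    unfolding sets_eq_cosets using sub by (rule sets_measure_of[symmetric])
  from sets_eq_imp_space_eq[OF this] show ?thesis using sub by (simp add: space_measure_of)
qed

lemma B_closed: "x \<in> B n \<Longrightarrow> x \<in> carrier R"
  using B_subset by auto

lemma B_neg: "x \<in> B n \<Longrightarrow> \<ominus> x \<in> B n"
  using B_minus[OF B_zero, of x n] B_closed by (simp add: a_minus_def)

lemma B_add: "x \<in> B n \<Longrightarrow> y \<in> B n \<Longrightarrow> x \<oplus> y \<in> B n"
  using B_minus[of x n "\<ominus> y"] B_neg[of y n] B_closed by (simp add: a_minus_def)

lemma minus_zero [simp]: "x \<in> carrier R \<Longrightarrow> x \<ominus> \<zero> = x"
  by (simp add: a_minus_def)

lemma minus_self [simp]: "x \<in> carrier R \<Longrightarrow> x \<ominus> x = \<zero>"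
  by (simp add: a_minus_def r_neg)

lemma B_swap: "x \<in> carrier R \<Longrightarrow> y \<in> carrier R \<Longrightarrow> x \<ominus> y \<in> B n \<longleftrightarrow> y \<ominus> x \<in> B n"
  using B_neg minus_swap by metis

lemma B_trans: "x \<in> carrier R \<Longrightarrow> y \<in> carrier R \<Longrightarrow> z \<in> carrier R \<Longrightarrow>
    x \<ominus> y \<in> B n \<Longrightarrow> y \<ominus> z \<in> B n \<Longrightarrow> x \<ominus> z \<in> B n"
  using B_add minus_trans by metis

lemma coset_zero: "coset \<zero> n = B n"
  using B_closed by (auto simp: coset_def)

lemma coset_self: "a \<in> carrier R \<Longrightarrow> a \<in> coset a n"
  by (simp add: coset_def B_zero)

lemma coset_eq:
  assumes "a \<in> carrier R" "b \<in> coset a n"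
  shows "coset b n = coset a n"
proof -
  have b: "b \<in> carrier R" "b \<ominus> a \<in> B n" "a \<ominus> b \<in> B n"
    using assms B_swap by (auto simp: coset_def)
  show ?thesis using assms(1) b B_trans[of _ b a n] B_trans[of _ a b n] by (auto simp: coset_def)
qed

text \<open>Like balls of an ultrametric space, cosets are nested or disjoint: any common point
  serves as a center of both. Hence the cosets together with the empty set form a generator stable
  under intersection.\<close>

lemma coset_Int:
  assumes "a \<in> carrier R" "b \<in> carrier R" "m \<le> n"
  shows "coset a n \<inter> coset b m = (if b \<in> coset a n then coset b m else {})"
proof (cases "b \<in> coset a n")
  case True
  have "coset b m \<subseteq> coset b n" using B_mono[OF assms(3)] by (auto simp: coset_def)
  then show ?thesis using coset_eq[OF assms(1) True] True by auto
next
  case False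
  have "x \<notin> coset b m" if x: "x \<in> coset a n" for x
  proof
    assume "x \<in> coset b m"
    then have "x \<in> carrier R" "x \<ominus> b \<in> B n" using B_mono[OF assms(3)] by (auto simp: coset_def)
    then have "b \<in> coset x n" using assms B_swap[of x b n] by (simp add: coset_def)
    then show False using False coset_eq[OF assms(1) x] by simp
  qed
  then show ?thesis using False by auto
qed

lemma coset_sets [measurable]: "a \<in> carrier R \<Longrightarrow> coset a n \<in> sets M"
  unfolding sets_eq_cosets by (rule sigma_sets.Basic) (auto simp: cosets_def)

lemma B_sets [measurable]: "B n \<in> sets M"
  using coset_sets[of \<zero> n] by (simp add: coset_zero)

lemma coset_translate: "a \<in> carrier R \<Longrightarrow> coset a n = (\<lambda>x. a \<oplus> x) ` B n"
proof
  assume a: "a \<in> carrier R"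
  show "coset a n \<subseteq> (\<lambda>x. a \<oplus> x) ` B n"
  proof
    fix x assume x: "x \<in> coset a n"
    then have "x = a \<oplus> (x \<ominus> a)" "x \<ominus> a \<in> B n" using a add_minus_cancel by (auto simp: coset_def)
    then show "x \<in> (\<lambda>x. a \<oplus> x) ` B n" by (rule image_eqI)
  qed
  show "(\<lambda>x. a \<oplus> x) ` B n \<subseteq> coset a n"
    using a B_closed add_minus_left by (auto simp: coset_def)
qed

lemma emeasure_coset: "a \<in> carrier R \<Longrightarrow> emeasure M (coset a n) = ennreal (w n)"
  using translation_invariant[OF _ B_sets] emeasure_B by (simp add: coset_translate)

lemma measure_coset: "a \<in> carrier R \<Longrightarrow> measure M (coset a n) = w n"
  using emeasure_coset w_pos[of n] by (simp add: measure_def)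

lemma translate_measurable:
  assumes a: "a \<in> carrier R"
  shows "(\<lambda>x. a \<oplus> x) \<in> measurable M M"
proof (rule measurable_sigma_sets[OF sets_eq_cosets])
  show "cosets \<subseteq> Pow (carrier R)" using coset_subset by (auto simp: cosets_def)
  show "(\<lambda>x. a \<oplus> x) \<in> space M \<rightarrow> carrier R" using a by auto
  fix y assume "y \<in> cosets"
  then obtain b n where b: "y = coset b n" "b \<in> carrier R" by (auto simp: cosets_def)
  have "a \<oplus> x \<ominus> b = x \<ominus> (b \<ominus> a)" if "x \<in> carrier R" for x
    using a b(2) that by (simp add: a_minus_def minus_add a_ac)
  then have "(\<lambda>x. a \<oplus> x) -` y \<inter> space M = coset (b \<ominus> a) n"
    using a b by (auto simp: coset_def)
  then show "(\<lambda>x. a \<oplus> x) -` y \<inter> space M \<in> sets M" using a b by simp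
qed

lemma distr_translate:
  assumes a: "a \<in> carrier R"
  shows "distr M M (\<lambda>x. a \<oplus> x) = M"
proof (rule measure_eqI)
  fix X assume "X \<in> sets (distr M M (\<lambda>x. a \<oplus> x))"
  then have X: "X \<in> sets M" by simp
  have "(\<lambda>x. a \<oplus> x) -` X \<inter> space M = (\<lambda>x. \<ominus> a \<oplus> x) ` X"
  proof
    show "(\<lambda>x. a \<oplus> x) -` X \<inter> space M \<subseteq> (\<lambda>x. \<ominus> a \<oplus> x) ` X"
      using a by (auto simp: r_neg1 intro!: image_eqI[of _ _ "a \<oplus> _"])
    show "(\<lambda>x. \<ominus> a \<oplus> x) ` X \<subseteq> (\<lambda>x. a \<oplus> x) -` X \<inter> space M"
      using a sets.sets_into_space[OF X] by (auto simp: r_neg2 subset_iff)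
  qed
  then show "emeasure (distr M M (\<lambda>x. a \<oplus> x)) X = emeasure M X"
    using X a translation_invariant[of "\<ominus> a" X] by (simp add: emeasure_distr translate_measurable)
qed simp

lemma integral_translate:
  fixes f :: "'a \<Rightarrow> complex"
  assumes a: "a \<in> carrier R" and f: "f \<in> borel_measurable M"
  shows "(LINT x|M. f (a \<oplus> x)) = (LINT x|M. f x)"
  using integral_distr[OF translate_measurable[OF a] f] distr_translate[OF a] by simp

text \<open>Every preimage is a union of cosets, and there are only countably many cosets.\<close>

lemma locally_constant_measurable:
  fixes h :: "'a \<Rightarrow> complex"
  assumes "\<And>x b. x \<in> carrier R \<Longrightarrow> b \<in> B n \<Longrightarrow> h (x \<oplus> b) = h x"
  shows "h \<in> borel_measurable M"
proof (rule measurableI)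
  fix X :: "complex set"
  define G where "G = {C \<in> cosets. C \<subseteq> h -` X}"
  have "h -` X \<inter> space M = \<Union>G"
  proof
    show "\<Union>G \<subseteq> h -` X \<inter> space M" using coset_subset by (auto simp: G_def cosets_def)
    show "h -` X \<inter> space M \<subseteq> \<Union>G"
    proof
      fix x assume x: "x \<in> h -` X \<inter> space M"
      have "coset x n \<subseteq> h -` X"
      proof
        fix y assume "y \<in> coset x n"
        then have "y \<in> carrier R" "y \<ominus> x \<in> B n" by (auto simp: coset_def)
        then have "h y = h x" using assms[of x "y \<ominus> x"] add_minus_cancel[of x y] x by simp
        then show "y \<in> h -` X" using x by simp
      qed
      then have "coset x n \<in> G" using x by (auto simp: G_def cosets_def)
      then show "x \<in> \<Union>G" using coset_self x by auto
    qed
  qed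
  moreover have "\<Union>G \<in> sets M"
  proof (rule sets.countable_Union)
    show "countable G" unfolding G_def using countable_cosets' by (rule countable_subset[rotated]) auto
    show "G \<subseteq> sets M" by (auto simp: G_def cosets_def)
  qed
  ultimately show "h -` X \<inter> space M \<in> sets M" by simp
qed simp

lemma e_add_right: "x \<in> carrier R \<Longrightarrow> y \<in> carrier R \<Longrightarrow> z \<in> carrier R \<Longrightarrow> e z (x \<oplus> y) = e z x * e z y"
  using e_add[of x y z] by (simp add: e_commute[of z])

lemma e_zero: "y \<in> carrier R \<Longrightarrow> e \<zero> y = 1"
proof -
  assume y: "y \<in> carrier R"
  have "e \<zero> y * e \<zero> y = e \<zero> y" using e_add[of \<zero> \<zero> y] y by simp
  moreover have "e \<zero> y \<noteq> 0" using e_norm[OF zero_closed y] by auto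
  ultimately show ?thesis by simp
qed

lemma e_neg: 
  assumes "x \<in> carrier R" "y \<in> carrier R"
  shows "e (\<ominus> x) y = cnj (e x y)"
proof -
  have "e x y * e (\<ominus> x) y = 1" using e_add[of x "\<ominus> x" y] assms by (simp add: r_neg e_zero)
  moreover have "e x y * cnj (e x y) = 1"
    using e_norm[OF assms] by (simp add: complex_norm_square[symmetric])
  moreover have "e x y \<noteq> 0" using e_norm[OF assms] by auto
  ultimately show ?thesis by (metis mult_cancel_left)
qed

lemma e_minus: "x \<in> carrier R \<Longrightarrow> y \<in> carrier R \<Longrightarrow> z \<in> carrier R \<Longrightarrow> e (x \<ominus> y) z = e x z * cnj (e y z)"
  by (simp add: a_minus_def e_add e_neg)

text \<open>If \<open>y\<close> is in \<open>B n\<close>, the character \<open>e y\<close> is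
  constant on the cosets of \<open>B (- n)\<close>.\<close>

lemma e_measurable [measurable]:
  assumes y: "y \<in> carrier R"
  shows "e y \<in> borel_measurable M"
proof -
  obtain n where n: "y \<in> B n" using B_cover[OF y] by blast
  show ?thesis
  proof (rule locally_constant_measurable)
    show "e y (x \<oplus> b) = e y x" if "x \<in> carrier R" "b \<in> B (- n)" for x b
      using that y n B_closed e_trivial[of y n b] by (simp add: e_add_right)
  qed
qed

section \<open>Indicator functions of cosets and the Fourier integral\<close>

definition ind :: "'a \<Rightarrow> int \<Rightarrow> 'a \<Rightarrow> complex" where
  "ind a n = indicator (coset a n)"

lemma ind_zero: "ind \<zero> n = indicator (B n)"
  by (simp add: ind_def coset_zero)

lemma ind_measurable [measurable]: "a \<in> carrier R \<Longrightarrow> ind a n \<in> borel_measurable M"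
  unfolding ind_def by measurable

lemma cnj_ind [simp]: "cnj (ind a n x) = ind a n x"
  by (simp add: ind_def indicator_def)

lemma has_bochner_integral_ind:
  "a \<in> carrier R \<Longrightarrow> has_bochner_integral M (ind a n) (complex_of_real (w n))"
  unfolding ind_def using has_bochner_integral_complex_indicator[OF coset_sets[of a n]]
  by (simp add: emeasure_coset measure_coset)

lemma integral_ind: "a \<in> carrier R \<Longrightarrow> (LINT x|M. ind a n x) = complex_of_real (w n)"
  by (rule has_bochner_integral_integral_eq[OF has_bochner_integral_ind])

definition LL :: "('a \<Rightarrow> complex) \<Rightarrow> bool" where
  "LL f \<longleftrightarrow> f \<in> L2 M \<and> integrable M f"

lemma LL_lin: "LL f \<Longrightarrow> LL g \<Longrightarrow> LL (\<lambda>x. a * f x + b * g x)"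
  by (auto simp: LL_def)

lemma LL_add: "LL f \<Longrightarrow> LL g \<Longrightarrow> LL (\<lambda>x. f x + g x)"
  by (auto simp: LL_def)

lemma LL_scale: "LL f \<Longrightarrow> LL (\<lambda>x. a * f x)"
  by (auto simp: LL_def)

lemma LL_diff: "LL f \<Longrightarrow> LL g \<Longrightarrow> LL (\<lambda>x. f x - g x)"
  by (auto simp: LL_def)

lemma LL_cnj: "LL f \<Longrightarrow> LL (\<lambda>x. cnj (f x))"
  by (auto simp: LL_def)

lemma LL_zero: "LL (\<lambda>x. 0)"
  by (auto simp: LL_def)

lemma LL_bound:
  assumes "LL g" "f \<in> borel_measurable M" "\<And>x. x \<in> carrier R \<Longrightarrow> cmod (f x) \<le> cmod (g x)"
  shows "LL f"
proof -
  have "AE x in M. cmod (f x) \<le> cmod (g x)" by (rule AE_I2) (use assms(3) in simp)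
  then show ?thesis
    using L2_bound(1)[of g M f] Bochner_Integration.integrable_bound[of M g f] assms(1,2) by (simp add: LL_def)
qed

lemma LL_cong: "LL f \<Longrightarrow> (\<And>x. x \<in> carrier R \<Longrightarrow> f x = g x) \<Longrightarrow> LL g"
proof -
  assume f: "LL f" and eq: "\<And>x. x \<in> carrier R \<Longrightarrow> f x = g x"
  have "f \<in> borel_measurable M" using f by (simp add: LL_def L2_measurable)
  moreover have "f \<in> borel_measurable M \<longleftrightarrow> g \<in> borel_measurable M"
    by (rule measurable_cong) (simp add: eq)
  ultimately have "g \<in> borel_measurable M" by simp
  then show "LL g" using eq by (intro LL_bound[OF f]) auto
qed

lemma LL_indicator:
  assumes "X \<in> sets M" "emeasure M X < \<infinity>"
  shows "LL (\<lambda>x. indicator X x :: complex)"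
proof -
  have int: "integrable M (indicator X :: 'a \<Rightarrow> complex)"
    using has_bochner_integral_complex_indicator[OF assms] integrable.simps by blast
  moreover have "(cmod (indicator X x))\<^sup>2 = cmod (indicator X x)" for x by (simp add: indicator_def)
  ultimately show ?thesis using assms integrable_norm[OF int] by (simp add: LL_def L2_def)
qed

lemma LL_ind: "a \<in> carrier R \<Longrightarrow> LL (ind a n)"
  using LL_indicator[OF coset_sets[of a n]] by (simp add: ind_def emeasure_coset)

definition F :: "('a \<Rightarrow> complex) \<Rightarrow> 'a \<Rightarrow> complex" where
  "F f \<xi> = (LINT x|M. f x * e \<xi> x)"

lemma integrable_e:
  assumes "integrable M f" "y \<in> carrier R"
  shows "integrable M (\<lambda>x. f x * e y x)"
  by (rule Bochner_Integration.integrable_bound[OF assms(1)])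
    (use assms in \<open>auto simp: norm_mult e_norm\<close>)

lemma F_lin: "integrable M f \<Longrightarrow> integrable M g \<Longrightarrow> y \<in> carrier R \<Longrightarrow>
    F (\<lambda>x. a * f x + b * g x) y = a * F f y + b * F g y"
proof -
  assume *: "integrable M f" "integrable M g" "y \<in> carrier R"
  have "F (\<lambda>x. a * f x + b * g x) y = (LINT x|M. a * (f x * e y x) + b * (g x * e y x))"
    unfolding F_def by (simp add: algebra_simps)
  also have "\<dots> = a * F f y + b * F g y"
    using integrable_e[OF *(1,3)] integrable_e[OF *(2,3)] unfolding F_def by simp
  finally show ?thesis .
qed

lemma F_diff: "integrable M f \<Longrightarrow> integrable M g \<Longrightarrow> y \<in> carrier R \<Longrightarrow>
    F (\<lambda>x. f x - g x) y = F f y - F g y"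
  using F_lin[of f g y 1 "-1"] by simp

lemma F_cong: "(\<And>x. x \<in> carrier R \<Longrightarrow> f x = g x) \<Longrightarrow> F f = F g"
  unfolding F_def by (intro ext Bochner_Integration.integral_cong) auto

lemma F_bound:
  assumes "integrable M f" "y \<in> carrier R"
  shows "cmod (F f y) \<le> (LINT x|M. cmod (f x))"
proof -
  have "cmod (F f y) \<le> (LINT x|M. cmod (f x * e y x))" unfolding F_def by (rule integral_norm_bound)
  also have "\<dots> = (LINT x|M. cmod (f x))"
    using assms by (intro Bochner_Integration.integral_cong) (auto simp: norm_mult e_norm)
  finally show ?thesis .
qed

text \<open>Orthogonality of characters: if \<open>e b y\<close> differs from 1 for some
  \<open>b\<close> in \<open>B n\<close>, translation by \<open>b\<close> multiplies the integral by
  that number without changing it. The exact evaluations of Fourier integrals below all reduce to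
  this one.\<close>

lemma character_integral:
  assumes y: "y \<in> carrier R"
  shows "(LINT x|M. ind \<zero> n x * e y x) = (if y \<in> B (- n) then complex_of_real (w n) else 0)"
proof (cases "y \<in> B (- n)")
  case True
  have "ind \<zero> n x * e y x = ind \<zero> n x" for x
    using e_trivial[OF _ True, of x] B_closed[of x n] y
    by (auto simp: ind_zero indicator_def e_commute[of y])
  then have "(LINT x|M. ind \<zero> n x * e y x) = (LINT x|M. ind \<zero> n x)" by presburger
  then show ?thesis using True integral_ind[of \<zero> n] by simp
next
  case False
  obtain b where b: "b \<in> B n" "e b y \<noteq> 1" using e_separates[OF y False] by blast
  have bc: "b \<in> carrier R" using b B_closed by blast
  define I where "I = (LINT x|M. ind \<zero> n x * e y x)"
  have ib: "ind \<zero> n (b \<oplus> x) = ind \<zero> n x" if "x \<in> carrier R" for x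
  proof -
    have "b \<oplus> x \<in> B n \<longleftrightarrow> x \<in> B n"
      using B_add[OF b(1), of x] B_add[OF B_neg[OF b(1)], of "b \<oplus> x"] r_neg1[of b x] bc that by auto
    then show ?thesis by (simp add: ind_zero indicator_def)
  qed
  have "I = (LINT x|M. ind \<zero> n (b \<oplus> x) * e y (b \<oplus> x))"
    unfolding I_def using y by (intro integral_translate[symmetric] bc) measurable
  also have "\<dots> = (LINT x|M. e y b * (ind \<zero> n x * e y x))"
    using bc y by (intro Bochner_Integration.integral_cong) (auto simp: ib e_add_right)
  also have "\<dots> = e y b * I" unfolding I_def by (rule integral_mult_right_zero)
  finally have "I = 0" using b e_commute[OF bc y] by simp
  then show ?thesis using False by (simp add: I_def)
qed

lemma F_ind:
  assumes a: "a \<in> carrier R" and y: "y \<in> carrier R"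
  shows "F (ind a n) y = complex_of_real (w n) * (e a y * ind \<zero> (- n) y)"
proof -
  have ia: "ind a n (a \<oplus> x) = ind \<zero> n x" if "x \<in> carrier R" for x
    using a that add_minus_left[OF a that] by (simp add: ind_def coset_def indicator_def)
  have "F (ind a n) y = (LINT x|M. ind a n (a \<oplus> x) * e y (a \<oplus> x))"
    unfolding F_def using a y by (intro integral_translate[symmetric] a) measurable
  also have "\<dots> = (LINT x|M. e y a * (ind \<zero> n x * e y x))"
    using a y by (intro Bochner_Integration.integral_cong) (auto simp: ia e_add_right)
  also have "\<dots> = e y a * (LINT x|M. ind \<zero> n x * e y x)" by (rule integral_mult_right_zero)
  finally show ?thesis unfolding character_integral[OF y]
    using a y by (simp add: e_commute[of y a] ind_zero indicator_def)
qed

text \<open>Linear combinations of coset indicators, the analogue of Bruhat-Schwartz functions.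
  Building them one term at a time gives an induction rule and spares a normal form with disjoint
  cosets.\<close>

inductive step :: "('a \<Rightarrow> complex) \<Rightarrow> bool" where
  step_zero: "step (\<lambda>_. 0)"
| step_add: "a \<in> carrier R \<Longrightarrow> step g \<Longrightarrow> step (\<lambda>x. c * ind a n x + g x)"

lemma step_ind: "a \<in> carrier R \<Longrightarrow> step (ind a n)"
  using step_add[OF _ step_zero, of a 1 n] by simp

lemma step_LL: "step g \<Longrightarrow> LL g"
proof (induction rule: step.induct)
  case (step_add a g c n)
  then show ?case using LL_lin[OF LL_ind step_add(3), of a c n 1] by simp
qed (rule LL_zero)

lemma step_plus: "step g \<Longrightarrow> step h \<Longrightarrow> step (\<lambda>x. g x + h x)"
proof (induction rule: step.induct)
  case (step_add a g c n)
  show ?case using step.step_add[OF step_add(1) step_add(3)[OF step_add(4)], of c n]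
    by (simp add: add.assoc)
qed simp

lemma step_scale: "step g \<Longrightarrow> step (\<lambda>x. c * g x)"
proof (induction rule: step.induct)
  case (step_add a g d n)
  show ?case using step.step_add[OF step_add(1) step_add(3), of "c * d" n] by (simp add: algebra_simps)
qed (simp add: step_zero)

lemma step_lin: "step g \<Longrightarrow> step h \<Longrightarrow> step (\<lambda>x. a * g x + b * h x)"
  by (intro step_plus step_scale)

lemma step_diff: "step g \<Longrightarrow> step h \<Longrightarrow> step (\<lambda>x. g x - h x)"
  using step_lin[of g h 1 "-1"] by simp

lemma LL_F_ind:
  assumes a: "a \<in> carrier R"
  shows "LL (F (ind a n))"
proof (rule LL_cong)
  show "LL (\<lambda>y. complex_of_real (w n) * (e a y * ind \<zero> (- n) y))"
  proof (intro LL_scale LL_bound[OF LL_ind[OF zero_closed]])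
    show "(\<lambda>y. e a y * ind \<zero> (- n) y) \<in> borel_measurable M" using a by measurable
    show "cmod (e a x * ind \<zero> (- n) x) \<le> cmod (ind \<zero> (- n) x)" if "x \<in> carrier R" for x
      using a that by (simp add: norm_mult e_norm)
  qed
qed (simp add: F_ind a)

lemma F_step_add:
  "a \<in> carrier R \<Longrightarrow> step g \<Longrightarrow> y \<in> carrier R \<Longrightarrow> F (\<lambda>x. c * ind a n x + g x) y = c * F (ind a n) y + F g y"
  using F_lin[of "ind a n" g y c 1] step_LL[of g] LL_ind[of a n] by (simp add: LL_def)

lemma LL_F_step: "step g \<Longrightarrow> LL (F g)"
proof (induction rule: step.induct)
  case step_zero
  then show ?case by (simp add: F_def[abs_def] LL_zero)
next
  case (step_add a g c n)
  show ?case
    by (rule LL_cong[OF LL_add[OF LL_scale[OF LL_F_ind[OF step_add(1), of n], of c] step_add(3)]])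
      (simp add: F_step_add step_add)
qed

section \<open>Parseval's identity and inversion for step functions\<close>

definition ip :: "('a \<Rightarrow> complex) \<Rightarrow> ('a \<Rightarrow> complex) \<Rightarrow> complex" where
  "ip f g = (LINT x|M. f x * cnj (g x))"

lemma ip_commute: "ip g f = cnj (ip f g)"
  unfolding ip_def by (simp add: mult.commute flip: Bochner_Integration.integral_cnj)

lemma ip_lin: "f \<in> L2 M \<Longrightarrow> g \<in> L2 M \<Longrightarrow> h \<in> L2 M \<Longrightarrow> ip (\<lambda>x. c * f x + g x) h = c * ip f h + ip g h"
proof -
  assume *: "f \<in> L2 M" "g \<in> L2 M" "h \<in> L2 M"
  have "ip (\<lambda>x. c * f x + g x) h = (LINT x|M. c * (f x * cnj (h x)) + g x * cnj (h x))"
    unfolding ip_def by (simp add: algebra_simps)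
  also have "\<dots> = c * ip f h + ip g h"
    using L2_mult_integrable[OF *(1) L2_cnj[OF *(3)]] L2_mult_integrable[OF *(2) L2_cnj[OF *(3)]]
    unfolding ip_def by simp
  finally show ?thesis .
qed

lemma ip_cong: "(\<And>x. x \<in> carrier R \<Longrightarrow> f x = f' x) \<Longrightarrow> (\<And>x. x \<in> carrier R \<Longrightarrow> g x = g' x) \<Longrightarrow> ip f g = ip f' g'"
  unfolding ip_def by (intro Bochner_Integration.integral_cong) auto

lemma ip_self: "f \<in> L2 M \<Longrightarrow> ip f f = complex_of_real ((L2_norm M f)\<^sup>2)"
proof -
  assume f: "f \<in> L2 M"
  have "ip f f = (LINT x|M. complex_of_real ((cmod (f x))\<^sup>2))"
    unfolding ip_def by (intro Bochner_Integration.integral_cong refl complex_norm_square[symmetric])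
  also have "\<dots> = complex_of_real ((L2_norm M f)\<^sup>2)"
    unfolding L2_norm_power2 by (rule integral_complex_of_real)
  finally show ?thesis .
qed

text \<open>For \<open>m \<le> n\<close> the two transforms overlap on the smaller dual ball
  \<open>B (- n)\<close>, and what remains is the integral of the character of
  \<open>a \<ominus> b\<close> over it: nonzero exactly if the cosets meet, and then
  \<open>w n * w m * w (- n) = w m\<close> is the measure of their intersection. Conjugate symmetry
  covers the other case.\<close>

lemma ip_ind:
  assumes a: "a \<in> carrier R" and b: "b \<in> carrier R"
  shows "ip (F (ind a n)) (F (ind b m)) = ip (ind a n) (ind b m)"
proof -
  have le: "ip (F (ind a n)) (F (ind b m)) = ip (ind a n) (ind b m)"
    if a: "a \<in> carrier R" and b: "b \<in> carrier R" and mn: "m \<le> n" for a b n m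
  proof -
    have ab: "a \<ominus> b \<in> carrier R" using a b by simp
    have "ind \<zero> (- n) x * ind \<zero> (- m) x = ind \<zero> (- n) x" for x
      using B_mono[of "-n" "-m"] mn by (auto simp: ind_zero indicator_def)
    note ii = this
    have "F (ind a n) x * cnj (F (ind b m) x) = complex_of_real (w n * w m) * (ind \<zero> (- n) x * e (a \<ominus> b) x)"
      if x: "x \<in> carrier R" for x
    proof -
      have "F (ind a n) x * cnj (F (ind b m) x)
          = complex_of_real (w n * w m) * ((ind \<zero> (- n) x * ind \<zero> (- m) x) * (e a x * cnj (e b x)))"
        using x by (simp add: F_ind a b)
      then show ?thesis unfolding ii e_minus[OF a b x] .
    qed
    then have "ip (F (ind a n)) (F (ind b m))
       = (LINT x|M. complex_of_real (w n * w m) * (ind \<zero> (- n) x * e (a \<ominus> b) x))"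
      unfolding ip_def by (intro Bochner_Integration.integral_cong) auto
    also have "\<dots> = complex_of_real (w n * w m) * (LINT x|M. ind \<zero> (- n) x * e (a \<ominus> b) x)"
      by (rule integral_mult_right_zero)
    also have "\<dots> = (if a \<ominus> b \<in> B n then complex_of_real (w n * w (- n) * w m) else 0)"
      unfolding character_integral[OF ab] by simp
    also have "\<dots> = (if b \<in> coset a n then complex_of_real (w m) else 0)"
      unfolding w_dual using B_swap[OF a b] b by (simp add: coset_def)
    also have "\<dots> = (LINT x|M. (if b \<in> coset a n then ind b m x else 0))"
      using b integral_ind by simp
    also have "\<dots> = ip (ind a n) (ind b m)"
    proof -
      have "(if b \<in> coset a n then ind b m x else 0) = ind a n x * cnj (ind b m x)" for x
        using coset_Int[OF a b mn] by (auto simp: ind_def indicator_def split: if_splits)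
      then show ?thesis unfolding ip_def by simp
    qed
    finally show ?thesis .
  qed
  show ?thesis
  proof (cases "m \<le> n")
    case True
    then show ?thesis using le a b by blast
  next
    case False
    then have "ip (F (ind b m)) (F (ind a n)) = ip (ind b m) (ind a n)" using le a b by simp
    then show ?thesis using ip_commute by metis
  qed
qed

text \<open>Two inductions, one per argument. Linearity of \<open>ip\<close> is used in the first
  argument, so the second one is brought to the front by conjugate symmetry.\<close>

lemma step_Parseval:
  assumes "step g" "step h"
  shows "ip (F g) (F h) = ip g h"
proof -
  note LLs = step_LL LL_F_step LL_ind LL_F_ind
  have 1: "ip (F (ind a n)) (F h) = ip (ind a n) h" if a: "a \<in> carrier R" and "step h" for a n h
    using that(2)
  proof (induction rule: step.induct)
    case step_zero
    then show ?case by (simp add: ip_def F_def[abs_def])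
  next
    case (step_add b h c m)
    have "ip (F (\<lambda>x. c * ind b m x + h x)) (F (ind a n)) = ip (\<lambda>y. c * F (ind b m) y + F h y) (F (ind a n))"
      by (intro ip_cong) (simp_all add: F_step_add step_add)
    also have "\<dots> = c * ip (F (ind b m)) (F (ind a n)) + ip (F h) (F (ind a n))"
      using LLs a step_add by (intro ip_lin) (auto simp: LL_def)
    also have "\<dots> = c * ip (ind b m) (ind a n) + ip h (ind a n)"
      using ip_ind[OF step_add(1) a] step_add(3) ip_commute by metis
    also have "\<dots> = ip (\<lambda>x. c * ind b m x + h x) (ind a n)"
      using LLs a step_add by (intro ip_lin[symmetric]) (auto simp: LL_def)
    finally show ?case using ip_commute by metis
  qed
  from assms show ?thesis
  proof (induction rule: step.induct)
    case step_zero
    then show ?case by (simp add: ip_def F_def[abs_def])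
  next
    case (step_add a g c n)
    have "ip (F (\<lambda>x. c * ind a n x + g x)) (F h) = ip (\<lambda>y. c * F (ind a n) y + F g y) (F h)"
      by (intro ip_cong) (simp_all add: F_step_add step_add)
    also have "\<dots> = c * ip (F (ind a n)) (F h) + ip (F g) (F h)"
      using LLs step_add by (intro ip_lin) (auto simp: LL_def)
    also have "\<dots> = c * ip (ind a n) h + ip g h"
      using 1[OF step_add(1,4)] step_add(3)[OF step_add(4)] by simp
    also have "\<dots> = ip (\<lambda>x. c * ind a n x + g x) h"
      using LLs step_add by (intro ip_lin[symmetric]) (auto simp: LL_def)
    finally show ?case .
  qed
qed

lemma step_Plancherel:
  assumes "step g"
  shows "L2_norm M (F g) = L2_norm M g"
proof -
  have "complex_of_real ((L2_norm M (F g))\<^sup>2) = complex_of_real ((L2_norm M g)\<^sup>2)"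
    using step_Parseval[OF assms assms] step_LL[OF assms] LL_F_step[OF assms] by (simp add: ip_self LL_def)
  then show ?thesis by (simp only: of_real_eq_iff) (simp add: power2_eq_iff_nonneg)
qed

text \<open>Conjugation replaces the character by its inverse, so this is Fourier inversion in terms
  of \<open>F\<close> alone. For a coset indicator it is once more the integral of a character, now
  over \<open>B (- n)\<close>.\<close>

lemma step_inversion:
  assumes "step g" "x \<in> carrier R"
  shows "F (\<lambda>\<xi>. cnj (F g \<xi>)) x = cnj (g x)"
  using assms
proof (induction rule: step.induct)
  case step_zero
  then show ?case by (simp add: F_def[abs_def])
next
  case (step_add a g c n)
  have xa: "x \<ominus> a \<in> carrier R" using step_add by simp
  have "F (\<lambda>\<xi>. cnj (F (ind a n) \<xi>)) x = (LINT \<xi>|M. complex_of_real (w n) * (ind \<zero> (- n) \<xi> * e (x \<ominus> a) \<xi>))"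
    unfolding F_def[of "\<lambda>\<xi>. cnj (F (ind a n) \<xi>)"] using step_add
    by (intro Bochner_Integration.integral_cong) (auto simp: F_ind e_minus algebra_simps)
  also have "\<dots> = complex_of_real (w n) * (LINT \<xi>|M. ind \<zero> (- n) \<xi> * e (x \<ominus> a) \<xi>)"
    by (rule integral_mult_right_zero)
  also have "\<dots> = (if x \<ominus> a \<in> B n then complex_of_real (w n * w (- n)) else 0)"
    unfolding character_integral[OF xa] by simp
  also have "\<dots> = cnj (ind a n x)"
    unfolding w_dual using step_add by (simp add: ind_def coset_def indicator_def)
  finally have 1: "F (\<lambda>\<xi>. cnj (F (ind a n) \<xi>)) x = cnj (ind a n x)" .
  have "F (\<lambda>\<xi>. cnj (F (\<lambda>x. c * ind a n x + g x) \<xi>)) x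
      = F (\<lambda>\<xi>. cnj c * cnj (F (ind a n) \<xi>) + 1 * cnj (F g \<xi>)) x"
    by (rule fun_cong[OF F_cong]) (simp add: F_step_add step_add)
  also have "\<dots> = cnj c * F (\<lambda>\<xi>. cnj (F (ind a n) \<xi>)) x + 1 * F (\<lambda>\<xi>. cnj (F g \<xi>)) x"
    using LL_F_ind[OF step_add(1)] LL_F_step[OF step_add(2)] step_add by (intro F_lin) (auto simp: LL_def)
  also have "\<dots> = cnj (c * ind a n x + g x)" using 1 step_add by simp
  finally show ?case .
qed

section \<open>Density of step functions\<close>

definition close :: "('a \<Rightarrow> complex) \<Rightarrow> ('a \<Rightarrow> complex) \<Rightarrow> real \<Rightarrow> bool" where
  "close f g \<epsilon> \<longleftrightarrow> (LINT x|M. cmod (f x - g x)) < \<epsilon> \<and> L2_norm M (\<lambda>x. f x - g x) < \<epsilon>"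

text \<open>Approximation is in L^1 and L^2 at once: the first makes Fourier integrals converge
  pointwise, the second is the norm of Plancherel's theorem.\<close>

definition approx :: "('a \<Rightarrow> complex) \<Rightarrow> bool" where
  "approx f \<longleftrightarrow> LL f \<and> (\<forall>\<epsilon>>0. \<exists>g. step g \<and> close f g \<epsilon>)"

lemma close_trans:
  assumes "LL f" "LL g" "LL h" "close f g \<epsilon>" "close g h \<delta>"
  shows "close f h (\<epsilon> + \<delta>)"
proof -
  have int: "integrable M (\<lambda>x. cmod (f x - g x))" "integrable M (\<lambda>x. cmod (g x - h x))"
    "integrable M (\<lambda>x. cmod (f x - h x))"
    using assms by (auto simp: LL_def)
  have "(LINT x|M. cmod (f x - h x)) \<le> (LINT x|M. cmod (f x - g x) + cmod (g x - h x))"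
    using int by (intro integral_mono) (auto intro: norm_diff_triangle_ineq order_trans[OF _ norm_triangle_ineq])
  also have "\<dots> = (LINT x|M. cmod (f x - g x)) + (LINT x|M. cmod (g x - h x))"
    using int by simp
  finally show ?thesis
    using assms L2_norm_triangle_diff[of f M g h] by (auto simp: close_def LL_def)
qed

lemma step_approx: "step g \<Longrightarrow> approx g"
  unfolding approx_def close_def using step_LL by (auto intro!: exI[of _ g])

lemma approx_LL: "approx f \<Longrightarrow> LL f"
  by (simp add: approx_def)

text \<open>A triangle inequality with two halves of \<epsilon>. It lets each density step start
  from the functions reached before instead of from step functions.\<close>

lemma approx_limit:
  assumes f: "LL f" and h: "\<And>\<epsilon>. \<epsilon> > 0 \<Longrightarrow> \<exists>h. approx h \<and> close f h \<epsilon>"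
  shows "approx f"
  unfolding approx_def
proof (intro conjI f allI impI)
  fix \<epsilon> :: real assume "\<epsilon> > 0"
  then have e2: "\<epsilon> / 2 > 0" by simp
  obtain h where h: "approx h" "close f h (\<epsilon>/2)" using h[OF e2] by blast
  obtain g where g: "step g" "close h g (\<epsilon>/2)" using h(1) e2 unfolding approx_def by blast
  show "\<exists>g. step g \<and> close f g \<epsilon>"
    using close_trans[OF f approx_LL[OF h(1)] step_LL[OF g(1)] h(2) g(2)] g(1) by auto
qed

lemma approx_cong:
  assumes "approx f" "\<And>x. x \<in> carrier R \<Longrightarrow> f x = g x"
  shows "approx g"
proof (rule approx_limit)
  show "LL g" using LL_cong[OF approx_LL[OF assms(1)] assms(2)] .
  have "(LINT x|M. cmod (g x - f x)) = (LINT x|M. 0)"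
    using assms(2) by (intro Bochner_Integration.integral_cong) auto
  moreover have "L2_norm M (\<lambda>x. g x - f x) = L2_norm M (\<lambda>x. 0)"
    using assms(2) by (intro L2_norm_cong) auto
  ultimately show "\<exists>h. approx h \<and> close g h \<epsilon>" if "\<epsilon> > 0" for \<epsilon>
    using assms(1) that by (intro exI[of _ f]) (simp add: close_def)
qed

lemma close_scale:
  assumes "LL f" "LL g" "close f g \<epsilon>"
  shows "close (\<lambda>x. c * f x) (\<lambda>x. c * g x) ((cmod c + 1) * \<epsilon>)"
proof -
  have e: "\<epsilon> > 0" using assms(3) L2_norm_nonneg[of M "\<lambda>x. f x - g x"] unfolding close_def by linarith
  have eq: "c * f x - c * g x = c * (f x - g x)" for x by (simp add: right_diff_distrib)
  have *: "cmod c * r < (cmod c + 1) * \<epsilon>" if "r < \<epsilon>" "r \<ge> 0" for r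
  proof -
    have "cmod c * r \<le> cmod c * \<epsilon>" using that by (intro mult_left_mono) auto
    also have "\<dots> < (cmod c + 1) * \<epsilon>" using e by (simp add: distrib_right)
    finally show ?thesis .
  qed
  show ?thesis unfolding close_def eq L2_norm_scale norm_mult
    using assms(3) by (auto simp: close_def intro!: *)
qed

lemma close_add:
  assumes "LL f" "LL g" "LL f'" "LL g'" "close f g \<epsilon>" "close f' g' \<delta>"
  shows "close (\<lambda>x. f x + f' x) (\<lambda>x. g x + g' x) (\<epsilon> + \<delta>)"
proof (rule close_trans)
  show "LL (\<lambda>x. f x + f' x)" "LL (\<lambda>x. g x + f' x)" "LL (\<lambda>x. g x + g' x)" using assms by (auto intro: LL_add)
  show "close (\<lambda>x. f x + f' x) (\<lambda>x. g x + f' x) \<epsilon>" "close (\<lambda>x. g x + f' x) (\<lambda>x. g x + g' x) \<delta>"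
    using assms by (simp_all add: close_def)
qed

lemma approx_scale:
  assumes "approx f"
  shows "approx (\<lambda>x. c * f x)"
  unfolding approx_def
proof (intro conjI allI impI)
  show "LL (\<lambda>x. c * f x)" using approx_LL[OF assms] by (rule LL_scale)
  fix \<epsilon> :: real assume e: "\<epsilon> > 0"
  have c: "cmod c + 1 > 0" using norm_ge_zero[of c] by linarith
  then have "\<epsilon> / (cmod c + 1) > 0" using e by simp
  then obtain g where g: "step g" "close f g (\<epsilon> / (cmod c + 1))" using assms unfolding approx_def by blast
  from close_scale[OF approx_LL[OF assms] step_LL[OF g(1)] g(2), of c]
  show "\<exists>g. step g \<and> close (\<lambda>x. c * f x) g \<epsilon>"
    using step_scale[OF g(1)] c by auto
qed

lemma approx_add:
  assumes "approx f" "approx g"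
  shows "approx (\<lambda>x. f x + g x)"
  unfolding approx_def
proof (intro conjI allI impI)
  show "LL (\<lambda>x. f x + g x)" using assms by (intro LL_add approx_LL)
  fix \<epsilon> :: real assume e: "\<epsilon> > 0"
  then have e2: "\<epsilon> / 2 > 0" by simp
  obtain f' where f': "step f'" "close f f' (\<epsilon> / 2)" using assms(1) e2 unfolding approx_def by blast
  obtain g' where g': "step g'" "close g g' (\<epsilon> / 2)" using assms(2) e2 unfolding approx_def by blast
  from close_add[OF approx_LL[OF assms(1)] step_LL[OF f'(1)] approx_LL[OF assms(2)] step_LL[OF g'(1)] f'(2) g'(2)]
  show "\<exists>h. step h \<and> close (\<lambda>x. f x + g x) h \<epsilon>" using step_plus[OF f'(1) g'(1)] by auto
qed

lemma approx_sum:
  assumes "finite I" "\<And>i. i \<in> I \<Longrightarrow> approx (f i)"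
  shows "approx (\<lambda>x. \<Sum>i\<in>I. f i x)"
  using assms by (induction I rule: finite_induct) (auto intro: approx_add step_approx step_zero)

lemma approx_incseq:
  assumes C: "incseq C" "\<And>k. C k \<in> sets M" "\<And>k. approx (indicator (C k))"
    and fin: "emeasure M (\<Union>k. C k) < \<infinity>"
  shows "approx (indicator (\<Union>k. C k))"
proof (rule approx_limit)
  have D: "(\<Union>k. C k) \<in> sets M" using C by auto
  show "LL (indicator (\<Union>k. C k))" using LL_indicator[OF D fin] .
  fix \<epsilon> :: real assume e: "\<epsilon> > 0"
  have finC: "emeasure M (C k) < \<infinity>" for k
    using emeasure_mono[OF _ D, of "C k"] fin by (auto intro: order_le_less_trans)
  have lim: "(\<lambda>k. measure M (C k)) \<longlonglongrightarrow> measure M (\<Union>k. C k)"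
    using C fin by (intro Lim_measure_incseq) auto
  \<comment> \<open>The L^2 norm of an indicator is the square root of the measure of the set:
    \<open>\<epsilon>^2\<close> serves this norm, \<epsilon> the L^1 norm.\<close>
  define d where "d = min \<epsilon> (\<epsilon>\<^sup>2)"
  have d: "d > 0" using e by (simp add: d_def)
  obtain k where "\<bar>measure M (C k) - measure M (\<Union>k. C k)\<bar> < d"
    using LIMSEQ_D[OF lim d] by auto
  moreover have "measure M ((\<Union>k. C k) - C k) = measure M (\<Union>k. C k) - measure M (C k)"
    using D C(2) fin by (intro measure_Diff) auto
  ultimately have k: "measure M ((\<Union>k. C k) - C k) < d" by linarith
  have diff: "(indicator (\<Union>k. C k) x - indicator (C k) x :: complex) = indicator ((\<Union>k. C k) - C k) x" for x
    by (auto simp: indicator_def)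
  have "emeasure M ((\<Union>k. C k) - C k) < \<infinity>"
    using emeasure_mono[OF _ D, of "(\<Union>k. C k) - C k"] fin by (auto intro: order_le_less_trans)
  then have int: "(LINT x|M. indicator ((\<Union>k. C k) - C k) x) = measure M ((\<Union>k. C k) - C k)"
    using sets.sets_into_space[OF D] by (subst Bochner_Integration.integral_indicator)
      (auto intro!: arg_cong[where f = "measure M"])
  have abs: "cmod (indicator X x) = indicator X x" "(indicator X x :: real)\<^sup>2 = indicator X x" for X :: "'a set" and x
    by (auto simp: indicator_def)
  have "sqrt (measure M ((\<Union>k. C k) - C k)) < \<epsilon>"
    using k e by (intro real_less_lsqrt) (auto simp: d_def)
  then have "close (indicator (\<Union>k. C k)) (indicator (C k)) \<epsilon>"
    unfolding close_def diff L2_norm_def abs int using k by (simp add: d_def)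
  then show "\<exists>h. approx h \<and> close (indicator (\<Union>k. C k)) h \<epsilon>" using C(3) by blast
qed

lemma B_finite: "X \<in> sets M \<Longrightarrow> emeasure M (X \<inter> B n) < \<infinity>"
  using emeasure_mono[of "X \<inter> B n" "B n" M] emeasure_B[of n] by (auto intro: order_le_less_trans)

lemma approx_ind: "a \<in> carrier R \<Longrightarrow> approx (indicator (coset a n))"
  using step_approx[OF step_ind[of a n]] by (simp add: ind_def)

text \<open>Dynkin's argument for the generator consisting of cosets. Intersecting with
  \<open>B n\<close> keeps all measures finite, so that the complement of \<open>X\<close> can be
  treated as \<open>B n\<close> minus \<open>X\<close>.\<close>

lemma approx_indicator_B:
  assumes "X \<in> sets M"
  shows "approx (indicator (X \<inter> B n))"
proof -
  \<comment> \<open>The empty set is adjoined because disjoint cosets occur.\<close>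
  define G where "G = insert {} cosets"
  have GP: "G \<subseteq> Pow (carrier R)" using coset_subset by (auto simp: G_def cosets_def)
  have stable: "Int_stable G"
  proof (rule Int_stableI)
    fix X Y assume "X \<in> G" "Y \<in> G"
    then consider (empty) "X = {} \<or> Y = {}"
      | (coset) a n b m where "a \<in> carrier R" "b \<in> carrier R" "X = coset a n" "Y = coset b m"
      by (auto simp: G_def cosets_def)
    moreover have "coset a n \<inter> coset b m \<in> G" if a: "a \<in> carrier R" and b: "b \<in> carrier R" for a b n m
    proof (cases "m \<le> n")
      case True
      then show ?thesis unfolding coset_Int[OF a b True] using b by (auto simp: G_def cosets_def)
    next
      case False
      then have nm: "n \<le> m" by simp
      show ?thesis
        unfolding Int_commute[of "coset a n"] coset_Int[OF b a nm] using a by (auto simp: G_def cosets_def)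
    qed
    ultimately show "X \<inter> Y \<in> G" by cases (auto simp: G_def)
  qed
  have setsG: "sets M = sigma_sets (carrier R) G"
  proof
    show "sets M \<subseteq> sigma_sets (carrier R) G"
      unfolding sets_eq_cosets G_def by (intro sigma_sets_subseteq) auto
    have "G \<subseteq> sets M" by (auto simp: G_def cosets_def)
    then show "sigma_sets (carrier R) G \<subseteq> sets M" using sets.sigma_sets_subset[of G M] by simp
  qed
  have "X \<in> sigma_sets (carrier R) G" using assms setsG by simp
  from stable GP this show ?thesis
  proof (induction rule: sigma_sets_induct_disjoint)
    case (basic X)
    then consider "X = {}" | a m where "a \<in> carrier R" "X = coset a m" by (auto simp: G_def cosets_def)
    then show ?case
    proof cases
      case 1
      then show ?thesis using step_approx[OF step_zero] by (simp add: indicator_def[abs_def])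
    next
      case 2
      have "X \<inter> B n = coset a m \<inter> coset \<zero> n" using 2 by (simp add: coset_zero)
      also have "\<dots> \<in> G"
        using stable 2 by (intro Int_stableD[OF stable]) (auto simp: G_def cosets_def)
      finally consider "X \<inter> B n = {}" | b k where "b \<in> carrier R" "X \<inter> B n = coset b k"
        by (auto simp: G_def cosets_def)
      then show ?thesis
        using step_approx[OF step_zero] approx_ind by cases (simp_all add: indicator_def[abs_def])
    qed
  next
    case empty
    then show ?case using step_approx[OF step_zero] by (simp add: indicator_def[abs_def])
  next
    case (compl X)
    have "approx (\<lambda>x. indicator (B n) x + - 1 * indicator (X \<inter> B n) x)"
      using approx_ind[of \<zero> n] compl by (intro approx_add approx_scale) (simp_all add: coset_zero)
    then show ?case
      by (rule approx_cong) (use B_closed in \<open>auto simp: indicator_def\<close>)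
  next
    case (union A)
    define C where "C k = (\<Union>i<k. A i \<inter> B n)" for k :: nat
    have As: "A i \<in> sets M" for i using union setsG by auto
    have UC: "(\<Union>k. C k) = (\<Union>i. A i) \<inter> B n" by (auto simp: C_def)
    have Cs: "C k \<in> sets M" for k unfolding C_def using As by auto
    have "approx (indicator (C k))" for k
    proof -
      have "approx (\<lambda>x. \<Sum>i<k. indicator (A i \<inter> B n) x)" using union by (intro approx_sum) auto
      then show ?thesis
      proof (rule approx_cong)
        fix x
        have "disjoint_family_on (\<lambda>i. A i \<inter> B n) {..<k}"
          using union(1) by (auto simp: disjoint_family_on_def)
        then show "(\<Sum>i<k. indicator (A i \<inter> B n) x) = (indicator (C k) x :: complex)"
          unfolding C_def by (subst indicator_UN_disjoint) auto
      qed
    qed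
    moreover have "incseq C" unfolding C_def incseq_def by (intro allI impI UN_mono) auto
    ultimately have "approx (indicator (\<Union>k. C k))"
      using B_finite[of "\<Union>i. A i" n] As Cs by (intro approx_incseq) (auto simp: UC)
    then show ?case by (simp add: UC)
  qed
qed

lemma approx_indicator:
  assumes X: "X \<in> sets M" and fin: "emeasure M X < \<infinity>"
  shows "approx (indicator X)"
proof -
  have "x \<in> (\<Union>k::nat. X \<inter> B (int k))" if x: "x \<in> X" for x
  proof -
    have "x \<in> carrier R" using x sets.sets_into_space[OF X] by auto
    then obtain n where "x \<in> B n" using B_cover by blast
    then have "x \<in> B (int (nat n))" using B_mono[of n "int (nat n)"] by auto
    then show ?thesis using x by blast
  qed
  then have U: "(\<Union>k::nat. X \<inter> B (int k)) = X" by auto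
  have "approx (indicator (\<Union>k::nat. X \<inter> B (int k)))"
  proof (rule approx_incseq)
    show "incseq (\<lambda>k::nat. X \<inter> B (int k))"
      unfolding incseq_def by (intro allI impI Int_mono order_refl B_mono) simp
    show "emeasure M (\<Union>k::nat. X \<inter> B (int k)) < \<infinity>" unfolding U by (rule fin)
  qed (use X in \<open>auto intro: approx_indicator_B\<close>)
  then show ?thesis unfolding U .
qed

lemma approx_simple:
  assumes s: "simple_function M s" and int: "integrable M s"
  shows "approx s"
proof -
  define Y where "Y = s ` carrier R - {0}"
  define E where "E y = s -` {y} \<inter> carrier R" for y
  have fY: "finite Y" using simple_functionD(1)[OF s] by (simp add: Y_def)
  have Es: "E y \<in> sets M" for y using simple_functionD(2)[OF s, of "{y}"] by (simp add: E_def)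
  have "approx (\<lambda>x. \<Sum>y\<in>Y. y * indicator (E y) x)"
  proof (intro approx_sum fY approx_scale approx_indicator Es)
    fix y assume y: "y \<in> Y"
    then have y0: "cmod y > 0" by (auto simp: Y_def)
    have "integrable M (indicator (E y) :: 'a \<Rightarrow> real)"
    proof (rule Bochner_Integration.integrable_bound)
      \<comment> \<open>On the level set of \<open>y\<close> this quotient equals 1, so it dominates
        the indicator.\<close>
      show "integrable M (\<lambda>x. cmod (s x) / cmod y)" using int by auto
      show "(indicator (E y) :: 'a \<Rightarrow> real) \<in> borel_measurable M" using Es by measurable
      show "AE x in M. norm (indicator (E y) x :: real) \<le> norm (cmod (s x) / cmod y)"
        using y0 by (auto simp: E_def indicator_def)
    qed
    then show "emeasure M (E y) < \<infinity>"
      using sets.sets_into_space[OF Es[of y]] by (simp add: integrable_indicator_iff Int_absorb2)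
  qed
  then show ?thesis
  proof (rule approx_cong)
    fix x assume x: "x \<in> carrier R"
    have "(\<Sum>y\<in>Y. y * indicator (E y) x) = (\<Sum>y\<in>Y. if y = s x then y else 0)"
      using x by (intro sum.cong) (auto simp: E_def indicator_def)
    also have "\<dots> = s x" using fY x by (auto simp: Y_def)
    finally show "(\<Sum>y\<in>Y. y * indicator (E y) x) = s x" .
  qed
qed

text \<open>Simple functions with \<open>|s i| \<le> 2 |f|\<close> converge pointwise to
  \<open>f\<close>, and \<open>3 |f|\<close> dominates the differences in both norms.\<close>

lemma LL_approx:
  assumes f: "LL f"
  shows "approx f"
proof (rule approx_limit[OF f])
  fix \<epsilon> :: real assume e: "\<epsilon> > 0"
  have fm: "f \<in> borel_measurable M" "f \<in> L2 M" "integrable M f" using f by (auto simp: LL_def)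
  from borel_measurable_implies_sequence_metric[OF fm(1), of 0]
  obtain s where s: "\<And>i. simple_function M (s i)" "\<And>x. x \<in> space M \<Longrightarrow> (\<lambda>i. s i x) \<longlonglongrightarrow> f x"
    "\<And>i x. x \<in> space M \<Longrightarrow> dist (s i x) 0 \<le> 2 * dist (f x) 0"
    by blast
  have sm: "s i \<in> borel_measurable M" for i using s(1) by (rule borel_measurable_simple_function)
  have sLL: "LL (s i)" for i
    by (rule LL_bound[OF LL_scale[OF f, of 2] sm]) (use s(3) in \<open>auto simp: norm_mult\<close>)
  have le: "cmod (s i x - f x) \<le> cmod (3 * f x)" if "x \<in> space M" for i x
    using s(3)[OF that, of i] norm_triangle_ineq4[of "s i x" "f x"] by (simp add: norm_mult)
  have l2: "(\<lambda>i. L2_norm M (\<lambda>x. s i x - f x)) \<longlonglongrightarrow> 0"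
  proof (rule L2_dominated_convergence_sequentially[OF L2_scale[OF fm(2), of 3] _ _ le])
    show "(\<lambda>x. s i x - f x) \<in> borel_measurable M" for i using sm fm by auto
    show "(\<lambda>i. s i x - f x) \<longlonglongrightarrow> 0" if "x \<in> space M" for x using s(2)[OF that] by (simp add: LIM_zero_iff)
  qed
  have "(\<lambda>i. LINT x|M. cmod (s i x - f x)) \<longlonglongrightarrow> (LINT x|M. 0)"
  proof (rule integral_dominated_convergence[where w = "\<lambda>x. cmod (3 * f x)"])
    show "AE x in M. (\<lambda>i. cmod (s i x - f x)) \<longlonglongrightarrow> 0"
      using s(2) by (auto intro!: AE_I2 tendsto_norm_zero simp: LIM_zero_iff)
    show "AE x in M. norm (cmod (s i x - f x)) \<le> cmod (3 * f x)" for i using le by (auto intro!: AE_I2)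
    show "integrable M (\<lambda>x. cmod (3 * f x))" using fm by (intro integrable_norm) simp
    show "(\<lambda>x. cmod (s i x - f x)) \<in> borel_measurable M" for i
      using sm[of i] fm(1) by measurable
  qed simp
  then have l1: "(\<lambda>i. LINT x|M. cmod (s i x - f x)) \<longlonglongrightarrow> 0" by simp
  have "\<forall>\<^sub>F i in sequentially. (LINT x|M. cmod (s i x - f x)) < \<epsilon> \<and> L2_norm M (\<lambda>x. s i x - f x) < \<epsilon>"
    using order_tendstoD(2)[OF l1 e] order_tendstoD(2)[OF l2 e] by eventually_elim simp
  then obtain i where i: "(LINT x|M. cmod (s i x - f x)) < \<epsilon>" "L2_norm M (\<lambda>x. s i x - f x) < \<epsilon>"
    by (auto simp: eventually_sequentially)
  have "close f (s i) \<epsilon>"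
    using i L2_norm_commute[of M f "s i"] by (simp add: close_def norm_minus_commute)
  then show "\<exists>h. approx h \<and> close f h \<epsilon>"
    using approx_simple[OF s(1)] sLL[of i] by (auto simp: LL_def)
qed

section \<open>Plancherel's theorem for functions that are integrable and square integrable\<close>

lemma LL_step_sequence:
  assumes "LL f"
  obtains g where "\<And>k::nat. step (g k)" "(\<lambda>k. LINT x|M. cmod (f x - g k x)) \<longlonglongrightarrow> 0"
    "(\<lambda>k. L2_norm M (\<lambda>x. f x - g k x)) \<longlonglongrightarrow> 0"
proof -
  have "\<exists>g. step g \<and> close f g (inverse (real (Suc k)))" for k
    using LL_approx[OF assms] unfolding approx_def by simp
  then obtain g where g: "\<And>k. step (g k)" "\<And>k. close f (g k) (inverse (real (Suc k)))" by metis
  show thesis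
  proof (rule that[OF g(1)])
    show "(\<lambda>k. LINT x|M. cmod (f x - g k x)) \<longlonglongrightarrow> 0"
      by (rule tendsto_sandwich[OF _ _ tendsto_const LIMSEQ_inverse_real_of_nat])
        (use g(2) in \<open>auto simp: close_def less_imp_le simp del: of_nat_Suc\<close>)
    show "(\<lambda>k. L2_norm M (\<lambda>x. f x - g k x)) \<longlonglongrightarrow> 0"
      by (rule tendsto_sandwich[OF _ _ tendsto_const LIMSEQ_inverse_real_of_nat])
        (use g(2) in \<open>auto simp: close_def less_imp_le simp del: of_nat_Suc\<close>)
  qed
qed

text \<open>L^1 convergence makes the transforms of approximating step functions converge pointwise,
  which also provides measurability of \<open>F f\<close>. Their L^2 distances are those of the step
  functions, so Fatou's lemma bounds the distance from \<open>F f\<close> to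
  \<open>F (g k)\<close>.\<close>

lemma Plancherel:
  assumes f: "LL f"
  shows "F f \<in> L2 M" "L2_norm M (F f) = L2_norm M f"
proof -
  obtain g where g: "\<And>k::nat. step (g k)" "(\<lambda>k. LINT x|M. cmod (f x - g k x)) \<longlonglongrightarrow> 0"
    "(\<lambda>k. L2_norm M (\<lambda>x. f x - g k x)) \<longlonglongrightarrow> 0" using LL_step_sequence[OF f] by blast
  have gLL: "LL (g k)" and FgLL: "LL (F (g k))" for k using g step_LL LL_F_step by auto
  have FgL2: "F (g k) \<in> L2 M" for k using FgLL by (simp add: LL_def)
  have pw: "(\<lambda>k. F (g k) y) \<longlonglongrightarrow> F f y" if y: "y \<in> carrier R" for y
  proof (rule Lim_transform2[OF tendsto_const])
    show "(\<lambda>k. F f y - F (g k) y) \<longlonglongrightarrow> 0"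
    proof (rule tendsto_0_le[where K = 1, OF g(2)], intro always_eventually allI)
      fix k
      have "F f y - F (g k) y = F (\<lambda>x. f x - g k x) y"
        using f gLL[of k] y by (intro F_diff[symmetric]) (auto simp: LL_def)
      also have "cmod \<dots> \<le> (LINT x|M. cmod (f x - g k x))"
        using LL_diff[OF f gLL[of k]] y by (intro F_bound) (auto simp: LL_def)
      finally show "norm (F f y - F (g k) y) \<le> norm (LINT x|M. cmod (f x - g k x)) * 1" by simp
    qed
  qed
  have Fm: "F f \<in> borel_measurable M"
    by (rule borel_measurable_LIMSEQ_metric[where f = "\<lambda>k. F (g k)"])
      (use FgL2 pw in \<open>auto dest: L2_measurable\<close>)
  have diffs: "L2_norm M (\<lambda>y. F (g j) y - F (g k) y) = L2_norm M (\<lambda>x. g j x - g k x)" for j k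
  proof -
    have "L2_norm M (\<lambda>y. F (g j) y - F (g k) y) = L2_norm M (F (\<lambda>x. g j x - g k x))"
      using gLL by (intro L2_norm_cong) (auto simp: F_diff LL_def)
    also have "\<dots> = L2_norm M (\<lambda>x. g j x - g k x)" by (intro step_Plancherel step_diff g)
    finally show ?thesis .
  qed
  have key: "(\<lambda>y. F f y - F (g k) y) \<in> L2 M \<and> L2_norm M (\<lambda>y. F f y - F (g k) y) \<le> \<epsilon> + L2_norm M (\<lambda>x. f x - g k x)"
    if e: "\<epsilon> > 0" for k \<epsilon>
  proof -
    obtain N where N: "\<And>j. j \<ge> N \<Longrightarrow> L2_norm M (\<lambda>x. f x - g j x) < \<epsilon>"
      using LIMSEQ_D[OF g(3) e] by auto
    have le: "L2_norm M (\<lambda>y. F (g j) y - F (g k) y) \<le> \<epsilon> + L2_norm M (\<lambda>x. f x - g k x)" if "j \<ge> N" for j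
    proof -
      have "L2_norm M (\<lambda>x. g j x - g k x) \<le> L2_norm M (\<lambda>x. g j x - f x) + L2_norm M (\<lambda>x. f x - g k x)"
        using f gLL by (intro L2_norm_triangle_diff) (auto simp: LL_def)
      then show ?thesis using N[OF that] L2_norm_commute[of M f "g j"] diffs[of j k] by simp
    qed
    have ae: "AE y in M. (\<lambda>j. F (g j) y - F (g k) y) \<longlonglongrightarrow> F f y - F (g k) y"
      by (rule AE_I2) (use pw in \<open>auto intro!: tendsto_diff\<close>)
    show ?thesis
      using L2_Fatou[of "\<lambda>j y. F (g j) y - F (g k) y" M, OF _ _ ae le] FgL2 Fm
      by (auto dest: L2_measurable)
  qed
  show FL2: "F f \<in> L2 M" using L2_add[OF conjunct1[OF key[of 1 0]] FgL2[of 0]] by simp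
  have "(\<lambda>k. L2_norm M (F f) - L2_norm M (F (g k))) \<longlonglongrightarrow> 0"
  proof (rule tendsto_0_le[where K = 1, OF g(3)], intro always_eventually allI)
    fix k
    have "L2_norm M (\<lambda>y. F f y - F (g k) y) \<le> L2_norm M (\<lambda>x. f x - g k x)"
    proof (rule field_le_epsilon)
      fix \<epsilon> :: real assume "0 < \<epsilon>"
      from key[OF this, of k] show "L2_norm M (\<lambda>y. F f y - F (g k) y) \<le> L2_norm M (\<lambda>x. f x - g k x) + \<epsilon>"
        by linarith
    qed
    then show "norm (L2_norm M (F f) - L2_norm M (F (g k))) \<le> norm (L2_norm M (\<lambda>x. f x - g k x)) * 1"
      using L2_norm_diff_abs[OF FL2 FgL2[of k]] by simp
  qed
  moreover have "(\<lambda>k. L2_norm M (F (g k)) - L2_norm M f) \<longlonglongrightarrow> 0"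
  proof (rule tendsto_0_le[where K = 1, OF g(3)], intro always_eventually allI)
    fix k
    show "norm (L2_norm M (F (g k)) - L2_norm M f) \<le> norm (L2_norm M (\<lambda>x. f x - g k x)) * 1"
      using L2_norm_diff_abs[of f M "g k"] f gLL[of k] step_Plancherel[OF g(1)[of k]]
      by (simp add: LL_def abs_minus_commute)
  qed
  ultimately have "(\<lambda>k. (L2_norm M (F f) - L2_norm M (F (g k))) + (L2_norm M (F (g k)) - L2_norm M f)) \<longlonglongrightarrow> 0 + 0"
    by (rule tendsto_add)
  then have "(\<lambda>k::nat. L2_norm M (F f) - L2_norm M f) \<longlonglongrightarrow> 0" by simp
  then show "L2_norm M (F f) = L2_norm M f" by (simp add: LIMSEQ_const_iff)
qed

lemma Plancherel_diff:
  assumes "LL f" "LL g"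
  shows "L2_norm M (\<lambda>y. F f y - F g y) = L2_norm M (\<lambda>x. f x - g x)"
proof -
  have "L2_norm M (\<lambda>y. F f y - F g y) = L2_norm M (F (\<lambda>x. f x - g x))"
    using assms by (intro L2_norm_cong) (auto simp: F_diff LL_def)
  then show ?thesis using Plancherel(2)[OF LL_diff[OF assms]] by simp
qed

section \<open>Extension of the Fourier transform to L^2\<close>

lemma LL_dense:
  assumes f: "f \<in> L2 M"
  obtains \<phi> where "\<And>n::nat. LL (\<phi> n)" "(\<lambda>n. L2_norm M (\<lambda>x. \<phi> n x - f x)) \<longlonglongrightarrow> 0"
proof
  \<comment> \<open>Truncation to a ball: integrable as a product of two square integrable
    functions.\<close>
  let ?\<phi> = "\<lambda>n::nat. \<lambda>x. ind \<zero> (int n) x * f x"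
  have m: "?\<phi> n \<in> borel_measurable M" for n using L2_measurable[OF f] by measurable
  show "LL (?\<phi> n)" for n
  proof -
    have "integrable M (?\<phi> n)" using LL_ind[OF zero_closed] f by (intro L2_mult_integrable) (auto simp: LL_def)
    moreover have "?\<phi> n \<in> L2 M"
      by (rule L2_bound(1)[OF f m]) (auto simp: ind_def indicator_def)
    ultimately show ?thesis by (simp add: LL_def)
  qed
  show "(\<lambda>n. L2_norm M (\<lambda>x. ?\<phi> n x - f x)) \<longlonglongrightarrow> 0"
  proof (rule L2_dominated_convergence_sequentially[OF f])
    show "(\<lambda>x. ?\<phi> n x - f x) \<in> borel_measurable M" for n using L2_measurable[OF f] m by auto
    show "cmod (?\<phi> n x - f x) \<le> cmod (f x)" for n x by (auto simp: ind_def indicator_def)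
    fix x assume "x \<in> space M"
    then obtain N where N: "x \<in> B N" using B_cover[of x] by auto
    have "x \<in> B (int n)" if "n \<ge> nat N" for n
    proof -
      have "N \<le> int n" using that by simp
      then show ?thesis using B_mono N by blast
    qed
    then have "?\<phi> n x - f x = 0" if "n \<ge> nat N" for n using that by (simp add: ind_zero)
    then show "(\<lambda>n. ?\<phi> n x - f x) \<longlonglongrightarrow> 0"
      by (intro tendsto_eventually) (auto simp: eventually_sequentially)
  qed
qed

text \<open>Repeats the condition under the choice operator in \<open>fourier_L2\<close>, with
  \<open>F\<close> in place of \<open>fourier\<close>, so that in the p-adic setting the two chosen
  functions coincide literally.\<close>

definition FL_spec :: "('a \<Rightarrow> complex) \<Rightarrow> ('a \<Rightarrow> complex) \<Rightarrow> bool" where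
  "FL_spec f g \<longleftrightarrow> g \<in> L2 M \<and>
        (\<exists>\<phi>::nat \<Rightarrow> 'a \<Rightarrow> complex.
           (\<forall>n. \<phi> n \<in> L2 M \<and> integrable M (\<phi> n) \<and> F (\<phi> n) \<in> L2 M) \<and>
           (\<lambda>n. L2_norm M (\<lambda>x. \<phi> n x - f x)) \<longlonglongrightarrow> 0 \<and>
           (\<lambda>n. L2_norm M (\<lambda>\<xi>. F (\<phi> n) \<xi> - g \<xi>)) \<longlonglongrightarrow> 0)"

definition FL :: "('a \<Rightarrow> complex) \<Rightarrow> 'a \<Rightarrow> complex" where
  "FL f = (SOME g. FL_spec f g)"

lemma FL_spec_FL:
  assumes f: "f \<in> L2 M"
  shows "FL_spec f (FL f)"
proof -
  obtain \<phi> where \<phi>: "\<And>n::nat. LL (\<phi> n)" "(\<lambda>n. L2_norm M (\<lambda>x. \<phi> n x - f x)) \<longlonglongrightarrow> 0"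
    using LL_dense[OF f] by blast
  have \<phi>': "\<phi> n \<in> L2 M" "integrable M (\<phi> n)" "F (\<phi> n) \<in> L2 M" for n
    using \<phi>(1) Plancherel by (auto simp: LL_def)
  have "\<exists>g\<in>L2 M. (\<lambda>n. L2_norm M (\<lambda>x. F (\<phi> n) x - g x)) \<longlonglongrightarrow> 0"
  proof (rule L2_complete[OF \<phi>'(3)])
    fix e :: real assume "e > 0"
    then have e2: "e / 2 > 0" by simp
    obtain N where N: "\<And>n. n \<ge> N \<Longrightarrow> L2_norm M (\<lambda>x. \<phi> n x - f x) < e / 2"
      using LIMSEQ_D[OF \<phi>(2) e2] by auto
    have "L2_norm M (\<lambda>x. F (\<phi> m) x - F (\<phi> n) x) < e" if "m \<ge> N" "n \<ge> N" for m n
      using Plancherel_diff[OF \<phi>(1)[of m] \<phi>(1)[of n]] L2_norm_triangle_diff[OF \<phi>'(1)[of m] f \<phi>'(1)[of n]]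
        N[OF that(1)] N[OF that(2)] L2_norm_commute[of M f "\<phi> n"] by simp
    then show "\<exists>N. \<forall>m\<ge>N. \<forall>n\<ge>N. L2_norm M (\<lambda>x. F (\<phi> m) x - F (\<phi> n) x) < e" by blast
  qed
  then have "\<exists>g. FL_spec f g" unfolding FL_spec_def using \<phi>' \<phi>(2) by blast
  then show ?thesis unfolding FL_def by (rule someI_ex)
qed

lemma FL_closed: "f \<in> L2 M \<Longrightarrow> FL f \<in> L2 M"
  using FL_spec_FL by (simp add: FL_spec_def)

text \<open>The working property of the extension, from which its norm, linearity and inversion
  follow. Along an admissible sequence \<phi>, both sides are compared with the common value
  \<open>\<parallel>F \<psi> - F (\<phi> n)\<parallel> = \<parallel>\<psi> - \<phi>
  n\<parallel>\<close>.\<close>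

lemma FL_F_diff:
  assumes f: "f \<in> L2 M" and \<psi>: "LL \<psi>"
  shows "L2_norm M (\<lambda>y. F \<psi> y - FL f y) = L2_norm M (\<lambda>x. \<psi> x - f x)"
proof -
  obtain \<phi> where "\<And>n::nat. \<phi> n \<in> L2 M \<and> integrable M (\<phi> n) \<and> F (\<phi> n) \<in> L2 M"
    and lim: "(\<lambda>n. L2_norm M (\<lambda>x. \<phi> n x - f x)) \<longlonglongrightarrow> 0" "(\<lambda>n. L2_norm M (\<lambda>\<xi>. F (\<phi> n) \<xi> - FL f \<xi>)) \<longlonglongrightarrow> 0"
    using FL_spec_FL[OF f] unfolding FL_spec_def by blast
  then have \<phi>: "\<And>n. LL (\<phi> n)" "\<And>n. \<phi> n \<in> L2 M" "\<And>n. F (\<phi> n) \<in> L2 M" by (auto simp: LL_def)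
  have \<psi>L: "\<psi> \<in> L2 M" "F \<psi> \<in> L2 M" using \<psi> Plancherel by (auto simp: LL_def)
  let ?a = "L2_norm M (\<lambda>y. F \<psi> y - FL f y)" and ?b = "L2_norm M (\<lambda>x. \<psi> x - f x)"
  have "\<bar>?a - ?b\<bar> \<le> L2_norm M (\<lambda>x. \<phi> n x - f x) + L2_norm M (\<lambda>\<xi>. F (\<phi> n) \<xi> - FL f \<xi>)" for n
  proof -
    have 1: "\<bar>?a - L2_norm M (\<lambda>y. F \<psi> y - F (\<phi> n) y)\<bar> \<le> L2_norm M (\<lambda>\<xi>. F (\<phi> n) \<xi> - FL f \<xi>)"
      using L2_norm_diff_abs[of "\<lambda>y. F \<psi> y - FL f y" M "\<lambda>y. F \<psi> y - F (\<phi> n) y"] \<psi>L \<phi> FL_closed[OF f]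
      by simp
    have 2: "\<bar>?b - L2_norm M (\<lambda>x. \<psi> x - \<phi> n x)\<bar> \<le> L2_norm M (\<lambda>x. \<phi> n x - f x)"
      using L2_norm_diff_abs[of "\<lambda>y. \<psi> y - f y" M "\<lambda>y. \<psi> y - \<phi> n y"] \<psi>L \<phi> f by simp
    show ?thesis using 1 2 Plancherel_diff[OF \<psi> \<phi>(1)[of n]] by linarith
  qed
  moreover have "(\<lambda>n. L2_norm M (\<lambda>x. \<phi> n x - f x) + L2_norm M (\<lambda>\<xi>. F (\<phi> n) \<xi> - FL f \<xi>)) \<longlonglongrightarrow> 0"
    using tendsto_add[OF lim] by simp
  ultimately have "\<bar>?a - ?b\<bar> \<le> 0" by (intro tendsto_lowerbound[of _ 0 sequentially]) auto
  then show ?thesis by simp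
qed

lemma FL_eq_F: "LL \<psi> \<Longrightarrow> L2_eq M (FL \<psi>) (F \<psi>)"
  using FL_F_diff[of \<psi> \<psi>] Plancherel(1) FL_closed L2_norm_commute[of M "FL \<psi>" "F \<psi>"]
  by (simp add: L2_eq_iff LL_def)

lemma LL_dense_close:
  assumes f: "f \<in> L2 M" and e: "\<epsilon> > 0"
  obtains g where "step g" "L2_norm M (\<lambda>x. g x - f x) < \<epsilon>"
proof -
  obtain \<phi> where \<phi>: "\<And>n::nat. LL (\<phi> n)" "(\<lambda>n. L2_norm M (\<lambda>x. \<phi> n x - f x)) \<longlonglongrightarrow> 0"
    using LL_dense[OF f] by blast
  have e2: "\<epsilon> / 2 > 0" using e by simp
  obtain n where n: "L2_norm M (\<lambda>x. \<phi> n x - f x) < \<epsilon> / 2" using LIMSEQ_D[OF \<phi>(2) e2] by auto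
  obtain g where g: "step g" "close (\<phi> n) g (\<epsilon> / 2)"
    using LL_approx[OF \<phi>(1)[of n]] e2 unfolding approx_def by blast
  have "L2_norm M (\<lambda>x. g x - f x) \<le> L2_norm M (\<lambda>x. g x - \<phi> n x) + L2_norm M (\<lambda>x. \<phi> n x - f x)"
    using step_LL[OF g(1)] \<phi>(1)[of n] f by (intro L2_norm_triangle_diff) (auto simp: LL_def)
  also have "\<dots> < \<epsilon>" using n g(2) L2_norm_commute[of M g "\<phi> n"] by (simp add: close_def)
  finally show thesis using that g(1) by blast
qed

lemma FL_norm:
  assumes f: "f \<in> L2 M"
  shows "L2_norm M (FL f) = L2_norm M f"
proof -
  have "L2_norm M (\<lambda>y. F (\<lambda>x. 0) y - FL f y) = L2_norm M (\<lambda>x. 0 - f x)" by (rule FL_F_diff[OF f LL_zero])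
  moreover have "L2_norm M (\<lambda>x. - f x) = L2_norm M f" "L2_norm M (\<lambda>x. - FL f x) = L2_norm M (FL f)"
    using L2_norm_scale[of M "-1"] by simp_all
  ultimately show ?thesis by (simp add: F_def)
qed

lemma L2_norm_lin_le:
  assumes "f \<in> L2 M" "g \<in> L2 M"
  shows "L2_norm M (\<lambda>x. a * f x + b * g x) \<le> cmod a * L2_norm M f + cmod b * L2_norm M g"
  using L2_norm_triangle[of "\<lambda>x. a * f x" M "\<lambda>x. b * g x"] assms by (simp add: L2_norm_scale)

lemma FL_lin:
  assumes f: "f \<in> L2 M" and g: "g \<in> L2 M"
  shows "L2_eq M (FL (\<lambda>x. a * f x + b * g x)) (\<lambda>x. a * FL f x + b * FL g x)"
proof -
  let ?h = "\<lambda>x. a * f x + b * g x"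
  have h: "?h \<in> L2 M" using f g by simp
  \<comment> \<open>Two errors of at most \<open>(|a| + |b|) \<epsilon> / C\<close> are added; the
    summand 1 keeps \<open>C\<close> positive.\<close>
  define C where "C = 2 * (cmod a + cmod b) + 1"
  have C: "C > 0" by (simp add: C_def add_nonneg_pos)
  have "L2_norm M (\<lambda>y. FL ?h y - (a * FL f y + b * FL g y)) \<le> \<epsilon>" if e: "\<epsilon> > 0" for \<epsilon>
  proof -
    have eC: "\<epsilon> / C > 0" using e C by simp
    obtain \<phi> where \<phi>: "step \<phi>" "L2_norm M (\<lambda>x. \<phi> x - f x) < \<epsilon> / C" using LL_dense_close[OF f eC] by blast
    obtain \<psi> where \<psi>: "step \<psi>" "L2_norm M (\<lambda>x. \<psi> x - g x) < \<epsilon> / C" using LL_dense_close[OF g eC] by blast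
    let ?k = "\<lambda>x. a * \<phi> x + b * \<psi> x"
    have kLL: "LL ?k" "LL \<phi>" "LL \<psi>" using step_LL \<phi> \<psi> by (auto intro: LL_lin)
    have FkL: "F ?k \<in> L2 M" "F \<phi> \<in> L2 M" "F \<psi> \<in> L2 M" using kLL by (auto intro: Plancherel)
    note FLs = FL_closed[OF h] FL_closed[OF f] FL_closed[OF g]
    have mono: "cmod a * L2_norm M (\<lambda>x. \<phi> x - f x) + cmod b * L2_norm M (\<lambda>x. \<psi> x - g x) \<le> (cmod a + cmod b) * (\<epsilon> / C)"
      using \<phi>(2) \<psi>(2) unfolding distrib_right by (intro add_mono mult_left_mono) auto
    have "L2_norm M (\<lambda>y. F ?k y - FL ?h y) = L2_norm M (\<lambda>x. ?k x - ?h x)" by (rule FL_F_diff[OF h kLL(1)])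
    also have "\<dots> = L2_norm M (\<lambda>x. a * (\<phi> x - f x) + b * (\<psi> x - g x))" by (simp add: algebra_simps)
    also have "\<dots> \<le> (cmod a + cmod b) * (\<epsilon> / C)"
      using kLL f g by (intro order_trans[OF L2_norm_lin_le mono]) (auto simp: LL_def)
    finally have 1: "L2_norm M (\<lambda>y. FL ?h y - F ?k y) \<le> (cmod a + cmod b) * (\<epsilon> / C)"
      using L2_norm_commute[of M "FL ?h" "F ?k"] by simp
    have "L2_norm M (\<lambda>y. F ?k y - (a * FL f y + b * FL g y))
        = L2_norm M (\<lambda>y. a * (F \<phi> y - FL f y) + b * (F \<psi> y - FL g y))"
      using kLL by (intro L2_norm_cong arg_cong[where f = cmod]) (simp add: F_lin LL_def algebra_simps)
    also have "\<dots> \<le> cmod a * L2_norm M (\<lambda>y. F \<phi> y - FL f y) + cmod b * L2_norm M (\<lambda>y. F \<psi> y - FL g y)"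
      using FkL FLs by (intro L2_norm_lin_le) auto
    also have "\<dots> \<le> (cmod a + cmod b) * (\<epsilon> / C)"
      unfolding FL_F_diff[OF f kLL(2)] FL_F_diff[OF g kLL(3)] by (rule mono)
    finally have 2: "L2_norm M (\<lambda>y. F ?k y - (a * FL f y + b * FL g y)) \<le> (cmod a + cmod b) * (\<epsilon> / C)" .
    have "L2_norm M (\<lambda>y. FL ?h y - (a * FL f y + b * FL g y)) \<le> 2 * ((cmod a + cmod b) * (\<epsilon> / C))"
    proof -
      have "(\<lambda>y. a * FL f y + b * FL g y) \<in> L2 M" using FLs by simp
      from order_trans[OF L2_norm_triangle_diff[OF FLs(1) FkL(1) this] add_mono[OF 1 2]]
      show ?thesis unfolding mult_2 .
    qed
    also have "\<dots> \<le> C * (\<epsilon> / C)"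
      using eC unfolding mult.assoc[symmetric] by (intro mult_right_mono) (auto simp: C_def)
    finally show ?thesis using C by simp
  qed
  then have "L2_norm M (\<lambda>y. FL ?h y - (a * FL f y + b * FL g y)) \<le> 0" by (rule field_le_epsilon) simp
  then show ?thesis using FL_closed h f g by (simp add: L2_eq_iff order_antisym)
qed

text \<open>Exact for step functions. Conjugation and both transforms preserve distances, so
  replacing \<open>f\<close> by a step function within \<epsilon>/2 costs at most \<epsilon>/2 on
  either side of the identity.\<close>

lemma FL_inversion:
  assumes f: "f \<in> L2 M"
  shows "L2_eq M (FL (\<lambda>y. cnj (FL f y))) (\<lambda>x. cnj (f x))"
proof -
  let ?h = "\<lambda>y. cnj (FL f y)"
  have h: "?h \<in> L2 M" using FL_closed[OF f] by simp
  have "L2_norm M (\<lambda>x. FL ?h x - cnj (f x)) \<le> \<epsilon>" if e: "\<epsilon> > 0" for \<epsilon>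
  proof -
    have e2: "\<epsilon> / 2 > 0" using e by simp
    obtain g where g: "step g" "L2_norm M (\<lambda>x. g x - f x) < \<epsilon> / 2" using LL_dense_close[OF f e2] by blast
    let ?k = "\<lambda>y. cnj (F g y)"
    have k: "LL ?k" by (intro LL_cnj LL_F_step g)
    have Fk: "F ?k \<in> L2 M" using Plancherel(1)[OF k] .
    have gL: "g \<in> L2 M" using step_LL[OF g(1)] by (simp add: LL_def)
    have cd: "L2_norm M (\<lambda>x. cnj (u x) - cnj (v x)) = L2_norm M (\<lambda>x. u x - v x)" for u v
      using L2_norm_cnj[of M "\<lambda>x. u x - v x"] by simp
    have "L2_norm M (\<lambda>x. F ?k x - FL ?h x) = L2_norm M (\<lambda>x. g x - f x)"
      unfolding FL_F_diff[OF h k] cd by (rule FL_F_diff[OF f step_LL[OF g(1)]])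
    moreover have "L2_norm M (\<lambda>x. F ?k x - cnj (f x)) = L2_norm M (\<lambda>x. g x - f x)"
      unfolding cd[of g f, symmetric] using step_inversion[OF g(1)] by (intro L2_norm_cong) simp
    moreover have "L2_norm M (\<lambda>x. FL ?h x - cnj (f x))
        \<le> L2_norm M (\<lambda>x. FL ?h x - F ?k x) + L2_norm M (\<lambda>x. F ?k x - cnj (f x))"
      using FL_closed[OF h] Fk f by (intro L2_norm_triangle_diff) auto
    ultimately show ?thesis using g(2) L2_norm_commute[of M "FL ?h" "F ?k"] by simp
  qed
  then have "L2_norm M (\<lambda>x. FL ?h x - cnj (f x)) \<le> 0" by (rule field_le_epsilon) simp
  then show ?thesis using FL_closed[OF h] f by (simp add: L2_eq_iff order_antisym)
qed

text \<open>The preimage is read off from inversion applied to the conjugate of \<open>g\<close>: it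
  is the conjugate of \<open>FL\<close> of that conjugate.\<close>

lemma FL_surj:
  assumes g: "g \<in> L2 M"
  shows "\<exists>f\<in>L2 M. L2_eq M (FL f) g"
  using FL_inversion[of "\<lambda>x. cnj (g x)"] g FL_closed[of "\<lambda>x. cnj (g x)"]
  by (intro bexI[of _ "\<lambda>y. cnj (FL (\<lambda>x. cnj (g x)) y)"]) auto

lemma FL_cong: 
  assumes "L2_eq M f g"
  shows "L2_eq M (FL f) (FL g)"
proof -
  have fg: "f \<in> L2 M" "g \<in> L2 M" using assms by (auto simp: L2_eq_def)
  have "L2_eq M (FL (\<lambda>x. f x - g x)) (\<lambda>x. FL f x - FL g x)" using FL_lin[OF fg, of 1 "-1"] by simp
  then have "L2_norm M (\<lambda>x. FL f x - FL g x) = L2_norm M (\<lambda>x. f x - g x)"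
    using L2_eq_norm FL_norm[OF L2_diff[OF fg]] by metis
  then show ?thesis using assms fg by (simp add: L2_eq_iff FL_closed)
qed

text \<open>Polarization: preservation of norms gives the real part, and the imaginary part of
  \<open>ip f g\<close> is the real part of \<open>ip (- \<i> f) g\<close>.\<close>

lemma Parseval:
  assumes f: "LL f" and g: "LL g"
  shows "ip (F f) (F g) = ip f g"
proof -
  have re: "Re (ip (F u) (F v)) = Re (ip u v)" if u: "LL u" and v: "LL v" for u v
  proof -
    have "L2_norm M (\<lambda>x. F u x + F v x) = L2_norm M (F (\<lambda>x. u x + v x))"
      using F_lin[of u v _ 1 1] u v by (intro L2_norm_cong) (simp add: LL_def)
    then have "L2_norm M (\<lambda>x. F u x + F v x) = L2_norm M (\<lambda>x. u x + v x)"
      using Plancherel(2)[OF LL_add[OF u v]] by simp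
    then show ?thesis
      using L2_norm_add_power2[of u M v] L2_norm_add_power2[of "F u" M "F v"] Plancherel[OF u] Plancherel[OF v] u v
      by (simp add: LL_def ip_def)
  qed
  have scale: "ip (\<lambda>x. c * u x) v = c * ip u v" for c u v
    unfolding ip_def by (simp add: mult.assoc)
  have "Re (ip (F (\<lambda>x. - \<i> * f x)) (F g)) = Re (ip (\<lambda>x. - \<i> * f x) g)"
    by (intro re LL_scale f g)
  moreover have "ip (F (\<lambda>x. - \<i> * f x)) (F g) = ip (\<lambda>y. - \<i> * F f y) (F g)"
    using F_lin[of f f _ "-\<i>" 0] f by (intro ip_cong) (simp_all add: LL_def)
  ultimately have "Im (ip (F f) (F g)) = Im (ip f g)" unfolding scale by simp
  then show ?thesis using re[OF f g] by (simp add: complex_eq_iff)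
qed

section \<open>The multiplication formula and convolution\<close>

lemma F_cnj_F_step: "step f \<Longrightarrow> LL (\<lambda>y. cnj (F f y))"
  by (intro LL_cnj LL_F_step)

text \<open>A step function \<open>g\<close> is, by inversion, the conjugate of the transform of
  \<open>v = cnj (F g)\<close>; so the left side becomes \<open>ip (F h) (F v)\<close>, and
  Parseval's identity yields the right side. Density extends this to \<open>f\<close> in L^2, as
  both sides are continuous in \<open>f\<close>.\<close>

lemma multiplication_formula:
  assumes h: "LL h" and f: "f \<in> L2 M"
  shows "(LINT x|M. F h x * f x) = (LINT x|M. h x * FL f x)"
proof -
  have FhL: "F h \<in> L2 M" and hL: "h \<in> L2 M" using Plancherel(1)[OF h] h by (auto simp: LL_def)
  have stp: "(LINT x|M. F h x * g x) = (LINT x|M. h x * F g x)" if g: "step g" for g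
  proof -
    let ?v = "\<lambda>y. cnj (F g y)"
    have "(LINT x|M. F h x * g x) = ip (F h) (F ?v)"
      unfolding ip_def using step_inversion[OF g] by (intro Bochner_Integration.integral_cong) auto
    also have "\<dots> = ip h ?v" by (intro Parseval h F_cnj_F_step g)
    finally show ?thesis by (simp add: ip_def)
  qed
  have "cmod ((LINT x|M. F h x * f x) - (LINT x|M. h x * FL f x)) \<le> \<epsilon>" if e: "\<epsilon> > 0" for \<epsilon>
  proof -
    define N where "N = L2_norm M h"
    have N: "2 * N + 1 > 0" unfolding N_def using L2_norm_nonneg[of M h] by linarith
    have eN: "\<epsilon> / (2 * N + 1) > 0" using e N by simp
    obtain g where g: "step g" "L2_norm M (\<lambda>x. g x - f x) < \<epsilon> / (2 * N + 1)" using LL_dense_close[OF f eN] by blast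
    have gL: "g \<in> L2 M" "F g \<in> L2 M" "LL g" using step_LL[OF g(1)] Plancherel(1) by (auto simp: LL_def)
    have d1: "(LINT x|M. F h x * g x) - (LINT x|M. F h x * f x) = (LINT x|M. F h x * (g x - f x))"
      using L2_mult_integrable[OF FhL gL(1)] L2_mult_integrable[OF FhL f] by (simp add: right_diff_distrib)
    have d2: "(LINT x|M. h x * F g x) - (LINT x|M. h x * FL f x) = (LINT x|M. h x * (F g x - FL f x))"
      using L2_mult_integrable[OF hL gL(2)] L2_mult_integrable[OF hL FL_closed[OF f]] by (simp add: right_diff_distrib)
    have b1: "cmod (LINT x|M. F h x * (g x - f x)) \<le> N * L2_norm M (\<lambda>x. g x - f x)"
      using L2_Cauchy_Schwarz[OF FhL L2_diff[OF gL(1) f]] Plancherel(2)[OF h] by (simp add: N_def)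
    have b2: "cmod (LINT x|M. h x * (F g x - FL f x)) \<le> N * L2_norm M (\<lambda>x. g x - f x)"
      using L2_Cauchy_Schwarz[OF hL L2_diff[OF gL(2) FL_closed[OF f]]] FL_F_diff[OF f gL(3)] by (simp add: N_def)
    have "(LINT x|M. F h x * f x) - (LINT x|M. h x * FL f x)
        = (LINT x|M. h x * (F g x - FL f x)) - (LINT x|M. F h x * (g x - f x))"
      using stp[OF g(1)] d1 d2 by (simp add: algebra_simps)
    also have "cmod \<dots> \<le> N * L2_norm M (\<lambda>x. g x - f x) + N * L2_norm M (\<lambda>x. g x - f x)"
      using norm_triangle_ineq4[of "LINT x|M. h x * (F g x - FL f x)" "LINT x|M. F h x * (g x - f x)"] b1 b2
      by linarith
    also have "\<dots> = 2 * N * L2_norm M (\<lambda>x. g x - f x)" by simp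
    also have "\<dots> \<le> (2 * N + 1) * (\<epsilon> / (2 * N + 1))"
      using g(2) N L2_norm_nonneg[of M h] by (intro mult_mono) (auto simp: N_def)
    also have "\<dots> = \<epsilon>" using N by simp
    finally show ?thesis .
  qed
  then have "cmod ((LINT x|M. F h x * f x) - (LINT x|M. h x * FL f x)) \<le> 0" by (rule field_le_epsilon) simp
  then show ?thesis by simp
qed

text \<open>For \<open>x\<close> fixed, \<open>y \<mapsto> K (x - y)\<close> is the Fourier transform of \<open>\<xi> \<mapsto> m \<xi> * e (- x) \<xi>\<close>, so
  the multiplication formula evaluates the convolution with \<open>K\<close> pointwise.\<close>

lemma convolution_multiplier:
  fixes m :: "'a \<Rightarrow> complex"
  defines "K \<equiv> \<lambda>x. LINT \<xi>|M. e (\<ominus> x) \<xi> * m \<xi>"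
  defines "conv \<equiv> \<lambda>f x. LINT y|M. K (x \<ominus> y) * f y"
  assumes m: "LL m" and m1: "\<And>\<xi>. \<xi> \<in> carrier R \<Longrightarrow> cmod (m \<xi>) \<le> 1" and f: "f \<in> L2 M"
  shows "conv f \<in> L2 M" "L2_eq M (FL (conv f)) (\<lambda>\<xi>. m \<xi> * FL f \<xi>)"
proof -
  have mm [measurable]: "m \<in> borel_measurable M" and mL: "m \<in> L2 M" using m by (auto simp: LL_def dest: L2_measurable)
  have GL: "(\<lambda>\<xi>. m \<xi> * FL f \<xi>) \<in> L2 M"
  proof (rule L2_bound(1)[OF FL_closed[OF f]])
    show "(\<lambda>\<xi>. m \<xi> * FL f \<xi>) \<in> borel_measurable M" using L2_measurable[OF FL_closed[OF f]] by measurable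
    show "AE x in M. cmod (m x * FL f x) \<le> cmod (FL f x)"
      using m1 by (auto simp: norm_mult intro!: AE_I2 mult_left_le_one_le)
  qed
  \<comment> \<open>\<open>m\<close> and \<open>FL f\<close> are both square integrable, so their
    product is integrable and its transform is an honest integral, defined at every point.\<close>
  have G: "LL (\<lambda>\<xi>. cnj (m \<xi> * FL f \<xi>))"
    using GL L2_mult_integrable[OF mL FL_closed[OF f]] by (intro LL_cnj) (auto simp: LL_def)
  have conv: "conv f x = cnj (F (\<lambda>\<xi>. cnj (m \<xi> * FL f \<xi>)) x)" if x: "x \<in> carrier R" for x
  proof -
    let ?h = "\<lambda>\<xi>. m \<xi> * e (\<ominus> x) \<xi>"
    have h: "LL ?h"
      by (rule LL_bound[OF m]) (use x in \<open>auto simp: norm_mult e_norm\<close>)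
    have "K (x \<ominus> y) = F ?h y" if y: "y \<in> carrier R" for y
      unfolding K_def F_def using x y
      by (intro Bochner_Integration.integral_cong) (auto simp: minus_swap e_minus e_neg)
    then have "conv f x = (LINT y|M. F ?h y * f y)"
      unfolding conv_def by (intro Bochner_Integration.integral_cong) auto
    also have "\<dots> = (LINT \<xi>|M. ?h \<xi> * FL f \<xi>)" by (rule multiplication_formula[OF h f])
    also have "\<dots> = (LINT \<xi>|M. cnj (cnj (m \<xi> * FL f \<xi>) * e x \<xi>))"
      using x by (intro Bochner_Integration.integral_cong) (auto simp: e_neg)
    also have "\<dots> = cnj (F (\<lambda>\<xi>. cnj (m \<xi> * FL f \<xi>)) x)" unfolding F_def by (rule Bochner_Integration.integral_cnj)
    finally show ?thesis .
  qed
  let ?c = "\<lambda>x. cnj (F (\<lambda>\<xi>. cnj (m \<xi> * FL f \<xi>)) x)"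
  have cL: "?c \<in> L2 M" using Plancherel(1)[OF G] by (rule L2_cnj)
  have "conv f \<in> borel_measurable M \<longleftrightarrow> ?c \<in> borel_measurable M"
    by (rule measurable_cong) (simp add: conv)
  then show convL: "conv f \<in> L2 M"
    using L2_measurable[OF cL] conv by (intro L2_bound(1)[OF cL]) auto
  have "L2_eq M (FL (conv f)) (FL (\<lambda>y. cnj (FL (\<lambda>\<xi>. cnj (m \<xi> * FL f \<xi>)) y)))"
  proof (rule FL_cong, rule L2_eq_trans)
    show "L2_eq M (conv f) ?c" using convL cL conv by (intro L2_eqI_space) auto
    have "AE y in M. FL (\<lambda>\<xi>. cnj (m \<xi> * FL f \<xi>)) y = F (\<lambda>\<xi>. cnj (m \<xi> * FL f \<xi>)) y"
      using FL_eq_F[OF G] by (simp add: L2_eq_def)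
    then have "AE y in M. ?c y = cnj (FL (\<lambda>\<xi>. cnj (m \<xi> * FL f \<xi>)) y)" by eventually_elim simp
    then show "L2_eq M ?c (\<lambda>y. cnj (FL (\<lambda>\<xi>. cnj (m \<xi> * FL f \<xi>)) y))"
      using cL G FL_closed by (intro L2_eqI) (auto simp: LL_def)
  qed
  moreover have "L2_eq M (FL (\<lambda>y. cnj (FL (\<lambda>\<xi>. cnj (m \<xi> * FL f \<xi>)) y))) (\<lambda>x. cnj (cnj (m x * FL f x)))"
    using G by (intro FL_inversion) (simp add: LL_def)
  ultimately show "L2_eq M (FL (conv f)) (\<lambda>\<xi>. m \<xi> * FL f \<xi>)" using L2_eq_trans by fastforce
qed

end

section \<open>The p-adic numbers\<close>

lemma LIMSEQ_0_le:
  fixes f g :: "nat \<Rightarrow> real"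
  assumes "g \<longlonglongrightarrow> 0" "\<And>n. 0 \<le> f n" "\<And>n. f n \<le> g n"
  shows "f \<longlonglongrightarrow> 0"
proof (rule tendsto_0_le[where K = 1, OF assms(1)], intro always_eventually allI)
  show "norm (f n) \<le> norm (g n) * 1" for n using assms(2)[of n] assms(3)[of n] by simp
qed

lemma complex_of_rat: "complex_of_rat r = complex_of_real (real_of_rat r)"
  by (cases r) (simp add: of_rat_rat)

locale padic =
  fixes p :: nat
  assumes prime_p: "prime p"
begin

lemma p_gt_1: "real p > 1"
  using prime_gt_1_nat[OF prime_p] by simp

lemma prime_int_p: "prime (int p)"
  using prime_p by simp

lemma prime_elem_int_p: "prime_elem (int p)"
  using prime_int_p by blast

lemma multiplicity_mult:
  "a \<noteq> 0 \<Longrightarrow> b \<noteq> 0 \<Longrightarrow>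
    multiplicity (int p) (a * b) = multiplicity (int p) a + multiplicity (int p) b"
  by (rule prime_elem_multiplicity_mult_distrib[OF prime_elem_int_p])

section \<open>The p-adic absolute value on the rationals\<close>

abbreviation (input) A :: "rat \<Rightarrow> real" where "A \<equiv> padic_abs_rat p"

lemma A_zero [simp]: "A 0 = 0"
  by (simp add: padic_abs_rat_def)

text \<open>The definition reads off the reduced fraction; cross multiplication
  \<open>a d = c b\<close> shows that the multiplicities in any other fraction have the same
  difference.\<close>

lemma A_Fract:
  assumes "a \<noteq> 0" "b \<noteq> 0"
  shows "A (Fract a b) = real p powi (int (multiplicity (int p) b) - int (multiplicity (int p) a))"
proof -
  obtain c d where q: "quotient_of (Fract a b) = (c, d)" by fastforce
  have d: "d \<noteq> 0" and r: "Fract a b = Fract c d" using quotient_of_denom_pos[OF q] quotient_of_div[OF q]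
    by (auto simp: Fract_of_int_quotient)
  have eq: "a * d = c * b" using r assms(2) d by (simp add: eq_rat)
  then have c: "c \<noteq> 0" using assms d by auto
  have "multiplicity (int p) (a * d) = multiplicity (int p) (c * b)" using eq by simp
  then have "multiplicity (int p) a + multiplicity (int p) d = multiplicity (int p) c + multiplicity (int p) b"
    using assms c d by (simp add: multiplicity_mult)
  then have "int (multiplicity (int p) d) - int (multiplicity (int p) c)
      = int (multiplicity (int p) b) - int (multiplicity (int p) a)" by linarith
  then show ?thesis using assms by (simp add: padic_abs_rat_def q Zero_rat_def eq_rat)
qed

lemma A_pos: "r \<noteq> 0 \<Longrightarrow> A r > 0"
  using p_gt_1 by (simp add: padic_abs_rat_def)

lemma A_nonneg [simp]: "A r \<ge> 0"
  using A_pos[of r] by (cases "r = 0") (auto simp: less_imp_le)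

lemma Fract_nonzero:
  assumes "r \<noteq> 0"
  obtains a b where "r = Fract a b" "a \<noteq> 0" "b \<noteq> 0"
  using assms by (cases r rule: Rat_cases_nonzero) auto

lemma A_mult: "A (r * s) = A r * A s"
proof (cases "r = 0 \<or> s = 0")
  case False
  then obtain a b c d where r: "r = Fract a b" "a \<noteq> 0" "b \<noteq> 0" and s: "s = Fract c d" "c \<noteq> 0" "d \<noteq> 0"
    using Fract_nonzero by metis
  show ?thesis using r s p_gt_1
    by (simp add: A_Fract multiplicity_mult power_int_add[symmetric] algebra_simps)
qed auto

lemma A_of_int: "n \<noteq> 0 \<Longrightarrow> A (of_int n) = real p powi (- int (multiplicity (int p) n))"
  using A_Fract[of n 1] by (simp add: Fract_of_int_eq)

lemma A_one [simp]: "A 1 = 1"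
  using A_of_int[of 1] by simp

lemma A_neg [simp]: "A (- r) = A r"
proof -
  have "A (- 1) = 1" using A_of_int[of "-1"] by (simp add: multiplicity_unit_right)
  then show ?thesis using A_mult[of "-1" r] by simp
qed

lemma A_minus_commute: "A (r - s) = A (s - r)"
  using A_neg[of "r - s"] by simp

lemma A_inverse: "A (inverse r) = inverse (A r)"
proof (cases "r = 0")
  case False
  then have "A r * A (inverse r) = 1" by (simp add: A_mult[symmetric])
  then show ?thesis by (simp add: inverse_unique)
qed simp

lemma A_power: "A (r ^ n) = A r ^ n"
  by (induction n) (auto simp: A_mult)

lemma A_of_int_le_1: "A (of_int n) \<le> 1"
  using p_gt_1 by (cases "n = 0") (auto simp: A_of_int power_int_minus intro!: inverse_le_1_iff[THEN iffD2])

lemma A_of_nat_le_1: "A (of_nat n) \<le> 1"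
  using A_of_int_le_1[of "int n"] by simp

lemma A_p: "A (of_nat p) = inverse (real p)"
  using A_of_int[of "int p"] prime_p by (simp add: power_int_minus)

text \<open>Bridge between estimates and congruences modulo powers of p; the number 0 satisfies both
  sides.\<close>

lemma A_of_int_le_iff: "A (of_int n) \<le> inverse (real p) ^ k \<longleftrightarrow> int p ^ k dvd n"
proof (cases "n = 0")
  case False
  have "A (of_int n) = inverse (real p) ^ multiplicity (int p) n"
    using False by (simp add: A_of_int power_int_minus power_inverse)
  then have "A (of_int n) \<le> inverse (real p) ^ k \<longleftrightarrow> k \<le> multiplicity (int p) n"
    using p_gt_1 by (simp only:) (rule power_decreasing_iff, auto simp: inverse_less_1_iff)
  also have "\<dots> \<longleftrightarrow> int p ^ k dvd n"
    using False prime_int_p by (intro power_dvd_iff_le_multiplicity[symmetric]) (auto dest: not_prime_unit)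
  finally show ?thesis .
qed (use p_gt_1 in auto)

lemma A_of_int_eq_1: "\<not> int p dvd n \<Longrightarrow> A (of_int n) = 1"
  using A_of_int[of n] by (cases "n = 0") (auto simp: not_dvd_imp_multiplicity_0)

text \<open>Over the common denominator \<open>b d\<close> the claim concerns integers, where the
  smaller of the powers of p dividing the summands divides the sum.\<close>

lemma A_ultrametric: "A (r + s) \<le> max (A r) (A s)"
proof (cases "r = 0 \<or> s = 0 \<or> r + s = 0")
  case False
  then obtain a b c d where r: "r = Fract a b" "a \<noteq> 0" "b \<noteq> 0" and s: "s = Fract c d" "c \<noteq> 0" "d \<noteq> 0"
    using Fract_nonzero by metis
  define u where "u = inverse (of_int (b * d) :: rat)"
  have ru: "r = of_int (a * d) * u" "s = of_int (c * b) * u"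
    using r s by (simp_all add: u_def Fract_of_int_quotient field_simps)
  have rs: "r + s = of_int (a * d + c * b) * u" unfolding ru by (simp add: algebra_simps)
  have n0: "a * d + c * b \<noteq> 0"
  proof
    assume "a * d + c * b = 0"
    then have "r + s = 0" unfolding rs by (simp only: of_int_0 mult_zero_left)
    then show False using False by simp
  qed
  let ?v = "\<lambda>n. multiplicity (int p) n"
  have "int p ^ min (?v (a*d)) (?v (c*b)) dvd a * d + c * b"
    by (intro dvd_add) (auto intro: multiplicity_dvd')
  then have A: "A (of_int (a * d + c * b)) \<le> inverse (real p) ^ min (?v (a*d)) (?v (c*b))"
    using A_of_int_le_iff by blast
  have Av: "A (of_int n) = inverse (real p) ^ ?v n" if "n \<noteq> 0" for n
    using that by (simp add: A_of_int power_int_minus power_inverse)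
  have "A (of_int (a * d + c * b)) \<le> max (A (of_int (a * d))) (A (of_int (c * b)))"
    using A r s Av[of "a*d"] Av[of "c*b"] by (auto simp: min_def max_def split: if_splits)
  then have "A (of_int (a * d + c * b)) * A u \<le> max (A (of_int (a * d))) (A (of_int (c * b))) * A u"
    by (intro mult_right_mono) auto
  also have "\<dots> = max (A (of_int (a * d)) * A u) (A (of_int (c * b)) * A u)"
    by (simp add: max_mult_distrib_right)
  finally show ?thesis unfolding rs unfolding ru A_mult .
qed (auto simp: max_def)

lemma A_ultrametric_diff: "A (r - s) \<le> max (A r) (A s)"
  using A_ultrametric[of r "- s"] by simp

lemma A_triangle: "A (r + s) \<le> A r + A s"
  using A_ultrametric[of r s] A_nonneg[of r] A_nonneg[of s] by linarith

lemma A_diff_abs: "\<bar>A r - A s\<bar> \<le> A (r - s)"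
  using A_triangle[of "r - s" s] A_triangle[of "s - r" r] A_minus_commute[of r s] by simp

text \<open>The reduced denominator is prime to p, hence invertible modulo \<open>p^k\<close>;
  \<open>j\<close> is the residue of the numerator times that inverse. It supplies the numerators of
  fractional parts and the representatives of cosets of the balls.\<close>

lemma A_residue:
  assumes "A r \<le> 1"
  obtains j where "j < p ^ k" "A (r - of_nat j) \<le> inverse (real p) ^ k"
proof -
  obtain a b where q: "quotient_of r = (a, b)" by fastforce
  have b: "b > 0" "coprime a b" "r = of_int a / of_int b"
    using quotient_of_denom_pos[OF q] quotient_of_coprime[OF q] quotient_of_div[OF q] by auto
  \<comment> \<open>A denominator divisible by p comes with a numerator of absolute value 1, and
    then \<open>1 = A r * A (of_int b) \<le> 1/p\<close>.\<close>
  have ndvd: "\<not> int p dvd b"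
  proof
    assume dvd: "int p dvd b"
    then have "\<not> int p dvd a" using b(2) prime_int_p by (meson coprime_common_divisor not_prime_unit)
    then have "A (of_int a) = 1" by (rule A_of_int_eq_1)
    moreover have "A (of_int b) \<le> inverse (real p)" using A_of_int_le_iff[of b 1] dvd by simp
    moreover have "A (of_int a) = A r * A (of_int b)" using b by (simp add: A_mult[symmetric])
    ultimately have "1 \<le> 1 * inverse (real p)"
      using assms mult_mono[of "A r" 1 "A (of_int b)" "inverse (real p)"] by simp
    then show False using p_gt_1 by (simp add: field_simps)
  qed
  have cop: "coprime b (int p ^ k)"
    using prime_imp_coprime[OF prime_int_p ndvd] by (simp add: coprime_commute)
  obtain x where x: "[b * x = 1] (mod int p ^ k)" using cong_solve_coprime_int[OF cop] by blast
  define j where "j = nat ((a * x) mod int p ^ k)"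
  have pk: "int p ^ k > 0" using prime_gt_0_nat[OF prime_p] by simp
  have j: "int j = (a * x) mod int p ^ k" using pk by (simp add: j_def)
  have "[b * int j = b * (a * x)] (mod int p ^ k)"
    unfolding j by (intro cong_scalar_left) simp
  also have "b * (a * x) = a * (b * x)" by simp
  also have "[a * (b * x) = a * 1] (mod int p ^ k)" using x by (rule cong_scalar_left)
  finally have "int p ^ k dvd a - b * int j" by (simp add: cong_iff_dvd_diff dvd_diff_commute)
  then have "A (of_int (a - b * int j)) \<le> inverse (real p) ^ k" using A_of_int_le_iff by blast
  moreover have "of_int (a - b * int j) = (r - of_nat j) * of_int b" using b by (simp add: field_simps)
  moreover have "A (of_int b) = 1" using ndvd by (rule A_of_int_eq_1)
  ultimately have "A (r - of_nat j) \<le> inverse (real p) ^ k" by (simp add: A_mult)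
  moreover have "int j < int p ^ k" unfolding j using pk by simp
  then have "j < p ^ k" by (metis of_nat_less_iff of_nat_power)
  ultimately show thesis using that by blast
qed

text \<open>\<open>r p^k\<close> is an integer of absolute value at most \<open>p^(-k)\<close>,
  hence divisible by \<open>p^k\<close>. This is what makes fractional parts unique.\<close>

lemma A_integer:
  assumes "A r \<le> 1" "r * of_nat p ^ k \<in> \<int>"
  shows "r \<in> \<int>"
proof -
  obtain m where m: "r * of_nat p ^ k = of_int m" using assms(2) by (auto elim: Ints_cases)
  have "A (of_int m) = A r * inverse (real p) ^ k" unfolding m[symmetric] by (simp add: A_mult A_power A_p)
  also have "\<dots> \<le> 1 * inverse (real p) ^ k" using assms p_gt_1 by (intro mult_right_mono) auto
  finally have "int p ^ k dvd m" using A_of_int_le_iff by simp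
  then obtain n where "m = int p ^ k * n" by (rule dvdE)
  then have "r * of_nat p ^ k = of_int n * of_nat p ^ k" using m by (simp add: mult.commute)
  then have "r = of_int n" using p_gt_1 by (simp del: of_nat_power)
  then show ?thesis by simp
qed

section \<open>Cauchy sequences modulo null sequences\<close>

abbreviation (input) "C \<equiv> padic_cauchy_ring p"

lemma C_simps [simp]:
  "carrier C = {X. padic_cauchy p X}" "mult C X Y = (\<lambda>n. X n * Y n)" "one C = (\<lambda>_. 1)"
  "zero C = (\<lambda>_. 0)" "add C X Y = (\<lambda>n. X n + Y n)"
  by (simp_all add: padic_cauchy_ring_def)

lemma padic_cauchyD: "padic_cauchy p X \<Longrightarrow> e > 0 \<Longrightarrow> \<exists>N. \<forall>m\<ge>N. \<forall>n\<ge>N. A (X m - X n) < e"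
  by (simp add: padic_cauchy_def)

lemma padic_cauchy_convergent:
  assumes "padic_cauchy p X"
  shows "convergent (\<lambda>n. A (X n))"
proof (rule Cauchy_convergent)
  show "Cauchy (\<lambda>n. A (X n))"
  proof (rule metric_CauchyI)
    fix e :: real assume "e > 0"
    then obtain N where N: "\<And>m n. m \<ge> N \<Longrightarrow> n \<ge> N \<Longrightarrow> A (X m - X n) < e" using padic_cauchyD[OF assms] by blast
    have "dist (A (X m)) (A (X n)) < e" if "m \<ge> N" "n \<ge> N" for m n
      using A_diff_abs[of "X m" "X n"] N[OF that] by (simp add: dist_real_def)
    then show "\<exists>N. \<forall>m\<ge>N. \<forall>n\<ge>N. dist (A (X m)) (A (X n)) < e" by blast
  qed
qed

lemma padic_cauchy_bounded:
  assumes "padic_cauchy p X"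
  obtains K where "K > 0" "\<And>n. A (X n) \<le> K"
proof -
  have "Bseq (\<lambda>n. A (X n))" using padic_cauchy_convergent[OF assms] convergent_imp_Bseq by blast
  then obtain K where "K > 0" "\<And>n. norm (A (X n)) \<le> K" by (rule BseqE) auto
  then show thesis using that by auto
qed

lemma padic_cauchy_const: "padic_cauchy p (\<lambda>_. r)"
  by (auto simp: padic_cauchy_def)

lemma padic_cauchy_neg: "padic_cauchy p X \<Longrightarrow> padic_cauchy p (\<lambda>n. - X n)"
proof -
  have "A (- r - - s) = A (r - s)" for r s using A_neg[of "r - s"] by simp
  then show "padic_cauchy p X \<Longrightarrow> ?thesis" by (simp add: padic_cauchy_def)
qed

lemma padic_cauchy_add:
  assumes "padic_cauchy p X" "padic_cauchy p Y"
  shows "padic_cauchy p (\<lambda>n. X n + Y n)"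
  unfolding padic_cauchy_def
proof (intro allI impI)
  fix e :: real assume e: "e > 0"
  obtain N where N: "\<And>m n. m \<ge> N \<Longrightarrow> n \<ge> N \<Longrightarrow> A (X m - X n) < e" using padic_cauchyD[OF assms(1) e] by blast
  obtain N' where N': "\<And>m n. m \<ge> N' \<Longrightarrow> n \<ge> N' \<Longrightarrow> A (Y m - Y n) < e" using padic_cauchyD[OF assms(2) e] by blast
  have "A (X m + Y m - (X n + Y n)) < e" if "m \<ge> max N N'" "n \<ge> max N N'" for m n
    using A_ultrametric[of "X m - X n" "Y m - Y n"] N[of m n] N'[of m n] that by (simp add: algebra_simps)
  then show "\<exists>N. \<forall>m\<ge>N. \<forall>n\<ge>N. A (X m + Y m - (X n + Y n)) < e" by blast
qed

lemma padic_cauchy_mult: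
  assumes "padic_cauchy p X" "padic_cauchy p Y"
  shows "padic_cauchy p (\<lambda>n. X n * Y n)"
  unfolding padic_cauchy_def
proof (intro allI impI)
  fix e :: real assume e: "e > 0"
  obtain K where K: "K > 0" "\<And>n. A (X n) \<le> K" using padic_cauchy_bounded[OF assms(1)] by blast
  obtain L where L: "L > 0" "\<And>n. A (Y n) \<le> L" using padic_cauchy_bounded[OF assms(2)] by blast
  have eL: "e / L > 0" and eK: "e / K > 0" using e K L by auto
  obtain N where N: "\<And>m n. m \<ge> N \<Longrightarrow> n \<ge> N \<Longrightarrow> A (X m - X n) < e / L" using padic_cauchyD[OF assms(1) eL] by blast
  obtain N' where N': "\<And>m n. m \<ge> N' \<Longrightarrow> n \<ge> N' \<Longrightarrow> A (Y m - Y n) < e / K" using padic_cauchyD[OF assms(2) eK] by blast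
  have "A (X m * Y m - X n * Y n) < e" if mn: "m \<ge> max N N'" "n \<ge> max N N'" for m n
  proof -
    have "X m * Y m - X n * Y n = (X m - X n) * Y m + X n * (Y m - Y n)" by (simp add: algebra_simps)
    then have "A (X m * Y m - X n * Y n) \<le> max (A (X m - X n) * A (Y m)) (A (X n) * A (Y m - Y n))"
      using A_ultrametric by (metis A_mult)
    moreover have "A (X m - X n) * A (Y m) < e"
    proof -
      have "A (X m - X n) * A (Y m) \<le> A (X m - X n) * L" using L by (intro mult_left_mono) auto
      also have "\<dots> < e / L * L" using N[of m n] mn L by (intro mult_strict_right_mono) auto
      finally show ?thesis using L by simp
    qed
    moreover have "A (X n) * A (Y m - Y n) < e"
    proof -
      have "A (X n) * A (Y m - Y n) \<le> K * A (Y m - Y n)" using K by (intro mult_right_mono) auto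
      also have "\<dots> < K * (e / K)" using N'[of m n] mn K by (intro mult_strict_left_mono) auto
      finally show ?thesis using K by simp
    qed
    ultimately show ?thesis by simp
  qed
  then show "\<exists>N. \<forall>m\<ge>N. \<forall>n\<ge>N. A (X m * Y m - X n * Y n) < e" by blast
qed

lemma C_cring: "cring C"
proof (rule cringI)
  show "abelian_group C"
  proof (rule abelian_groupI)
    fix X assume "X \<in> carrier C"
    then show "\<exists>Y\<in>carrier C. Y \<oplus>\<^bsub>C\<^esub> X = \<zero>\<^bsub>C\<^esub>"
      by (intro bexI[of _ "\<lambda>n. - X n"]) (auto intro: padic_cauchy_neg)
  qed (auto intro: padic_cauchy_add padic_cauchy_const simp: algebra_simps)
  show "comm_monoid C"
    by (rule comm_monoidI) (auto intro: padic_cauchy_mult padic_cauchy_const simp: algebra_simps)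
qed (auto simp: algebra_simps)

lemma C_minus: "padic_cauchy p X \<Longrightarrow> \<ominus>\<^bsub>C\<^esub> X = (\<lambda>n. - X n)"
proof -
  interpret cring C by (rule C_cring)
  show "padic_cauchy p X \<Longrightarrow> ?thesis"
    by (rule minus_equality) (auto intro: padic_cauchy_neg)
qed

lemma null_cauchy:
  assumes "X \<in> padic_null p"
  shows "padic_cauchy p X"
  unfolding padic_cauchy_def
proof (intro allI impI)
  fix e :: real assume "e > 0"
  then obtain N where "\<And>n. n \<ge> N \<Longrightarrow> A (X n) < e"
    using assms LIMSEQ_D[of "\<lambda>n. A (X n)" 0 e] by (auto simp: padic_null_def)
  then have "A (X m - X n) < e" if "m \<ge> N" "n \<ge> N" for m n
    using A_ultrametric_diff[of "X m" "X n"] that by (meson max_less_iff_conj order_le_less_trans)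
  then show "\<exists>N. \<forall>m\<ge>N. \<forall>n\<ge>N. A (X m - X n) < e" by blast
qed

lemma null_add: "X \<in> padic_null p \<Longrightarrow> Y \<in> padic_null p \<Longrightarrow> (\<lambda>n. X n + Y n) \<in> padic_null p"
proof -
  assume "X \<in> padic_null p" "Y \<in> padic_null p"
  then have "(\<lambda>n. A (X n) + A (Y n)) \<longlonglongrightarrow> 0 + 0" unfolding padic_null_def by (intro tendsto_add) auto
  then have "(\<lambda>n. A (X n + Y n)) \<longlonglongrightarrow> 0"
    by (intro LIMSEQ_0_le[OF _ A_nonneg A_triangle]) simp
  then show ?thesis by (simp add: padic_null_def)
qed

lemma null_mult:
  assumes "padic_cauchy p X" "Y \<in> padic_null p"
  shows "(\<lambda>n. X n * Y n) \<in> padic_null p"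
proof -
  obtain K where K: "K > 0" "\<And>n. A (X n) \<le> K" using padic_cauchy_bounded[OF assms(1)] by blast
  have "(\<lambda>n. K * A (Y n)) \<longlonglongrightarrow> K * 0" using assms(2) unfolding padic_null_def by (intro tendsto_mult) auto
  moreover have "A (X n * Y n) \<le> K * A (Y n)" for n
    unfolding A_mult using K by (intro mult_right_mono) auto
  ultimately have "(\<lambda>n. A (X n * Y n)) \<longlonglongrightarrow> 0"
    using LIMSEQ_0_le[of "\<lambda>n. K * A (Y n)" "\<lambda>n. A (X n * Y n)"] by simp
  then show ?thesis by (simp add: padic_null_def)
qed

lemma null_ideal: "ideal (padic_null p) C"
proof (rule idealI)
  interpret cring C by (rule C_cring)
  show "ring C" by (rule ring_axioms)
  show "subgroup (padic_null p) (add_monoid C)"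
  proof
    show "padic_null p \<subseteq> carrier (add_monoid C)" using null_cauchy by auto
    show "inv\<^bsub>add_monoid C\<^esub> X \<in> padic_null p" if "X \<in> padic_null p" for X
      using C_minus[OF null_cauchy[OF that]] that by (simp add: a_inv_def padic_null_def)
  qed (auto simp: null_add, simp add: padic_null_def)
  show "X \<otimes>\<^bsub>C\<^esub> Y \<in> padic_null p" "Y \<otimes>\<^bsub>C\<^esub> X \<in> padic_null p"
    if "Y \<in> padic_null p" "X \<in> carrier C" for X Y
    using null_mult[of X Y] that by (auto simp: mult.commute)
qed

sublocale null: ideal "padic_null p" C
  by (rule null_ideal)

sublocale Q: cring "Qp p"
  unfolding Qp_def by (rule null.quotient_is_cring[OF C_cring])

lemma Qp_cring: "cring (Qp p)"
  by (rule Q.is_cring)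

definition cls :: "(nat \<Rightarrow> rat) \<Rightarrow> padic" where
  "cls X = padic_null p +>\<^bsub>C\<^esub> X"

sublocale cls: ring_hom_ring C "Qp p" cls
  unfolding Qp_def cls_def[abs_def] by (rule null.rcos_ring_hom_ring)

lemma Qp_carrier: "carrier (Qp p) = cls ` {X. padic_cauchy p X}"
  by (auto simp: Qp_def FactRing_def A_RCOSETS_def' cls_def)

lemma cls_closed: "padic_cauchy p X \<Longrightarrow> cls X \<in> carrier (Qp p)"
  using cls.hom_closed by simp

lemma cls_add: "padic_cauchy p X \<Longrightarrow> padic_cauchy p Y \<Longrightarrow> cls X \<oplus>\<^bsub>Qp p\<^esub> cls Y = cls (\<lambda>n. X n + Y n)"
  using cls.hom_add[of X Y] by simp

lemma cls_mult: "padic_cauchy p X \<Longrightarrow> padic_cauchy p Y \<Longrightarrow> cls X \<otimes>\<^bsub>Qp p\<^esub> cls Y = cls (\<lambda>n. X n * Y n)"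
  using cls.hom_mult[of X Y] by simp

lemma cls_uminus: "padic_cauchy p X \<Longrightarrow> \<ominus>\<^bsub>Qp p\<^esub> cls X = cls (\<lambda>n. - X n)"
  using cls.hom_a_inv[of X] C_minus[of X] by simp

lemma cls_minus: "padic_cauchy p X \<Longrightarrow> padic_cauchy p Y \<Longrightarrow> cls X \<ominus>\<^bsub>Qp p\<^esub> cls Y = cls (\<lambda>n. X n - Y n)"
  by (simp add: a_minus_def cls_uminus cls_add padic_cauchy_neg)

lemma cls_zero: "cls (\<lambda>_. 0) = \<zero>\<^bsub>Qp p\<^esub>"
  using cls.hom_zero by simp

lemma cls_one: "cls (\<lambda>_. 1) = \<one>\<^bsub>Qp p\<^esub>"
  using cls.hom_one by simp

text \<open>Justifies the definite description in \<open>padic_abs\<close>: representatives differ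
  by null sequences, and \<open>|A r - A s| \<le> A (r - s)\<close> gives them the same
  limit.\<close>

lemma padic_abs_cls:
  assumes X: "padic_cauchy p X"
  shows "(\<lambda>n. A (X n)) \<longlonglongrightarrow> padic_abs p (cls X)"
proof -
  obtain c where c: "(\<lambda>n. A (X n)) \<longlonglongrightarrow> c" using padic_cauchy_convergent[OF X] by (auto simp: convergent_def)
  have mem: "X \<in> cls X"
    using null.a_rcos_self[of X] X by (simp add: cls_def)
  have "(\<lambda>n. A (Y n)) \<longlonglongrightarrow> c" if Y: "Y \<in> cls X" for Y
  proof -
    obtain Z where Z: "Z \<in> padic_null p" "Y = (\<lambda>n. Z n + X n)"
      using Y by (auto simp: cls_def a_r_coset_def')
    have "(\<lambda>n. A (Y n) - A (X n)) \<longlonglongrightarrow> 0"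
    proof (rule tendsto_0_le[where K = 1 and f = "\<lambda>n. A (Z n)"])
      show "(\<lambda>n. A (Z n)) \<longlonglongrightarrow> 0" using Z by (simp add: padic_null_def)
      show "\<forall>\<^sub>F n in sequentially. norm (A (Y n) - A (X n)) \<le> norm (A (Z n)) * 1"
      proof (intro always_eventually allI)
        show "norm (A (Y n) - A (X n)) \<le> norm (A (Z n)) * 1" for n
          using A_diff_abs[of "Y n" "X n"] Z by simp
      qed
    qed
    from tendsto_add[OF this c] show ?thesis by simp
  qed
  then have "padic_abs p (cls X) = c"
    unfolding padic_abs_def using mem by (intro the_equality) (auto intro: LIMSEQ_unique[OF _ c])
  then show ?thesis using c by simp
qed

section \<open>The absolute value on the completion\<close>

lemma Qp_cases:
  assumes "x \<in> carrier (Qp p)"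
  obtains X where "padic_cauchy p X" "x = cls X"
  using assms by (auto simp: Qp_carrier)

lemma abs_nonneg: "x \<in> carrier (Qp p) \<Longrightarrow> padic_abs p x \<ge> 0"
  by (elim Qp_cases) (auto intro: LIMSEQ_le_const[OF padic_abs_cls])

lemma abs_zero [simp]: "padic_abs p \<zero>\<^bsub>Qp p\<^esub> = 0"
  using padic_abs_cls[OF padic_cauchy_const[of 0]] by (simp add: cls_zero LIMSEQ_const_iff)

lemma abs_eq_0:
  assumes "x \<in> carrier (Qp p)" "padic_abs p x = 0"
  shows "x = \<zero>\<^bsub>Qp p\<^esub>"
proof -
  obtain X where X: "padic_cauchy p X" "x = cls X" using Qp_cases[OF assms(1)] .
  have "X \<in> padic_null p" using padic_abs_cls[OF X(1)] X assms(2) by (simp add: padic_null_def)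
  then have "cls X = cls (\<lambda>_. 0)"
    unfolding cls_def using null.a_rcos_const[of X] null.a_rcos_const[of "\<lambda>_. 0"] by (simp add: padic_null_def)
  then show ?thesis using X by (simp add: cls_zero)
qed

lemma abs_mult:
  assumes "x \<in> carrier (Qp p)" "y \<in> carrier (Qp p)"
  shows "padic_abs p (x \<otimes>\<^bsub>Qp p\<^esub> y) = padic_abs p x * padic_abs p y"
proof -
  obtain X where X: "padic_cauchy p X" "x = cls X" using Qp_cases[OF assms(1)] .
  obtain Y where Y: "padic_cauchy p Y" "y = cls Y" using Qp_cases[OF assms(2)] .
  have "(\<lambda>n. A (X n * Y n)) \<longlonglongrightarrow> padic_abs p x * padic_abs p y"
    unfolding A_mult X(2) Y(2) by (intro tendsto_mult padic_abs_cls X Y)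
  then show ?thesis
    using padic_abs_cls[OF padic_cauchy_mult[OF X(1) Y(1)]] X Y LIMSEQ_unique by (simp add: cls_mult)
qed

lemma abs_ultrametric:
  assumes "x \<in> carrier (Qp p)" "y \<in> carrier (Qp p)"
  shows "padic_abs p (x \<oplus>\<^bsub>Qp p\<^esub> y) \<le> max (padic_abs p x) (padic_abs p y)"
proof -
  obtain X where X: "padic_cauchy p X" "x = cls X" using Qp_cases[OF assms(1)] .
  obtain Y where Y: "padic_cauchy p Y" "y = cls Y" using Qp_cases[OF assms(2)] .
  have "(\<lambda>n. max (A (X n)) (A (Y n))) \<longlonglongrightarrow> max (padic_abs p x) (padic_abs p y)"
    unfolding X(2) Y(2) by (intro tendsto_max padic_abs_cls X Y)
  then show ?thesis
    using padic_abs_cls[OF padic_cauchy_add[OF X(1) Y(1)]] X Y A_ultrametric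
    by (intro LIMSEQ_le[of "\<lambda>n. A (X n + Y n)"]) (auto simp: cls_add)
qed

lemma abs_uminus:
  assumes "x \<in> carrier (Qp p)"
  shows "padic_abs p (\<ominus>\<^bsub>Qp p\<^esub> x) = padic_abs p x"
proof -
  obtain X where X: "padic_cauchy p X" "x = cls X" using Qp_cases[OF assms(1)] .
  show ?thesis
    using padic_abs_cls[OF padic_cauchy_neg[OF X(1)]] padic_abs_cls[OF X(1)] X LIMSEQ_unique
    by (auto simp: cls_uminus)
qed

lemma abs_ultrametric_minus:
  assumes "x \<in> carrier (Qp p)" "y \<in> carrier (Qp p)"
  shows "padic_abs p (x \<ominus>\<^bsub>Qp p\<^esub> y) \<le> max (padic_abs p x) (padic_abs p y)"
  using abs_ultrametric[of x "\<ominus>\<^bsub>Qp p\<^esub> y"] abs_uminus[of y] assms by (simp add: a_minus_def)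

lemma rat_to_Qp_cls: "rat_to_Qp p r = cls (\<lambda>_. r)"
  by (simp add: rat_to_Qp_def cls_def)

lemma rat_closed [simp]: "rat_to_Qp p r \<in> carrier (Qp p)"
  by (simp add: rat_to_Qp_cls cls_closed padic_cauchy_const)

lemma rat_add: "rat_to_Qp p r \<oplus>\<^bsub>Qp p\<^esub> rat_to_Qp p s = rat_to_Qp p (r + s)"
  by (simp add: rat_to_Qp_cls cls_add padic_cauchy_const)

lemma rat_minus: "rat_to_Qp p r \<ominus>\<^bsub>Qp p\<^esub> rat_to_Qp p s = rat_to_Qp p (r - s)"
  by (simp add: rat_to_Qp_cls cls_minus padic_cauchy_const)

lemma rat_mult: "rat_to_Qp p r \<otimes>\<^bsub>Qp p\<^esub> rat_to_Qp p s = rat_to_Qp p (r * s)"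
  by (simp add: rat_to_Qp_cls cls_mult padic_cauchy_const)

lemma rat_one: "rat_to_Qp p 1 = \<one>\<^bsub>Qp p\<^esub>"
  by (simp add: rat_to_Qp_cls cls_one)

lemma rat_zero: "rat_to_Qp p 0 = \<zero>\<^bsub>Qp p\<^esub>"
  by (simp add: rat_to_Qp_cls cls_zero)

lemma abs_rat: "padic_abs p (rat_to_Qp p r) = A r"
  using padic_abs_cls[OF padic_cauchy_const[of r]] by (simp add: rat_to_Qp_cls LIMSEQ_const_iff)

lemma rat_dense:
  assumes "x \<in> carrier (Qp p)" "e > 0"
  obtains r where "padic_abs p (x \<ominus>\<^bsub>Qp p\<^esub> rat_to_Qp p r) \<le> e"
proof -
  obtain X where X: "padic_cauchy p X" "x = cls X" using Qp_cases[OF assms(1)] .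
  obtain N where N: "\<And>m n. m \<ge> N \<Longrightarrow> n \<ge> N \<Longrightarrow> A (X m - X n) < e" using padic_cauchyD[OF X(1) assms(2)] by blast
  have "padic_cauchy p (\<lambda>n. X n - X N)"
    using padic_cauchy_add[OF X(1) padic_cauchy_const[of "- X N"]] by simp
  from padic_abs_cls[OF this] have "padic_abs p (x \<ominus>\<^bsub>Qp p\<^esub> rat_to_Qp p (X N)) \<le> e"
    using X N by (intro LIMSEQ_le_const2[of "\<lambda>n. A (X n - X N)"])
      (auto simp: rat_to_Qp_cls cls_minus padic_cauchy_const intro!: exI[of _ N] less_imp_le)
  then show thesis using that by blast
qed

section \<open>Fractional parts and the additive character\<close>

lemma Zp_iff: "x \<in> Zp p \<longleftrightarrow> x \<in> carrier (Qp p) \<and> padic_abs p x \<le> 1"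
  by (simp add: Zp_def)

lemma Zp_minus: "x \<in> Zp p \<Longrightarrow> y \<in> Zp p \<Longrightarrow> x \<ominus>\<^bsub>Qp p\<^esub> y \<in> Zp p"
  using abs_ultrametric_minus[of x y] by (auto simp: Zp_iff)

lemma Zp_rat: "rat_to_Qp p r \<in> Zp p \<longleftrightarrow> A r \<le> 1"
  by (simp add: Zp_iff abs_rat)

text \<open>The defining property of the fractional part, before \<open>[0,1)\<close> fixes the representative.\<close>

definition frac_rep :: "padic \<Rightarrow> rat \<Rightarrow> bool" where
  "frac_rep x r \<longleftrightarrow> (\<exists>k::nat. r * of_nat p ^ k \<in> \<int>) \<and> x \<ominus>\<^bsub>Qp p\<^esub> rat_to_Qp p r \<in> Zp p"

lemma pow_p_Ints_diff:
  assumes "r * of_nat p ^ k \<in> \<int>" "s * of_nat p ^ l \<in> (\<int> :: rat set)"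
  shows "(r - s) * of_nat p ^ (k + l) \<in> \<int>" "(r + s) * of_nat p ^ (k + l) \<in> \<int>"
proof -
  have "(r - s) * of_nat p ^ (k + l) = (r * of_nat p ^ k) * of_nat p ^ l - (s * of_nat p ^ l) * of_nat p ^ k"
    "(r + s) * of_nat p ^ (k + l) = (r * of_nat p ^ k) * of_nat p ^ l + (s * of_nat p ^ l) * of_nat p ^ k"
    by (simp_all add: power_add algebra_simps)
  moreover have "(r * of_nat p ^ k) * of_nat p ^ l \<in> \<int>" "(s * of_nat p ^ l) * of_nat p ^ k \<in> \<int>"
    using Ints_mult[OF assms(1) Ints_power[OF Ints_of_nat]]
      Ints_mult[OF assms(2) Ints_power[OF Ints_of_nat]] by blast+
  ultimately show "(r - s) * of_nat p ^ (k + l) \<in> \<int>" "(r + s) * of_nat p ^ (k + l) \<in> \<int>" by auto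
qed

text \<open>The difference has a power of p as denominator and is p-integral, both remainders being
  p-adic integers.\<close>

lemma frac_rep_diff_Ints:
  assumes x: "x \<in> carrier (Qp p)" and r: "frac_rep x r" and s: "frac_rep x s"
  shows "r - s \<in> \<int>"
proof -
  obtain k l where kl: "r * of_nat p ^ k \<in> \<int>" "s * of_nat p ^ l \<in> \<int>" using r s by (auto simp: frac_rep_def)
  have "(x \<ominus>\<^bsub>Qp p\<^esub> rat_to_Qp p s) \<ominus>\<^bsub>Qp p\<^esub> (x \<ominus>\<^bsub>Qp p\<^esub> rat_to_Qp p r) = rat_to_Qp p r \<ominus>\<^bsub>Qp p\<^esub> rat_to_Qp p s"
    by (intro Q.minus_minus_cancel x rat_closed)
  also have "\<dots> = rat_to_Qp p (r - s)" by (rule rat_minus)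
  finally have "rat_to_Qp p (r - s) \<in> Zp p" using Zp_minus r s by (metis frac_rep_def)
  then show ?thesis using A_integer[OF _ pow_p_Ints_diff(1)[OF kl]] by (simp add: Zp_rat)
qed

text \<open>A rational \<open>s\<close> close to \<open>x\<close> becomes p-integral after
  multiplication by some \<open>p^k\<close>; the residue \<open>j\<close> of \<open>s p^k\<close>
  modulo \<open>p^k\<close> gives \<open>r = j / p^k\<close>, which is below 1 because
  \<open>j < p^k\<close>.\<close>

lemma frac_rep_exists:
  assumes x: "x \<in> carrier (Qp p)"
  shows "\<exists>r. frac_rep x r \<and> 0 \<le> r \<and> r < 1"
proof -
  obtain s where s: "padic_abs p (x \<ominus>\<^bsub>Qp p\<^esub> rat_to_Qp p s) \<le> 1" using rat_dense[OF x, of 1] by auto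
  obtain k where k: "A s < real p ^ k" using real_arch_pow[OF p_gt_1] by blast
  have "A (s * of_nat p ^ k) \<le> 1"
    using k p_gt_1 by (simp add: A_mult A_power A_p power_inverse field_simps)
  then obtain j where j: "j < p ^ k" "A (s * of_nat p ^ k - of_nat j) \<le> inverse (real p) ^ k"
    using A_residue[of _ k] by blast
  define r where "r = (of_nat j :: rat) / of_nat p ^ k"
  have p0: "(of_nat p :: rat) \<noteq> 0" using p_gt_1 by auto
  have "A (s - r) * inverse (real p) ^ k = A (s * of_nat p ^ k - of_nat j)"
    using p0 by (simp add: A_p[symmetric] A_power[symmetric] A_mult[symmetric] r_def left_diff_distrib)
  also have "\<dots> \<le> 1 * inverse (real p) ^ k" using j(2) by simp
  finally have Asr: "A (s - r) \<le> 1" using p_gt_1 by (subst (asm) mult_le_cancel_right) auto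
  have "x \<ominus>\<^bsub>Qp p\<^esub> rat_to_Qp p r = (x \<ominus>\<^bsub>Qp p\<^esub> rat_to_Qp p s) \<oplus>\<^bsub>Qp p\<^esub> (rat_to_Qp p s \<ominus>\<^bsub>Qp p\<^esub> rat_to_Qp p r)"
    using x by (simp add: a_minus_def Q.a_assoc Q.r_neg1)
  also have "padic_abs p \<dots> \<le> max (padic_abs p (x \<ominus>\<^bsub>Qp p\<^esub> rat_to_Qp p s)) (padic_abs p (rat_to_Qp p s \<ominus>\<^bsub>Qp p\<^esub> rat_to_Qp p r))"
    using x by (intro abs_ultrametric) auto
  also have "\<dots> \<le> 1" using s Asr by (simp add: rat_minus abs_rat)
  finally have "x \<ominus>\<^bsub>Qp p\<^esub> rat_to_Qp p r \<in> Zp p" using x by (simp add: Zp_iff)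
  moreover have "r * of_nat p ^ k \<in> \<int>" using p0 by (simp add: r_def)
  moreover have "0 \<le> r" by (simp add: r_def)
  moreover have "r < 1"
  proof -
    have "(of_nat j :: rat) < of_nat (p ^ k)" using j(1) by (simp only: of_nat_less_iff)
    then show ?thesis using p_gt_1 by (simp add: r_def divide_less_eq)
  qed
  ultimately show ?thesis unfolding frac_rep_def by blast
qed

lemma padic_frac:
  assumes x: "x \<in> carrier (Qp p)"
  shows "frac_rep x (padic_frac p x)" "0 \<le> padic_frac p x" "padic_frac p x < 1"
proof -
  have "\<exists>!r. 0 \<le> r \<and> r < 1 \<and> (\<exists>k::nat. r * of_nat p ^ k \<in> \<int>) \<and> x \<ominus>\<^bsub>Qp p\<^esub> rat_to_Qp p r \<in> Zp p"
  proof (rule ex_ex1I)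
    show "\<exists>r. 0 \<le> r \<and> r < 1 \<and> (\<exists>k::nat. r * of_nat p ^ k \<in> \<int>) \<and> x \<ominus>\<^bsub>Qp p\<^esub> rat_to_Qp p r \<in> Zp p"
      using frac_rep_exists[OF x] by (auto simp: frac_rep_def)
  next
    fix r s
    assume r: "0 \<le> r \<and> r < 1 \<and> (\<exists>k::nat. r * of_nat p ^ k \<in> \<int>) \<and> x \<ominus>\<^bsub>Qp p\<^esub> rat_to_Qp p r \<in> Zp p"
      and s: "0 \<le> s \<and> s < 1 \<and> (\<exists>k::nat. s * of_nat p ^ k \<in> \<int>) \<and> x \<ominus>\<^bsub>Qp p\<^esub> rat_to_Qp p s \<in> Zp p"
    have "r - s \<in> \<int>" using r s by (intro frac_rep_diff_Ints[OF x]) (auto simp: frac_rep_def)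
    then obtain n where n: "r - s = of_int n" by (auto elim: Ints_cases)
    have "(of_int n :: rat) < of_int 1" "(of_int (- 1) :: rat) < of_int n" unfolding n[symmetric] using r s by auto
    then have "n < 1" "-1 < n" by (simp_all only: of_int_less_iff)
    then show "r = s" using n by simp
  qed
  from theI'[OF this] show "frac_rep x (padic_frac p x)" "0 \<le> padic_frac p x" "padic_frac p x < 1"
    unfolding padic_frac_def frac_rep_def by auto
qed

definition char :: "padic \<Rightarrow> complex" where
  "char x = exp (2 * complex_of_real pi * \<i> * of_rat (padic_frac p x))"

lemma exp_of_rat_Ints: "r \<in> \<int> \<Longrightarrow> exp (2 * complex_of_real pi * \<i> * of_rat r) = 1"
  by (auto elim!: Ints_cases simp: exp_eq_1 of_rat_of_int_eq)

text \<open>Frees the character from the normalization to \<open>[0,1)\<close>: fractional parts may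
  be added without reducing the sum, which is how \<open>char_add\<close> is obtained.\<close>

lemma char_rep:
  assumes x: "x \<in> carrier (Qp p)" and r: "frac_rep x r"
  shows "char x = exp (2 * complex_of_real pi * \<i> * of_rat r)"
proof -
  have "padic_frac p x - r \<in> \<int>" using frac_rep_diff_Ints[OF x padic_frac(1)[OF x] r] .
  from exp_of_rat_Ints[OF this] show ?thesis
    by (simp add: char_def of_rat_diff right_diff_distrib exp_diff)
qed

lemma char_add:
  assumes x: "x \<in> carrier (Qp p)" and y: "y \<in> carrier (Qp p)"
  shows "char (x \<oplus>\<^bsub>Qp p\<^esub> y) = char x * char y"
proof -
  let ?r = "padic_frac p x" and ?s = "padic_frac p y"
  note r = padic_frac(1)[OF x] note s = padic_frac(1)[OF y]
  have "(x \<oplus>\<^bsub>Qp p\<^esub> y) \<ominus>\<^bsub>Qp p\<^esub> rat_to_Qp p (?r + ?s)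
      = (x \<ominus>\<^bsub>Qp p\<^esub> rat_to_Qp p ?r) \<oplus>\<^bsub>Qp p\<^esub> (y \<ominus>\<^bsub>Qp p\<^esub> rat_to_Qp p ?s)"
    using x y by (simp add: a_minus_def rat_add[symmetric] Q.minus_add Q.a_ac)
  moreover have "\<dots> \<in> Zp p"
    using abs_ultrametric[of "x \<ominus>\<^bsub>Qp p\<^esub> rat_to_Qp p ?r" "y \<ominus>\<^bsub>Qp p\<^esub> rat_to_Qp p ?s"] r s x y
    by (auto simp: frac_rep_def Zp_iff)
  moreover obtain k l where "?r * of_nat p ^ k \<in> \<int>" "?s * of_nat p ^ l \<in> \<int>" using r s by (auto simp: frac_rep_def)
  ultimately have "frac_rep (x \<oplus>\<^bsub>Qp p\<^esub> y) (?r + ?s)"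
    unfolding frac_rep_def using pow_p_Ints_diff(2) by metis
  then have "char (x \<oplus>\<^bsub>Qp p\<^esub> y) = exp (2 * complex_of_real pi * \<i> * of_rat (?r + ?s))"
    using x y by (intro char_rep) auto
  then show ?thesis by (simp add: char_def of_rat_add distrib_left exp_add)
qed

lemma char_norm: "cmod (char x) = 1"
  by (simp add: char_def norm_exp_eq_Re complex_of_rat)

text \<open>If the exponential is 1, the fractional part is an integer, and in \<open>[0,1)\<close>
  only 0 is left.\<close>

lemma char_eq_1_iff:
  assumes x: "x \<in> carrier (Qp p)"
  shows "char x = 1 \<longleftrightarrow> x \<in> Zp p"
proof
  assume "x \<in> Zp p"
  then have "frac_rep x 0" using x by (simp add: frac_rep_def rat_zero a_minus_def)
  from char_rep[OF x this] show "char x = 1" by simp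
next
  assume "char x = 1"
  then obtain n :: int where n: "Im (2 * complex_of_real pi * \<i> * of_rat (padic_frac p x)) = of_int (2 * n) * pi"
    unfolding char_def exp_eq_1 by blast
  then have "real_of_rat (padic_frac p x) = of_int n" by (simp add: complex_of_rat)
  then have e: "padic_frac p x = of_int n" by (metis of_rat_eq_iff of_rat_of_int_eq)
  with padic_frac(2,3)[OF x] have "(0::int) \<le> n" "n < 1" by simp_all
  then have "padic_frac p x = 0" using e by simp
  then show "x \<in> Zp p" using padic_frac(1)[OF x] x by (simp add: frac_rep_def rat_zero a_minus_def)
qed

lemma A_power_int: "A (r powi n) = A r powi n"
  by (cases n rule: int_cases2) (auto simp: power_int_minus A_inverse A_power)

lemma A_prod: "A (prod f I) = (\<Prod>i\<in>I. A (f i))"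
  by (induction I rule: infinite_finite_induct) (auto simp: A_mult)

lemma A_other_prime:
  assumes "prime q" "q \<noteq> p"
  shows "A (of_nat q) = 1"
proof -
  have "\<not> int p dvd int q" using assms prime_p primes_dvd_imp_eq by auto
  from A_of_int_eq_1[OF this] show ?thesis by simp
qed

section \<open>The p-adic topology\<close>

lemma metric: "Metric_space (carrier (Qp p)) (padic_dist p)"
proof
  show "0 \<le> padic_dist p x y" for x y by (simp add: padic_dist_def abs_nonneg)
  show "padic_dist p x y = padic_dist p y x" for x y
    using abs_uminus[of "x \<ominus>\<^bsub>Qp p\<^esub> y"] Q.minus_swap[of x y]
    by (auto simp: padic_dist_def Q.minus_closed)
  fix x y assume xy: "x \<in> carrier (Qp p)" "y \<in> carrier (Qp p)"
  have "(x \<ominus>\<^bsub>Qp p\<^esub> y) \<oplus>\<^bsub>Qp p\<^esub> y = x" using xy by (simp add: a_minus_def Q.a_assoc Q.l_neg)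
  then have eq: "x = y" if "x \<ominus>\<^bsub>Qp p\<^esub> y = \<zero>\<^bsub>Qp p\<^esub>" using that xy by simp
  show "padic_dist p x y = 0 \<longleftrightarrow> x = y"
  proof
    assume "padic_dist p x y = 0"
    then have "padic_abs p (x \<ominus>\<^bsub>Qp p\<^esub> y) = 0" using xy by (simp add: padic_dist_def)
    then show "x = y" using eq abs_eq_0 Q.minus_closed[OF xy] by blast
  next
    assume "x = y"
    then show "padic_dist p x y = 0" using xy by (simp add: padic_dist_def a_minus_def Q.r_neg)
  qed
  fix z assume z: "z \<in> carrier (Qp p)"
  have "padic_abs p ((x \<ominus>\<^bsub>Qp p\<^esub> y) \<oplus>\<^bsub>Qp p\<^esub> (y \<ominus>\<^bsub>Qp p\<^esub> z))
      \<le> max (padic_abs p (x \<ominus>\<^bsub>Qp p\<^esub> y)) (padic_abs p (y \<ominus>\<^bsub>Qp p\<^esub> z))"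
    using xy z by (intro abs_ultrametric) auto
  then show "padic_dist p x z \<le> padic_dist p x y + padic_dist p y z"
    using xy z abs_nonneg[of "x \<ominus>\<^bsub>Qp p\<^esub> y"] abs_nonneg[of "y \<ominus>\<^bsub>Qp p\<^esub> z"]
    by (simp add: padic_dist_def Q.minus_trans)
qed

lemma topspace_Qp: "topspace (Qp_topology p) = carrier (Qp p)"
  unfolding Qp_topology_def by (rule Metric_space.topspace_mtopology[OF metric])

lemma openin_Qp_iff:
  "openin (Qp_topology p) U \<longleftrightarrow> U \<subseteq> carrier (Qp p) \<and>
    (\<forall>x\<in>U. \<exists>r>0. \<forall>y\<in>carrier (Qp p). padic_abs p (y \<ominus>\<^bsub>Qp p\<^esub> x) < r \<longrightarrow> y \<in> U)"
proof -
  have ball: "Metric_space.mball (carrier (Qp p)) (padic_dist p) x r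
      = {y \<in> carrier (Qp p). padic_abs p (y \<ominus>\<^bsub>Qp p\<^esub> x) < r}" if "x \<in> carrier (Qp p)" for x r
    unfolding Metric_space.mball_def[OF metric] Metric_space.commute[OF metric, of x]
    using that by (auto simp: padic_dist_def)
  have "(\<exists>r>0. Metric_space.mball (carrier (Qp p)) (padic_dist p) x r \<subseteq> U) \<longleftrightarrow>
      (\<exists>r>0. \<forall>y\<in>carrier (Qp p). padic_abs p (y \<ominus>\<^bsub>Qp p\<^esub> x) < r \<longrightarrow> y \<in> U)"
    if "x \<in> carrier (Qp p)" for x
    by (simp only: ball[OF that] subset_iff Ball_def mem_Collect_eq imp_conjL)
  then show ?thesis
    unfolding Qp_topology_def Metric_space.openin_mtopology[OF metric] by blast
qed

text \<open>By the ultrametric inequality every point of the closed ball is the center of an open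
  ball of the same radius inside it.\<close>

lemma cball_open:
  assumes a: "a \<in> carrier (Qp p)" and r: "r > 0"
  shows "openin (Qp_topology p) {y \<in> carrier (Qp p). padic_abs p (y \<ominus>\<^bsub>Qp p\<^esub> a) \<le> r}"
  unfolding openin_Qp_iff
proof (intro conjI ballI)
  fix x assume "x \<in> {y \<in> carrier (Qp p). padic_abs p (y \<ominus>\<^bsub>Qp p\<^esub> a) \<le> r}"
  then have x: "x \<in> carrier (Qp p)" "padic_abs p (x \<ominus>\<^bsub>Qp p\<^esub> a) \<le> r" by auto
  have "padic_abs p (y \<ominus>\<^bsub>Qp p\<^esub> a) \<le> r"
    if y: "y \<in> carrier (Qp p)" "padic_abs p (y \<ominus>\<^bsub>Qp p\<^esub> x) < r" for y
    using abs_ultrametric[of "y \<ominus>\<^bsub>Qp p\<^esub> x" "x \<ominus>\<^bsub>Qp p\<^esub> a"] x y a by (simp add: Q.minus_trans)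
  then show "\<exists>s>0. \<forall>y\<in>carrier (Qp p). padic_abs p (y \<ominus>\<^bsub>Qp p\<^esub> x) < s
      \<longrightarrow> y \<in> {y \<in> carrier (Qp p). padic_abs p (y \<ominus>\<^bsub>Qp p\<^esub> a) \<le> r}"
    using r by blast
qed auto

end

section \<open>The ring of S-adic numbers and its filtration\<close>

locale padic_product =
  fixes S :: "nat set"
  assumes finite_S: "finite S" and S_nonempty: "S \<noteq> {}" and prime_S: "p \<in> S \<Longrightarrow> prime p"
begin

lemma padic_S: "p \<in> S \<Longrightarrow> padic p"
  by unfold_locales (rule prime_S)

lemma Qp_cring_S: "p \<in> S \<Longrightarrow> cring (Qp p)"
  using padic.Qp_cring[OF padic_S] .

lemma Qp_ring_S: "p \<in> S \<Longrightarrow> ring (Qp p)"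
  using Qp_cring_S cring_def by blast

lemma Qp_abelian_group_S: "p \<in> S \<Longrightarrow> abelian_group (Qp p)"
  using Qp_ring_S ring_def by blast

section \<open>The ring structure of the product\<close>

lemma QS_simps:
  "carrier (QS S) = (\<Pi>\<^sub>E p\<in>S. carrier (Qp p))"
  "x \<otimes>\<^bsub>QS S\<^esub> y = (\<lambda>p\<in>S. x p \<otimes>\<^bsub>Qp p\<^esub> y p)" "\<one>\<^bsub>QS S\<^esub> = (\<lambda>p\<in>S. \<one>\<^bsub>Qp p\<^esub>)"
  "\<zero>\<^bsub>QS S\<^esub> = (\<lambda>p\<in>S. \<zero>\<^bsub>Qp p\<^esub>)" "x \<oplus>\<^bsub>QS S\<^esub> y = (\<lambda>p\<in>S. x p \<oplus>\<^bsub>Qp p\<^esub> y p)"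
  by (simp_all add: QS_def)

lemma QS_component: "x \<in> carrier (QS S) \<Longrightarrow> p \<in> S \<Longrightarrow> x p \<in> carrier (Qp p)"
  by (auto simp: QS_simps)

lemma QS_eqI:
  "x \<in> carrier (QS S) \<Longrightarrow> y \<in> carrier (QS S) \<Longrightarrow> (\<And>p. p \<in> S \<Longrightarrow> x p = y p) \<Longrightarrow> x = y"
  unfolding QS_simps by (rule PiE_ext)

lemma QS_I: "(\<And>p. p \<in> S \<Longrightarrow> f p \<in> carrier (Qp p)) \<Longrightarrow> (\<lambda>p\<in>S. f p) \<in> carrier (QS S)"
  by (auto simp: QS_simps)

lemma QS_cring: "cring (QS S)"
proof (rule cringI)
  have add: "x \<oplus>\<^bsub>QS S\<^esub> y \<in> carrier (QS S)" if "x \<in> carrier (QS S)" "y \<in> carrier (QS S)" for x y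
    unfolding QS_simps(5) using that QS_component
    by (intro QS_I abelian_monoid.a_closed abelian_group.axioms Qp_abelian_group_S) auto
  have mult: "x \<otimes>\<^bsub>QS S\<^esub> y \<in> carrier (QS S)" if "x \<in> carrier (QS S)" "y \<in> carrier (QS S)" for x y
    unfolding QS_simps(2) using that QS_component
    by (intro QS_I monoid.m_closed ring.is_monoid Qp_ring_S) auto
  have zero: "\<zero>\<^bsub>QS S\<^esub> \<in> carrier (QS S)"
    unfolding QS_simps(4) by (intro QS_I abelian_monoid.zero_closed abelian_group.axioms Qp_abelian_group_S)
  have one: "\<one>\<^bsub>QS S\<^esub> \<in> carrier (QS S)"
    unfolding QS_simps(3) by (intro QS_I monoid.one_closed ring.is_monoid Qp_ring_S)
  show "abelian_group (QS S)"
  proof (rule abelian_groupI)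
    fix x y z assume xyz: "x \<in> carrier (QS S)" "y \<in> carrier (QS S)" "z \<in> carrier (QS S)"
    note c = xyz[THEN QS_component]
    show "x \<oplus>\<^bsub>QS S\<^esub> y \<oplus>\<^bsub>QS S\<^esub> z = x \<oplus>\<^bsub>QS S\<^esub> (y \<oplus>\<^bsub>QS S\<^esub> z)"
    proof (rule QS_eqI)
      fix p assume p: "p \<in> S"
      interpret cring "Qp p" by (rule Qp_cring_S[OF p])
      show "(x \<oplus>\<^bsub>QS S\<^esub> y \<oplus>\<^bsub>QS S\<^esub> z) p = (x \<oplus>\<^bsub>QS S\<^esub> (y \<oplus>\<^bsub>QS S\<^esub> z)) p"
        using c[OF p] p by (simp add: QS_simps a_assoc)
    qed (intro add xyz)+
    show "x \<oplus>\<^bsub>QS S\<^esub> y = y \<oplus>\<^bsub>QS S\<^esub> x"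
    proof (rule QS_eqI)
      fix p assume p: "p \<in> S"
      interpret cring "Qp p" by (rule Qp_cring_S[OF p])
      show "(x \<oplus>\<^bsub>QS S\<^esub> y) p = (y \<oplus>\<^bsub>QS S\<^esub> x) p"
        using c[OF p] p by (simp add: QS_simps a_comm)
    qed (intro add xyz)+
    show "\<zero>\<^bsub>QS S\<^esub> \<oplus>\<^bsub>QS S\<^esub> x = x"
    proof (rule QS_eqI)
      fix p assume p: "p \<in> S"
      interpret cring "Qp p" by (rule Qp_cring_S[OF p])
      show "(\<zero>\<^bsub>QS S\<^esub> \<oplus>\<^bsub>QS S\<^esub> x) p = x p" using c[OF p] p by (simp add: QS_simps)
    qed (intro add xyz zero)+
    show "\<exists>y\<in>carrier (QS S). y \<oplus>\<^bsub>QS S\<^esub> x = \<zero>\<^bsub>QS S\<^esub>"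
    proof (intro bexI QS_eqI)
      show inv: "(\<lambda>p\<in>S. \<ominus>\<^bsub>Qp p\<^esub> x p) \<in> carrier (QS S)"
        using c(1) by (intro QS_I abelian_group.a_inv_closed Qp_abelian_group_S) auto
      fix p assume p: "p \<in> S"
      interpret cring "Qp p" by (rule Qp_cring_S[OF p])
      show "((\<lambda>p\<in>S. \<ominus>\<^bsub>Qp p\<^esub> x p) \<oplus>\<^bsub>QS S\<^esub> x) p = \<zero>\<^bsub>QS S\<^esub> p"
        using c[OF p] p by (simp add: QS_simps l_neg)
    next
      have inv: "(\<lambda>p\<in>S. \<ominus>\<^bsub>Qp p\<^esub> x p) \<in> carrier (QS S)"
        using c(1) by (intro QS_I abelian_group.a_inv_closed Qp_abelian_group_S) auto
      show "(\<lambda>p\<in>S. \<ominus>\<^bsub>Qp p\<^esub> x p) \<oplus>\<^bsub>QS S\<^esub> x \<in> carrier (QS S)" by (intro add inv xyz)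
    qed (rule zero)
  qed (auto intro: add zero)
  show "comm_monoid (QS S)"
  proof (rule comm_monoidI)
    fix x y z assume xyz: "x \<in> carrier (QS S)" "y \<in> carrier (QS S)" "z \<in> carrier (QS S)"
    note c = xyz[THEN QS_component]
    show "x \<otimes>\<^bsub>QS S\<^esub> y \<otimes>\<^bsub>QS S\<^esub> z = x \<otimes>\<^bsub>QS S\<^esub> (y \<otimes>\<^bsub>QS S\<^esub> z)"
    proof (rule QS_eqI)
      fix p assume p: "p \<in> S"
      interpret cring "Qp p" by (rule Qp_cring_S[OF p])
      show "(x \<otimes>\<^bsub>QS S\<^esub> y \<otimes>\<^bsub>QS S\<^esub> z) p = (x \<otimes>\<^bsub>QS S\<^esub> (y \<otimes>\<^bsub>QS S\<^esub> z)) p"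
        using c[OF p] p by (simp add: QS_simps m_assoc)
    qed (intro mult xyz)+
    show "x \<otimes>\<^bsub>QS S\<^esub> y = y \<otimes>\<^bsub>QS S\<^esub> x"
    proof (rule QS_eqI)
      fix p assume p: "p \<in> S"
      interpret cring "Qp p" by (rule Qp_cring_S[OF p])
      show "(x \<otimes>\<^bsub>QS S\<^esub> y) p = (y \<otimes>\<^bsub>QS S\<^esub> x) p"
        using c[OF p] p by (simp add: QS_simps m_comm)
    qed (intro mult xyz)+
    show "\<one>\<^bsub>QS S\<^esub> \<otimes>\<^bsub>QS S\<^esub> x = x"
    proof (rule QS_eqI)
      fix p assume p: "p \<in> S"
      interpret cring "Qp p" by (rule Qp_cring_S[OF p])
      show "(\<one>\<^bsub>QS S\<^esub> \<otimes>\<^bsub>QS S\<^esub> x) p = x p" using c[OF p] p by (simp add: QS_simps)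
    qed (intro mult xyz one)+
  qed (auto intro: mult one)
  fix x y z assume xyz: "x \<in> carrier (QS S)" "y \<in> carrier (QS S)" "z \<in> carrier (QS S)"
  note c = xyz[THEN QS_component]
  show "(x \<oplus>\<^bsub>QS S\<^esub> y) \<otimes>\<^bsub>QS S\<^esub> z = x \<otimes>\<^bsub>QS S\<^esub> z \<oplus>\<^bsub>QS S\<^esub> y \<otimes>\<^bsub>QS S\<^esub> z"
  proof (rule QS_eqI)
    fix p assume p: "p \<in> S"
    interpret cring "Qp p" by (rule Qp_cring_S[OF p])
    show "((x \<oplus>\<^bsub>QS S\<^esub> y) \<otimes>\<^bsub>QS S\<^esub> z) p = (x \<otimes>\<^bsub>QS S\<^esub> z \<oplus>\<^bsub>QS S\<^esub> y \<otimes>\<^bsub>QS S\<^esub> z) p"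
      using c[OF p] p by (simp add: QS_simps l_distr)
  qed (intro add mult xyz)+
qed

sublocale QS: cring "QS S"
  by (rule QS_cring)

lemma QS_uminus: "x \<in> carrier (QS S) \<Longrightarrow> p \<in> S \<Longrightarrow> (\<ominus>\<^bsub>QS S\<^esub> x) p = \<ominus>\<^bsub>Qp p\<^esub> x p"
proof -
  assume x: "x \<in> carrier (QS S)" and p: "p \<in> S"
  interpret cring "Qp p" by (rule Qp_cring_S[OF p])
  have "(\<ominus>\<^bsub>QS S\<^esub> x) p \<oplus>\<^bsub>Qp p\<^esub> x p = (\<ominus>\<^bsub>QS S\<^esub> x \<oplus>\<^bsub>QS S\<^esub> x) p" using p by (simp add: QS_simps)
  also have "\<dots> = \<zero>\<^bsub>Qp p\<^esub>" using x p by (simp add: QS.l_neg QS_simps(4))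
  finally show ?thesis using x p by (intro minus_equality[symmetric]) (auto intro: QS_component)
qed

lemma QS_minus: "x \<in> carrier (QS S) \<Longrightarrow> y \<in> carrier (QS S) \<Longrightarrow> p \<in> S \<Longrightarrow>
    (x \<ominus>\<^bsub>QS S\<^esub> y) p = x p \<ominus>\<^bsub>Qp p\<^esub> y p"
  using QS_uminus[of y p] by (simp add: a_minus_def QS_simps(5))

lemma QS_mult: "p \<in> S \<Longrightarrow> (x \<otimes>\<^bsub>QS S\<^esub> y) p = x p \<otimes>\<^bsub>Qp p\<^esub> y p"
  by (simp add: QS_simps)

lemma QS_add: "p \<in> S \<Longrightarrow> (x \<oplus>\<^bsub>QS S\<^esub> y) p = x p \<oplus>\<^bsub>Qp p\<^esub> y p"
  by (simp add: QS_simps)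

lemma QS_zero: "p \<in> S \<Longrightarrow> \<zero>\<^bsub>QS S\<^esub> p = \<zero>\<^bsub>Qp p\<^esub>"
  by (simp add: QS_simps)

lemma rat_to_QS_closed [simp]: "rat_to_QS S r \<in> carrier (QS S)"
  unfolding rat_to_QS_def by (intro QS_I) (rule padic.rat_closed[OF padic_S])

lemma rat_to_QS_component: "p \<in> S \<Longrightarrow> rat_to_QS S r p = rat_to_Qp p r"
  by (simp add: rat_to_QS_def)

section \<open>Enumeration of the prime powers, exponents and radii\<close>

definition prime_powers :: "nat set" where
  "prime_powers = {p ^ l | p l. p \<in> S \<and> l \<ge> 1}"

lemma prime_power_base_unique:
  assumes "p \<in> S" "q \<in> S" "l \<ge> 1" "m \<ge> 1" "p ^ l = q ^ m"
  shows "p = q"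
proof -
  have "p dvd q ^ m" using assms(3) by (simp add: assms(5)[symmetric])
  then have "p dvd q" using prime_S[OF assms(1)] prime_dvd_power by blast
  then show ?thesis using primes_dvd_imp_eq prime_S assms(1,2) by blast
qed

lemma infinite_prime_powers: "infinite prime_powers"
proof -
  obtain p where p: "p \<in> S" using S_nonempty by blast
  then have "p > 1" using prime_S prime_gt_1_nat by blast
  then have "inj (\<lambda>l. p ^ Suc l)" by (auto intro!: injI)
  then have inf: "infinite (range (\<lambda>l. p ^ Suc l))" using range_inj_infinite by blast
  have "p ^ Suc l \<in> prime_powers" for l
    using p unfolding prime_powers_def by (intro CollectI exI[of _ p] exI[of _ "Suc l"]) simp
  then have "range (\<lambda>l. p ^ Suc l) \<subseteq> prime_powers" by blast
  then show ?thesis using inf infinite_super by blast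
qed

lemma pk_eqI: "p \<in> S \<Longrightarrow> l \<ge> 1 \<Longrightarrow> qk S k = p ^ l \<Longrightarrow> pk S k = p"
  unfolding pk_def using prime_power_base_unique by (intro the_equality) auto

lemma qk_prime_power: "qk S k \<in> prime_powers"
  unfolding qk_def prime_powers_def[symmetric] using infinite_prime_powers by (rule enumerate_in_set)

lemma pk_in_S: "pk S k \<in> S"
  using qk_prime_power[of k] pk_eqI[of _ _ k] by (auto simp: prime_powers_def)

lemma pk_infinitely_often:
  assumes p: "p \<in> S" and l: "l \<ge> 1"
  shows "\<exists>k\<ge>1. qk S k = p ^ l \<and> pk S k = p"
proof -
  have "p ^ l \<in> prime_powers" using p l unfolding prime_powers_def by blast
  then obtain n where n: "enumerate prime_powers n = p ^ l"
    using enumerate_Ex[OF infinite_prime_powers] by metis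
  then have "qk S (Suc n) = p ^ l" by (simp add: qk_def prime_powers_def)
  then show ?thesis using pk_eqI[OF p l] by (intro exI[of _ "Suc n"]) auto
qed

definition count_pk :: "nat \<Rightarrow> nat \<Rightarrow> nat" where
  "count_pk p n = card {k \<in> {1..n}. pk S k = p}"

text \<open>For p in S, the p-adic valuation of the rational number \<open>exp (psi S n)\<close>:
  the number of indices up to n whose prime is p, extended as an odd function. Thus
  \<open>Bn S n\<close> has radius \<open>p powi exponent p n\<close> in the component p.\<close>

definition exponent :: "nat \<Rightarrow> int \<Rightarrow> int" where
  "exponent p n = (if n \<ge> 0 then int (count_pk p (nat n)) else - int (count_pk p (nat (- n))))"

text \<open>The index of \<open>Bn S (n - 1)\<close> in \<open>Bn S n\<close>. For
  \<open>n \<le> 0\<close> the increment from \<open>n - 1\<close> to \<open>n\<close> mirrors the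
  one from \<open>- n\<close> to \<open>1 - n\<close>, hence the shifted argument.\<close>

definition step_prime :: "int \<Rightarrow> nat" where
  "step_prime n = (if n \<ge> 1 then pk S (nat n) else pk S (nat (1 - n)))"

lemma count_pk_Suc: "count_pk p (Suc n) = count_pk p n + (if pk S (Suc n) = p then 1 else 0)"
proof -
  have "{k \<in> {1..Suc n}. pk S k = p}
      = (if pk S (Suc n) = p then insert (Suc n) {k \<in> {1..n}. pk S k = p} else {k \<in> {1..n}. pk S k = p})"
    by (auto simp: le_Suc_eq)
  then show ?thesis by (simp add: count_pk_def)
qed

lemma exponent_uminus: "exponent p (- n) = - exponent p n"
  by (auto simp: exponent_def count_pk_def)

lemma exponent_step: "exponent p n = exponent p (n - 1) + (if step_prime n = p then 1 else 0)"
proof (cases "n \<ge> 1")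
  case True
  then have "nat n = Suc (nat (n - 1))" by simp
  then show ?thesis using True count_pk_Suc[of p "nat (n - 1)"] by (simp add: exponent_def step_prime_def)
next
  case False
  then have *: "nat (1 - n) = Suc (nat (- n))" by simp
  show ?thesis
    using False count_pk_Suc[of p "nat (- n)"] exponent_uminus[of p "- n"] exponent_uminus[of p "1 - n"]
    by (simp add: exponent_def step_prime_def *)
qed

lemma step_prime_in_S: "step_prime n \<in> S"
  by (simp add: step_prime_def pk_in_S)

lemma exponent_mono:
  assumes "m \<le> n"
  shows "exponent p m \<le> exponent p n"
  using assms
proof (induction n rule: int_ge_induct)
  case (step i)
  then show ?case using exponent_step[of p "i + 1"] by (simp split: if_splits)
qed simp

text \<open>The first L powers of p occupy L different places in the enumeration, none of them
  beyond the sum of their indices.\<close>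

lemma count_pk_large:
  assumes p: "p \<in> S"
  shows "\<exists>n. count_pk p n \<ge> L"
proof -
  obtain k where k: "\<And>l. l \<ge> 1 \<Longrightarrow> k l \<ge> 1 \<and> qk S (k l) = p ^ l \<and> pk S (k l) = p"
    using pk_infinitely_often[OF p] by metis
  have p1: "p > 1" using prime_S[OF p] prime_gt_1_nat by blast
  have inj: "inj_on k {1..L}"
  proof (rule inj_onI)
    fix l m assume "l \<in> {1..L}" "m \<in> {1..L}" "k l = k m"
    then have "p ^ l = p ^ m" using k[of l] k[of m] by simp
    then show "l = m" using p1 by simp
  qed
  define n where "n = (\<Sum>l\<in>{1..L}. k l)"
  have "k ` {1..L} \<subseteq> {j \<in> {1..n}. pk S j = p}"
  proof (rule image_subsetI)
    fix l assume l: "l \<in> {1..L}"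
    have "k l \<le> n" unfolding n_def using l by (intro member_le_sum) auto
    then show "k l \<in> {j \<in> {1..n}. pk S j = p}" using k[of l] l by simp
  qed
  then have "card (k ` {1..L}) \<le> count_pk p n" unfolding count_pk_def by (intro card_mono) auto
  then show ?thesis using inj by (intro exI[of _ n]) (simp add: card_image)
qed

text \<open>All radii grow simultaneously, since S is finite and the exponents are monotone. At n
  this shows that the balls cover; at \<open>- n\<close>, that they shrink to 0 and form a
  neighbourhood base.\<close>

lemma exponent_large: "\<exists>n\<ge>0. \<forall>p\<in>S. exponent p n \<ge> int L"
proof -
  have "\<forall>p\<in>S. \<exists>n. count_pk p n \<ge> L" using count_pk_large by blast
  from bchoice[OF this] obtain N where N: "\<And>p. p \<in> S \<Longrightarrow> count_pk p (N p) \<ge> L" by blast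
  define n where "n = (\<Sum>p\<in>S. N p)"
  have "exponent p (int n) \<ge> int L" if p: "p \<in> S" for p
  proof -
    have "N p \<le> n" unfolding n_def using finite_S p by (intro member_le_sum) auto
    then have "exponent p (int (N p)) \<le> exponent p (int n)" by (intro exponent_mono) simp
    then show ?thesis using N[OF p] by (simp add: exponent_def)
  qed
  then show ?thesis by (intro exI[of _ "int n"]) auto
qed

lemma exponent_zero: "exponent p 0 = 0"
  by (simp add: exponent_def count_pk_def)

text \<open>Both the Haar measure of \<open>Bn S n\<close> and the value of the norm on
  \<open>Bn S n\<close> outside \<open>Bn S (n - 1)\<close>.\<close>

definition w :: "int \<Rightarrow> real" where
  "w n = exp (psi S n)"

lemma psi_uminus: "psi S (- n) = - psi S n"
  by (simp add: psi_def)

lemma pk_gt_1: "real (pk S k) > 1"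
  using prime_gt_1_nat[OF prime_S[OF pk_in_S]] by simp

lemma w_pos: "w n > 0"
  by (simp add: w_def)

lemma w_dual: "w n * w (- n) = 1"
  by (simp add: w_def psi_uminus exp_minus)

lemma w_zero: "w 0 = 1"
  by (simp add: w_def psi_def)

lemma w_step: "w n = real (step_prime n) * w (n - 1)"
proof (cases "n \<ge> 1")
  case True
  then have n: "nat n = Suc (nat (n - 1))" by simp
  have "psi S n = psi S (n - 1) + ln (real (pk S (nat n)))"
    using True by (simp add: psi_def n)
  then show ?thesis using True pk_gt_1[of "nat n"] by (simp add: w_def exp_add step_prime_def)
next
  case False
  then have n: "nat (1 - n) = Suc (nat (- n))" by simp
  have "psi S (1 - n) = psi S (- n) + ln (real (pk S (nat (1 - n))))"
    using False by (simp add: psi_def n)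
  then have "psi S n = psi S (n - 1) + ln (real (pk S (nat (1 - n))))"
    using psi_uminus[of n] psi_uminus[of "n - 1"] by simp
  then show ?thesis using False pk_gt_1[of "nat (1 - n)"] by (simp add: w_def exp_add step_prime_def)
qed

lemma step_prime_ge_2: "real (step_prime n) \<ge> 2"
  using prime_ge_2_nat[OF prime_S[OF step_prime_in_S]] by simp

lemma w_double: "2 * w (n - 1) \<le> w n"
  unfolding w_step[of n] using step_prime_ge_2[of n] w_pos[of "n - 1"] by (intro mult_right_mono) auto

lemma w_mono: "m \<le> n \<Longrightarrow> w m \<le> w n"
proof (induction n rule: int_ge_induct)
  case (step i)
  then show ?case using w_double[of "i + 1"] w_pos[of i] by simp
qed simp

lemma w_strict_mono: "m < n \<Longrightarrow> w m < w n"
  using w_mono[of m "n - 1"] w_double[of n] w_pos[of "n - 1"] by simp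

lemma w_le_iff: "w m \<le> w n \<longleftrightarrow> m \<le> n"
  using w_mono[of m n] w_strict_mono[of n m] by linarith

text \<open>Each step multiplies by a prime, hence at least by 2. This growth makes the series
  bounding the heat multiplier converge.\<close>

lemma w_ge_power: "w (int n) \<ge> 2 ^ n"
proof (induction n)
  case (Suc n)
  then show ?case using w_double[of "int (Suc n)"] by simp
qed (simp add: w_zero)

text \<open>The rational number equal to \<open>exp (psi S n)\<close>, with its prime factorization
  visible; it replaces the definite description in \<open>exp_psi_rat\<close>.\<close>

definition scale :: "int \<Rightarrow> rat" where
  "scale n = (\<Prod>p\<in>S. of_nat p powi exponent p n)"

lemma scale_nonzero: "scale n \<noteq> 0"
  using finite_S prime_S prime_gt_0_nat by (force simp: scale_def)

lemma of_rat_powi: "real_of_rat (r powi n) = real_of_rat r powi n"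
  by (cases n rule: int_cases2) (auto simp: power_int_minus of_rat_inverse of_rat_power)

lemma of_rat_scale: "real_of_rat (scale n) = (\<Prod>p\<in>S. real p powi exponent p n)"
  by (simp add: scale_def of_rat_prod of_rat_powi)

lemma w_eq_scale: "w n = real_of_rat (scale n)"
proof -
  have step: "real_of_rat (scale m) = real (step_prime m) * real_of_rat (scale (m - 1))" for m
  proof -
    have p0: "real p \<noteq> 0" if "p \<in> S" for p using prime_gt_0_nat[OF prime_S[OF that]] by simp
    have "real_of_rat (scale m) = (\<Prod>p\<in>S. real p powi exponent p (m - 1) * (if step_prime m = p then real p else 1))"
      unfolding of_rat_scale using p0 by (intro prod.cong) (auto simp: exponent_step[of _ m] power_int_add)
    also have "\<dots> = real_of_rat (scale (m - 1)) * (\<Prod>p\<in>S. if step_prime m = p then real p else 1)"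
      unfolding of_rat_scale by (rule prod.distrib)
    also have "(\<Prod>p\<in>S. if step_prime m = p then real p else 1) = real (step_prime m)"
      using finite_S step_prime_in_S by simp
    finally show ?thesis by simp
  qed
  show ?thesis
  proof (induction n rule: int_induct[where k = 0])
    case base
    then show ?case by (simp add: w_zero scale_def exponent_zero)
  next
    case (step1 i)
    then show ?case using w_step[of "i + 1"] step[of "i + 1"] by simp
  next
    case (step2 i)
    then show ?case using w_step[of i] step[of i] step_prime_ge_2[of i] by simp
  qed
qed

lemma exp_psi_rat_eq: "exp_psi_rat S n = scale n"
  unfolding exp_psi_rat_def using w_eq_scale[of n] by (intro the_equality) (simp_all add: w_def)

text \<open>Every other prime of S is a unit at p, so only the factor p counts.\<close>

lemma padic_abs_scale:
  assumes p: "p \<in> S"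
  shows "padic_abs_rat p (scale n) = real p powi (- exponent p n)"
proof -
  interpret padic p by (rule padic_S[OF p])
  have "padic_abs_rat p (scale n) = (\<Prod>q\<in>S. padic_abs_rat p (of_nat q) powi exponent q n)"
    by (simp add: scale_def A_prod A_power_int)
  also have "\<dots> = (\<Prod>q\<in>S. if q = p then real p powi (- exponent p n) else 1)"
    using A_other_prime prime_S by (intro prod.cong) (auto simp: A_p power_int_minus power_int_inverse)
  also have "\<dots> = real p powi (- exponent p n)" using finite_S p by simp
  finally show ?thesis .
qed

text \<open>Multiplication by \<open>scale n\<close> changes the absolute value in the component p
  by the exact factor \<open>p powi (- exponent p n)\<close>, so it maps \<open>Bn S n\<close> onto
  \<open>ZS S\<close>. From here on the balls are polydiscs, treated one component at a
  time.\<close>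

lemma Bn_eq: "Bn S n = {x \<in> carrier (QS S). \<forall>p\<in>S. padic_abs p (x p) \<le> real p powi exponent p n}"
proof -
  have pos: "real p > 0" if "p \<in> S" for p using prime_gt_0_nat[OF prime_S[OF that]] by simp
  show ?thesis
  proof (intro equalityI subsetI)
    fix x assume "x \<in> Bn S n"
    then obtain z where z: "z \<in> ZS S" and x: "x = rat_to_QS S (inverse (scale n)) \<otimes>\<^bsub>QS S\<^esub> z"
      by (auto simp: Bn_def exp_psi_rat_eq)
    have zc: "z \<in> carrier (QS S)" using z by (auto simp: ZS_def QS_simps Zp_def)
    have "padic_abs p (x p) \<le> real p powi exponent p n" if p: "p \<in> S" for p
    proof -
      interpret padic p by (rule padic_S[OF p])
      have zp: "z p \<in> carrier (Qp p)" "padic_abs p (z p) \<le> 1" using z p by (auto simp: ZS_def Zp_def)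
      have "padic_abs p (x p) = real p powi exponent p n * padic_abs p (z p)"
        using zp padic_abs_scale[OF p] by (simp add: x QS_mult p rat_to_QS_component abs_mult abs_rat A_inverse power_int_minus)
      also have "\<dots> \<le> real p powi exponent p n * 1" using zp pos[OF p] by (intro mult_left_mono) auto
      finally show ?thesis by simp
    qed
    moreover have "x \<in> carrier (QS S)" unfolding x using zc by simp
    ultimately show "x \<in> {x \<in> carrier (QS S). \<forall>p\<in>S. padic_abs p (x p) \<le> real p powi exponent p n}" by blast
  next
    fix x assume "x \<in> {x \<in> carrier (QS S). \<forall>p\<in>S. padic_abs p (x p) \<le> real p powi exponent p n}"
    then have xc: "x \<in> carrier (QS S)" and xp: "\<And>p. p \<in> S \<Longrightarrow> padic_abs p (x p) \<le> real p powi exponent p n" by auto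
    define z where "z = rat_to_QS S (scale n) \<otimes>\<^bsub>QS S\<^esub> x"
    have zc: "z \<in> carrier (QS S)" unfolding z_def using xc by simp
    have "z p \<in> Zp p" if p: "p \<in> S" for p
    proof -
      interpret padic p by (rule padic_S[OF p])
      have "padic_abs p (z p) = real p powi (- exponent p n) * padic_abs p (x p)"
        using QS_component[OF xc p] padic_abs_scale[OF p] by (simp add: z_def QS_mult p rat_to_QS_component abs_mult abs_rat)
      also have "\<dots> \<le> real p powi (- exponent p n) * real p powi exponent p n"
        using xp[OF p] pos[OF p] by (intro mult_left_mono) auto
      also have "\<dots> = 1" using pos[OF p] by (simp add: power_int_minus)
      finally show ?thesis using QS_component[OF zc p] by (simp add: Zp_def)
    qed
    then have "z \<in> ZS S" using zc by (auto simp: ZS_def QS_simps PiE_iff)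
    moreover have "x = rat_to_QS S (inverse (scale n)) \<otimes>\<^bsub>QS S\<^esub> z"
    proof (rule QS_eqI[OF xc])
      show "rat_to_QS S (inverse (scale n)) \<otimes>\<^bsub>QS S\<^esub> z \<in> carrier (QS S)" using zc by simp
      fix p assume p: "p \<in> S"
      interpret padic p by (rule padic_S[OF p])
      have "(rat_to_QS S (inverse (scale n)) \<otimes>\<^bsub>QS S\<^esub> z) p
          = (rat_to_Qp p (inverse (scale n)) \<otimes>\<^bsub>Qp p\<^esub> rat_to_Qp p (scale n)) \<otimes>\<^bsub>Qp p\<^esub> x p"
        using QS_component[OF xc p] by (simp add: z_def QS_mult p rat_to_QS_component Q.m_assoc)
      then show "x p = (rat_to_QS S (inverse (scale n)) \<otimes>\<^bsub>QS S\<^esub> z) p"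
        using QS_component[OF xc p] scale_nonzero[of n] by (simp add: rat_mult rat_one)
    qed
    ultimately show "x \<in> Bn S n" by (auto simp: Bn_def exp_psi_rat_eq)
  qed
qed

section \<open>The balls as a filtration by subgroups\<close>

lemma p_pos: "p \<in> S \<Longrightarrow> real p > 0"
  using prime_gt_0_nat[OF prime_S] by simp

lemma S_gt_1: "p \<in> S \<Longrightarrow> real p > 1"
  using prime_gt_1_nat[OF prime_S] by simp

lemma Bn_carrier: "Bn S n \<subseteq> carrier (QS S)"
  by (auto simp: Bn_eq)

lemma Bn_closed: "x \<in> Bn S n \<Longrightarrow> x \<in> carrier (QS S)"
  using Bn_carrier by blast

lemma Bn_zero: "\<zero>\<^bsub>QS S\<^esub> \<in> Bn S n"
proof -
  have "padic_abs p \<zero>\<^bsub>Qp p\<^esub> = 0" if "p \<in> S" for p using padic.abs_zero[OF padic_S[OF that]] .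
  then show ?thesis using p_pos by (auto simp: Bn_eq QS_zero less_imp_le)
qed

lemma Bn_minus:
  assumes "x \<in> Bn S n" "y \<in> Bn S n"
  shows "x \<ominus>\<^bsub>QS S\<^esub> y \<in> Bn S n"
proof -
  have c: "x \<in> carrier (QS S)" "y \<in> carrier (QS S)" using assms Bn_carrier by auto
  have "padic_abs p ((x \<ominus>\<^bsub>QS S\<^esub> y) p) \<le> real p powi exponent p n" if p: "p \<in> S" for p
    using order_trans[OF padic.abs_ultrametric_minus[OF padic_S[OF p] QS_component[OF c(1) p] QS_component[OF c(2) p]]
        max.boundedI] assms p
    by (auto simp: Bn_eq QS_minus[OF c p])
  then show ?thesis using c by (simp add: Bn_eq)
qed

lemma Bn_mono:
  assumes "m \<le> n"
  shows "Bn S m \<subseteq> Bn S n"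
proof -
  have "real p powi exponent p m \<le> real p powi exponent p n" if "p \<in> S" for p
    using exponent_mono[OF assms] S_gt_1[OF that] by (intro power_int_increasing) auto
  then show ?thesis unfolding Bn_eq by (auto intro: order_trans)
qed

lemma Bn_cover:
  assumes x: "x \<in> carrier (QS S)"
  shows "\<exists>n. x \<in> Bn S n"
proof -
  have "\<forall>p\<in>S. \<exists>L::nat. padic_abs p (x p) \<le> real p ^ L"
    using real_arch_pow[OF S_gt_1] less_imp_le by meson
  from bchoice[OF this] obtain L where L: "\<And>p. p \<in> S \<Longrightarrow> padic_abs p (x p) \<le> real p ^ L p" by blast
  \<comment> \<open>A single index serves all primes, the sum being an upper bound for every
    \<open>L p\<close>.\<close>
  obtain n where n: "\<And>p. p \<in> S \<Longrightarrow> exponent p n \<ge> int (\<Sum>p\<in>S. L p)" using exponent_large by blast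
  have "padic_abs p (x p) \<le> real p powi exponent p n" if p: "p \<in> S" for p
  proof -
    have "L p \<le> (\<Sum>p\<in>S. L p)" using finite_S p by (intro member_le_sum) auto
    then have "int (L p) \<le> exponent p n" using n[OF p] by linarith
    then have "real p powi int (L p) \<le> real p powi exponent p n"
      using S_gt_1[OF p] by (intro power_int_increasing) auto
    then show ?thesis using L[OF p] by simp
  qed
  then show ?thesis using x by (auto simp: Bn_eq)
qed

lemma Bn_separate:
  assumes x: "\<And>n. x \<in> Bn S n"
  shows "x = \<zero>\<^bsub>QS S\<^esub>"
proof (rule QS_eqI)
  show xc: "x \<in> carrier (QS S)" using x Bn_carrier by blast
  show "\<zero>\<^bsub>QS S\<^esub> \<in> carrier (QS S)" by simp
  fix p assume p: "p \<in> S"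
  interpret padic p by (rule padic_S[OF p])
  have "padic_abs p (x p) \<le> \<epsilon>" if e: "\<epsilon> > 0" for \<epsilon>
  proof -
    obtain L where L: "inverse (real p) ^ L < \<epsilon>"
      using real_arch_pow_inv[OF e, of "inverse (real p)"] S_gt_1[OF p]
      by (metis inverse_less_1_iff)
    obtain n where n: "exponent p n \<ge> int L" using exponent_large p by blast
    have "padic_abs p (x p) \<le> real p powi exponent p (- n)" using x[of "- n"] p by (simp add: Bn_eq)
    also have "\<dots> \<le> real p powi (- int L)"
      using n S_gt_1[OF p] by (intro power_int_increasing) (auto simp: exponent_uminus)
    also have "\<dots> < \<epsilon>" using L by (simp add: power_int_minus power_inverse)
    finally show ?thesis by simp
  qed
  then have "padic_abs p (x p) \<le> 0" by (rule field_le_epsilon) simp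
  then have "padic_abs p (x p) = 0" using abs_nonneg[OF QS_component[OF xc p]] by simp
  then show "x p = \<zero>\<^bsub>QS S\<^esub> p" using abs_eq_0 QS_component[OF xc p] p by (simp add: QS_zero)
qed

section \<open>Cosets of the balls and the Borel sets\<close>

definition QS_coset :: "padics \<Rightarrow> int \<Rightarrow> padics set" where
  "QS_coset a n = {x \<in> carrier (QS S). x \<ominus>\<^bsub>QS S\<^esub> a \<in> Bn S n}"

text \<open>The same family as \<open>cosets\<close> of the abstract group, repeated because it must
  be available before the hypotheses of that locale are verified: it describes the sets on which the
  Haar measure lives.\<close>

definition QS_cosets :: "padics set set" where
  "QS_cosets = {QS_coset a n | a n. a \<in> carrier (QS S)}"

lemma QS_coset_zero: "QS_coset \<zero>\<^bsub>QS S\<^esub> n = Bn S n"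
  by (auto simp: QS_coset_def a_minus_def Bn_closed)

lemma QS_coset_self: "a \<in> carrier (QS S) \<Longrightarrow> a \<in> QS_coset a n"
  by (simp add: QS_coset_def a_minus_def QS.r_neg Bn_zero)

lemma Bn_add:
  assumes "x \<in> Bn S n" "y \<in> Bn S n"
  shows "x \<oplus>\<^bsub>QS S\<^esub> y \<in> Bn S n"
proof -
  have c: "x \<in> carrier (QS S)" "y \<in> carrier (QS S)" using assms Bn_carrier by auto
  have "x \<ominus>\<^bsub>QS S\<^esub> (\<zero>\<^bsub>QS S\<^esub> \<ominus>\<^bsub>QS S\<^esub> y) \<in> Bn S n" using assms by (intro Bn_minus Bn_zero)
  then show ?thesis using c by (simp add: a_minus_def)
qed

lemma QS_coset_cong:
  assumes "a \<in> carrier (QS S)" "b \<in> carrier (QS S)" "a \<ominus>\<^bsub>QS S\<^esub> b \<in> Bn S n"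
  shows "QS_coset a n = QS_coset b n"
proof -
  have *: "QS_coset a n \<subseteq> QS_coset b n"
    if "a \<in> carrier (QS S)" "b \<in> carrier (QS S)" "a \<ominus>\<^bsub>QS S\<^esub> b \<in> Bn S n" for a b
  proof
    fix x assume "x \<in> QS_coset a n"
    then have x: "x \<in> carrier (QS S)" "x \<ominus>\<^bsub>QS S\<^esub> a \<in> Bn S n" by (auto simp: QS_coset_def)
    from Bn_add[OF x(2) that(3)] show "x \<in> QS_coset b n"
      using x(1) that by (simp add: QS_coset_def QS.minus_trans)
  qed
  have "b \<ominus>\<^bsub>QS S\<^esub> a \<in> Bn S n"
    using Bn_minus[OF Bn_zero assms(3)] assms(1,2) QS.minus_swap[of a b] by (simp add: a_minus_def[of _ "\<zero>\<^bsub>QS S\<^esub>"])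
  then show ?thesis using *[OF assms] *[of b a] assms by blast
qed

lemma QS_coset_PiE:
  assumes a: "a \<in> carrier (QS S)"
  shows "QS_coset a n = (\<Pi>\<^sub>E p\<in>S. {y \<in> carrier (Qp p). padic_abs p (y \<ominus>\<^bsub>Qp p\<^esub> a p) \<le> real p powi exponent p n})"
    (is "_ = ?P")
proof (intro equalityI subsetI)
  fix x assume x: "x \<in> QS_coset a n"
  then have xc: "x \<in> carrier (QS S)" and xB: "x \<ominus>\<^bsub>QS S\<^esub> a \<in> Bn S n" by (auto simp: QS_coset_def)
  show "x \<in> ?P"
  proof (rule PiE_I)
    fix p assume p: "p \<in> S"
    show "x p \<in> {y \<in> carrier (Qp p). padic_abs p (y \<ominus>\<^bsub>Qp p\<^esub> a p) \<le> real p powi exponent p n}"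
      using xB p QS_component[OF xc p] by (simp add: Bn_eq QS_minus[OF xc a p, symmetric])
  next
    show "x p = undefined" if "p \<notin> S" for p using xc that by (auto simp: QS_simps)
  qed
next
  fix x assume x: "x \<in> ?P"
  have xc: "x \<in> carrier (QS S)" using x by (auto simp: QS_simps PiE_iff)
  have "padic_abs p ((x \<ominus>\<^bsub>QS S\<^esub> a) p) \<le> real p powi exponent p n" if p: "p \<in> S" for p
    using PiE_mem[OF x p] by (simp add: QS_minus[OF xc a p])
  then show "x \<in> QS_coset a n" using xc a by (simp add: QS_coset_def Bn_eq)
qed

lemma topspace_QS: "topspace (QS_topology S) = carrier (QS S)"
  unfolding QS_topology_def topspace_product_topology QS_simps
  using padic.topspace_Qp[OF padic_S] by (intro PiE_cong) auto

lemma QS_coset_open: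
  assumes a: "a \<in> carrier (QS S)"
  shows "openin (QS_topology S) (QS_coset a n)"
  unfolding QS_topology_def openin_product_topology_alt
proof (intro ballI exI conjI)
  let ?U = "\<lambda>p. {y \<in> carrier (Qp p). padic_abs p (y \<ominus>\<^bsub>Qp p\<^esub> a p) \<le> real p powi exponent p n}"
  fix x assume x: "x \<in> QS_coset a n"
  show "finite {i \<in> S. ?U i \<noteq> topspace (Qp_topology i)}" using finite_S by simp
  show "openin (Qp_topology p) (?U p)" if p: "p \<in> S" for p
    using p_pos[OF p] by (intro padic.cball_open padic_S p QS_component[OF a p]) simp
  show "x \<in> Pi\<^sub>E S ?U" "Pi\<^sub>E S ?U \<subseteq> QS_coset a n" using x unfolding QS_coset_PiE[OF a] by auto
qed

text \<open>Each of the finitely many components asks for a radius below some power of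
  \<open>1/p\<close>; one sufficiently negative index makes all components of the ball that
  small.\<close>

lemma QS_open_contains_coset:
  assumes U: "openin (QS_topology S) U" and x: "x \<in> U"
  shows "\<exists>n. QS_coset x n \<subseteq> U"
proof -
  have xc: "x \<in> carrier (QS S)" using openin_subset[OF U] x topspace_QS by auto
  obtain V where V: "\<And>p. p \<in> S \<Longrightarrow> openin (Qp_topology p) (V p)" "x \<in> Pi\<^sub>E S V" "Pi\<^sub>E S V \<subseteq> U"
    using U x unfolding QS_topology_def openin_product_topology_alt by meson
  have "\<forall>p\<in>S. \<exists>L::nat. \<forall>y\<in>carrier (Qp p). padic_abs p (y \<ominus>\<^bsub>Qp p\<^esub> x p) \<le> inverse (real p) ^ L \<longrightarrow> y \<in> V p"
  proof
    fix p assume p: "p \<in> S"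
    interpret padic p by (rule padic_S[OF p])
    obtain r where r: "r > 0" "\<And>y. y \<in> carrier (Qp p) \<Longrightarrow> padic_abs p (y \<ominus>\<^bsub>Qp p\<^esub> x p) < r \<Longrightarrow> y \<in> V p"
      using V(1)[OF p] PiE_mem[OF V(2) p] unfolding openin_Qp_iff by blast
    obtain L where "inverse (real p) ^ L < r"
      using real_arch_pow_inv[OF r(1), of "inverse (real p)"] S_gt_1[OF p] by (auto simp: inverse_less_1_iff)
    then show "\<exists>L::nat. \<forall>y\<in>carrier (Qp p). padic_abs p (y \<ominus>\<^bsub>Qp p\<^esub> x p) \<le> inverse (real p) ^ L \<longrightarrow> y \<in> V p"
      using r(2) by (intro exI[of _ L]) auto
  qed
  from bchoice[OF this] obtain L where
    L: "\<And>p y. p \<in> S \<Longrightarrow> y \<in> carrier (Qp p) \<Longrightarrow> padic_abs p (y \<ominus>\<^bsub>Qp p\<^esub> x p) \<le> inverse (real p) ^ L p \<Longrightarrow> y \<in> V p"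
    by blast
  obtain n where n: "\<And>p. p \<in> S \<Longrightarrow> exponent p n \<ge> int (\<Sum>p\<in>S. L p)" using exponent_large by blast
  have le: "real p powi exponent p (- n) \<le> inverse (real p) ^ L p" if p: "p \<in> S" for p
  proof -
    have "L p \<le> (\<Sum>p\<in>S. L p)" using finite_S p by (intro member_le_sum) auto
    then have "exponent p (- n) \<le> - int (L p)" using n[OF p] exponent_uminus[of p n] by linarith
    then have "real p powi exponent p (- n) \<le> real p powi (- int (L p))"
      using S_gt_1[OF p] by (intro power_int_increasing) auto
    then show ?thesis by (simp add: power_int_minus power_inverse)
  qed
  have "QS_coset x (- n) \<subseteq> Pi\<^sub>E S V"
    unfolding QS_coset_PiE[OF xc] 
  proof (rule PiE_mono, rule subsetI)
    fix p y assume p: "p \<in> S"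
      and "y \<in> {y \<in> carrier (Qp p). padic_abs p (y \<ominus>\<^bsub>Qp p\<^esub> x p) \<le> real p powi exponent p (- n)}"
    then have y: "y \<in> carrier (Qp p)" "padic_abs p (y \<ominus>\<^bsub>Qp p\<^esub> x p) \<le> real p powi exponent p (- n)"
      by auto
    show "y \<in> V p" by (rule L[OF p y(1) order_trans[OF y(2) le[OF p]]])
  qed
  from subset_trans[OF this V(3)] show ?thesis by (rule exI[of _ "- n"])
qed

text \<open>Every coset has a center with rational components: the rationals are dense in each
  factor, and moving the center inside the ball does not change the coset. The rational may vary
  with p, so density in each factor suffices.\<close>

lemma countable_QS_cosets: "countable QS_cosets"
proof -
  define r where "r f = (\<lambda>p\<in>S. rat_to_Qp p (f p))" for f :: "nat \<Rightarrow> rat"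
  have rc: "r f \<in> carrier (QS S)" for f
    unfolding r_def by (intro QS_I) (rule padic.rat_closed[OF padic_S])
  have "QS_cosets \<subseteq> (\<lambda>(f, n). QS_coset (r f) n) ` ((\<Pi>\<^sub>E p\<in>S. UNIV) \<times> UNIV)"
  proof
    fix C assume "C \<in> QS_cosets"
    then obtain a n where a: "a \<in> carrier (QS S)" and C: "C = QS_coset a n" by (auto simp: QS_cosets_def)
    have "\<forall>p\<in>S. \<exists>s. padic_abs p (a p \<ominus>\<^bsub>Qp p\<^esub> rat_to_Qp p s) \<le> real p powi exponent p n"
    proof
      fix p assume p: "p \<in> S"
      show "\<exists>s. padic_abs p (a p \<ominus>\<^bsub>Qp p\<^esub> rat_to_Qp p s) \<le> real p powi exponent p n"
        using padic.rat_dense[OF padic_S[OF p] QS_component[OF a p], of "real p powi exponent p n"] p_pos[OF p]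
        by auto
    qed
    from bchoice[OF this] obtain s where
      s: "\<And>p. p \<in> S \<Longrightarrow> padic_abs p (a p \<ominus>\<^bsub>Qp p\<^esub> rat_to_Qp p (s p)) \<le> real p powi exponent p n" by blast
    define f where "f = restrict s S"
    have "a \<ominus>\<^bsub>QS S\<^esub> r f \<in> Bn S n"
      using s a rc by (auto simp: Bn_eq QS_minus f_def r_def)
    then have "C = QS_coset (r f) n" unfolding C by (intro QS_coset_cong a rc)
    moreover have "f \<in> (\<Pi>\<^sub>E p\<in>S. UNIV)" by (simp add: f_def)
    ultimately show "C \<in> (\<lambda>(f, n). QS_coset (r f) n) ` ((\<Pi>\<^sub>E p\<in>S. UNIV) \<times> UNIV)" by auto
  qed
  moreover have "countable ((\<lambda>(f, n). QS_coset (r f) n) ` ((\<Pi>\<^sub>E p\<in>S. (UNIV :: rat set)) \<times> (UNIV :: int set)))"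
    using finite_S by (intro countable_image countable_SIGMA countable_PiE) auto
  ultimately show ?thesis by (rule countable_subset)
qed

text \<open>Open sets are unions of cosets, countable ones because there are only countably many
  cosets. This turns the topological description of the measurable sets into the one the abstract
  group expects.\<close>

lemma borel_QS: "sigma_sets (topspace (QS_topology S)) {U. openin (QS_topology S) U} = sigma_sets (carrier (QS S)) QS_cosets"
proof -
  have "U \<in> sigma_sets (carrier (QS S)) QS_cosets" if U: "openin (QS_topology S) U" for U
  proof -
    define G where "G = {C \<in> QS_cosets. C \<subseteq> U}"
    have "U = \<Union>G"
    proof
      show "U \<subseteq> \<Union>G"
      proof
        fix x assume x: "x \<in> U"
        have xc: "x \<in> carrier (QS S)" using openin_subset[OF U] x topspace_QS by auto
        obtain n where "QS_coset x n \<subseteq> U" using QS_open_contains_coset[OF U x] by blast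
        then have "QS_coset x n \<in> G" using xc by (auto simp: G_def QS_cosets_def)
        then show "x \<in> \<Union>G" using QS_coset_self[OF xc] by blast
      qed
    qed (auto simp: G_def)
    moreover have "countable G" using countable_QS_cosets by (rule countable_subset[rotated]) (auto simp: G_def)
    moreover have "G \<subseteq> sigma_sets (carrier (QS S)) QS_cosets" by (auto simp: G_def)
    ultimately show ?thesis
      using sigma_sets_UNION[of G "carrier (QS S)" QS_cosets] by auto
  qed
  moreover have "C \<in> sigma_sets (carrier (QS S)) {U. openin (QS_topology S) U}" if "C \<in> QS_cosets" for C
    using that QS_coset_open by (auto simp: QS_cosets_def)
  ultimately show ?thesis unfolding topspace_QS
    by (intro sigma_sets_eqI) auto
qed

section \<open>Splitting a ball into translates of the next smaller one\<close>

lemma QS_coset_translate: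
  assumes a: "a \<in> carrier (QS S)"
  shows "QS_coset a n = (\<lambda>x. a \<oplus>\<^bsub>QS S\<^esub> x) ` Bn S n"
proof (intro equalityI subsetI)
  fix x assume "x \<in> QS_coset a n"
  then have x: "x \<in> carrier (QS S)" "x \<ominus>\<^bsub>QS S\<^esub> a \<in> Bn S n" by (auto simp: QS_coset_def)
  have "a \<oplus>\<^bsub>QS S\<^esub> (x \<ominus>\<^bsub>QS S\<^esub> a) = x" using a x(1) by (rule QS.add_minus_cancel)
  then show "x \<in> (\<lambda>x. a \<oplus>\<^bsub>QS S\<^esub> x) ` Bn S n" using x(2) by (metis image_eqI)
next
  fix x assume "x \<in> (\<lambda>x. a \<oplus>\<^bsub>QS S\<^esub> x) ` Bn S n"
  then obtain b where b: "b \<in> Bn S n" "x = a \<oplus>\<^bsub>QS S\<^esub> b" by blast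
  have bc: "b \<in> carrier (QS S)" using b Bn_carrier by blast
  have "(a \<oplus>\<^bsub>QS S\<^esub> b) \<ominus>\<^bsub>QS S\<^esub> a = b" using a bc by (rule QS.add_minus_left)
  then show "x \<in> QS_coset a n" using a b bc by (simp add: QS_coset_def)
qed

text \<open>The multiples \<open>j * exp (- psi S n)\<close>; those with
  \<open>j < step_prime n\<close> represent the cosets of \<open>Bn S (n - 1)\<close> in
  \<open>Bn S n\<close>.\<close>

definition coset_rep :: "int \<Rightarrow> nat \<Rightarrow> padics" where
  "coset_rep n j = rat_to_QS S (of_nat j * inverse (scale n))"

lemma coset_rep_closed: "coset_rep n j \<in> carrier (QS S)"
  by (simp add: coset_rep_def)

lemma coset_rep_component: "p \<in> S \<Longrightarrow> coset_rep n j p = rat_to_Qp p (of_nat j * inverse (scale n))"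
  by (simp add: coset_rep_def rat_to_QS_component)

lemma abs_inverse_scale: "p \<in> S \<Longrightarrow> padic_abs_rat p (inverse (scale n)) = real p powi exponent p n"
  using padic.A_inverse[OF padic_S] padic_abs_scale by (simp add: power_int_minus)

lemma coset_rep_Bn: "coset_rep n j \<in> Bn S n"
proof -
  have "padic_abs p (coset_rep n j p) \<le> real p powi exponent p n" if p: "p \<in> S" for p
  proof -
    interpret padic p by (rule padic_S[OF p])
    have "padic_abs p (coset_rep n j p) = padic_abs_rat p (of_nat j) * real p powi exponent p n"
      by (simp add: coset_rep_component p abs_rat A_mult abs_inverse_scale)
    also have "\<dots> \<le> 1 * real p powi exponent p n"
      using A_of_nat_le_1 p_pos[OF p] by (intro mult_right_mono) auto
    finally show ?thesis by simp
  qed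
  then show ?thesis using coset_rep_closed by (simp add: Bn_eq)
qed

text \<open>Only the component at \<open>q = step_prime n\<close> shrinks between the two balls; in
  all others every element of \<open>Bn S n\<close> is already small enough. In the component q, the
  residue modulo q of a rational approximation, scaled to be q-integral, selects
  \<open>j\<close>.\<close>

lemma Bn_decomposition: "Bn S n = (\<Union>j<step_prime n. QS_coset (coset_rep n j) (n - 1))"
proof (intro equalityI subsetI)
  fix x assume "x \<in> (\<Union>j<step_prime n. QS_coset (coset_rep n j) (n - 1))"
  then obtain j where j: "x \<in> carrier (QS S)" "x \<ominus>\<^bsub>QS S\<^esub> coset_rep n j \<in> Bn S (n - 1)"
    by (auto simp: QS_coset_def)
  have "(x \<ominus>\<^bsub>QS S\<^esub> coset_rep n j) \<oplus>\<^bsub>QS S\<^esub> coset_rep n j \<in> Bn S n"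
    using j(2) Bn_mono[of "n - 1" n] by (intro Bn_add coset_rep_Bn) auto
  then show "x \<in> Bn S n" using j(1) coset_rep_closed by (simp add: a_minus_def QS.a_assoc QS.l_neg)
next
  fix x assume x: "x \<in> Bn S n"
  then have xc: "x \<in> carrier (QS S)" using Bn_carrier by blast
  define q where "q = step_prime n"
  have q: "q \<in> S" by (simp add: q_def step_prime_in_S)
  interpret padic q by (rule padic_S[OF q])
  define \<rho> where "\<rho> = real q powi exponent q n"
  have \<rho>: "\<rho> > 0" using p_pos[OF q] by (simp add: \<rho>_def)
  have \<rho>': "real q powi exponent q (n - 1) = \<rho> * inverse (real q)"
    using exponent_step[of q n] p_pos[OF q] by (simp add: \<rho>_def q_def[symmetric] power_int_add)
  have xq: "x q \<in> carrier (Qp q)" "padic_abs q (x q) \<le> \<rho>"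
    using QS_component[OF xc q] x q by (auto simp: Bn_eq \<rho>_def)
  have "\<rho> * inverse (real q) > 0" using \<rho> p_pos[OF q] by simp
  \<comment> \<open>The rational \<open>s\<close> is taken within the radius of the smaller ball, so
    it determines the same coset as \<open>x q\<close>.\<close>
  then obtain s where s: "padic_abs q (x q \<ominus>\<^bsub>Qp q\<^esub> rat_to_Qp q s) \<le> \<rho> * inverse (real q)"
    using rat_dense[OF xq(1)] by blast
  have q1: "inverse (real q) \<le> 1" using S_gt_1[OF q] by (simp add: inverse_le_1_iff)
  have "padic_abs_rat q s = padic_abs q (x q \<ominus>\<^bsub>Qp q\<^esub> (x q \<ominus>\<^bsub>Qp q\<^esub> rat_to_Qp q s))"
    using Q.minus_minus_cancel[OF xq(1) rat_closed[of s] Q.zero_closed] xq(1)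
    by (simp add: a_minus_def abs_rat[symmetric])
  also have "\<dots> \<le> max (padic_abs q (x q)) (padic_abs q (x q \<ominus>\<^bsub>Qp q\<^esub> rat_to_Qp q s))"
    using xq by (intro abs_ultrametric_minus) auto
  also have "\<dots> \<le> \<rho>"
  proof -
    have "\<rho> * inverse (real q) \<le> \<rho> * 1" using q1 \<rho> by (intro mult_left_mono) auto
    then show ?thesis using xq(2) s by simp
  qed
  finally have "padic_abs_rat q s \<le> \<rho>" .
  moreover have Ac: "padic_abs_rat q (scale n) = inverse \<rho>" using padic_abs_scale[OF q] by (simp add: \<rho>_def power_int_minus)
  ultimately have "padic_abs_rat q (s * scale n) \<le> \<rho> * inverse \<rho>"
    unfolding A_mult Ac using \<rho> by (intro mult_right_mono) auto
  then have "padic_abs_rat q (s * scale n) \<le> 1" using \<rho> by simp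
  \<comment> \<open>\<open>s\<close> has absolute value at most \<rho> and \<open>scale n\<close>
    has absolute value \<open>1/\<rho>\<close>: the product is q-integral and has a residue modulo
    q.\<close>
  then obtain j where j: "j < q" "padic_abs_rat q (s * scale n - of_nat j) \<le> inverse (real q)"
    using A_residue[of "s * scale n" 1] by auto
  have "s - of_nat j * inverse (scale n) = (s * scale n - of_nat j) * inverse (scale n)"
    using scale_nonzero[of n] by (simp add: field_simps)
  then have "padic_abs_rat q (s - of_nat j * inverse (scale n)) = padic_abs_rat q (s * scale n - of_nat j) * \<rho>"
    by (simp add: A_mult abs_inverse_scale[OF q] \<rho>_def)
  also have "\<dots> \<le> inverse (real q) * \<rho>" using j(2) \<rho> by (intro mult_right_mono) auto
  finally have sj: "padic_abs q (rat_to_Qp q s \<ominus>\<^bsub>Qp q\<^esub> coset_rep n j q) \<le> \<rho> * inverse (real q)"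
    by (simp add: coset_rep_component[OF q] rat_minus abs_rat mult.commute)
  have "padic_abs q (x q \<ominus>\<^bsub>Qp q\<^esub> coset_rep n j q)
      = padic_abs q ((x q \<ominus>\<^bsub>Qp q\<^esub> rat_to_Qp q s) \<oplus>\<^bsub>Qp q\<^esub> (rat_to_Qp q s \<ominus>\<^bsub>Qp q\<^esub> coset_rep n j q))"
    using xq(1) QS_component[OF coset_rep_closed q] by (simp add: Q.minus_trans)
  also have "\<dots> \<le> max (padic_abs q (x q \<ominus>\<^bsub>Qp q\<^esub> rat_to_Qp q s)) (padic_abs q (rat_to_Qp q s \<ominus>\<^bsub>Qp q\<^esub> coset_rep n j q))"
    using xq(1) QS_component[OF coset_rep_closed q] by (intro abs_ultrametric) auto
  also have "\<dots> \<le> \<rho> * inverse (real q)" using s sj by simp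
  finally have at_q: "padic_abs q (x q \<ominus>\<^bsub>Qp q\<^esub> coset_rep n j q) \<le> real q powi exponent q (n - 1)"
    unfolding \<rho>' .
  have "padic_abs p ((x \<ominus>\<^bsub>QS S\<^esub> coset_rep n j) p) \<le> real p powi exponent p (n - 1)" if p: "p \<in> S" for p
  proof (cases "p = q")
    case True
    then show ?thesis using at_q by (simp add: QS_minus[OF xc coset_rep_closed q])
  next
    case False
    then have "exponent p (n - 1) = exponent p n" using exponent_step[of p n] by (simp add: q_def)
    then show ?thesis using Bn_minus[OF x coset_rep_Bn, of j] p by (simp add: Bn_eq)
  qed
  then have "x \<in> QS_coset (coset_rep n j) (n - 1)"
    using xc coset_rep_closed by (simp add: QS_coset_def Bn_eq)
  then show "x \<in> (\<Union>j<step_prime n. QS_coset (coset_rep n j) (n - 1))" using j(1) by (auto simp: q_def)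
qed

text \<open>A common point would put the difference of two representatives into the smaller ball;
  then q divides \<open>j - i\<close>, impossible for distinct numbers below q.\<close>

lemma Bn_decomposition_disjoint:
  "disjoint_family_on (\<lambda>j. QS_coset (coset_rep n j) (n - 1)) {..<step_prime n}"
proof (unfold disjoint_family_on_def, intro ballI impI)
  fix i j assume ij: "i \<in> {..<step_prime n}" "j \<in> {..<step_prime n}" "i \<noteq> j"
  show "QS_coset (coset_rep n i) (n - 1) \<inter> QS_coset (coset_rep n j) (n - 1) = {}"
  proof (rule ccontr)
    assume "\<not> ?thesis"
    then obtain x where xc: "x \<in> carrier (QS S)"
      and xi: "x \<ominus>\<^bsub>QS S\<^esub> coset_rep n i \<in> Bn S (n - 1)" and xj: "x \<ominus>\<^bsub>QS S\<^esub> coset_rep n j \<in> Bn S (n - 1)"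
      by (auto simp: QS_coset_def)
    have "coset_rep n j \<ominus>\<^bsub>QS S\<^esub> coset_rep n i \<in> Bn S (n - 1)"
      using Bn_minus[OF xi xj] QS.minus_minus_cancel[OF xc coset_rep_closed coset_rep_closed] by simp
    define q where "q = step_prime n"
    have q: "q \<in> S" by (simp add: q_def step_prime_in_S)
    interpret padic q by (rule padic_S[OF q])
    have "padic_abs q ((coset_rep n j \<ominus>\<^bsub>QS S\<^esub> coset_rep n i) q) \<le> real q powi exponent q (n - 1)"
      using \<open>coset_rep n j \<ominus>\<^bsub>QS S\<^esub> coset_rep n i \<in> Bn S (n - 1)\<close> q by (simp add: Bn_eq)
    then have "padic_abs_rat q (of_nat j * inverse (scale n) - of_nat i * inverse (scale n)) \<le> real q powi exponent q (n - 1)"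
      by (simp add: QS_minus[OF coset_rep_closed coset_rep_closed q] coset_rep_component[OF q] rat_minus abs_rat)
    moreover have "of_nat j * inverse (scale n) - of_nat i * inverse (scale n) = of_int (int j - int i) * inverse (scale n)"
      by (simp add: left_diff_distrib)
    moreover have "real q powi exponent q (n - 1) = inverse (real q) * real q powi exponent q n"
      using exponent_step[of q n] p_pos[OF q] by (simp add: q_def[symmetric] power_int_add)
    ultimately have "padic_abs_rat q (of_int (int j - int i)) * real q powi exponent q n
        \<le> inverse (real q) * real q powi exponent q n"
      by (simp only: A_mult abs_inverse_scale[OF q])
    then have "padic_abs_rat q (of_int (int j - int i)) \<le> inverse (real q) ^ 1"
      using p_pos[OF q] by (simp del: of_int_diff)
    then have "int q dvd int j - int i" unfolding A_of_int_le_iff by simp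
    then have "int j mod int q = int i mod int q" by (simp add: mod_eq_dvd_iff)
    then show False using ij by (simp add: q_def[symmetric] del: of_nat_mod)
  qed
qed

section \<open>Duality of the balls under the character\<close>

lemma chi_char: "chi S x = (\<Prod>p\<in>S. padic.char p (x p))"
  unfolding chi_def using padic.char_def[OF padic_S] by (intro prod.cong) auto

lemma chi_norm: "cmod (chi S x) = 1"
  unfolding chi_char prod_norm[symmetric] using padic.char_norm[OF padic_S] by (simp add: prod.neutral)

lemma chi_add:
  "x \<in> carrier (QS S) \<Longrightarrow> y \<in> carrier (QS S) \<Longrightarrow> chi S (x \<oplus>\<^bsub>QS S\<^esub> y) = chi S x * chi S y"
  unfolding chi_char prod.distrib[symmetric]
  using padic.char_add[OF padic_S] QS_component by (intro prod.cong) (auto simp: QS_add)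

text \<open>The radii of \<open>Bn S n\<close> and \<open>Bn S (- n)\<close> are inverse to each
  other in each component, so products of elements are p-adic integers.\<close>

lemma chi_trivial:
  assumes x: "x \<in> Bn S n" and y: "y \<in> Bn S (- n)"
  shows "chi S (x \<otimes>\<^bsub>QS S\<^esub> y) = 1"
  unfolding chi_char
proof (rule prod.neutral, rule ballI)
  fix p assume p: "p \<in> S"
  interpret padic p by (rule padic_S[OF p])
  have c: "x p \<in> carrier (Qp p)" "y p \<in> carrier (Qp p)" using x y Bn_carrier QS_component p by blast+
  have "padic_abs p (x p) * padic_abs p (y p) \<le> real p powi exponent p n * real p powi exponent p (- n)"
    using x y p p_pos[OF p] abs_nonneg[OF c(2)] by (intro mult_mono) (auto simp: Bn_eq)
  also have "\<dots> = 1" using p_pos[OF p] by (simp add: exponent_uminus power_int_minus)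
  finally show "padic.char p ((x \<otimes>\<^bsub>QS S\<^esub> y) p) = 1"
    using c p by (simp add: char_eq_1_iff Zp_iff QS_mult abs_mult)
qed

text \<open>Some component p of \<open>y\<close> is too large. The test element vanishes in all
  other components and has the maximal absolute value \<open>p powi exponent p n\<close> at p, so
  only the factor at p remains, and its argument is not a p-adic integer.\<close>

lemma chi_separates:
  assumes y: "y \<in> carrier (QS S)" "y \<notin> Bn S (- n)"
  shows "\<exists>x\<in>Bn S n. chi S (x \<otimes>\<^bsub>QS S\<^esub> y) \<noteq> 1"
proof -
  obtain p where p: "p \<in> S" and yp: "padic_abs p (y p) > real p powi exponent p (- n)"
    using y by (auto simp: Bn_eq not_le)
  \<comment> \<open>The exponent is negated because p has p-adic absolute value \<open>1/p\<close>;
    so the absolute value of \<open>r\<close> is exactly the radius of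
    \<open>Bn S n\<close>.\<close>
  define r :: rat where "r = of_nat p powi (- exponent p n)"
  define x where "x = (\<lambda>q\<in>S. if q = p then rat_to_Qp q r else \<zero>\<^bsub>Qp q\<^esub>)"
  interpret padic p by (rule padic_S[OF p])
  have Ar: "padic_abs_rat p r = real p powi exponent p n"
    unfolding r_def A_power_int A_p by (simp add: power_int_minus power_int_inverse)
  have xc: "x \<in> carrier (QS S)"
    unfolding x_def using padic.rat_closed[OF padic_S] abelian_monoid.zero_closed[OF abelian_group.axioms(1)[OF Qp_abelian_group_S]]
    by (intro QS_I) auto
  have "padic_abs q (x q) \<le> real q powi exponent q n" if q: "q \<in> S" for q
    using q p p_pos[OF q] Ar padic.abs_zero[OF padic_S[OF q]] by (auto simp: x_def abs_rat less_imp_le)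
  then have xB: "x \<in> Bn S n" using xc by (simp add: Bn_eq)
  have "chi S (x \<otimes>\<^bsub>QS S\<^esub> y) = (\<Prod>q\<in>S. if q = p then padic.char p (rat_to_Qp p r \<otimes>\<^bsub>Qp p\<^esub> y p) else 1)"
    unfolding chi_char
  proof (rule prod.cong[OF refl])
    fix q assume q: "q \<in> S"
    interpret Qq: padic q by (rule padic_S[OF q])
    have "Qq.char \<zero>\<^bsub>Qp q\<^esub> = 1" by (simp add: Qq.char_eq_1_iff Qq.Zp_iff)
    then show "Qq.char ((x \<otimes>\<^bsub>QS S\<^esub> y) q) = (if q = p then padic.char p (rat_to_Qp p r \<otimes>\<^bsub>Qp p\<^esub> y p) else 1)"
      using q QS_component[OF y(1) q] by (auto simp: QS_mult x_def)
  qed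
  also have "\<dots> = padic.char p (rat_to_Qp p r \<otimes>\<^bsub>Qp p\<^esub> y p)" using finite_S p by simp
  also have "\<dots> \<noteq> 1"
  proof -
    have "real p powi exponent p n * real p powi exponent p (- n) < real p powi exponent p n * padic_abs p (y p)"
      using yp p_pos[OF p] by (intro mult_strict_left_mono) auto
    then have "1 < padic_abs p (rat_to_Qp p r \<otimes>\<^bsub>Qp p\<^esub> y p)"
      using p_pos[OF p] QS_component[OF y(1) p] by (simp add: exponent_uminus power_int_minus abs_mult abs_rat Ar)
    then show ?thesis using QS_component[OF y(1) p] by (simp add: char_eq_1_iff Zp_iff)
  qed
  finally show ?thesis using xB by blast
qed

end

section \<open>Haar measure and the heat semigroup\<close>

text \<open>\<open>exp u \<ge> (u / k)^k\<close> follows from \<open>exp v \<ge> v\<close> at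
  \<open>v = u / k\<close>. For \<open>u = t * y powr \<alpha>\<close> and
  \<open>k \<ge> 2 / \<alpha>\<close> the right side grows at least like the square of y; the
  constant is \<open>C = (k / t)^k\<close>.\<close>

lemma exp_minus_powr_le:
  fixes t \<alpha> :: real
  assumes "t > 0" "\<alpha> > 0"
  shows "\<exists>C>0. \<forall>y\<ge>1. exp (- t * y powr \<alpha>) \<le> C / y\<^sup>2"
proof -
  obtain k :: nat where k: "real k \<ge> 2 / \<alpha>" using real_arch_simple by blast
  have k0: "real k > 0" using k assms(2) by (meson divide_pos_pos less_le_trans zero_less_numeral)
  have \<alpha>k: "\<alpha> * real k \<ge> 2" using k assms(2) by (simp add: divide_le_eq mult.commute)
  have "exp (- t * y powr \<alpha>) \<le> (real k / t) ^ k / y\<^sup>2" if y: "y \<ge> 1" for y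
  proof -
    define u where "u = t * y powr \<alpha>"
    have u: "u > 0" using assms y by (simp add: u_def)
    have "u / real k \<le> exp (u / real k)" using exp_ge_add_one_self[of "u / real k"] by linarith
    then have "(u / real k) ^ k \<le> exp (u / real k) ^ k" using u k0 by (intro power_mono) auto
    also have "\<dots> = exp u" using k0 by (simp add: exp_of_nat_mult[symmetric])
    finally have "inverse (exp u) \<le> inverse ((u / real k) ^ k)" using u k0 by (intro le_imp_inverse_le) auto
    also have "\<dots> = (real k / t) ^ k / (y powr \<alpha>) ^ k"
      using assms by (simp add: u_def power_divide power_mult_distrib)
    also have "(y powr \<alpha>) ^ k = y powr (\<alpha> * real k)" using y by (simp add: powr_powr flip: powr_realpow)
    also have "(real k / t) ^ k / y powr (\<alpha> * real k) \<le> (real k / t) ^ k / y powr 2"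
      using y \<alpha>k assms k0 by (intro divide_left_mono powr_mono mult_pos_pos) auto
    finally show ?thesis using y by (simp add: u_def exp_minus)
  qed
  moreover have "(real k / t) ^ k > 0" using k0 assms by simp
  ultimately show ?thesis by blast
qed

locale haar_padic_product = padic_product +
  fixes \<mu> :: "padics measure"
  assumes haar: "normalized_haar_QS S \<mu>"
begin

section \<open>Measure of the balls\<close>

lemma sets_\<mu>: "sets \<mu> = sigma_sets (carrier (QS S)) QS_cosets"
  using haar unfolding normalized_haar_QS_def haar_measure_def borel_QS by blast

lemma \<mu>_translate:
  assumes "a \<in> carrier (QS S)" "X \<in> sets \<mu>"
  shows "emeasure \<mu> ((\<lambda>x. a \<oplus>\<^bsub>QS S\<^esub> x) ` X) = emeasure \<mu> X"
proof -
  have "(\<lambda>x. a \<oplus>\<^bsub>QS S\<^esub> x) ` X = a <+\<^bsub>QS S\<^esub> X" by (auto simp: a_l_coset_def')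
  then show ?thesis using haar assms unfolding normalized_haar_QS_def haar_measure_def by simp
qed

lemma QS_coset_sets: "a \<in> carrier (QS S) \<Longrightarrow> QS_coset a n \<in> sets \<mu>"
  unfolding sets_\<mu> by (rule sigma_sets.Basic) (auto simp: QS_cosets_def)

lemma Bn_sets: "Bn S n \<in> sets \<mu>"
  using QS_coset_sets[of "\<zero>\<^bsub>QS S\<^esub>" n] by (simp add: QS_coset_zero)

lemma emeasure_QS_coset: "a \<in> carrier (QS S) \<Longrightarrow> emeasure \<mu> (QS_coset a n) = emeasure \<mu> (Bn S n)"
  unfolding QS_coset_translate by (rule \<mu>_translate[OF _ Bn_sets])

lemma emeasure_Bn_step: "emeasure \<mu> (Bn S n) = ennreal (real (step_prime n)) * emeasure \<mu> (Bn S (n - 1))"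
proof -
  have "emeasure \<mu> (Bn S n) = emeasure \<mu> (\<Union>j<step_prime n. QS_coset (coset_rep n j) (n - 1))"
    by (simp only: Bn_decomposition[of n, symmetric])
  also have "\<dots> = (\<Sum>j<step_prime n. emeasure \<mu> (QS_coset (coset_rep n j) (n - 1)))"
    using QS_coset_sets coset_rep_closed Bn_decomposition_disjoint[of n]
    by (intro sum_emeasure[symmetric]) auto
  also have "\<dots> = of_nat (step_prime n) * emeasure \<mu> (Bn S (n - 1))"
    using emeasure_QS_coset[OF coset_rep_closed] by simp
  finally show ?thesis by (simp add: ennreal_of_nat_eq_real_of_nat)
qed

lemma Bn_0: "Bn S 0 = ZS S"
  unfolding set_eq_iff by (simp add: Bn_eq exponent_zero ZS_def Zp_def QS_simps PiE_iff) blast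

text \<open>The normalization fixes the measure of \<open>Bn S 0 = ZS S\<close>; translation
  invariance multiplies it by \<open>step_prime n\<close> at each step up, and on the way down this
  nonzero finite factor is cancelled.\<close>

lemma emeasure_Bn: "emeasure \<mu> (Bn S n) = ennreal (w n)"
proof (induction n rule: int_induct[where k = 0])
  case base
  then show ?case using haar by (simp add: Bn_0 w_zero normalized_haar_QS_def)
next
  case (step1 i)
  then show ?case
    using emeasure_Bn_step[of "i + 1"] w_step[of "i + 1"] w_pos[of i] by (simp add: ennreal_mult less_imp_le)
next
  case (step2 i)
  have "ennreal (real (step_prime i)) * emeasure \<mu> (Bn S (i - 1)) = ennreal (real (step_prime i)) * ennreal (w (i - 1))"
    using step2 emeasure_Bn_step[of i] w_step[of i] w_pos[of "i - 1"] by (simp add: ennreal_mult less_imp_le)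
  moreover have "ennreal (real (step_prime i)) \<noteq> 0" using step_prime_ge_2[of i] by simp
  ultimately show ?case by (simp add: ennreal_mult_cancel_left)
qed

sublocale D: dual_filtered_group "QS S" \<mu> "Bn S" w "\<lambda>\<xi> x. chi S (\<xi> \<otimes>\<^bsub>QS S\<^esub> x)"
proof unfold_locales
  show "Bn S n \<subseteq> carrier (QS S)" for n by (rule Bn_carrier)
  show "\<zero>\<^bsub>QS S\<^esub> \<in> Bn S n" for n by (rule Bn_zero)
  show "x \<ominus>\<^bsub>QS S\<^esub> y \<in> Bn S n" if "x \<in> Bn S n" "y \<in> Bn S n" for x y n using that by (rule Bn_minus)
  show "Bn S m \<subseteq> Bn S n" if "m \<le> n" for m n using that by (rule Bn_mono)
  show "\<exists>n. x \<in> Bn S n" if "x \<in> carrier (QS S)" for x using that by (rule Bn_cover)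
  show "sets \<mu> = sigma_sets (carrier (QS S)) {{x \<in> carrier (QS S). x \<ominus>\<^bsub>QS S\<^esub> a \<in> Bn S n} |a n. a \<in> carrier (QS S)}"
    using sets_\<mu> by (simp add: QS_cosets_def QS_coset_def)
  show "countable {{x \<in> carrier (QS S). x \<ominus>\<^bsub>QS S\<^esub> a \<in> Bn S n} |a n. a \<in> carrier (QS S)}"
    using countable_QS_cosets by (simp add: QS_cosets_def QS_coset_def)
  show "emeasure \<mu> ((\<lambda>x. a \<oplus>\<^bsub>QS S\<^esub> x) ` X) = emeasure \<mu> X"
    if "a \<in> carrier (QS S)" "X \<in> sets \<mu>" for a X using that by (rule \<mu>_translate)
  show "emeasure \<mu> (Bn S n) = ennreal (w n)" for n by (rule emeasure_Bn)
  show "0 < w n" for n by (rule w_pos)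
  show "w n * w (- n) = 1" for n by (rule w_dual)
  show "cmod (chi S (x \<otimes>\<^bsub>QS S\<^esub> y)) = 1" for x y by (rule chi_norm)
  show "chi S (x \<otimes>\<^bsub>QS S\<^esub> y) = chi S (y \<otimes>\<^bsub>QS S\<^esub> x)"
    if "x \<in> carrier (QS S)" "y \<in> carrier (QS S)" for x y using that by (simp add: QS.m_comm)
  show "chi S ((x \<oplus>\<^bsub>QS S\<^esub> y) \<otimes>\<^bsub>QS S\<^esub> z) = chi S (x \<otimes>\<^bsub>QS S\<^esub> z) * chi S (y \<otimes>\<^bsub>QS S\<^esub> z)"
    if "x \<in> carrier (QS S)" "y \<in> carrier (QS S)" "z \<in> carrier (QS S)" for x y z
    using that by (simp add: QS.l_distr chi_add)
  show "chi S (x \<otimes>\<^bsub>QS S\<^esub> y) = 1" if "x \<in> Bn S n" "y \<in> Bn S (- n)" for x y n using that by (rule chi_trivial)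
  show "\<exists>x\<in>Bn S n. chi S (x \<otimes>\<^bsub>QS S\<^esub> y) \<noteq> 1" if "y \<in> carrier (QS S)" "y \<notin> Bn S (- n)" for y n
    using that by (rule chi_separates)
qed

section \<open>Identification of the Fourier transform, and the level sets of the norm\<close>

lemma fourier_eq: "fourier S \<mu> = D.F"
  by (intro ext) (simp add: fourier_def D.F_def)

lemma fourier_L2_eq: "fourier_L2 S \<mu> = D.FL"
  unfolding fourier_L2_def[abs_def] D.FL_def[abs_def] D.FL_spec_def fourier_eq ..

text \<open>A nonzero element lies outside some ball and inside another, and the balls increase; so
  there is a single level at which it enters. This makes the definite description in
  \<open>norm_QS\<close> meaningful.\<close>

lemma norm_level:
  assumes x: "x \<in> carrier (QS S)" "x \<noteq> \<zero>\<^bsub>QS S\<^esub>"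
  obtains n where "norm_QS S x = w n" "x \<in> Bn S n" "x \<notin> Bn S (n - 1)"
proof -
  obtain m where m: "x \<notin> Bn S m" using Bn_separate[of x] x(2) by blast
  obtain k where k: "x \<in> Bn S k" using Bn_cover[OF x(1)] by blast
  have mk: "m \<le> k" using m k Bn_mono[of k m] by (cases "m \<le> k") auto
  have "\<exists>n. x \<in> Bn S n \<and> x \<notin> Bn S (n - 1)"
  proof (rule ccontr)
    assume neg: "\<not> ?thesis"
    have "x \<in> Bn S j" if "j \<le> k" for j
      using that
    proof (induction j rule: int_le_induct)
      case (step i)
      then show ?case using neg by blast
    qed (rule k)
    then show False using m mk by blast
  qed
  then obtain n where n: "x \<in> Bn S n" "x \<notin> Bn S (n - 1)" by blast
  have uniq: "j = n" if j: "x \<in> Bn S j \<and> x \<notin> Bn S (j - 1)" for j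
  proof (rule antisym)
    show "j \<le> n" using Bn_mono[of n "j - 1"] j n by force
    show "n \<le> j" using Bn_mono[of j "n - 1"] j n by force
  qed
  have "(THE n. x \<in> Bn S n \<and> x \<notin> Bn S (n - 1)) = n"
    by (rule the_equality, intro conjI n, rule uniq)
  then have "norm_QS S x = w n" using x(2) by (simp add: norm_QS_def w_def)
  then show thesis using that n by blast
qed

lemma norm_le_iff:
  assumes x: "x \<in> carrier (QS S)"
  shows "norm_QS S x \<le> w n \<longleftrightarrow> x \<in> Bn S n"
proof (cases "x = \<zero>\<^bsub>QS S\<^esub>")
  case True
  then show ?thesis using w_pos[of n] Bn_zero by (simp add: norm_QS_def less_imp_le)
next
  case False
  obtain m where m: "norm_QS S x = w m" "x \<in> Bn S m" "x \<notin> Bn S (m - 1)" using norm_level[OF x False] .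
  show ?thesis
  proof (cases "m \<le> n")
    case True
    then show ?thesis using m Bn_mono[OF True] w_le_iff by auto
  next
    case False
    then have "Bn S n \<subseteq> Bn S (m - 1)" by (intro Bn_mono) simp
    then show ?thesis using m False w_le_iff by auto
  qed
qed

lemma norm_nonneg: "norm_QS S x \<ge> 0"
  by (simp add: norm_QS_def)

text \<open>Sublevel sets are countable unions of balls together with 0. The point 0 is added
  separately because for \<open>r = 0\<close> no ball is small enough; it is measurable as the
  intersection of all balls.\<close>

lemma norm_measurable [measurable]: "norm_QS S \<in> borel_measurable \<mu>"
proof (rule borel_measurable_iff_le[THEN iffD2], rule allI)
  fix r :: real
  have z: "{\<zero>\<^bsub>QS S\<^esub>} \<in> sets \<mu>"
  proof -
    have "{\<zero>\<^bsub>QS S\<^esub>} = (\<Inter>n. Bn S n)" using Bn_zero Bn_separate by auto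
    also have "\<dots> \<in> sets \<mu>" using Bn_sets by (intro sets.countable_INT) auto
    finally show ?thesis .
  qed
  have "{x \<in> space \<mu>. norm_QS S x \<le> r} = (if r < 0 then {} else {\<zero>\<^bsub>QS S\<^esub>} \<union> (\<Union>n\<in>{n. w n \<le> r}. Bn S n))"
  proof (cases "r < 0")
    case True
    have "\<not> norm_QS S x \<le> r" for x using norm_nonneg[of x] True by linarith
    then show ?thesis using True by simp
  next
    case False
    have "x \<in> {\<zero>\<^bsub>QS S\<^esub>} \<union> (\<Union>n\<in>{n. w n \<le> r}. Bn S n)" if x: "x \<in> carrier (QS S)" "norm_QS S x \<le> r" for x
    proof (cases "x = \<zero>\<^bsub>QS S\<^esub>")
      case False
      from norm_level[OF x(1) this] obtain n where "norm_QS S x = w n" "x \<in> Bn S n" by blast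
      then show ?thesis using x(2) by auto
    qed simp
    moreover have "x \<in> carrier (QS S) \<and> norm_QS S x \<le> r"
      if x: "x \<in> {\<zero>\<^bsub>QS S\<^esub>} \<union> (\<Union>n\<in>{n. w n \<le> r}. Bn S n)" for x
    proof (cases "x = \<zero>\<^bsub>QS S\<^esub>")
      case True
      then show ?thesis using False by (simp add: norm_QS_def)
    next
      case False
      then obtain n where n: "w n \<le> r" "x \<in> Bn S n" using x by blast
      then show ?thesis using norm_le_iff[OF Bn_closed[OF n(2)], of n] Bn_closed[OF n(2)] by linarith
    qed
    ultimately have "{x \<in> carrier (QS S). norm_QS S x \<le> r} = {\<zero>\<^bsub>QS S\<^esub>} \<union> (\<Union>n\<in>{n. w n \<le> r}. Bn S n)"
      by blast
    then show ?thesis using False by simp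
  qed
  also have "\<dots> \<in> sets \<mu>"
    using sets.Un[OF z sets.countable_UN''[of "{n. w n \<le> r}" "Bn S"]] Bn_sets by simp
  finally show "{x \<in> space \<mu>. norm_QS S x \<le> r} \<in> sets \<mu>" .
qed

section \<open>The heat multiplier and the heat operator\<close>

definition heat_multiplier :: "real \<Rightarrow> real \<Rightarrow> padics \<Rightarrow> real" where
  "heat_multiplier \<alpha> t \<xi> = exp (- t * norm_QS S \<xi> powr \<alpha>)"

lemma heat_multiplier_measurable [measurable]: "heat_multiplier \<alpha> t \<in> borel_measurable \<mu>"
  unfolding heat_multiplier_def by measurable

lemma heat_multiplier_bounds: "t \<ge> 0 \<Longrightarrow> 0 \<le> heat_multiplier \<alpha> t \<xi> \<and> heat_multiplier \<alpha> t \<xi> \<le> 1"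
  by (simp add: heat_multiplier_def)

text \<open>Makes the integral defining the heat kernel absolutely convergent. The quadratic decay
  beats the measure of the balls and leaves a geometric series.\<close>

lemma heat_multiplier_integrable:
  assumes t: "t > 0" and \<alpha>: "\<alpha> > 0"
  shows "integrable \<mu> (heat_multiplier \<alpha> t)"
proof -
  obtain C where C: "C > 0" "\<And>y. y \<ge> 1 \<Longrightarrow> exp (- t * y powr \<alpha>) \<le> C / y\<^sup>2"
    using exp_minus_powr_le[OF t \<alpha>] by blast
  define h where "h n x = ennreal (C / (w (int n))\<^sup>2) * indicator (Bn S (int n)) x" for n x
  text \<open>On \<open>B\<^sub>n \<setminus> B\<^sub>n\<^sub>-\<^sub>1\<close> the multiplier is at most \<open>C / w\<^sub>n\<^sup>2\<close>, while \<open>B\<^sub>n\<close> has measure \<open>w\<^sub>n \<ge> 2\<^sup>n\<close>.\<close>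
  define g where "g x = indicator (Bn S 0) x + (\<Sum>n. h n x)" for x
  have le: "ennreal (heat_multiplier \<alpha> t x) \<le> g x" if x: "x \<in> carrier (QS S)" for x
  proof (cases "x \<in> Bn S 0")
    case True
    then have "1 \<le> g x" by (simp add: g_def)
    moreover have "ennreal (heat_multiplier \<alpha> t x) \<le> 1" using heat_multiplier_bounds[of t \<alpha> x] t by simp
    ultimately show ?thesis by (rule order_trans[rotated])
  next
    case False
    then have "x \<noteq> \<zero>\<^bsub>QS S\<^esub>" using Bn_zero by auto
    then obtain n where n: "norm_QS S x = w n" "x \<in> Bn S n" using norm_level[OF x] by blast
    have "n > 0" using False n Bn_mono[of n 0] by (cases "n > 0") auto
    then obtain k where k: "n = int k" using zero_le_imp_eq_int[of n] by auto
    have "w n \<ge> 1" using w_mono[of 0 n] \<open>n > 0\<close> by (simp add: w_zero)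
    then have "heat_multiplier \<alpha> t x \<le> C / (w n)\<^sup>2" unfolding heat_multiplier_def n(1) by (rule C(2))
    then have "ennreal (heat_multiplier \<alpha> t x) \<le> ennreal (C / (w (int k))\<^sup>2) * indicator (Bn S (int k)) x"
      using n k by (simp add: ennreal_leI)
    also have "\<dots> = h k x" by (simp only: h_def)
    also have "\<dots> \<le> (\<Sum>n. h n x)" using sum_le_suminf[of "\<lambda>n. h n x" "{k}"] by simp
    also have "\<dots> \<le> g x" unfolding g_def by simp
    finally show ?thesis .
  qed
  have "(\<integral>\<^sup>+x. ennreal (heat_multiplier \<alpha> t x) \<partial>\<mu>) \<le> (\<integral>\<^sup>+x. g x \<partial>\<mu>)"
    using le by (intro nn_integral_mono) simp
  also have "\<dots> = emeasure \<mu> (Bn S 0) + (\<Sum>n. ennreal (C / (w (int n))\<^sup>2) * emeasure \<mu> (Bn S (int n)))"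
    unfolding g_def h_def using Bn_sets
    by (simp add: nn_integral_add nn_integral_suminf nn_integral_cmult)
  also have "\<dots> \<le> 1 + (\<Sum>n. ennreal (C * (1/2)^n))"
  proof (intro add_mono suminf_le)
    show "emeasure \<mu> (Bn S 0) \<le> 1" by (simp add: emeasure_Bn w_zero)
    show "ennreal (C / (w (int n))\<^sup>2) * emeasure \<mu> (Bn S (int n)) \<le> ennreal (C * (1/2)^n)" for n
    proof -
      have "C / (w (int n))\<^sup>2 * w (int n) = C / w (int n)"
        using w_pos[of "int n"] by (simp add: power2_eq_square)
      also have "\<dots> \<le> C / 2 ^ n" using C(1) w_ge_power[of n] w_pos[of "int n"]
        by (intro divide_left_mono) auto
      finally show ?thesis
        using C(1) w_pos[of "int n"] by (simp add: emeasure_Bn ennreal_mult[symmetric] less_imp_le ennreal_leI power_divide)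
    qed
  qed auto
  also have "\<dots> < \<infinity>"
  proof -
    have "summable (\<lambda>n. C * (1/2::real)^n)" by (intro summable_mult summable_geometric) simp
    then have "(\<Sum>n. ennreal (C * (1/2)^n)) = ennreal (\<Sum>n. C * (1/2)^n)"
      using C(1) by (intro suminf_ennreal2) auto
    then show ?thesis by simp
  qed
  finally show ?thesis
    using heat_multiplier_bounds[of t \<alpha>] t by (intro integrableI_nonneg) auto
qed

text \<open>The values lie in \<open>[0,1]\<close>, so the square is dominated by the function
  itself.\<close>

lemma heat_multiplier_LL:
  assumes t: "t > 0" and \<alpha>: "\<alpha> > 0"
  shows "D.LL (\<lambda>\<xi>. complex_of_real (heat_multiplier \<alpha> t \<xi>))"
proof -
  have b: "0 \<le> heat_multiplier \<alpha> t x" "heat_multiplier \<alpha> t x \<le> 1" for x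
    using heat_multiplier_bounds[of t \<alpha> x] t by auto
  have "integrable \<mu> (\<lambda>x. (heat_multiplier \<alpha> t x)\<^sup>2)"
  proof (rule Bochner_Integration.integrable_bound[OF heat_multiplier_integrable[OF t \<alpha>]])
    show "AE x in \<mu>. norm ((heat_multiplier \<alpha> t x)\<^sup>2) \<le> norm (heat_multiplier \<alpha> t x)"
      using b by (auto simp: power2_eq_square intro!: mult_left_le)
  qed measurable
  then show ?thesis
    using heat_multiplier_integrable[OF t \<alpha>] b by (simp add: D.LL_def L2_def)
qed

lemma heat_operator_eq:
  assumes t: "t > 0"
  shows "heat_operator S \<mu> \<alpha> t f = (\<lambda>x. LINT y|\<mu>. (LINT \<xi>|\<mu>.
      chi S ((\<ominus>\<^bsub>QS S\<^esub> (x \<ominus>\<^bsub>QS S\<^esub> y)) \<otimes>\<^bsub>QS S\<^esub> \<xi>) * complex_of_real (heat_multiplier \<alpha> t \<xi>)) * f y)"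
  using t by (intro ext) (simp add: heat_operator_def convolution_QS_def heat_kernel_def heat_multiplier_def)

lemma heat_operator_FL:
  assumes t: "t \<ge> 0" and \<alpha>: "\<alpha> > 0" and f: "f \<in> L2 \<mu>"
  shows "heat_operator S \<mu> \<alpha> t f \<in> L2 \<mu>"
    "L2_eq \<mu> (D.FL (heat_operator S \<mu> \<alpha> t f)) (\<lambda>\<xi>. complex_of_real (heat_multiplier \<alpha> t \<xi>) * D.FL f \<xi>)"
proof -
  have "heat_operator S \<mu> \<alpha> t f \<in> L2 \<mu> \<and>
    L2_eq \<mu> (D.FL (heat_operator S \<mu> \<alpha> t f)) (\<lambda>\<xi>. complex_of_real (heat_multiplier \<alpha> t \<xi>) * D.FL f \<xi>)"
  proof (cases "t = 0")
    case True
    then show ?thesis using f D.FL_closed[OF f] by (simp add: heat_operator_def heat_multiplier_def L2_eq_refl)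
  next
    case False
    then have t0: "t > 0" using t by simp
    have b: "cmod (complex_of_real (heat_multiplier \<alpha> t \<xi>)) \<le> 1" for \<xi>
      using heat_multiplier_bounds[OF t, of \<alpha> \<xi>] by simp
    from D.convolution_multiplier[OF heat_multiplier_LL[OF t0 \<alpha>] b f] show ?thesis
      unfolding heat_operator_eq[OF t0] by simp
  qed
  then show "heat_operator S \<mu> \<alpha> t f \<in> L2 \<mu>"
    "L2_eq \<mu> (D.FL (heat_operator S \<mu> \<alpha> t f)) (\<lambda>\<xi>. complex_of_real (heat_multiplier \<alpha> t \<xi>) * D.FL f \<xi>)"
    by auto
qed

text \<open>Surjectivity of the transform shows that the choice in \<open>inv_fourier_L2\<close> has
  a candidate, so the chosen function meets its specification.\<close>

lemma D_op_spec:
  assumes "f \<in> Dom_D S \<mu> \<alpha>"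
  shows "D_op S \<mu> \<alpha> f \<in> L2 \<mu> \<and>
    L2_eq \<mu> (D.FL (D_op S \<mu> \<alpha> f)) (\<lambda>\<xi>. complex_of_real (norm_QS S \<xi> powr \<alpha>) * D.FL f \<xi>)"
proof -
  have "(\<lambda>\<xi>. complex_of_real (norm_QS S \<xi> powr \<alpha>) * D.FL f \<xi>) \<in> L2 \<mu>"
    using assms by (simp add: Dom_D_def fourier_L2_eq)
  from D.FL_surj[OF this] have "\<exists>g. g \<in> L2 \<mu> \<and>
    L2_eq \<mu> (D.FL g) (\<lambda>\<xi>. complex_of_real (norm_QS S \<xi> powr \<alpha>) * D.FL f \<xi>)" by blast
  from someI_ex[OF this] show ?thesis by (simp add: D_op_def inv_fourier_L2_def fourier_L2_eq)
qed

lemma spectral: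
  assumes \<alpha>: "\<alpha> > 0"
  shows "spectral_semigroup \<mu> D.FL (\<lambda>\<xi>. norm_QS S \<xi> powr \<alpha>) (Dom_D S \<mu> \<alpha>) (D_op S \<mu> \<alpha>) (heat_operator S \<mu> \<alpha>)"
proof
  show "f \<in> L2 \<mu> \<Longrightarrow> D.FL f \<in> L2 \<mu>" for f by (rule D.FL_closed)
  show "f \<in> L2 \<mu> \<Longrightarrow> g \<in> L2 \<mu> \<Longrightarrow>
      L2_eq \<mu> (D.FL (\<lambda>x. a * f x + b * g x)) (\<lambda>x. a * D.FL f x + b * D.FL g x)" for f g a b
    by (rule D.FL_lin)
  show "f \<in> L2 \<mu> \<Longrightarrow> L2_norm \<mu> (D.FL f) = L2_norm \<mu> f" for f by (rule D.FL_norm)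
  show "g \<in> L2 \<mu> \<Longrightarrow> \<exists>f\<in>L2 \<mu>. L2_eq \<mu> (D.FL f) g" for g by (rule D.FL_surj)
  show "(\<lambda>\<xi>. norm_QS S \<xi> powr \<alpha>) \<in> borel_measurable \<mu>" by measurable
  show "0 \<le> norm_QS S x powr \<alpha>" for x by simp
  show "f \<in> Dom_D S \<mu> \<alpha> \<longleftrightarrow> f \<in> L2 \<mu> \<and> (\<lambda>x. complex_of_real (norm_QS S x powr \<alpha>) * D.FL f x) \<in> L2 \<mu>" for f
    by (simp add: Dom_D_def fourier_L2_eq)
  show "f \<in> Dom_D S \<mu> \<alpha> \<Longrightarrow> D_op S \<mu> \<alpha> f \<in> L2 \<mu>"
    "f \<in> Dom_D S \<mu> \<alpha> \<Longrightarrow> L2_eq \<mu> (D.FL (D_op S \<mu> \<alpha> f)) (\<lambda>x. complex_of_real (norm_QS S x powr \<alpha>) * D.FL f x)" for f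
    using D_op_spec by auto
  show "0 \<le> t \<Longrightarrow> f \<in> L2 \<mu> \<Longrightarrow> heat_operator S \<mu> \<alpha> t f \<in> L2 \<mu>" for t f by (rule heat_operator_FL(1)[OF _ \<alpha>])
  show "0 \<le> t \<Longrightarrow> f \<in> L2 \<mu> \<Longrightarrow> L2_eq \<mu> (D.FL (heat_operator S \<mu> \<alpha> t f))
      (\<lambda>x. complex_of_real (exp (- t * norm_QS S x powr \<alpha>)) * D.FL f x)" for t f
    using heat_operator_FL(2)[OF _ \<alpha>] by (simp add: heat_multiplier_def)
qed

end

theorem theorem4p9:
  fixes S :: "nat set" and \<alpha> :: real and \<mu> :: "padics measure"
  assumes "finite S" and "S \<noteq> {}" and "\<forall>p\<in>S. prime p"
    and "normalized_haar_QS S \<mu>"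
    and "\<alpha> > 0"
  shows "(\<exists>U. C0_semigroup_generated_by \<mu> U (Dom_D S \<mu> \<alpha>) (\<lambda>f x. - D_op S \<mu> \<alpha> f x)) \<and>
    (\<forall>U. C0_semigroup_generated_by \<mu> U (Dom_D S \<mu> \<alpha>) (\<lambda>f x. - D_op S \<mu> \<alpha> f x) \<longrightarrow>
       (\<forall>t\<ge>0. \<forall>f\<in>L2 \<mu>. L2_eq \<mu> (U t f) (heat_operator S \<mu> \<alpha> t f))) \<and>
    (\<forall>f\<in>Dom_D S \<mu> \<alpha>.
       classical_solution S \<mu> \<alpha> f (\<lambda>t. heat_operator S \<mu> \<alpha> t f) \<and>
       (\<forall>u. classical_solution S \<mu> \<alpha> f u \<longrightarrow>
          (\<forall>t\<ge>0. L2_eq \<mu> (u t) (heat_operator S \<mu> \<alpha> t f))))"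
proof -
  interpret haar_padic_product S \<mu>
    using assms by unfold_locales auto
  interpret spectral_semigroup \<mu> D.FL "\<lambda>\<xi>. norm_QS S \<xi> powr \<alpha>" "Dom_D S \<mu> \<alpha>" "D_op S \<mu> \<alpha>" "heat_operator S \<mu> \<alpha>"
    by (rule spectral[OF assms(5)])
  \<comment> \<open>Both notions unfold to the same formula once the abstract data are the operator
    \<open>D_op\<close> and its domain.\<close>
  have "classical_solution S \<mu> \<alpha> f u \<longleftrightarrow> solution f u" for f u
    by (simp add: classical_solution_def solution_def)
  \<comment> \<open>The heat operators themselves witness the existence of a semigroup with the
    prescribed generator.\<close>
  then show ?thesis
    using H_generated generated_unique H_solution solution_unique by blast
qed

end
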